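(* Let $w$ be a doubling weight, $r\in\mathbb{N}$, $p=1$ or $p=\infty$, and $f\in L_p[-1,1]$. Then, for $0<\alpha<r$, we have $$E_n(f)_{p,w_n}=O(n^{-\alpha})\iff\omega_\varphi^{r+1}(f,n^{-1})_{p,w_n}=O(n^{-\alpha})\qquad(n\to\infty).$$
   Context: A doubling weight is a nonnegative $w\in L_1[-1,1]$, extended by $0$ outside $[-1,1]$, for which there is a constant $L$ (the doubling constant of $w$) with $\int_{2I}w\le L\int_I w$ for all intervals $I\subset[-1,1]$, where $2I$ is the interval with the same center as $I$ and twice its length. Let $\varphi(x)=\sqrt{1-x^2}$, $\rho_n(x)=n^{-1}\sqrt{1-x^2}+n^{-2}$, and $w_n(x)=\frac{1}{\rho_n(x)}\int_{x-\rho_n(x)}^{x+\rho_n(x)}w(u)\,du$. For a weight $v$ on $[-1,1]$: $\|g\|_{1,v}=\int_{-1}^1|g| v$ and $\|g\|_{\infty,v}=\operatorname{ess\,sup}_{[-1,1]}|g|v$. $\Pi_n$ is the set of algebraic polynomials of degree $\le n-1$ and $E_n(f)_{p,v}=\inf_{P\in\Pi_n}\|f-P\|_{p,v}$. Symmetric difference, for $k\in\mathbb{N}$: $\Delta_h^k(f,x)=\sum_{i=0}^k\binom ki(-1)^{k-i}f(x-kh/2+ih)$ if $x\pm kh/2\in[-1,1]$, and $0$ otherwise. Modulus: $\omega_\varphi^k(f,t)_{p,v}=\sup_{0<h\le t}\|\Delta_{h\varphi(\cdot)}^k(f,\cdot)\|_{p,v}$. *)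

theory Defs
  imports "HOL-Probability.Essential_Supremum" "HOL-Computational_Algebra.Polynomial"
begin

text \<open>
  The weight is a total function vanishing outside \<open>[-1,1]\<close>; with centre \<open>c\<close> and half-length \<open>d\<close>,
  the interval is \<open>I = [c - d, c + d]\<close> and its double is \<open>2I = [c - 2 d, c + 2 d]\<close>.
  Endpoints are Lebesgue-null, so closed intervals suffice.
\<close>

definition doubling_weight :: "(real \<Rightarrow> real) \<Rightarrow> bool" where
  "doubling_weight w \<longleftrightarrow>
     (\<forall>x. 0 \<le> w x) \<and> (\<forall>x. x \<notin> {-1..1} \<longrightarrow> w x = 0) \<and> integrable lebesgue w \<and>
     (\<exists>L. \<forall>c d. 0 \<le> d \<and> {c - d..c + d} \<subseteq> {-1..1} \<longrightarrow>
        (LINT u:{c - 2 * d..c + 2 * d}|lebesgue. w u) \<le> L * (LINT u:{c - d..c + d}|lebesgue. w u))"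

definition phi :: "real \<Rightarrow> real" where
  "phi x = sqrt (1 - x\<^sup>2)"

definition rho :: "nat \<Rightarrow> real \<Rightarrow> real" where
  "rho n x = sqrt (1 - x\<^sup>2) / real n + 1 / (real n)\<^sup>2"

definition avg_weight :: "(real \<Rightarrow> real) \<Rightarrow> nat \<Rightarrow> real \<Rightarrow> real" where
  "avg_weight w n x = (1 / rho n x) * (LINT u:{x - rho n x..x + rho n x}|lebesgue. w u)"

text \<open>
  Norms take values in \<^typ>\<open>ennreal\<close>, so that divergent integrals, suprema and infima are
  never silently replaced by a finite value. Only the exponents \<open>1\<close> and \<open>\<infinity>\<close> are used.
\<close>

definition wnorm :: "ennreal \<Rightarrow> (real \<Rightarrow> real) \<Rightarrow> (real \<Rightarrow> real) \<Rightarrow> ennreal" where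
  "wnorm p v g =
     (if p = 1 then (\<integral>\<^sup>+x. ennreal (\<bar>g x\<bar> * v x) \<partial>lebesgue_on {-1..1})
      else if p = \<infinity> then esssup (lebesgue_on {-1..1}) (\<lambda>x. ennreal (\<bar>g x\<bar> * v x))
      else undefined)"

definition in_Lp :: "ennreal \<Rightarrow> (real \<Rightarrow> real) \<Rightarrow> bool" where
  "in_Lp p f \<longleftrightarrow> f \<in> borel_measurable (lebesgue_on {-1..1}) \<and> wnorm p (\<lambda>_. 1) f < \<infinity>"

definition best_approx :: "nat \<Rightarrow> (real \<Rightarrow> real) \<Rightarrow> ennreal \<Rightarrow> (real \<Rightarrow> real) \<Rightarrow> ennreal" where
  "best_approx n f p v = (INF P\<in>{P :: real poly. degree P < n}. wnorm p v (\<lambda>x. f x - poly P x))"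

definition central_difference :: "nat \<Rightarrow> real \<Rightarrow> (real \<Rightarrow> real) \<Rightarrow> real \<Rightarrow> real" where
  "central_difference k h f x =
     (if x - real k * h / 2 \<in> {-1..1} \<and> x + real k * h / 2 \<in> {-1..1}
      then \<Sum>i=0..k. real (k choose i) * (-1) ^ (k - i) * f (x - real k * h / 2 + real i * h)
      else 0)"

definition phi_modulus ::
  "nat \<Rightarrow> (real \<Rightarrow> real) \<Rightarrow> real \<Rightarrow> ennreal \<Rightarrow> (real \<Rightarrow> real) \<Rightarrow> ennreal" where
  "phi_modulus k f t p v = (SUP h\<in>{0<..t}. wnorm p v (\<lambda>x. central_difference k (h * phi x) f x))"

text \<open>Landau's \<open>a n = O(g n)\<close> for \<open>n \<rightarrow> \<infinity>\<close>, for a sequence in \<^typ>\<open>ennreal\<close>; it forces \<open>a n < \<infinity>\<close> eventually.\<close>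

definition is_bigO :: "(nat \<Rightarrow> ennreal) \<Rightarrow> (nat \<Rightarrow> real) \<Rightarrow> bool" where
  "is_bigO a g \<longleftrightarrow> (\<exists>C\<ge>0. \<forall>\<^sub>F n in sequentially. a n \<le> ennreal (C * \<bar>g n\<bar>))"

end

(* Write x = cos theta and k = r + 1. A polynomial Q of degree at most m is dominated on discs of radius
   comparable to rho_m by local averages of |Q| against a rapidly decaying trigonometric kernel, so
   Cauchy's estimate bounds rho_m^k |Q^(k)| by such averages. Doubling makes w_m vary only polynomially in
   m |theta - t|, hence the averages may be taken with the weight w_m. For m <= n the differences of step
   h phi, h <= 1/n, then gain (rho_n/rho_m)^k, and w_n <= (rho_m/rho_n) w_m costs one power: what remains is
   (m/n)^r, which explains the condition alpha < r. Summing over the dyadic telescoping series of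
   near-best approximants gives the implication from approximation to smoothness.

   Conversely, an L_1 Whitney inequality yields polynomials p_j of degree at most r on overlapping
   intervals of length comparable to rho_n. They are blended by polynomials that approximate the jumps
   1[theta > theta_j] up to rapidly decaying errors, while the differences p_(j+1) - p_j grow only
   polynomially away from their intervals. *)

theory Submission
  imports Defs "HOL-Complex_Analysis.Complex_Analysis"
begin

section \<open>Finite differences\<close>

\<comment> \<open>The two norms share almost all of the argument. The sup norm gets no Whitney
  inequality of its own: local polynomials are always chosen in the mean, and a pointwise bound is
  recovered by averaging the identity that expresses a value of \<open>f\<close> by the other points
  of a chord. In the mean norm two obstacles appear. The kernel bound produces the measure
  \<open>(sin t + 1/m) dt\<close> instead of \<open>sin t dt\<close>, and the surplus near the end
  points has to be absorbed. Moreover the modulus is a supremum over steps \<open>h\<close>, and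
  suprema taken separately on each panel cannot be summed, while averages over \<open>h\<close> can.
  This is why Whitney's inequality is stated with an average over all chords of an interval: mapping
  the ends of a chord to its midpoint and its step divided by \<open>phi\<close> turns that average
  into one over steps \<open>h <= 1/n\<close>. The nodes have spacing \<open>pi/(7n)\<close>, so
  that a panel of two cells has angular length below \<open>1/n\<close>, as this map requires.
  Approximate jumps decay with exponent \<open>2 * k + s + 4\<close>: \<open>2 * k\<close> pays for
  the growth of polynomials of degree below \<open>k\<close>, \<open>s\<close> for the variation of
  the weight, and 4 is left for summation.\<close>
syntax
  "_lborel_nn" :: "pttrn \<Rightarrow> ennreal \<Rightarrow> ennreal" ("(NN _./ _)" [0, 10] 10)
  "_lborel_set_nn" :: "pttrn \<Rightarrow> real set \<Rightarrow> ennreal \<Rightarrow> ennreal" ("(NN _\<in>_./ _)" [0, 51, 10] 10)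
translations
  "NN x. f" \<rightharpoonup> "CONST nn_integral CONST lborel (\<lambda>x. f)"
  "NN x\<in>A. f" \<rightharpoonup> "CONST set_nn_integral CONST lborel A (\<lambda>x. f)"

text \<open>Forward form of the difference: its recursion in \<open>k\<close> is simpler than that
  of \<open>central_difference\<close>, which is the same expression started at
  \<open>x - k * h / 2\<close>.\<close>

definition fdiff :: "nat \<Rightarrow> real \<Rightarrow> (real \<Rightarrow> real) \<Rightarrow> real \<Rightarrow> real" where
  "fdiff k h f x = (\<Sum>i=0..k. real (k choose i) * (-1) ^ (k - i) * f (x + real i * h))"

lemma fdiff_Suc: "fdiff (Suc k) h f x = fdiff k h f (x + h) - fdiff k h f x"
proof -
  let ?g = "\<lambda>i. f (x + real i * h)"
  have "(\<Sum>i=0..Suc k. real (Suc k choose i) * (-1) ^ (Suc k - i) * ?g i)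
     = (-1) ^ Suc k * ?g 0 + (\<Sum>i=0..k. real (Suc k choose Suc i) * (-1) ^ (k - i) * ?g (Suc i))"
    by (subst sum.atLeast0_atMost_Suc_shift) simp
  also have "(\<Sum>i=0..k. real (Suc k choose Suc i) * (-1) ^ (k - i) * ?g (Suc i))
     = (\<Sum>i=0..k. real (k choose i) * (-1) ^ (k - i) * ?g (Suc i))
       + (\<Sum>i=0..k. real (k choose Suc i) * (-1) ^ (k - i) * ?g (Suc i))"
    by (simp add: sum.distrib[symmetric] algebra_simps)
  also have "(\<Sum>i=0..k. real (k choose Suc i) * (-1) ^ (k - i) * ?g (Suc i))
     = (\<Sum>i=1..Suc k. real (k choose i) * (-1) ^ (Suc k - i) * ?g i)"
    using sum.shift_bounds_cl_Suc_ivl[of "\<lambda>i. real (k choose i) * (-1) ^ (Suc k - i) * ?g i" 0 k] by simp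
  also have "\<dots> = (\<Sum>i=0..Suc k. real (k choose i) * (-1) ^ (Suc k - i) * ?g i) - (-1) ^ Suc k * ?g 0"
    by (subst sum.atLeast_Suc_atMost[of 0 "Suc k"]) auto
  also have "(\<Sum>i=0..Suc k. real (k choose i) * (-1) ^ (Suc k - i) * ?g i) = - fdiff k h f x"
    by (simp add: fdiff_def sum_negf[symmetric] Suc_diff_le)
  finally show ?thesis
    by (simp add: fdiff_def algebra_simps)
qed

text \<open>The operator acts on polynomials rather than on functions so that it can be iterated
  with \<open>^^\<close> and commuted with \<open>pderiv\<close>.\<close>

definition shift_diff :: "real \<Rightarrow> real poly \<Rightarrow> real poly" where
  "shift_diff h Q = pcompose Q [:h, 1:] - Q"

lemma poly_shift_diff: "poly (shift_diff h Q) x = poly Q (x + h) - poly Q x"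
  by (simp add: shift_diff_def poly_pcompose add.commute)

lemma fdiff_eq_poly: "fdiff k h (poly Q) x = poly ((shift_diff h ^^ k) Q) x"
proof (induction k arbitrary: x)
  case 0 then show ?case by (simp add: fdiff_def)
next
  case (Suc k) then show ?case by (simp add: fdiff_Suc poly_shift_diff)
qed

lemma pderiv_shift_diff: "pderiv (shift_diff h Q) = shift_diff h (pderiv Q)"
  by (simp add: shift_diff_def pderiv_diff pderiv_pcompose pderiv_pCons)

lemma pderiv_shift_diff_pow: "pderiv ((shift_diff h ^^ k) Q) = (shift_diff h ^^ k) (pderiv Q)"
  by (induction k arbitrary: Q) (simp_all add: pderiv_shift_diff)

text \<open>Induction on the order: the mean value theorem for \<open>(shift_diff h ^^ k) Q\<close>
  trades one difference for one derivative, and the two operators commute.\<close>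

lemma fdiff_poly_mvt:
  assumes "0 < h"
  shows "\<exists>\<xi>. x \<le> \<xi> \<and> \<xi> \<le> x + real k * h \<and> fdiff k h (poly Q) x = h ^ k * poly ((pderiv ^^ k) Q) \<xi>"
proof (induction k arbitrary: Q x)
  case 0 then show ?case by (auto simp: fdiff_def)
next
  case (Suc k)
  have "\<exists>z>x. z < x + h \<and> poly ((shift_diff h ^^ k) Q) (x + h) - poly ((shift_diff h ^^ k) Q) x
      = (x + h - x) * poly (pderiv ((shift_diff h ^^ k) Q)) z"
    by (rule poly_MVT) (use assms in auto)
  then obtain z where z: "x < z" "z < x + h"
    "fdiff (Suc k) h (poly Q) x = h * poly ((shift_diff h ^^ k) (pderiv Q)) z"
    by (auto simp: fdiff_Suc fdiff_eq_poly pderiv_shift_diff_pow poly_shift_diff)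
  obtain \<xi> where "z \<le> \<xi>" "\<xi> \<le> z + real k * h"
    "fdiff k h (poly (pderiv Q)) z = h ^ k * poly ((pderiv ^^ k) (pderiv Q)) \<xi>"
    using Suc[of z "pderiv Q"] by auto
  then show ?case using z
    by (intro exI[of _ \<xi>]) (auto simp: fdiff_eq_poly funpow_swap1 algebra_simps)
qed

lemma fdiff_poly_abs_le:
  assumes "0 < h" and "\<And>\<xi>. x \<le> \<xi> \<Longrightarrow> \<xi> \<le> x + real k * h \<Longrightarrow> \<bar>poly ((pderiv ^^ k) Q) \<xi>\<bar> \<le> B"
  shows "\<bar>fdiff k h (poly Q) x\<bar> \<le> h ^ k * B"
  using fdiff_poly_mvt[OF assms(1), of x k Q] assms by (auto simp: abs_mult intro!: mult_left_mono)

lemma pderiv_pow_eq_0: "degree (Q :: real poly) < k \<Longrightarrow> (pderiv ^^ k) Q = 0"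
proof (induction k arbitrary: Q)
  case (Suc k)
  have "(pderiv ^^ k) (pderiv Q) = 0"
  proof (cases "degree Q = 0")
    case True
    then have "pderiv Q = 0" by (simp add: pderiv_eq_0_iff)
    then show ?thesis by (induction k) (auto simp: pderiv_0)
  qed (use Suc in \<open>auto simp: degree_pderiv\<close>)
  then show ?case by (simp add: funpow_swap1)
qed simp

lemma fdiff_pos_poly_eq_0: "0 < h \<Longrightarrow> degree Q < k \<Longrightarrow> fdiff k h (poly Q) x = 0"
  using fdiff_poly_mvt[of h x k Q] by (auto simp: pderiv_pow_eq_0)

text \<open>Reversal of the summation index. Up to sign, a difference along a chord is thus
  independent of the direction in which the chord is traversed.\<close>

lemma fdiff_reflect: "fdiff k (-h) f (x + real k * h) = (-1) ^ k * fdiff k h f x"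
proof -
  have "fdiff k (-h) f (x + real k * h)
    = (\<Sum>i=0..k. real (k choose (k - i)) * (-1) ^ (k - (k - i)) * f (x + real k * h + real (k - i) * (- h)))"
    unfolding fdiff_def
    by (rule sum.reindex_bij_witness[of _ "\<lambda>i. k - i" "\<lambda>i. k - i"]) auto
  also have "\<dots> = (\<Sum>i=0..k. (-1) ^ k * (real (k choose i) * (-1) ^ (k - i) * f (x + real i * h)))"
  proof (intro sum.cong refl)
    fix i assume "i \<in> {0..k}"
    then have i: "i \<le> k" by auto
    have "(-1::real) ^ (k - (k - i)) = (-1) ^ k * (-1) ^ (k - i)"
      using i by (metis add_diff_cancel_left' diff_diff_cancel le_add_diff_inverse minus_one_power_iff power_add even_add)
    moreover have "f (x + real k * h + real (k - i) * (- h)) = f (x + real i * h)"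
      using i by (intro arg_cong[of _ _ f]) (simp add: of_nat_diff algebra_simps)
    ultimately show "real (k choose (k - i)) * (-1) ^ (k - (k - i)) * f (x + real k * h + real (k - i) * (- h))
      = (-1) ^ k * (real (k choose i) * (-1) ^ (k - i) * f (x + real i * h))"
      using i binomial_symmetric[OF i] by simp
  qed
  finally show ?thesis by (simp add: fdiff_def sum_distrib_left)
qed

lemma fdiff_zero: "k \<ge> 1 \<Longrightarrow> fdiff k 0 f x = 0"
proof (induction k)
  case (Suc k)
  then show ?case by (simp add: fdiff_Suc)
qed simp

lemma fdiff_poly_eq_0: "degree Q < k \<Longrightarrow> fdiff k h (poly Q) x = 0"
  using fdiff_pos_poly_eq_0[of h Q k x] fdiff_pos_poly_eq_0[of "-h" Q k "x + real k * h"]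
    fdiff_reflect[of k h "poly Q" x] fdiff_zero[of k "poly Q" x]
  by (cases h "0::real" rule: linorder_cases) auto

lemma fdiff_add: "fdiff k h (\<lambda>x. f x + g x) x = fdiff k h f x + fdiff k h g x"
  by (simp add: fdiff_def algebra_simps sum.distrib)

lemma fdiff_diff: "fdiff k h (\<lambda>x. f x - g x) x = fdiff k h f x - fdiff k h g x"
  by (simp add: fdiff_def algebra_simps sum_subtractf)

text \<open>The term with \<open>i = 0\<close> has coefficient \<open>(-1) ^ k\<close>, so the
  difference can be solved for \<open>f x\<close>. The bounds for values along chords start from
  this identity.\<close>

lemma fdiff_solve_first:
  "f x = (-1) ^ k * fdiff k h f x - (\<Sum>i=1..k. (-1) ^ i * real (k choose i) * f (x + real i * h))"
proof -
  have "(-1) ^ k * fdiff k h f x = (\<Sum>i=0..k. (-1) ^ i * real (k choose i) * f (x + real i * h))"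
    unfolding fdiff_def sum_distrib_left
  proof (intro sum.cong refl)
    fix i assume "i \<in> {0..k}"
    then have "(-1::real) ^ k * (-1) ^ (k - i) = (-1) ^ i"
      by (simp add: minus_one_power_iff)
    then show "(-1) ^ k * (real (k choose i) * (-1) ^ (k - i) * f (x + real i * h))
      = (-1) ^ i * real (k choose i) * f (x + real i * h)" by (simp add: mult_ac)
  qed
  also have "\<dots> = f x + (\<Sum>i=1..k. (-1) ^ i * real (k choose i) * f (x + real i * h))"
    by (subst sum.atLeast_Suc_atMost) auto
  finally show ?thesis by simp
qed

lemma central_difference_eq_fdiff:
  "central_difference k h f x =
    (if x - real k * h / 2 \<in> {-1..1} \<and> x + real k * h / 2 \<in> {-1..1} then fdiff k h f (x - real k * h / 2) else 0)"
  by (simp add: central_difference_def fdiff_def)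

section \<open>Primitives and mean-value estimates for polynomials\<close>

lemma borel_measurable_poly[measurable]: "poly p \<in> borel_measurable (borel :: real measure)"
  by (intro borel_measurable_continuous_onI continuous_intros)

lemma pderiv_sum: "pderiv (\<Sum>i\<in>A. f i) = (\<Sum>i\<in>A. pderiv (f i))"
  by (induction A rule: infinite_finite_induct) (simp_all add: pderiv_add)

lemma poly_antideriv:
  fixes P :: "real poly"
  obtains Q where "pderiv Q = P" "poly Q 0 = c" "degree Q \<le> Suc (degree P)"
proof
  define Q where "Q = [:c:] + (\<Sum>i\<le>degree P. monom (coeff P i / real (Suc i)) (Suc i))"
  have "pderiv Q = (\<Sum>i\<le>degree P. monom (coeff P i) i)"
    unfolding Q_def by (simp add: pderiv_add pderiv_sum pderiv_monom pderiv_pCons del: of_nat_Suc)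
  then show "pderiv Q = P" by (simp add: poly_as_sum_of_monoms)
  show "poly Q 0 = c" by (simp add: Q_def poly_sum poly_monom)
  show "degree Q \<le> Suc (degree P)"
    unfolding Q_def by (intro degree_add_le degree_sum_le) (auto intro: order.trans[OF degree_monom_le])
qed

text \<open>A \<open>k\<close>-fold primitive serves below as a device for averaging: its
  \<open>k\<close>-th difference quotient is a weighted mean of \<open>P\<close>.\<close>

lemma poly_antideriv_pow:
  fixes P :: "real poly"
  obtains Q where "(pderiv ^^ k) Q = P"
proof -
  have "\<exists>Q. (pderiv ^^ k) Q = P"
  proof (induction k arbitrary: P)
    case (Suc k)
    obtain R where "pderiv R = P" by (rule poly_antideriv)
    with Suc[of R] show ?case by auto
  qed auto
  then show thesis using that by blast
qed

lemma poly_diff_le_nn_integral: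
  fixes P :: "real poly"
  assumes "a \<le> b"
  shows "ennreal \<bar>poly P b - poly P a\<bar> \<le> (NN x\<in>{a..b}. ennreal \<bar>poly (pderiv P) x\<bar>)"
proof -
  have int: "integrable lborel (\<lambda>x. poly (pderiv P) x * indicator {a..b} x)"
    using borel_integrable_compact[of "{a..b}" "poly (pderiv P)"]
    by (simp add: continuous_on_poly mult.commute indicator_scaleR_eq_if indicator_times_eq_if)
  have "(\<integral>x. poly (pderiv P) x * indicator {a..b} x \<partial>lborel) = poly P b - poly P a"
    by (rule integral_FTC_Icc_real) (use assms in \<open>auto intro: poly_DERIV\<close>)
  then have "ennreal \<bar>poly P b - poly P a\<bar> = ennreal (norm (\<integral>x. poly (pderiv P) x * indicator {a..b} x \<partial>lborel))"
    by simp
  also have "\<dots> \<le> (NN x. ennreal (norm (poly (pderiv P) x * indicator {a..b} x)))"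
    by (rule integral_norm_bound_ennreal[OF int])
  also have "\<dots> = (NN x\<in>{a..b}. ennreal \<bar>poly (pderiv P) x\<bar>)"
    by (intro nn_integral_cong) (auto simp: indicator_def)
  finally show ?thesis .
qed

lemma set_nn_integral_affine:
  fixes f :: "real \<Rightarrow> ennreal"
  assumes [measurable]: "f \<in> borel_measurable borel" and "0 < c"
    and sub: "\<And>x. x \<in> A \<Longrightarrow> t + c * x \<in> B" and [measurable]: "B \<in> sets borel"
  shows "(NN x\<in>A. f (t + c * x)) \<le> ennreal (1 / c) * (NN y\<in>B. f y)"
proof -
  have "(NN x\<in>A. f (t + c * x)) \<le> (NN x. f (t + c * x) * indicator B (t + c * x))"
    by (intro nn_integral_mono) (auto simp: indicator_def sub)
  also have "\<dots> = ennreal (1/c) * (ennreal \<bar>c\<bar> * (NN x. f (t + c * x) * indicator B (t + c * x)))"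
    using \<open>0 < c\<close> by (simp add: mult.assoc[symmetric] ennreal_mult'[symmetric])
  also have "\<dots> = ennreal (1/c) * (NN y\<in>B. f y)"
    using \<open>0 < c\<close> by (subst nn_integral_real_affine[of "\<lambda>y. f y * indicator B y" c t]) auto
  finally show ?thesis .
qed

text \<open>One difference quotient is the mean of a derivative over \<open>[x, x + h]\<close>; by
  Fubini this mean costs only an enlargement of the interval by \<open>h\<close>. Induction hands
  the remaining \<open>k\<close> quotients to \<open>pderiv G\<close>.\<close>

lemma fdiff_quotient_integral_le:
  fixes G :: "real poly"
  assumes "0 < h"
  shows "(NN x\<in>{\<alpha>..\<beta>}. ennreal (\<bar>fdiff k h (poly G) x\<bar> / h ^ k))
    \<le> (NN x\<in>{\<alpha>..\<beta> + real k * h}. ennreal \<bar>poly ((pderiv ^^ k) G) x\<bar>)"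
proof (induction k arbitrary: G \<beta>)
  case 0 then show ?case by (simp add: fdiff_def)
next
  case (Suc k)
  define P where "P = smult (1 / h ^ k) ((shift_diff h ^^ k) G)"
  have P: "poly (pderiv P) x = fdiff k h (poly (pderiv G)) x / h ^ k" for x
    by (simp add: P_def pderiv_smult pderiv_shift_diff_pow fdiff_eq_poly)
  have "(NN x\<in>{\<alpha>..\<beta>}. ennreal (\<bar>fdiff (Suc k) h (poly G) x\<bar> / h ^ Suc k))
     \<le> (NN x\<in>{\<alpha>..\<beta>}. ennreal (1 / h) * (NN t\<in>{0..h}. ennreal \<bar>poly (pderiv P) (x + t)\<bar>))"
  proof (intro nn_integral_mono mult_right_mono)
    fix x
    have "\<bar>fdiff (Suc k) h (poly G) x\<bar> / h ^ Suc k = (1 / h) * \<bar>poly P (x + h) - poly P x\<bar>"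
      using assms
      by (simp add: P_def fdiff_eq_poly poly_shift_diff abs_mult abs_divide right_diff_distrib[symmetric] diff_divide_distrib[symmetric])
    also have "ennreal \<dots> = ennreal (1 / h) * ennreal \<bar>poly P (x + h) - poly P x\<bar>"
      using assms by (intro ennreal_mult) auto
    also have "\<dots> \<le> ennreal (1 / h) * (NN t\<in>{x..x+h}. ennreal \<bar>poly (pderiv P) t\<bar>)"
      using assms by (intro mult_left_mono poly_diff_le_nn_integral) auto
    also have "(NN t\<in>{x..x+h}. ennreal \<bar>poly (pderiv P) t\<bar>) =
       (NN t\<in>{0..h}. ennreal \<bar>poly (pderiv P) (x + t)\<bar>)"
      by (subst nn_integral_real_affine[of _ 1 x]) (auto intro!: nn_integral_cong simp: indicator_def)
    finally show "ennreal (\<bar>fdiff (Suc k) h (poly G) x\<bar> / h ^ Suc k)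
       \<le> ennreal (1 / h) * (NN t\<in>{0..h}. ennreal \<bar>poly (pderiv P) (x + t)\<bar>)" .
  qed auto
  also have "\<dots> = ennreal (1 / h) * (NN x. (NN t. ennreal \<bar>poly (pderiv P) (x + t)\<bar> * indicator {0..h} t * indicator {\<alpha>..\<beta>} x))"
    by (simp add: nn_integral_cmult[symmetric] nn_integral_multc[symmetric] mult.assoc)
  also have "(NN x. (NN t. ennreal \<bar>poly (pderiv P) (x + t)\<bar> * indicator {0..h} t * indicator {\<alpha>..\<beta>} x))
    = (NN t. (NN x. ennreal \<bar>poly (pderiv P) (x + t)\<bar> * indicator {0..h} t * indicator {\<alpha>..\<beta>} x))"
    by (rule lborel_pair.Fubini') measurable
  also have "ennreal (1 / h) * \<dots> \<le> ennreal (1 / h) * (NN t. (NN x\<in>{\<alpha>..\<beta>+h}. ennreal \<bar>poly (pderiv P) x\<bar>) * indicator {0..h} t)"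
  proof (intro mult_left_mono nn_integral_mono)
    fix t
    show "(NN x. ennreal \<bar>poly (pderiv P) (x + t)\<bar> * indicator {0..h} t * indicator {\<alpha>..\<beta>} x)
      \<le> (NN x\<in>{\<alpha>..\<beta>+h}. ennreal \<bar>poly (pderiv P) x\<bar>) * indicator {0..h} t"
    proof (cases "t \<in> {0..h}")
      case True
      have "(NN x\<in>{\<alpha>..\<beta>}. ennreal \<bar>poly (pderiv P) (t + 1 * x)\<bar>)
        \<le> ennreal (1 / 1) * (NN x\<in>{\<alpha>..\<beta>+h}. ennreal \<bar>poly (pderiv P) x\<bar>)"
        by (rule set_nn_integral_affine) (use True in auto)
      with True show ?thesis by (simp add: add.commute)
    qed simp
  qed auto
  also have "\<dots> = (NN x\<in>{\<alpha>..\<beta>+h}. ennreal \<bar>poly (pderiv P) x\<bar>)"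
  proof -
    have "ennreal (1 / h) * (X * ennreal h) = X" for X
      using assms by (subst mult.left_commute) (simp add: ennreal_mult'[symmetric])
    then show ?thesis using assms by (subst nn_integral_cmult) auto
  qed
  also have "\<dots> = (NN x\<in>{\<alpha>..\<beta>+h}. ennreal (\<bar>fdiff k h (poly (pderiv G)) x\<bar> / h ^ k))"
    using assms by (simp add: P abs_divide)
  also have "\<dots> \<le> (NN x\<in>{\<alpha>..\<beta> + h + real k * h}. ennreal \<bar>poly ((pderiv ^^ k) (pderiv G)) x\<bar>)"
    by (rule Suc)
  also have "\<beta> + h + real k * h = \<beta> + real (Suc k) * h" by (simp add: algebra_simps)
  finally show ?case by (simp only: funpow_Suc_right o_apply)
qed

text \<open>Taylor approximation without a remainder formula: an approximant of the derivative is
  integrated, and its error does not grow because the interval has length 1.\<close>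

lemma poly_taylor_approx:
  fixes G :: "real poly"
  shows "\<exists>p. degree p < Suc k \<and> (\<forall>x\<in>{0..1}. ennreal \<bar>poly G x - poly p x\<bar> \<le>
      (NN t\<in>{0..1}. ennreal \<bar>poly ((pderiv ^^ Suc k) G) t\<bar>))"
proof (induction k arbitrary: G)
  case 0
  have "ennreal \<bar>poly G x - poly [:poly G 0:] x\<bar> \<le> (NN t\<in>{0..1}. ennreal \<bar>poly ((pderiv ^^ Suc 0) G) t\<bar>)"
    if "x \<in> {0..1}" for x
    using poly_diff_le_nn_integral[of 0 x G] that
    by (auto elim!: order.trans intro!: nn_set_integral_set_mono)
  then show ?case by (intro exI[of _ "[:poly G 0:]"]) auto
next
  case (Suc k)
  obtain p' where p': "degree p' < Suc k" and bd: "\<And>x. x \<in> {0..1} \<Longrightarrow> ennreal \<bar>poly (pderiv G) x - poly p' x\<bar> \<le>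
      (NN t\<in>{0..1}. ennreal \<bar>poly ((pderiv ^^ Suc k) (pderiv G)) t\<bar>)"
    using Suc[of "pderiv G"] by blast
  obtain p where p: "pderiv p = p'" "poly p 0 = poly G 0" "degree p \<le> Suc (degree p')"
    by (rule poly_antideriv)
  let ?M = "\<integral>\<^sup>+t\<in>{0..1}. ennreal \<bar>poly ((pderiv ^^ Suc k) (pderiv G)) t\<bar> \<partial>lborel"
  have "ennreal \<bar>poly G x - poly p x\<bar> \<le> ?M" if x: "x \<in> {0..1}" for x
  proof -
    have "ennreal \<bar>poly G x - poly p x\<bar> = ennreal \<bar>poly (G - p) x - poly (G - p) 0\<bar>" using p by simp
    also have "\<dots> \<le> (NN t\<in>{0..x}. ennreal \<bar>poly (pderiv (G - p)) t\<bar>)"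
      using x by (intro poly_diff_le_nn_integral) auto
    also have "\<dots> \<le> (NN (t::real). ?M * indicator {0..1} t)"
      by (rule nn_integral_mono) (use bd x in \<open>auto simp: indicator_def pderiv_diff p\<close>)
    also have "\<dots> = ?M" by (subst nn_integral_cmult_indicator) auto
    finally show ?thesis .
  qed
  then show ?case using p p' by (intro exI[of _ p]) (auto simp: funpow_swap1)
qed

section \<open>Whitney's inequality in the mean\<close>

text \<open>The free variables are the ends of the chord instead of base point and step. The
  \<open>k + 1\<close> points divide the segment from \<open>x\<close> to \<open>u\<close> into
  equal parts and stay inside any interval that contains both ends.\<close>

definition chord_diff :: "nat \<Rightarrow> (real \<Rightarrow> real) \<Rightarrow> real \<Rightarrow> real \<Rightarrow> real" where
  "chord_diff k f x u = \<bar>fdiff k ((u - x) / real k) f x\<bar>"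

lemma fdiff_measurable[measurable (raw)]:
  assumes [measurable]: "f \<in> borel_measurable borel" "h \<in> borel_measurable M" "x \<in> borel_measurable M"
  shows "(\<lambda>z. fdiff k (h z) f (x z)) \<in> borel_measurable M"
  unfolding fdiff_def by measurable

lemma chord_diff_measurable[measurable (raw)]:
  assumes [measurable]: "f \<in> borel_measurable borel" "u \<in> borel_measurable M" "x \<in> borel_measurable M"
  shows "(\<lambda>z. chord_diff k f (x z) (u z)) \<in> borel_measurable M"
  unfolding chord_diff_def by measurable

text \<open>Coefficients of the remaining chord points when the difference is solved for its first
  value.\<close>

definition solve_coeff :: "nat \<Rightarrow> nat \<Rightarrow> real" where
  "solve_coeff k i = - ((-1) ^ i * real (k choose i))"

lemma abs_solve_coeff_le: "\<bar>solve_coeff k i\<bar> \<le> 2 ^ k"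
proof -
  have "\<bar>solve_coeff k i\<bar> = real (k choose i)" by (simp add: solve_coeff_def abs_mult power_abs)
  also have "k choose i \<le> 2 ^ k" by (rule binomial_le_pow2)
  finally show ?thesis by simp
qed

lemma chord_representation:
  assumes "k \<ge> 1"
  shows "f x - (\<Sum>i=1..k. solve_coeff k i * f ((1 - real i / real k) * x + real i / real k * u))
    = (-1) ^ k * fdiff k ((u - x) / real k) f x"
proof -
  have *: "x + real i * ((u - x) / real k) = (1 - real i / real k) * x + real i / real k * u" for i
    using assms by (simp add: field_simps)
  show ?thesis
    using fdiff_solve_first[of f x k "(u - x) / real k"] unfolding *
    by (simp add: solve_coeff_def sum_negf)
qed

text \<open>In \<open>chord_representation\<close> the point \<open>u\<close> is averaged near
  \<open>A\<close>: \<open>f\<close> is replaced by the \<open>k\<close>-th difference quotient, of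
  step \<open>(i / k) * h\<close>, of a \<open>k\<close>-fold primitive \<open>F\<close>. The
  outcome approximates \<open>f x\<close>, while \<open>k\<close> derivatives in \<open>x\<close>
  turn \<open>F\<close> back into \<open>f\<close> and leave plain \<open>k\<close>-th differences
  of \<open>f\<close>. Both the error and the derivative are therefore governed by differences along
  chords.\<close>

definition chord_smooth :: "nat \<Rightarrow> real poly \<Rightarrow> real \<Rightarrow> real \<Rightarrow> real poly" where
  "chord_smooth k F A h = (\<Sum>i=1..k. smult (solve_coeff k i / (real i / real k * h) ^ k)
      (pcompose ((shift_diff (real i / real k * h) ^^ k) F) [:real i / real k * A, 1 - real i / real k:]))"

lemma poly_chord_smooth:
  "poly (chord_smooth k F A h) x = (\<Sum>i=1..k. solve_coeff k i / (real i / real k * h) ^ k *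
      fdiff k (real i / real k * h) (poly F) ((1 - real i / real k) * x + real i / real k * A))"
  unfolding chord_smooth_def
  by (simp add: poly_sum poly_pcompose fdiff_eq_poly mult.commute add.commute)

lemma pderiv_pow_sum: "(pderiv ^^ k) (\<Sum>i\<in>A. f i) = (\<Sum>i\<in>A. (pderiv ^^ k) (f i))"
  by (induction k) (simp_all add: pderiv_sum)

lemma pderiv_pow_smult: "(pderiv ^^ k) (smult a (p :: real poly)) = smult a ((pderiv ^^ k) p)"
  by (induction k) (simp_all add: pderiv_smult)

lemma pderiv_pow_diff: "(pderiv ^^ k) (p - q :: real poly) = (pderiv ^^ k) p - (pderiv ^^ k) q"
  by (induction k) (simp_all add: pderiv_diff)

lemma pderiv_pow_pcompose_affine:
  "(pderiv ^^ k) (pcompose (p :: real poly) [:b, a:]) = smult (a ^ k) (pcompose ((pderiv ^^ k) p) [:b, a:])"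
  by (induction k) (simp_all add: pderiv_smult pderiv_pcompose pderiv_pCons mult.commute)

lemma pderiv_pow_shift_diff_pow: "(pderiv ^^ j) ((shift_diff h ^^ k) Q) = (shift_diff h ^^ k) ((pderiv ^^ j) Q)"
  by (induction j) (simp_all add: pderiv_shift_diff_pow)

lemma pderiv_pow_monom: "(pderiv ^^ k) (monom (c / fact k) k) = [:c :: real:]"
proof (induction k)
  case (Suc k)
  have "pderiv (monom (c / fact (Suc k)) (Suc k)) = monom (c / fact k) k"
    by (simp add: pderiv_monom)
  with Suc show ?case by (simp add: funpow_swap1)
qed (simp add: monom_0)

lemma poly_pderiv_chord_smooth:
  assumes "(pderiv ^^ k) F = f"
  shows "poly ((pderiv ^^ k) (chord_smooth k F A h)) x =
    (\<Sum>i=1..k. solve_coeff k i / (real i / real k * h) ^ k * (1 - real i / real k) ^ k *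
      fdiff k (real i / real k * h) (poly f) ((1 - real i / real k) * x + real i / real k * A))"
  unfolding chord_smooth_def
  by (simp add: pderiv_pow_sum pderiv_pow_smult pderiv_pow_pcompose_affine pderiv_pow_shift_diff_pow assms
      poly_sum poly_pcompose fdiff_eq_poly mult_ac add.commute)

text \<open>Everything is read off one auxiliary polynomial whose \<open>k\<close>-th derivative is
  a chord difference and whose \<open>k\<close>-th difference quotient is the error.\<close>

lemma chord_smooth_error:
  assumes k: "k \<ge> 1" and F: "(pderiv ^^ k) F = f" and h: "0 < h" "real k * h \<le> 1 / 2"
  shows "(NN A\<in>{0..1/2}. ennreal \<bar>poly f x - poly (chord_smooth k F A h) x\<bar>)
    \<le> (NN u\<in>{0..1}. ennreal (chord_diff k (poly f) x u))"
proof -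
  define s where "s i = real i / real k" for i
  \<comment> \<open>Here \<open>x\<close> is frozen. The monomial has the constant
    \<open>poly f x\<close> as its \<open>k\<close>-th derivative, and the factor
    \<open>1 / s i ^ k\<close> compensates the inner derivatives of the affine substitution.\<close>
  define G where "G = monom (poly f x / fact k) k
    - (\<Sum>i=1..k. smult (solve_coeff k i / s i ^ k) (pcompose F [:(1 - s i) * x, s i:]))"
  have s: "s i > 0" if "i \<in> {1..k}" for i using that by (auto simp: s_def)
  have DG: "poly ((pderiv ^^ k) G) u = (-1) ^ k * fdiff k ((u - x) / real k) (poly f) x" for u
  proof -
    have "poly ((pderiv ^^ k) G) u = poly f x - (\<Sum>i=1..k. solve_coeff k i * poly f ((1 - s i) * x + s i * u))"
      unfolding G_def pderiv_pow_diff pderiv_pow_monom pderiv_pow_sum pderiv_pow_smult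
        pderiv_pow_pcompose_affine F poly_diff poly_sum
      using s by (auto intro!: sum.cong simp: poly_pcompose mult.commute less_le)
    then show ?thesis using chord_representation[OF k, of "poly f" x u] by (simp add: s_def)
  qed
  have fG: "fdiff k h (poly G) A / h ^ k = poly f x - poly (chord_smooth k F A h) x" for A
  proof -
    have m: "fdiff k h (poly (monom (poly f x / fact k) k)) A = h ^ k * poly f x"
      using fdiff_poly_mvt[OF h(1), of A k "monom (poly f x / fact k) k"] by (auto simp: pderiv_pow_monom)
    have sum: "fdiff k h (\<lambda>u. \<Sum>i=1..k. g i u) A = (\<Sum>i=1..k. fdiff k h (g i) A)" for g
      unfolding fdiff_def by (simp add: sum_distrib_left) (rule sum.swap)
    have aff: "fdiff k h (\<lambda>u. c * g (v + t * u)) A = c * fdiff k (t * h) g (v + t * A)" for c g v t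
      unfolding fdiff_def by (simp add: sum_distrib_left algebra_simps)
    have "fdiff k h (poly G) A = h ^ k * poly f x
      - (\<Sum>i=1..k. solve_coeff k i / s i ^ k * fdiff k (s i * h) (poly F) ((1 - s i) * x + s i * A))"
      unfolding G_def poly_diff[abs_def] fdiff_diff m
    proof -
      have "poly (\<Sum>i=1..k. smult (solve_coeff k i / s i ^ k) (pcompose F [:(1 - s i) * x, s i:]))
          = (\<lambda>u. \<Sum>i=1..k. solve_coeff k i / s i ^ k * poly F ((1 - s i) * x + s i * u))"
        by (simp add: fun_eq_iff poly_sum poly_pcompose mult.commute)
      then show "h ^ k * poly f x - fdiff k h (poly (\<Sum>i=1..k. smult (solve_coeff k i / s i ^ k)
          (pcompose F [:(1 - s i) * x, s i:]))) A = h ^ k * poly f x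
      - (\<Sum>i=1..k. solve_coeff k i / s i ^ k * fdiff k (s i * h) (poly F) ((1 - s i) * x + s i * A))"
        by (simp only: sum aff)
    qed
    also have "\<dots> = h ^ k * (poly f x - poly (chord_smooth k F A h) x)"
      unfolding poly_chord_smooth s_def[symmetric] using h(1) s
      by (simp add: right_diff_distrib sum_distrib_left power_mult_distrib)
    finally show ?thesis using h(1) by simp
  qed
  have "(NN A\<in>{0..1/2}. ennreal \<bar>poly f x - poly (chord_smooth k F A h) x\<bar>)
    = (NN A\<in>{0..1/2}. ennreal (\<bar>fdiff k h (poly G) A\<bar> / h ^ k))"
    using h(1) by (simp add: fG[symmetric] abs_divide)
  also have "\<dots> \<le> (NN u\<in>{0..1/2 + real k * h}. ennreal \<bar>poly ((pderiv ^^ k) G) u\<bar>)"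
    by (rule fdiff_quotient_integral_le[OF h(1)])
  also have "\<dots> \<le> (NN u\<in>{0..1}. ennreal \<bar>poly ((pderiv ^^ k) G) u\<bar>)"
    using h by (intro nn_set_integral_set_mono) auto
  finally show ?thesis by (simp add: DG chord_diff_def abs_mult power_abs)
qed

text \<open>With \<open>s = i / k\<close>, the difference of step \<open>s * h\<close> started at
  \<open>y = (1 - s) * x + s * A\<close> is the chord difference from \<open>y\<close> to
  \<open>y + i * h\<close>. Two substitutions, \<open>h\<close> to the end point and
  \<open>A\<close> to \<open>y\<close>, turn the left side into a mean over chords. The bound
  \<open>h <= 1 / (2 * k)\<close> keeps the end point below 1.\<close>

lemma scaled_chord_integral_le:
  fixes f :: "real \<Rightarrow> real"
  assumes [measurable]: "f \<in> borel_measurable borel" and i: "1 \<le> i" "i \<le> k" and x: "x \<in> {0..1}"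
  shows "(NN A\<in>{0..1/2}. (NN h\<in>{1/(4*real k)..1/(2*real k)}.
       ennreal \<bar>fdiff k (real i / real k * h) f ((1 - real i / real k) * x + real i / real k * A)\<bar>))
    \<le> ennreal (real k) * (NN y\<in>{0..1}. (NN u\<in>{0..1}. ennreal (chord_diff k f y u)))"
proof -
  define s where "s = real i / real k"
  have k: "real k > 0" and s: "0 < s" "s \<le> 1" "real k * s = real i" using i by (auto simp: s_def)
  have inner: "(NN h\<in>{1/(4*real k)..1/(2*real k)}. ennreal \<bar>fdiff k (s * h) f ((1 - s) * x + s * A)\<bar>)
    \<le> (NN u\<in>{0..1}. ennreal (chord_diff k f ((1 - s) * x + s * A) u))" if A: "A \<in> {0..1/2}" for A
  proof -
    define y where "y = (1 - s) * x + s * A"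
    have "(NN h\<in>{1/(4*real k)..1/(2*real k)}. ennreal (chord_diff k f y (y + real i * h)))
      \<le> ennreal (1 / real i) * (NN u\<in>{0..1}. ennreal (chord_diff k f y u))"
    proof (rule set_nn_integral_affine)
      fix h assume h: "h \<in> {1/(4*real k)..1/(2*real k)}"
      then have "0 \<le> h" using k by (auto intro: order.trans[of 0 "1/(4*real k)"])
      have "real k * h \<le> 1/2" using h k by (simp add: field_simps)
      then have "A + real k * h \<le> 1" using A by auto
      then have "(1 - s) * x + s * (A + real k * h) \<le> (1 - s) * 1 + s * 1"
        using s x by (intro add_mono mult_left_mono) auto
      moreover have "y + real i * h = (1 - s) * x + s * (A + real k * h)"
        unfolding y_def s(3)[symmetric] by (simp add: algebra_simps)
      moreover have "y \<ge> 0" unfolding y_def using A x s by auto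
      moreover have "0 \<le> real i * h" using \<open>0 \<le> h\<close> by simp
      ultimately show "y + real i * h \<in> {0..1}" by simp
    qed (use i in auto)
    also have "\<dots> \<le> 1 * (NN u\<in>{0..1}. ennreal (chord_diff k f y u))"
      using i by (intro mult_right_mono) (auto simp: ennreal_le_1)
    finally have "(NN h\<in>{1/(4*real k)..1/(2*real k)}. ennreal (chord_diff k f y (y + real i * h)))
      \<le> (NN u\<in>{0..1}. ennreal (chord_diff k f y u))" by simp
    moreover have "chord_diff k f y (y + real i * h) = \<bar>fdiff k (s * h) f y\<bar>" for h
      using k by (simp add: chord_diff_def s_def)
    ultimately show ?thesis by (simp add: y_def)
  qed
  have "(NN A\<in>{0..1/2}. (NN h\<in>{1/(4*real k)..1/(2*real k)}.
       ennreal \<bar>fdiff k (s * h) f ((1 - s) * x + s * A)\<bar>))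
    \<le> (NN A\<in>{0..1/2}. (NN u\<in>{0..1}. ennreal (chord_diff k f ((1 - s) * x + s * A) u)))"
    using inner by (intro nn_integral_mono) (auto simp: indicator_def)
  also have "\<dots> \<le> ennreal (1 / s) * (NN y\<in>{0..1}. (NN u\<in>{0..1}. ennreal (chord_diff k f y u)))"
  proof (rule set_nn_integral_affine)
    fix A :: real assume "A \<in> {0..1/2}"
    then have "(1 - s) * x + s * A \<le> (1 - s) * 1 + s * 1" "0 \<le> (1 - s) * x + s * A"
      using s x by (intro add_mono mult_left_mono, auto)
    then show "(1 - s) * x + s * A \<in> {0..1}" by auto
  qed (use s in auto)
  also have "\<dots> \<le> ennreal (real k) * (NN y\<in>{0..1}. (NN u\<in>{0..1}. ennreal (chord_diff k f y u)))"
    using i by (intro mult_right_mono) (auto simp: s_def field_simps intro!: ennreal_leI)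
  finally show ?thesis by (simp add: s_def)
qed

text \<open>If every value exceeded the mean by the slack \<open>e\<close>, integrating this
  constant would contradict \<open>I\<close>.\<close>

lemma nn_integral_rectangle_exists_le:
  fixes Z :: "real \<Rightarrow> real \<Rightarrow> ennreal"
  assumes "a < b" "c < d" "0 \<le> I" "0 < e"
    and I: "(NN A\<in>{a..b}. (NN h\<in>{c..d}. Z A h)) \<le> ennreal I"
  shows "\<exists>A\<in>{a..b}. \<exists>h\<in>{c..d}. Z A h \<le> ennreal ((I + e) / ((b - a) * (d - c)))"
proof (rule ccontr)
  assume "\<not> ?thesis"
  then have Z: "ennreal ((I + e) / ((b - a) * (d - c))) \<le> Z A h" if "A \<in> {a..b}" "h \<in> {c..d}" for A h
    using that by (auto simp: not_le intro: less_imp_le)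
  have "ennreal (I + e) = (NN A\<in>{a..b}. (NN h\<in>{c..d}. ennreal ((I + e) / ((b - a) * (d - c)))))"
    using assms by (simp add: nn_integral_cmult_indicator ennreal_mult'[symmetric])
  also have "\<dots> \<le> (NN A\<in>{a..b}. (NN h\<in>{c..d}. Z A h))"
    by (intro nn_integral_mono) (auto simp: indicator_def intro!: nn_integral_mono Z)
  also note I
  finally show False using assms by simp
qed

lemma set_nn_integral_swap:
  fixes f :: "real \<Rightarrow> real \<Rightarrow> ennreal"
  assumes [measurable]: "(\<lambda>(x, y). f x y) \<in> borel_measurable (borel \<Otimes>\<^sub>M borel)" "A \<in> sets borel" "B \<in> sets borel"
  shows "(NN x\<in>A. (NN y\<in>B. f x y)) = (NN y\<in>B. (NN x\<in>A. f x y))"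
proof -
  have "(NN x\<in>A. (NN y\<in>B. f x y)) = (NN x. (NN y. f x y * indicator B y * indicator A x))"
    by (simp add: nn_integral_multc)
  also have "\<dots> = (NN y. (NN x. f x y * indicator B y * indicator A x))"
    by (rule lborel_pair.Fubini') measurable
  also have "\<dots> = (NN y. (NN x. f x y * indicator A x * indicator B y))"
    by (simp add: mult_ac)
  also have "\<dots> = (NN y\<in>B. (NN x\<in>A. f x y))"
    by (simp add: nn_integral_multc)
  finally show ?thesis .
qed

lemma set_nn_integral_mono_on:
  "(\<And>x. x \<in> A \<Longrightarrow> f x \<le> g x) \<Longrightarrow> (\<integral>\<^sup>+x\<in>A. f x \<partial>M) \<le> (\<integral>\<^sup>+x\<in>A. g x \<partial>M)"
  by (intro nn_integral_mono) (auto simp: indicator_def)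

lemma set_nn_integral_add:
  "f \<in> borel_measurable M \<Longrightarrow> g \<in> borel_measurable M \<Longrightarrow> A \<in> sets M \<Longrightarrow>
   (\<integral>\<^sup>+x\<in>A. f x + g x \<partial>M) = (\<integral>\<^sup>+x\<in>A. f x \<partial>M) + (\<integral>\<^sup>+x\<in>A. g x \<partial>M)"
  by (simp add: distrib_right nn_integral_add)

lemma set_nn_integral_sum:
  "(\<And>i. i \<in> I \<Longrightarrow> f i \<in> borel_measurable M) \<Longrightarrow> A \<in> sets M \<Longrightarrow>
   (\<integral>\<^sup>+x\<in>A. (\<Sum>i\<in>I. f i x) \<partial>M) = (\<Sum>i\<in>I. (\<integral>\<^sup>+x\<in>A. f i x \<partial>M))"
  by (simp only: sum_distrib_right) (intro nn_integral_sum, auto)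

lemma set_nn_integral_cmult:
  "f \<in> borel_measurable M \<Longrightarrow> A \<in> sets M \<Longrightarrow> (\<integral>\<^sup>+x\<in>A. c * f x \<partial>M) = c * (\<integral>\<^sup>+x\<in>A. f x \<partial>M)"
  by (simp only: mult.assoc) (intro nn_integral_cmult, auto)

lemma ennreal_abs_triangle: "ennreal \<bar>a - c\<bar> \<le> ennreal \<bar>a - b\<bar> + ennreal \<bar>b - c\<bar>"
  by (subst ennreal_plus[symmetric]) (auto intro!: ennreal_leI simp del: ennreal_plus)

definition chord_mean :: "nat \<Rightarrow> (real \<Rightarrow> real) \<Rightarrow> real \<Rightarrow> real \<Rightarrow> ennreal" where
  "chord_mean k f a b = (NN x\<in>{a..b}. (NN u\<in>{a..b}. ennreal (chord_diff k f x u)))"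

text \<open>Finiteness allows the mean to be handled as a real number when the parameters of the
  smoothing are chosen.\<close>

lemma chord_mean_poly_finite: "k \<ge> 1 \<Longrightarrow> chord_mean k (poly f) 0 1 < \<infinity>"
proof -
  assume "k \<ge> 1"
  have "continuous_on ({0..1} \<times> {0..1}) (\<lambda>(x,u). chord_diff k (poly f) x u)"
    unfolding chord_diff_def fdiff_def case_prod_beta using \<open>k \<ge> 1\<close> by (intro continuous_intros) auto
  then have "bounded ((\<lambda>(x,u). chord_diff k (poly f) x u) ` ({0..1} \<times> {0..1}))"
    by (intro compact_imp_bounded compact_continuous_image compact_Times) auto
  then obtain B where B: "\<And>x u. x \<in> {0..1} \<Longrightarrow> u \<in> {0..1} \<Longrightarrow> chord_diff k (poly f) x u \<le> B"
    unfolding bounded_iff by (force simp: chord_diff_def)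
  have "chord_mean k (poly f) 0 1 \<le> (NN (x::real)\<in>{0..1}. (NN (u::real)\<in>{0..1}. ennreal B))"
    unfolding chord_mean_def
    by (intro nn_integral_mono) (auto simp: indicator_def intro!: nn_integral_mono ennreal_leI B)
  also have "\<dots> < \<infinity>" by (simp add: nn_integral_cmult_indicator)
  finally show ?thesis .
qed

text \<open>The parameters of the smoothing are chosen by averaging; the smoothed function is then
  replaced by its Taylor polynomial.\<close>

lemma whitney_poly_unit:
  assumes k: "k \<ge> 1"
  shows "\<exists>C\<ge>0. \<forall>f :: real poly. \<forall>e>0. \<exists>p. degree p < k \<and>
    (NN x\<in>{0..1}. ennreal \<bar>poly f x - poly p x\<bar>) \<le> ennreal C * chord_mean k (poly f) 0 1 + ennreal e"
proof -
  \<comment> \<open>\<open>K\<close> counts the mean of the smoothing error once and the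
    \<open>k\<close> means of scaled differences with factor \<open>k\<close> each; \<open>M\<close>
    covers the coefficients of the \<open>k\<close>-th derivative. The factor \<open>8 * k\<close>
    in the final constant is the reciprocal of the area of the parameter rectangle.\<close>
  define K where "K = real (k * k) + 1"
  define M where "M = 1 + 2 ^ k * (4 * real k * real k) ^ k"
  have M: "M \<ge> 1" by (simp add: M_def)
  show ?thesis
  proof (intro exI[of _ "M * K * (8 * real k)"] conjI allI impI)
    show "0 \<le> M * K * (8 * real k)" using M by (auto simp: K_def)
    fix f :: "real poly" and e :: real assume "e > 0"
    obtain F where F: "(pderiv ^^ k) F = f" by (rule poly_antideriv_pow)
    \<comment> \<open>The lower end keeps the negative powers of \<open>h\<close> bounded, the upper
      end keeps the differences inside the unit interval.\<close>
    define a b where "a = 1 / (4 * real k)" and "b = 1 / (2 * real k)"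
    have ab: "0 < a" "a < b" "b - a = 1 / (4 * real k)" using k by (auto simp: a_def b_def field_simps)
    define E where "E A h = (NN x\<in>{0..1}. ennreal \<bar>poly f x - poly (chord_smooth k F A h) x\<bar>)" for A h
    define T where "T i A h = (NN x\<in>{0..1}. ennreal \<bar>fdiff k (real i / real k * h) (poly f) ((1 - real i / real k) * x + real i / real k * A)\<bar>)" for i A h
    define I where "I = enn2real (chord_mean k (poly f) 0 1)"
    have I: "chord_mean k (poly f) 0 1 = ennreal I" "I \<ge> 0"
      using chord_mean_poly_finite[OF k, of f] by (auto simp: I_def)
    have E[measurable]: "(\<lambda>(A, h). E A h) \<in> borel_measurable (borel \<Otimes>\<^sub>M borel)"
      unfolding E_def poly_chord_smooth by measurable
    have T[measurable]: "(\<lambda>(A, h). T i A h) \<in> borel_measurable (borel \<Otimes>\<^sub>M borel)" for i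
      unfolding T_def by measurable
    have "(NN A\<in>{0..1/2}. (NN h\<in>{a..b}. E A h))
      = (NN h\<in>{a..b}. (NN A\<in>{0..1/2}. E A h))"
      by (rule set_nn_integral_swap) auto
    also have "\<dots> \<le> (NN h\<in>{a..b}. chord_mean k (poly f) 0 1)"
    proof (rule set_nn_integral_mono_on)
      fix h assume h: "h \<in> {a..b}"
      have h': "0 < h" "real k * h \<le> 1/2" using h k ab by (auto simp: b_def field_simps)
      have "(NN A\<in>{0..1/2}. E A h)
        = (NN x\<in>{0..1}. (NN A\<in>{0..1/2}. ennreal \<bar>poly f x - poly (chord_smooth k F A h) x\<bar>))"
        unfolding E_def poly_chord_smooth by (rule set_nn_integral_swap) measurable
      also have "\<dots> \<le> chord_mean k (poly f) 0 1"
        unfolding chord_mean_def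
        by (rule set_nn_integral_mono_on) (rule chord_smooth_error[OF k F h'])
      finally show "(NN A\<in>{0..1/2}. E A h) \<le> chord_mean k (poly f) 0 1" .
    qed
    also have "\<dots> = ennreal I * ennreal (b - a)"
      using ab I by (simp add: I nn_integral_cmult_indicator)
    also have "\<dots> \<le> ennreal I"
    proof -
      have "I * (b - a) \<le> I * 1" using ab I k by (intro mult_left_mono) auto
      then show ?thesis using ab by (simp add: ennreal_mult''[symmetric] ennreal_leI)
    qed
    finally have avgE: "(NN A\<in>{0..1/2}. (NN h\<in>{a..b}. E A h)) \<le> ennreal I" .
    have avgT: "(NN A\<in>{0..1/2}. (NN h\<in>{a..b}. T i A h)) \<le> ennreal (real k * I)" if i: "i \<in> {1..k}" for i
    proof -
      define g where "g x A h = ennreal \<bar>fdiff k (real i / real k * h) (poly f) ((1 - real i / real k) * x + real i / real k * A)\<bar>" for x A h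
      have g[measurable (raw)]: "(\<lambda>z. g (x z) (A z) (h z)) \<in> borel_measurable N"
        if [measurable]: "x \<in> borel_measurable N" "A \<in> borel_measurable N" "h \<in> borel_measurable N" for x A h N
        unfolding g_def by measurable
      have "(NN A\<in>{0..1/2}. (NN h\<in>{a..b}. T i A h))
        = (NN A\<in>{0..1/2}. (NN x\<in>{0..1}. (NN h\<in>{a..b}. g x A h)))"
        unfolding T_def g_def[symmetric] by (subst set_nn_integral_swap[of _ "{a..b}"]) auto
      also have "\<dots> = (NN x\<in>{0..1}. (NN A\<in>{0..1/2}. (NN h\<in>{a..b}. g x A h)))"
        by (rule set_nn_integral_swap) auto
      also have "\<dots> \<le> (NN (x::real)\<in>{0..1}. ennreal (real k) * chord_mean k (poly f) 0 1)"
        unfolding g_def chord_mean_def a_def b_def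
        by (rule set_nn_integral_mono_on, rule scaled_chord_integral_le) (use i in auto)
      also have "\<dots> = ennreal (real k * I)"
        using I by (simp add: I nn_integral_cmult_indicator ennreal_mult'')
      finally show ?thesis .
    qed
    \<comment> \<open>One sum for all requirements, so that a single pair \<open>A\<close>,
      \<open>h\<close> meets them simultaneously.\<close>
    define Z where "Z A h = E A h + (\<Sum>i=1..k. T i A h)" for A h
    have "(NN A\<in>{0..1/2}. (NN h\<in>{a..b}. Z A h))
      = (NN A\<in>{0..1/2}. (NN h\<in>{a..b}. E A h))
        + (\<Sum>i=1..k. (NN A\<in>{0..1/2}. (NN h\<in>{a..b}. T i A h)))"
      unfolding Z_def by (simp add: set_nn_integral_add set_nn_integral_sum)
    also have "\<dots> \<le> ennreal I + (\<Sum>i=1..k. ennreal (real k * I))"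
      by (intro add_mono sum_mono avgE avgT)
    also have "\<dots> = ennreal (K * I)"
      using I by (subst sum_ennreal) (auto simp: K_def algebra_simps ennreal_plus[symmetric] simp del: ennreal_plus)
    finally have Zi: "(NN A\<in>{0..1/2}. (NN h\<in>{a..b}. Z A h)) \<le> ennreal (K * I)" .
    define e' where "e' = e / (M * (8 * real k))"
    have e': "e' > 0" using \<open>e > 0\<close> M k by (simp add: e'_def)
    obtain A h where Ah: "A \<in> {0..1/2}" "h \<in> {a..b}"
      and Z: "Z A h \<le> ennreal ((K * I + e') / ((1/2 - 0) * (b - a)))"
      using nn_integral_rectangle_exists_le[OF _ ab(2) _ e' Zi] I by (force simp: K_def)
    obtain p where p: "degree p < k" and pb: "\<And>x. x \<in> {0..1} \<Longrightarrow> ennreal \<bar>poly (chord_smooth k F A h) x - poly p x\<bar> \<le>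
        (NN t\<in>{0..1}. ennreal \<bar>poly ((pderiv ^^ k) (chord_smooth k F A h)) t\<bar>)"
      using poly_taylor_approx[of "k - 1" "chord_smooth k F A h"] k by auto
    define c where "c = (2::real) ^ k * (4 * real k * real k) ^ k"
    have coeff: "\<bar>solve_coeff k i / (real i / real k * h) ^ k * (1 - real i / real k) ^ k\<bar> \<le> c" if i: "i \<in> {1..k}" for i
    proof -
      have h: "1 / (4 * real k) \<le> h" "0 < h" using Ah ab by (auto simp: a_def)
      have "1 \<le> real i" "real i \<le> real k" using i by auto
      have "1 / (real i / real k * h) \<le> 4 * real k * real k"
      proof -
        have "1 / real k * (1 / (4 * real k)) \<le> real i / real k * h"
          using h \<open>1 \<le> real i\<close> by (intro mult_mono divide_right_mono) auto
        then have "1 / (real i / real k * h) \<le> 1 / (1 / real k * (1 / (4 * real k)))"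
          using k by (intro divide_left_mono mult_pos_pos) (use h \<open>1 \<le> real i\<close> in auto)
        then show ?thesis using k by simp
      qed
      then have "(1 / (real i / real k * h)) ^ k \<le> (4 * real k * real k) ^ k"
        using h by (intro power_mono) auto
      moreover have "(1 - real i / real k) ^ k \<le> 1" "0 \<le> (1 - real i / real k) ^ k"
        using \<open>real i \<le> real k\<close> k by (auto intro!: power_le_one simp: field_simps)
      moreover have "\<bar>1 - real i / real k\<bar> = 1 - real i / real k"
        using \<open>real i \<le> real k\<close> k by (simp add: field_simps)
      ultimately have "\<bar>solve_coeff k i\<bar> * (1 / (real i / real k * h)) ^ k * \<bar>1 - real i / real k\<bar> ^ k \<le> (2 ^ k * (4 * real k * real k) ^ k) * 1"
        using h by (intro mult_mono abs_solve_coeff_le) simp_all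
      then show ?thesis
        using h \<open>real i \<le> real k\<close> \<open>0 \<le> (1 - real i / real k) ^ k\<close>
        by (simp add: abs_mult abs_divide power_divide c_def power_abs abs_of_nonneg)
    qed
    have "c \<ge> 0" by (simp add: c_def)
    have D: "(NN t\<in>{0..1}. ennreal \<bar>poly ((pderiv ^^ k) (chord_smooth k F A h)) t\<bar>)
      \<le> ennreal c * (\<Sum>i=1..k. T i A h)"
    proof -
      have "ennreal \<bar>poly ((pderiv ^^ k) (chord_smooth k F A h)) t\<bar> \<le> ennreal c *
         (\<Sum>i=1..k. ennreal \<bar>fdiff k (real i / real k * h) (poly f) ((1 - real i / real k) * t + real i / real k * A)\<bar>)" for t
      proof -
        have "\<bar>poly ((pderiv ^^ k) (chord_smooth k F A h)) t\<bar>
          \<le> (\<Sum>i=1..k. c * \<bar>fdiff k (real i / real k * h) (poly f) ((1 - real i / real k) * t + real i / real k * A)\<bar>)"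
          unfolding poly_pderiv_chord_smooth[OF F]
          by (rule order.trans[OF sum_abs], intro sum_mono, subst abs_mult, intro mult_right_mono coeff) auto
        also have "ennreal \<dots> = ennreal c *
         (\<Sum>i=1..k. ennreal \<bar>fdiff k (real i / real k * h) (poly f) ((1 - real i / real k) * t + real i / real k * A)\<bar>)"
          using \<open>c \<ge> 0\<close> by (simp add: sum_distrib_left[symmetric] ennreal_mult' sum_nonneg)
        finally show ?thesis by (simp add: ennreal_leI)
      qed
      then have "(NN t\<in>{0..1}. ennreal \<bar>poly ((pderiv ^^ k) (chord_smooth k F A h)) t\<bar>)
        \<le> (NN t\<in>{0..1}. ennreal c *
         (\<Sum>i=1..k. ennreal \<bar>fdiff k (real i / real k * h) (poly f) ((1 - real i / real k) * t + real i / real k * A)\<bar>))"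
        by (intro set_nn_integral_mono_on)
      also have "\<dots> = ennreal c * (\<Sum>i=1..k. T i A h)"
        unfolding T_def
        by (subst set_nn_integral_cmult, measurable) (subst set_nn_integral_sum, auto)
      finally show ?thesis .
    qed
    have "(NN x\<in>{0..1}. ennreal \<bar>poly f x - poly p x\<bar>)
      \<le> (NN x\<in>{0..1}. (ennreal \<bar>poly f x - poly (chord_smooth k F A h) x\<bar> + ennreal c * (\<Sum>i=1..k. T i A h)))"
    proof (rule set_nn_integral_mono_on)
      fix x :: real assume x: "x \<in> {0..1}"
      have "ennreal \<bar>poly f x - poly p x\<bar> \<le> ennreal \<bar>poly f x - poly (chord_smooth k F A h) x\<bar> + ennreal \<bar>poly (chord_smooth k F A h) x - poly p x\<bar>"
        by (rule ennreal_abs_triangle)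
      also have "\<dots> \<le> ennreal \<bar>poly f x - poly (chord_smooth k F A h) x\<bar> + ennreal c * (\<Sum>i=1..k. T i A h)"
        using pb[OF x] D by (intro add_left_mono) (rule order.trans)
      finally show "ennreal \<bar>poly f x - poly p x\<bar> \<le> ennreal \<bar>poly f x - poly (chord_smooth k F A h) x\<bar> + ennreal c * (\<Sum>i=1..k. T i A h)" .
    qed
    also have "\<dots> = E A h + ennreal c * (\<Sum>i=1..k. T i A h)"
      by (simp add: distrib_right nn_integral_add nn_integral_cmult_indicator E_def)
    also have "\<dots> \<le> ennreal M * E A h + ennreal M * (\<Sum>i=1..k. T i A h)"
    proof (intro add_mono mult_right_mono)
      show "E A h \<le> ennreal M * E A h"
        using mult_right_mono[of 1 "ennreal M" "E A h"] M by simp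
      show "ennreal c \<le> ennreal M" by (intro ennreal_leI) (simp add: c_def M_def)
    qed auto
    also have "\<dots> = ennreal M * Z A h" by (simp add: Z_def distrib_left)
    also have "\<dots> \<le> ennreal M * ennreal ((K * I + e') / ((1/2 - 0) * (b - a)))"
      by (intro mult_left_mono Z) auto
    also have "\<dots> = ennreal (M * K * (8 * real k) * I + e)"
    proof -
      have "M * ((K * I + e') / ((1/2 - 0) * (b - a))) = M * K * (8 * real k) * I + e"
        using M k unfolding ab(3) e'_def by (simp add: field_simps)
      then show ?thesis using M by (simp add: ennreal_mult'[symmetric])
    qed
    also have "\<dots> = ennreal (M * K * (8 * real k)) * chord_mean k (poly f) 0 1 + ennreal e"
      using M k I \<open>e > 0\<close> by (simp add: I ennreal_mult'' ennreal_plus K_def)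
    finally show "\<exists>p. degree p < k \<and>
       (NN x\<in>{0..1}. ennreal \<bar>poly f x - poly p x\<bar>)
       \<le> ennreal (M * K * (8 * real k)) * chord_mean k (poly f) 0 1 + ennreal e"
      using p by blast
  qed
qed

section \<open>Density of polynomials and Whitney's inequality for integrable functions\<close>

lemma poly_dense_L1_unit:
  fixes f :: "real \<Rightarrow> real"
  assumes [measurable]: "f \<in> borel_measurable borel" and fin: "(NN x\<in>{0..1}. ennreal \<bar>f x\<bar>) < \<infinity>" and "e > 0"
  shows "\<exists>p. (NN x\<in>{0..1}. ennreal \<bar>f x - poly p x\<bar>) \<le> ennreal e"
proof -
  have cont: "\<exists>p. \<forall>x\<in>{0..1}. \<bar>g x - poly p x\<bar> \<le> e" if cg: "continuous_on {0..1} g" and e: "e > 0" for g :: "real \<Rightarrow> real" and e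
  proof -
    obtain h where h: "real_polynomial_function h" "\<And>x. x \<in> {0..1} \<Longrightarrow> \<bar>g x - h x\<bar> < e"
      by (rule Stone_Weierstrass_real_polynomial_function[of "{0..1}" g e]) (use cg e in auto)
    then obtain a n where "h = (\<lambda>x. \<Sum>i\<le>n. a i * x ^ i)" by (auto simp: real_polynomial_function_iff_sum)
    then have "h = poly (\<Sum>i\<le>n. monom (a i) i)" by (auto simp: poly_sum poly_monom)
    with h show ?thesis by (intro exI[of _ "\<Sum>i\<le>n. monom (a i) i"]) (auto intro: less_imp_le)
  qed
  define f0 where "f0 x = f x * indicator {0..1} x" for x
  have "integrable lborel f0"
  proof -
    have "(NN x. ennreal (norm (f0 x))) = (NN x\<in>{0..1}. ennreal \<bar>f x\<bar>)"
      by (intro nn_integral_cong) (simp add: f0_def indicator_def)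
    moreover have "f0 \<in> borel_measurable lborel" unfolding f0_def by measurable
    ultimately show ?thesis using fin by (simp add: integrable_iff_bounded)
  qed
  \<comment> \<open>The approximable functions are closed under sums and dominated limits, so only
    multiples of indicators remain. These are made continuous by Urysohn's lemma and then polynomial
    by the Stone-Weierstrass theorem.\<close>
  then have "\<forall>e>0. \<exists>p. (NN x\<in>{0..1}. ennreal \<bar>f0 x - poly p x\<bar>) \<le> ennreal e"
  proof (induction rule: integrable_induct)
    case (base A c)
    show ?case
    proof (intro allI impI)
      fix e :: real assume "e > 0"
      \<comment> \<open>The two sets where the Urysohn function may differ from the indicator have
        measure below \<open>d / 2\<close> each, which contributes at most
        \<open>|c| * d <= e / 2\<close>; the added 1 covers \<open>c = 0\<close>.\<close>
      define d where "d = e / (2 * (\<bar>c\<bar> + 1))"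
      have d: "d > 0" using \<open>e > 0\<close> by (simp add: d_def)
      have A: "A \<in> sets lebesgue" "A \<in> sets borel" using base by auto
      obtain T where T: "open T" "A \<subseteq> T" "emeasure lebesgue (T - A) < ennreal (d/2)"
        by (rule sets_lebesgue_outer_open[OF A(1), of "d/2"]) (use d in simp)
      obtain K where K: "closed K" "K \<subseteq> A" "emeasure lebesgue (A - K) < ennreal (d/2)"
        by (rule sets_lebesgue_inner_closed[OF A(1), of "d/2"]) (use d in simp)
      obtain g :: "real \<Rightarrow> real" where g: "continuous_on UNIV g" "\<And>x. g x \<in> closed_segment 1 0"
        "\<And>x. x \<in> K \<Longrightarrow> g x = 1" "\<And>x. x \<in> - T \<Longrightarrow> g x = 0"
        by (rule Urysohn[of K "- T" 1 0]) (use T K in auto)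
      have g01: "0 \<le> g x" "g x \<le> 1" for x using g(2)[of x] by (auto simp: closed_segment_eq_real_ivl)
      have [measurable]: "T \<in> sets borel" "K \<in> sets borel" "A \<in> sets borel" using T K A by auto
      obtain p where p: "\<And>x. x \<in> {0..1} \<Longrightarrow> \<bar>c * g x - poly p x\<bar> \<le> e/2"
      proof -
        have "continuous_on {0..1} (\<lambda>x. c * g x)"
          by (intro continuous_intros continuous_on_subset[OF g(1)]) auto
        from cont[OF this, of "e/2"] \<open>e > 0\<close> obtain p where "\<forall>x\<in>{0..1}. \<bar>c * g x - poly p x\<bar> \<le> e/2" by auto
        then show thesis by (intro that[of p]) blast
      qed
      have "(NN x\<in>{0..1}. ennreal \<bar>indicator A x *\<^sub>R c - poly p x\<bar>)
        \<le> (NN x\<in>{0..1}. (ennreal \<bar>c\<bar> * (indicator (T - A) x + indicator (A - K) x) + ennreal (e/2)))"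
      proof (rule set_nn_integral_mono_on)
        fix x :: real assume x: "x \<in> {0..1}"
        have "\<bar>indicator A x *\<^sub>R c - poly p x\<bar> \<le> \<bar>c\<bar> * \<bar>indicator A x - g x\<bar> + \<bar>c * g x - poly p x\<bar>"
        proof -
          have "\<bar>c\<bar> * \<bar>indicator A x - g x\<bar> = \<bar>c * indicator A x - c * g x\<bar>"
            unfolding right_diff_distrib[symmetric] by (rule abs_mult[symmetric])
          then show ?thesis by (simp add: mult.commute)
        qed
        also have "\<dots> \<le> \<bar>c\<bar> * (indicator (T - A) x + indicator (A - K) x) + e / 2"
          using p[OF x] g01[of x] g(3,4)[of x] T K
          by (intro add_mono mult_left_mono) (auto simp: indicator_def)
        finally show "ennreal \<bar>indicator A x *\<^sub>R c - poly p x\<bar> \<le> ennreal \<bar>c\<bar> * (indicator (T - A) x + indicator (A - K) x) + ennreal (e/2)"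
          using \<open>e > 0\<close>
          by (auto simp: indicator_def ennreal_plus[symmetric] ennreal_leI simp del: ennreal_plus)
      qed
      also have "\<dots> \<le> (NN x. (ennreal \<bar>c\<bar> * (indicator (T - A) x + indicator (A - K) x) + ennreal (e/2) * indicator {0..1} x))"
        by (intro nn_integral_mono) (auto simp: indicator_def)
      also have "\<dots> = ennreal \<bar>c\<bar> * (emeasure lborel (T - A) + emeasure lborel (A - K)) + ennreal (e/2)"
        by (simp add: nn_integral_add nn_integral_cmult)
      also have "\<dots> \<le> ennreal \<bar>c\<bar> * (ennreal (d/2) + ennreal (d/2)) + ennreal (e/2)"
        using T(3) K(3) by (intro add_mono mult_left_mono) (auto simp: less_imp_le)
      also have "\<dots> = ennreal (\<bar>c\<bar> * d + e/2)"
      proof -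
        have "ennreal (d/2) + ennreal (d/2) = ennreal d" using d by (subst ennreal_plus[symmetric]) auto
        moreover have "ennreal \<bar>c\<bar> * ennreal d = ennreal (\<bar>c\<bar> * d)" using d by (subst ennreal_mult'[symmetric]) auto
        ultimately show ?thesis using d \<open>e > 0\<close> by (simp add: ennreal_plus)
      qed
      also have "\<dots> \<le> ennreal e"
      proof (intro ennreal_leI)
        have "\<bar>c\<bar> * d \<le> (\<bar>c\<bar> + 1) * d" using d by (intro mult_right_mono) auto
        also have "\<dots> = e/2" by (simp add: d_def field_simps)
        finally show "\<bar>c\<bar> * d + e/2 \<le> e" by simp
      qed
      finally show "\<exists>p. (NN x\<in>{0..1}. ennreal \<bar>indicator A x *\<^sub>R c - poly p x\<bar>) \<le> ennreal e" by blast
    qed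
  next
    case (add f g)
    have [measurable]: "f \<in> borel_measurable borel" "g \<in> borel_measurable borel" using add by auto
    show ?case
    proof (intro allI impI)
      fix e :: real assume "e > 0"
      then obtain p q where pq: "(NN x\<in>{0..1}. ennreal \<bar>f x - poly p x\<bar>) \<le> ennreal (e/2)"
        "(NN x\<in>{0..1}. ennreal \<bar>g x - poly q x\<bar>) \<le> ennreal (e/2)"
        using add.IH[rule_format, of "e/2"] by auto
      have "(NN x\<in>{0..1}. ennreal \<bar>f x + g x - poly (p + q) x\<bar>)
        \<le> (NN x\<in>{0..1}. (ennreal \<bar>f x - poly p x\<bar> + ennreal \<bar>g x - poly q x\<bar>))"
        by (intro set_nn_integral_mono_on) (auto simp: ennreal_plus[symmetric] intro!: ennreal_leI simp del: ennreal_plus)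
      also have "\<dots> \<le> ennreal (e/2) + ennreal (e/2)"
        by (subst set_nn_integral_add) (auto intro: add_mono pq)
      also have "\<dots> = ennreal e" using \<open>e > 0\<close> by (subst ennreal_plus[symmetric]) auto
      finally show "\<exists>p. (NN x\<in>{0..1}. ennreal \<bar>f x + g x - poly p x\<bar>) \<le> ennreal e" by blast
    qed
  next
    case (lim f s)
    have [measurable]: "f \<in> borel_measurable borel" "\<And>i. s i \<in> borel_measurable borel" using lim by auto
    show ?case
    proof (intro allI impI)
      fix e :: real assume "e > 0"
      have "(\<lambda>i. (NN x. norm (f x - s i x))) \<longlonglongrightarrow> 0"
      proof (rule nn_integral_dominated_convergence_norm[where w = "\<lambda>x. 2 * norm (f x)"])
        show "(NN x. ennreal (2 * norm (f x))) < \<infinity>"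
          using \<open>integrable lborel f\<close> unfolding integrable_iff_bounded
          by (simp add: ennreal_mult' nn_integral_cmult ennreal_mult_less_top)
      qed (use lim in auto)
      then have "eventually (\<lambda>i. (NN x. norm (f x - s i x)) < ennreal (e/2)) sequentially"
        by (rule order_tendstoD) (use \<open>e > 0\<close> in auto)
      then obtain i where i: "(NN x. norm (f x - s i x)) < ennreal (e/2)"
        using eventually_happens by force
      obtain p where p: "(NN x\<in>{0..1}. ennreal \<bar>s i x - poly p x\<bar>) \<le> ennreal (e/2)"
        using lim.IH[of i] \<open>e > 0\<close> by (meson half_gt_zero)
      have "(NN x\<in>{0..1}. ennreal \<bar>f x - poly p x\<bar>)
        \<le> (NN x\<in>{0..1}. (ennreal \<bar>f x - s i x\<bar> + ennreal \<bar>s i x - poly p x\<bar>))"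
        by (intro set_nn_integral_mono_on ennreal_abs_triangle)
      also have "\<dots> \<le> (NN x. norm (f x - s i x)) + (NN x\<in>{0..1}. ennreal \<bar>s i x - poly p x\<bar>)"
        by (subst set_nn_integral_add) (auto intro!: add_mono nn_integral_mono simp: indicator_def)
      also have "\<dots> \<le> ennreal (e/2) + ennreal (e/2)" using i p by (intro add_mono) auto
      also have "\<dots> = ennreal e" using \<open>e > 0\<close> by (subst ennreal_plus[symmetric]) auto
      finally show "\<exists>p. (NN x\<in>{0..1}. ennreal \<bar>f x - poly p x\<bar>) \<le> ennreal e" by blast
    qed
  qed
  then obtain p where "(NN x\<in>{0..1}. ennreal \<bar>f0 x - poly p x\<bar>) \<le> ennreal e" using \<open>e > 0\<close> by blast
  moreover have "(NN x\<in>{0..1}. ennreal \<bar>f0 x - poly p x\<bar>) = (NN x\<in>{0..1}. ennreal \<bar>f x - poly p x\<bar>)"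
    by (intro nn_integral_cong) (auto simp: f0_def indicator_def)
  ultimately show ?thesis by auto
qed

text \<open>The map contracts by \<open>i / k\<close>, so the substitution costs at most
  \<open>k\<close>; convexity keeps the image in the interval.\<close>

lemma convex_pull_integral_le:
  fixes g :: "real \<Rightarrow> real"
  assumes [measurable]: "g \<in> borel_measurable borel" and "1 \<le> i" "i \<le> k" "x \<in> {a..b}"
  shows "(NN u\<in>{a..b}. ennreal \<bar>g ((1 - real i / real k) * x + real i / real k * u)\<bar>)
    \<le> ennreal (real k) * (NN u\<in>{a..b}. ennreal \<bar>g u\<bar>)"
proof -
  define s where "s = real i / real k"
  have s: "0 < s" "s \<le> 1" "1 / s \<le> real k" using assms by (auto simp: s_def field_simps)
  have "(NN u\<in>{a..b}. ennreal \<bar>g ((1 - s) * x + s * u)\<bar>)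
    \<le> ennreal (1 / s) * (NN u\<in>{a..b}. ennreal \<bar>g u\<bar>)"
  proof (rule set_nn_integral_affine)
    fix u assume u: "u \<in> {a..b}"
    have "(1 - s) *\<^sub>R x + s *\<^sub>R u \<in> {a..b}"
      using u s assms(4) by (intro convexD[of "{a..b}" x u "1 - s" s]) auto
    then show "(1 - s) * x + s * u \<in> {a..b}" by simp
  qed (use s in auto)
  also have "\<dots> \<le> ennreal (real k) * (NN u\<in>{a..b}. ennreal \<bar>g u\<bar>)"
    using s by (intro mult_right_mono ennreal_leI) auto
  finally show ?thesis by (simp add: s_def)
qed

lemma abs_le_chord_diff:
  assumes "k \<ge> 1"
  shows "\<bar>g x\<bar> \<le> chord_diff k g x u + 2 ^ k * (\<Sum>i=1..k. \<bar>g ((1 - real i / real k) * x + real i / real k * u)\<bar>)"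
proof -
  have "g x = (-1) ^ k * fdiff k ((u - x) / real k) g x
    + (\<Sum>i=1..k. solve_coeff k i * g ((1 - real i / real k) * x + real i / real k * u))"
    using chord_representation[OF assms, of g x u] by simp
  then have "\<bar>g x\<bar> = \<bar>(-1) ^ k * fdiff k ((u - x) / real k) g x
    + (\<Sum>i=1..k. solve_coeff k i * g ((1 - real i / real k) * x + real i / real k * u))\<bar>" by (rule arg_cong)
  also have "\<dots> \<le> \<bar>(-1) ^ k * fdiff k ((u - x) / real k) g x\<bar>
    + \<bar>\<Sum>i=1..k. solve_coeff k i * g ((1 - real i / real k) * x + real i / real k * u)\<bar>"
    by (rule abs_triangle_ineq)
  also have "\<bar>(-1) ^ k * fdiff k ((u - x) / real k) g x\<bar> = chord_diff k g x u"
    by (simp add: chord_diff_def abs_mult power_abs)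
  also have "\<bar>\<Sum>i=1..k. solve_coeff k i * g ((1 - real i / real k) * x + real i / real k * u)\<bar>
    \<le> 2 ^ k * (\<Sum>i=1..k. \<bar>g ((1 - real i / real k) * x + real i / real k * u)\<bar>)"
    unfolding sum_distrib_left
    by (rule order.trans[OF sum_abs], intro sum_mono, subst abs_mult, intro mult_right_mono abs_solve_coeff_le) auto
  finally show ?thesis by simp
qed

text \<open>The representation along chords is averaged over the free end \<open>u\<close>, which
  bounds values by means. For a polynomial of degree below \<open>k\<close> the difference term
  vanishes, and an inverse estimate of the supremum by the mean is left.\<close>

lemma abs_le_chord_diff_mean:
  assumes k: "k \<ge> 1" and "a < b" and x: "x \<in> {a..b}" and [measurable]: "g \<in> borel_measurable borel"
  shows "ennreal \<bar>g x\<bar> \<le> ennreal (1 / (b - a)) * (NN u\<in>{a..b}. ennreal (chord_diff k g x u))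
    + ennreal (2 ^ k * real k * real k / (b - a)) * (NN u\<in>{a..b}. ennreal \<bar>g u\<bar>)"
proof -
  let ?g = "\<lambda>i u. ennreal \<bar>g ((1 - real i / real k) * x + real i / real k * u)\<bar>"
  have "ennreal (b - a) * ennreal \<bar>g x\<bar> = (NN u\<in>{a..b}. ennreal \<bar>g x\<bar>)"
    using \<open>a < b\<close> by (subst nn_integral_cmult_indicator) (auto simp: mult.commute)
  also have "\<dots> \<le> (NN u\<in>{a..b}. (ennreal (chord_diff k g x u) + ennreal (2 ^ k) * (\<Sum>i=1..k. ?g i u)))"
  proof (rule set_nn_integral_mono_on)
    fix u
    show "ennreal \<bar>g x\<bar> \<le> ennreal (chord_diff k g x u) + ennreal (2 ^ k) * (\<Sum>i=1..k. ?g i u)"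
    proof -
      let ?S = "\<Sum>i=1..k. \<bar>g ((1 - real i / real k) * x + real i / real k * u)\<bar>"
      have "0 \<le> ?S" by (simp add: sum_nonneg)
      have "ennreal \<bar>g x\<bar> \<le> ennreal (chord_diff k g x u + 2 ^ k * ?S)"
        by (rule ennreal_leI[OF abs_le_chord_diff[OF k]])
      also have "\<dots> = ennreal (chord_diff k g x u) + ennreal (2 ^ k) * ennreal ?S"
        using \<open>0 \<le> ?S\<close> by (subst ennreal_plus) (auto simp: chord_diff_def ennreal_mult')
      also have "ennreal ?S = (\<Sum>i=1..k. ?g i u)" by (rule sum_ennreal[symmetric]) simp
      finally show ?thesis .
    qed
  qed
  also have "\<dots> = (NN u\<in>{a..b}. ennreal (chord_diff k g x u)) + ennreal (2 ^ k) * (\<Sum>i=1..k. (NN u\<in>{a..b}. ?g i u))"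
  proof -
    have [measurable]: "?g i \<in> borel_measurable borel" for i by measurable
    have [measurable]: "(\<lambda>u. \<Sum>i=1..k. ?g i u) \<in> borel_measurable borel" by (rule borel_measurable_sum) measurable
    have "(NN u\<in>{a..b}. (\<Sum>i=1..k. ?g i u)) = (\<Sum>i=1..k. (NN u\<in>{a..b}. ?g i u))"
      by (rule set_nn_integral_sum) auto
    moreover have "(NN u\<in>{a..b}. ennreal (2 ^ k) * (\<Sum>i=1..k. ?g i u)) = ennreal (2 ^ k) * (NN u\<in>{a..b}. (\<Sum>i=1..k. ?g i u))"
      by (rule set_nn_integral_cmult) auto
    ultimately show ?thesis
      by (subst set_nn_integral_add) auto
  qed
  also have "\<dots> \<le> (NN u\<in>{a..b}. ennreal (chord_diff k g x u))
      + ennreal (2 ^ k) * (\<Sum>i=1..k. ennreal (real k) * (NN u\<in>{a..b}. ennreal \<bar>g u\<bar>))"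
    using x by (intro add_left_mono mult_left_mono sum_mono convex_pull_integral_le) auto
  also have "\<dots> = (NN u\<in>{a..b}. ennreal (chord_diff k g x u))
      + ennreal (2 ^ k * real k * real k) * (NN u\<in>{a..b}. ennreal \<bar>g u\<bar>)"
  proof -
    have "ennreal (2 ^ k) * (\<Sum>i=1..k. ennreal (real k) * X) = ennreal (2 ^ k * real k * real k) * X" for X
    proof -
      have "(\<Sum>i=1..k. ennreal (real k) * X) = ennreal (real k) * (ennreal (real k) * X)"
        by (subst sum_constant) (simp add: ennreal_of_nat_eq_real_of_nat del: sum_constant)
      then have "ennreal (2 ^ k) * (\<Sum>i=1..k. ennreal (real k) * X) = (ennreal (2 ^ k) * ennreal (real k) * ennreal (real k)) * X"
        by (simp only: mult.assoc)
      also have "ennreal (2 ^ k) * ennreal (real k) * ennreal (real k) = ennreal (2 ^ k * real k * real k)"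
        by (subst ennreal_mult'[symmetric], simp, subst ennreal_mult'[symmetric]) auto
      finally show ?thesis .
    qed
    then show ?thesis by simp
  qed
  finally have *: "ennreal (b - a) * ennreal \<bar>g x\<bar> \<le> (NN u\<in>{a..b}. ennreal (chord_diff k g x u))
      + ennreal (2 ^ k * real k * real k) * (NN u\<in>{a..b}. ennreal \<bar>g u\<bar>)" .
  have "ennreal \<bar>g x\<bar> = ennreal (1 / (b - a)) * (ennreal (b - a) * ennreal \<bar>g x\<bar>)"
    using \<open>a < b\<close> by (subst mult.assoc[symmetric], subst ennreal_mult'[symmetric]) auto
  also have "\<dots> \<le> ennreal (1 / (b - a)) * ((NN u\<in>{a..b}. ennreal (chord_diff k g x u))
      + ennreal (2 ^ k * real k * real k) * (NN u\<in>{a..b}. ennreal \<bar>g u\<bar>))"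
    using * by (rule mult_left_mono) simp
  also have "ennreal (1 / (b - a)) * (ennreal c * X) = ennreal (c / (b - a)) * X" for c X
    using \<open>a < b\<close> by (subst mult.assoc[symmetric], subst ennreal_mult'[symmetric]) auto
  then have "ennreal (1 / (b - a)) * ((NN u\<in>{a..b}. ennreal (chord_diff k g x u))
      + ennreal (2 ^ k * real k * real k) * (NN u\<in>{a..b}. ennreal \<bar>g u\<bar>))
    = ennreal (1 / (b - a)) * (NN u\<in>{a..b}. ennreal (chord_diff k g x u))
    + ennreal (2 ^ k * real k * real k / (b - a)) * (NN u\<in>{a..b}. ennreal \<bar>g u\<bar>)"
    by (simp only: distrib_left)
  finally show ?thesis .
qed

lemma chord_diff_le_add:
  "chord_diff k P x u \<le> chord_diff k f x u + chord_diff k (\<lambda>y. f y - P y) x u"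
  unfolding chord_diff_def fdiff_diff by simp

lemma chord_diff_le_sum:
  assumes "k \<ge> 1"
  shows "chord_diff k g x u \<le> 2 ^ k * (\<Sum>i=0..k. \<bar>g ((1 - real i / real k) * x + real i / real k * u)\<bar>)"
proof -
  have "x + real i * ((u - x) / real k) = (1 - real i / real k) * x + real i / real k * u" for i
    using assms by (simp add: field_simps)
  then have "chord_diff k g x u = \<bar>\<Sum>i=0..k. real (k choose i) * (-1) ^ (k - i) * g ((1 - real i / real k) * x + real i / real k * u)\<bar>"
    unfolding chord_diff_def fdiff_def by simp
  also have "\<dots> \<le> 2 ^ k * (\<Sum>i=0..k. \<bar>g ((1 - real i / real k) * x + real i / real k * u)\<bar>)"
    unfolding sum_distrib_left
  proof (rule order.trans[OF sum_abs], intro sum_mono)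
    fix i
    have "real (k choose i) \<le> 2 ^ k" using binomial_le_pow2[of k i] by simp
    then show "\<bar>real (k choose i) * (-1) ^ (k - i) * g ((1 - real i / real k) * x + real i / real k * u)\<bar>
      \<le> 2 ^ k * \<bar>g ((1 - real i / real k) * x + real i / real k * u)\<bar>"
      by (simp add: abs_mult power_abs mult_right_mono)
  qed
  finally show ?thesis .
qed

text \<open>Stability of \<open>chord_mean\<close> under perturbations that are small in the mean;
  this carries Whitney's inequality from polynomials to integrable functions.\<close>

lemma chord_mean_unit_le:
  assumes k: "k \<ge> 1" and [measurable]: "g \<in> borel_measurable borel"
  shows "chord_mean k g 0 1 \<le> ennreal (2 ^ k * (real k + 1) * real k) * (NN u\<in>{0..1}. ennreal \<bar>g u\<bar>)"
proof -
  let ?G = "\<integral>\<^sup>+u\<in>{0..1}. ennreal \<bar>g u\<bar> \<partial>lborel"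
  let ?g = "\<lambda>i x u. ennreal \<bar>g ((1 - real i / real k) * x + real i / real k * u)\<bar>"
  have one: "(NN x\<in>{0..1}. (NN u\<in>{0..1}. ?g i x u)) \<le> ennreal (real k) * ?G" if i: "i \<le> k" for i
  proof (cases "i = 0")
    case True
    have "1 * ?G \<le> ennreal (real k) * ?G" using k by (intro mult_right_mono) auto
    moreover have "(NN (u::real)\<in>{0..1}. ennreal \<bar>g x\<bar>) = ennreal \<bar>g x\<bar>" for x
      by (subst nn_integral_cmult_indicator) auto
    ultimately show ?thesis using True by simp
  next
    case False
    have "(NN x\<in>{0..1}. (NN u\<in>{0..1}. ?g i x u))
      \<le> (NN (x::real)\<in>{0..1}. ennreal (real k) * ?G)"
      by (rule set_nn_integral_mono_on, rule convex_pull_integral_le) (use False i in auto)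
    also have "\<dots> = ennreal (real k) * ?G" by (subst nn_integral_cmult_indicator) auto
    finally show ?thesis .
  qed
  have ub: "ennreal (chord_diff k g x u) \<le> ennreal (2 ^ k) * (\<Sum>i=0..k. ?g i x u)" for x u
  proof -
    have "ennreal (chord_diff k g x u) \<le> ennreal (2 ^ k * (\<Sum>i=0..k. \<bar>g ((1 - real i / real k) * x + real i / real k * u)\<bar>))"
      by (rule ennreal_leI[OF chord_diff_le_sum[OF k]])
    also have "\<dots> = ennreal (2 ^ k) * (\<Sum>i=0..k. ?g i x u)"
      by (subst ennreal_mult') (auto simp: sum_nonneg)
    finally show ?thesis .
  qed
  have "chord_mean k g 0 1 \<le> (NN x\<in>{0..1}. (NN u\<in>{0..1}. ennreal (2 ^ k) * (\<Sum>i=0..k. ?g i x u)))"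
    unfolding chord_mean_def by (intro set_nn_integral_mono_on ub)
  also have "\<dots> = (NN x\<in>{0..1}. ennreal (2 ^ k) * (\<Sum>i=0..k. (NN u\<in>{0..1}. ?g i x u)))"
  proof -
    have "(NN u\<in>{0..1}. ennreal (2 ^ k) * (\<Sum>i=0..k. ?g i x u))
      = ennreal (2 ^ k) * (NN u\<in>{0..1}. (\<Sum>i=0..k. ?g i x u))" for x
      by (rule set_nn_integral_cmult) measurable
    moreover have "(NN u\<in>{0..1}. (\<Sum>i=0..k. ?g i x u)) = (\<Sum>i=0..k. (NN u\<in>{0..1}. ?g i x u))" for x
      by (rule set_nn_integral_sum) measurable
    ultimately show ?thesis by simp
  qed
  also have "\<dots> = ennreal (2 ^ k) * (NN x\<in>{0..1}. (\<Sum>i=0..k. (NN u\<in>{0..1}. ?g i x u)))"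
    by (rule set_nn_integral_cmult) measurable
  also have "(NN x\<in>{0..1}. (\<Sum>i=0..k. (NN u\<in>{0..1}. ?g i x u)))
     = (\<Sum>i=0..k. (NN x\<in>{0..1}. (NN u\<in>{0..1}. ?g i x u)))"
    by (rule set_nn_integral_sum) measurable
  also have "ennreal (2 ^ k) * \<dots> \<le> ennreal (2 ^ k) * (\<Sum>i=0..k. ennreal (real k) * ?G)"
    by (intro mult_left_mono sum_mono one) auto
  also have "\<dots> = ennreal (2 ^ k * (real k + 1) * real k) * ?G"
  proof -
    have "(\<Sum>i=0..k. ennreal (real k) * ?G) = ennreal (real k + 1) * (ennreal (real k) * ?G)"
      by (subst sum_constant) (simp add: ennreal_of_nat_eq_real_of_nat add.commute del: sum_constant)
    then have "ennreal (2 ^ k) * (\<Sum>i=0..k. ennreal (real k) * ?G)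
      = ennreal (2 ^ k) * ennreal (real k + 1) * ennreal (real k) * ?G" by (simp only: mult.assoc)
    also have "ennreal (2 ^ k) * ennreal (real k + 1) * ennreal (real k) = ennreal (2 ^ k * (real k + 1) * real k)"
      by (subst ennreal_mult'[symmetric], simp, subst ennreal_mult'[symmetric]) auto
    finally show ?thesis .
  qed
  finally show ?thesis .
qed

lemma whitney_L1_unit:
  assumes k: "k \<ge> 1"
  shows "\<exists>C\<ge>0. \<forall>f \<in> borel_measurable borel. (NN x\<in>{0..1}. ennreal \<bar>f x\<bar>) < \<infinity> \<longrightarrow> (\<forall>e>0. \<exists>p. degree p < k \<and>
    (NN x\<in>{0..1}. ennreal \<bar>f x - poly p x\<bar>) \<le> ennreal C * chord_mean k f 0 1 + ennreal e)"
proof -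
  obtain C where C: "C \<ge> 0" and W: "\<And>f e. e > 0 \<Longrightarrow> \<exists>p. degree p < k \<and>
    (NN x\<in>{0..1}. ennreal \<bar>poly f x - poly p x\<bar>) \<le> ennreal C * chord_mean k (poly f) 0 1 + ennreal e"
    using whitney_poly_unit[OF k] by blast
  define B where "B = 2 ^ k * (real k + 1) * real k"
  have B: "B \<ge> 0" by (simp add: B_def)
  show ?thesis
  proof (intro exI[of _ C] conjI ballI impI allI C)
    fix f :: "real \<Rightarrow> real" and e :: real
    assume [measurable]: "f \<in> borel_measurable borel" and fin: "(NN x\<in>{0..1}. ennreal \<bar>f x\<bar>) < \<infinity>" and "e > 0"
    \<comment> \<open>The approximation error enters once directly and once through the perturbed
      chord mean, with factor \<open>C * B\<close>; together they use up
      \<open>e / 2\<close>.\<close>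
    define d where "d = e / (2 * (1 + C * B))"
    have d: "d > 0" "(1 + C * B) * d = e / 2"
    proof -
      have "1 + C * B > 0" using C B by (simp add: add_pos_nonneg)
      then show "d > 0" using \<open>e > 0\<close> unfolding d_def by simp
      have "S * (e / (2 * S)) = e / 2" if "S > 0" for S using that by simp
      from this[OF \<open>1 + C * B > 0\<close>] show "(1 + C * B) * d = e / 2" unfolding d_def .
    qed
    obtain P where P: "(NN x\<in>{0..1}. ennreal \<bar>f x - poly P x\<bar>) \<le> ennreal d"
      using poly_dense_L1_unit[OF _ fin d(1)] by auto
    obtain p where p: "degree p < k" "(NN x\<in>{0..1}. ennreal \<bar>poly P x - poly p x\<bar>) \<le> ennreal C * chord_mean k (poly P) 0 1 + ennreal (e/2)"
      using W[of "e/2" P] \<open>e > 0\<close> by auto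
    have "chord_mean k (poly P) 0 1 \<le> (NN x\<in>{0..1}. (NN u\<in>{0..1}. (ennreal (chord_diff k f x u) + ennreal (chord_diff k (\<lambda>y. f y - poly P y) x u))))"
      unfolding chord_mean_def
      using chord_diff_le_add[of k "poly P" _ _ f]
      by (intro set_nn_integral_mono_on, subst ennreal_plus[symmetric])
        (auto simp: chord_diff_def intro!: ennreal_leI simp del: ennreal_plus)
    also have "\<dots> = chord_mean k f 0 1 + chord_mean k (\<lambda>y. f y - poly P y) 0 1"
      unfolding chord_mean_def by (simp add: set_nn_integral_add)
    also have "\<dots> \<le> chord_mean k f 0 1 + ennreal B * ennreal d"
      unfolding B_def using P by (intro add_left_mono order.trans[OF chord_mean_unit_le[OF k]] mult_left_mono) auto
    finally have cm: "chord_mean k (poly P) 0 1 \<le> chord_mean k f 0 1 + ennreal B * ennreal d" .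
    have "(NN x\<in>{0..1}. ennreal \<bar>f x - poly p x\<bar>)
      \<le> (NN x\<in>{0..1}. (ennreal \<bar>f x - poly P x\<bar> + ennreal \<bar>poly P x - poly p x\<bar>))"
      by (intro set_nn_integral_mono_on ennreal_abs_triangle)
    also have "\<dots> = (NN x\<in>{0..1}. ennreal \<bar>f x - poly P x\<bar>) + (NN x\<in>{0..1}. ennreal \<bar>poly P x - poly p x\<bar>)"
      by (rule set_nn_integral_add) auto
    also have "\<dots> \<le> ennreal d + (ennreal C * (chord_mean k f 0 1 + ennreal B * ennreal d) + ennreal (e/2))"
      using p(2) cm by (intro add_mono P order.trans[OF p(2)] mult_left_mono) auto
    also have "\<dots> = ennreal C * chord_mean k f 0 1 + (ennreal d + ennreal C * (ennreal B * ennreal d) + ennreal (e/2))"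
      by (simp add: distrib_left add_ac)
    also have "ennreal d + ennreal C * (ennreal B * ennreal d) + ennreal (e/2) = ennreal e"
    proof -
      have "ennreal C * (ennreal B * ennreal d) = ennreal (C * B * d)"
        using C B by (simp add: ennreal_mult' mult.assoc)
      moreover have "d + C * B * d + e / 2 = e" using d(2) by (simp add: algebra_simps)
      ultimately show ?thesis using d C B \<open>e > 0\<close>
        by (metis add_nonneg_nonneg ennreal_plus less_imp_le mult_nonneg_nonneg half_gt_zero)
    qed
    finally show "\<exists>p. degree p < k \<and> (NN x\<in>{0..1}. ennreal \<bar>f x - poly p x\<bar>) \<le> ennreal C * chord_mean k f 0 1 + ennreal e"
      using p(1) by blast
  qed
qed

text \<open>Affine transport from the unit interval: the single integral scales by the length, the
  double integral by its square, which leaves the factor \<open>1 / (b - a)\<close>.\<close>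

lemma whitney_L1:
  assumes k: "k \<ge> 1"
  shows "\<exists>C\<ge>0. \<forall>f \<in> borel_measurable borel. \<forall>a b. a < b \<longrightarrow> (NN x\<in>{a..b}. ennreal \<bar>f x\<bar>) < \<infinity> \<longrightarrow> (\<forall>e>0. \<exists>p. degree p < k \<and>
    (NN x\<in>{a..b}. ennreal \<bar>f x - poly p x\<bar>) \<le> ennreal (C / (b - a)) * chord_mean k f a b + ennreal e)"
proof -
  obtain C where C: "C \<ge> 0" and W: "\<And>f e. f \<in> borel_measurable borel \<Longrightarrow> (NN x\<in>{0..1}. ennreal \<bar>f x\<bar>) < \<infinity> \<Longrightarrow> e > 0 \<Longrightarrow> \<exists>p. degree p < k \<and>
    (NN x\<in>{0..1}. ennreal \<bar>f x - poly p x\<bar>) \<le> ennreal C * chord_mean k f 0 1 + ennreal e"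
    using whitney_L1_unit[OF k] by blast
  show ?thesis
  proof (intro exI[of _ C] conjI ballI impI allI C)
    fix f :: "real \<Rightarrow> real" and a b e :: real
    assume [measurable]: "f \<in> borel_measurable borel" and "a < b"
      and fin: "(NN x\<in>{a..b}. ennreal \<bar>f x\<bar>) < \<infinity>" and "e > 0"
    define l where "l = b - a"
    have l: "l > 0" "b = a + l" using \<open>a < b\<close> by (auto simp: l_def)
    define F where "F x = f (a + l * x)" for x
    have [measurable]: "F \<in> borel_measurable borel" unfolding F_def by measurable
    have sub: "a + l * x \<in> {a..b}" if "x \<in> {0..1}" for x
      using that l mult_left_le[of x l] mult_nonneg_nonneg[of l x] by auto
    have "(NN x\<in>{0..1}. ennreal \<bar>F x\<bar>) \<le> ennreal (1 / l) * (NN x\<in>{a..b}. ennreal \<bar>f x\<bar>)"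
      unfolding F_def by (rule set_nn_integral_affine) (use l sub in auto)
    also have "\<dots> < \<infinity>" using fin by (simp add: ennreal_mult_less_top)
    finally have finF: "(NN x\<in>{0..1}. ennreal \<bar>F x\<bar>) < \<infinity>" .
    obtain q where q: "degree q < k" "(NN x\<in>{0..1}. ennreal \<bar>F x - poly q x\<bar>) \<le> ennreal C * chord_mean k F 0 1 + ennreal (e / l)"
      using W[of F "e / l"] finF \<open>e > 0\<close> l by auto
    define p where "p = pcompose q [:- a / l, 1 / l:]"
    have p: "poly p y = poly q ((y - a) / l)" for y
      using l by (simp add: p_def poly_pcompose diff_divide_distrib)
    have "degree p \<le> degree q * degree [:- a / l, 1 / l:]" unfolding p_def by (rule degree_pcompose_le)
    also have "\<dots> \<le> degree q" using l by simp
    finally have dp: "degree p < k" using q(1) by simp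
    have "(NN x\<in>{a..b}. ennreal \<bar>f x - poly p x\<bar>) = (NN y\<in>{a..b}. ennreal \<bar>F (- a / l + 1 / l * y) - poly q (- a / l + 1 / l * y)\<bar>)"
    proof -
      have "(y - a) / l = - a / l + 1 / l * y" "a + l * (- a / l + 1 / l * y) = y" for y
        using l by (simp_all add: diff_divide_distrib right_diff_distrib)
      then show ?thesis by (simp only: p F_def)
    qed
    also have "\<dots> \<le> ennreal (1 / (1 / l)) * (NN x\<in>{0..1}. ennreal \<bar>F x - poly q x\<bar>)"
      by (rule set_nn_integral_affine) (use l in \<open>auto simp: field_simps\<close>)
    also have "\<dots> \<le> ennreal l * (ennreal C * chord_mean k F 0 1 + ennreal (e / l))"
      using q(2) l by (simp add: mult_left_mono)
    also have "\<dots> \<le> ennreal l * (ennreal C * (ennreal (1 / l) * (ennreal (1 / l) * chord_mean k f a b)) + ennreal (e / l))"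
    proof (intro mult_left_mono add_right_mono)
      have D: "chord_diff k F x u = chord_diff k f (a + l * x) (a + l * u)" for x u
        unfolding chord_diff_def fdiff_def F_def
        by (intro arg_cong[of _ _ abs] sum.cong refl arg_cong2[of _ _ _ _ "(*)"] arg_cong[of _ _ f]) (simp add: field_simps)
      have "chord_mean k F 0 1 \<le> (NN x\<in>{0..1}. ennreal (1 / l) * (NN u\<in>{a..b}. ennreal (chord_diff k f (a + l * x) u)))"
        unfolding chord_mean_def D by (rule set_nn_integral_mono_on, rule set_nn_integral_affine) (use l sub in auto)
      also have "\<dots> = ennreal (1 / l) * (NN x\<in>{0..1}. (NN u\<in>{a..b}. ennreal (chord_diff k f (a + l * x) u)))"
        by (rule set_nn_integral_cmult) measurable
      also have "\<dots> \<le> ennreal (1 / l) * (ennreal (1 / l) * chord_mean k f a b)"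
        unfolding chord_mean_def by (rule mult_left_mono, rule set_nn_integral_affine) (use l sub in auto)
      finally show "chord_mean k F 0 1 \<le> ennreal (1 / l) * (ennreal (1 / l) * chord_mean k f a b)" .
    qed auto
    also have "\<dots> = ennreal (C / (b - a)) * chord_mean k f a b + ennreal e"
    proof -
      have "ennreal l * (ennreal C * (ennreal (1 / l) * (ennreal (1 / l) * X))) = ennreal (C / l) * X" for X
      proof -
        have "ennreal l * (ennreal C * (ennreal (1 / l) * (ennreal (1 / l) * X))) = ennreal l * ennreal C * ennreal (1 / l) * ennreal (1 / l) * X"
          by (simp only: mult.assoc)
        also have "ennreal l * ennreal C * ennreal (1 / l) * ennreal (1 / l) = ennreal (l * C * (1 / l) * (1 / l))"
          using l C by (simp only: ennreal_mult' mult_nonneg_nonneg less_imp_le divide_nonneg_pos zero_le_one)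
        also have "l * C * (1 / l) * (1 / l) = C / l" using l by simp
        finally show ?thesis .
      qed
      moreover have "ennreal l * ennreal (e / l) = ennreal e" using l by (subst ennreal_mult'[symmetric]) auto
      ultimately show ?thesis by (simp add: distrib_left l_def)
    qed
    finally show "\<exists>p. degree p < k \<and> (NN x\<in>{a..b}. ennreal \<bar>f x - poly p x\<bar>)
      \<le> ennreal (C / (b - a)) * chord_mean k f a b + ennreal e" using dp by blast
  qed
qed

lemma chord_diff_diff_poly: "degree p < k \<Longrightarrow> chord_diff k (\<lambda>x. f x - poly p x) x u = chord_diff k f x u"
  by (simp add: chord_diff_def fdiff_diff fdiff_poly_eq_0)

text \<open>Subtracting \<open>p\<close> does not change chord differences of order
  \<open>k\<close>, so the averaged representation applies to \<open>f - p\<close>. It upgrades an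
  approximation in the mean to a pointwise one.\<close>

lemma approx_pointwise:
  assumes k: "k \<ge> 1" and "a < b" and x: "x \<in> {a..b}" and [measurable]: "f \<in> borel_measurable borel" and p: "degree p < k"
  shows "ennreal \<bar>f x - poly p x\<bar> \<le> ennreal (1 / (b - a)) * (NN u\<in>{a..b}. ennreal (chord_diff k f x u))
    + ennreal (2 ^ k * real k * real k / (b - a)) * (NN u\<in>{a..b}. ennreal \<bar>f u - poly p u\<bar>)"
  using abs_le_chord_diff_mean[OF k \<open>a < b\<close> x, of "\<lambda>x. f x - poly p x"] by (simp add: chord_diff_diff_poly[OF p])

section \<open>Growth of polynomials of bounded degree\<close>

lemma poly_coeff_bound:
  "\<exists>C\<ge>0. \<forall>(q :: real poly) B. degree q < k \<longrightarrow> (\<forall>x\<in>{0..1}. \<bar>poly q x\<bar> \<le> B) \<longrightarrow> (\<forall>j. \<bar>coeff q j\<bar> \<le> C * B)"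
proof (induction k)
  case 0
  then show ?case by auto
next
  case (Suc k)
  then obtain C where C: "C \<ge> 0" and IH': "\<forall>(q :: real poly) B. degree q < k \<longrightarrow> (\<forall>x\<in>{0..1}. \<bar>poly q x\<bar> \<le> B) \<longrightarrow> (\<forall>j. \<bar>coeff q j\<bar> \<le> C * B)"
    by (elim exE conjE)
  note IH = IH'[rule_format]
  \<comment> \<open>The \<open>k\<close>-th difference of step \<open>1 / k\<close> at 0 kills the
    lower terms and equals \<open>c * fact k / k ^ k\<close>, where \<open>c\<close> is the top
    coefficient. It is at most \<open>2 ^ k * B\<close>, whence \<open>|c| <= L * B\<close>. The
    remainder has smaller degree and is bounded by \<open>(1 + L) * B\<close>.\<close>
  define L where "L = (2 * real k) ^ k"
  have L: "L \<ge> 0" by (simp add: L_def)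
  show ?case
  proof (cases "k = 0")
    case True
    have "\<bar>coeff q j\<bar> \<le> 1 * B" if "degree q < Suc k" "\<forall>x\<in>{0..1}. \<bar>poly q x\<bar> \<le> B" for q :: "real poly" and B j
    proof -
      from that True have "degree q = 0" by simp
      then obtain c where q: "q = [:c:]" by (rule degree_eq_zeroE)
      have "\<bar>c\<bar> \<le> B" using bspec[OF that(2), of 0] q by simp
      then show ?thesis using q order.trans[OF abs_ge_zero] by (cases j) auto
    qed
    then show ?thesis by (intro exI[of _ 1]) auto
  next
    case False
    have "\<bar>coeff q j\<bar> \<le> (C * (1 + L) + L) * B" if q: "degree q < Suc k" "\<forall>x\<in>{0..1}. \<bar>poly q x\<bar> \<le> B" for q :: "real poly" and B j
    proof -
      have "B \<ge> 0" using q(2)[rule_format, of 0] by auto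
      define c where "c = coeff q k"
      define q' where "q' = q - monom c k"
      have dq': "degree q' < k"
      proof -
        have d: "degree q' \<le> k" unfolding q'_def using q(1) by (intro degree_diff_le) (auto simp: degree_monom_le)
        have "coeff q' k = 0" by (simp add: q'_def c_def)
        then have "degree q' \<noteq> k" using False leading_coeff_0_iff[of q'] by auto
        with d show ?thesis by simp
      qed
      define h where "h = 1 / real k"
      have h: "h > 0" using False by (simp add: h_def)
      have "fdiff k h (poly q) 0 = fdiff k h (poly q') 0 + fdiff k h (poly (monom c k)) 0"
        unfolding fdiff_add[symmetric] by (simp add: q'_def)
      also have "fdiff k h (poly q') 0 = 0" by (rule fdiff_poly_eq_0[OF dq'])
      also have "fdiff k h (poly (monom c k)) 0 = h ^ k * (c * fact k)"
        using fdiff_poly_mvt[OF h, of 0 k "monom c k"] pderiv_pow_monom[of k "c * fact k"] by auto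
      finally have e: "h ^ k * (c * fact k) = fdiff k h (poly q) 0" by simp
      have "\<bar>fdiff k h (poly q) 0\<bar> \<le> (\<Sum>i=0..k. real (k choose i) * B)"
        unfolding fdiff_def
      proof (rule order.trans[OF sum_abs], intro sum_mono)
        fix i assume "i \<in> {0..k}"
        then have "0 + real i * h \<in> {0..1}" using False by (auto simp: h_def)
        then have "\<bar>poly q (0 + real i * h)\<bar> \<le> B" using q(2) by blast
        then show "\<bar>real (k choose i) * (-1) ^ (k - i) * poly q (0 + real i * h)\<bar> \<le> real (k choose i) * B"
          by (simp add: abs_mult power_abs mult_left_mono)
      qed
      also have "\<dots> = 2 ^ k * B"
        by (simp add: sum_distrib_right[symmetric] of_nat_sum[symmetric] choose_row_sum atLeast0AtMost del: of_nat_sum)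
      finally have "h ^ k * (\<bar>c\<bar> * fact k) \<le> 2 ^ k * B" using h by (simp add: e[symmetric] abs_mult)
      moreover have "h ^ k * (\<bar>c\<bar> * 1) \<le> h ^ k * (\<bar>c\<bar> * fact k)"
        using h by (intro mult_left_mono) (auto simp: fact_ge_1)
      ultimately have "h ^ k * \<bar>c\<bar> \<le> 2 ^ k * B" by simp
      then have c: "\<bar>c\<bar> \<le> L * B" using False by (simp add: h_def L_def power_divide power_mult_distrib field_simps)
      have "\<bar>poly q' x\<bar> \<le> (1 + L) * B" if x: "x \<in> {0..1}" for x
      proof -
        have "\<bar>poly q' x\<bar> \<le> \<bar>poly q x\<bar> + \<bar>c\<bar> * \<bar>x ^ k\<bar>"
          unfolding q'_def by (simp add: poly_monom abs_mult[symmetric])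
        also have "\<dots> \<le> B + L * B * 1"
          using q(2) x c L \<open>B \<ge> 0\<close> by (intro add_mono mult_mono) (auto simp: power_le_one power_abs)
        finally show ?thesis by (simp add: algebra_simps)
      qed
      then have "\<bar>coeff q' j\<bar> \<le> C * ((1 + L) * B)" by (rule IH[OF dq'])
      moreover have "\<bar>coeff (monom c k) j\<bar> \<le> L * B" using c L \<open>B \<ge> 0\<close> by (auto simp: coeff_monom)
      moreover have "coeff q j = coeff q' j + coeff (monom c k) j" by (simp add: q'_def)
      ultimately show ?thesis by (simp add: algebra_simps)
    qed
    then show ?thesis using C L by (intro exI[of _ "C * (1 + L) + L"]) auto
  qed
qed

text \<open>The mean controls the supremum on \<open>[a, b]\<close>, and the supremum controls the
  coefficients in the variable \<open>(x - a) / (b - a)\<close>; outside the interval only the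
  powers of this variable grow.\<close>

lemma poly_growth:
  assumes k: "k \<ge> 1"
  shows "\<exists>C\<ge>0. \<forall>(q :: real poly) a b I x. degree q < k \<longrightarrow> a < b \<longrightarrow> 0 \<le> I \<longrightarrow>
    (NN u\<in>{a..b}. ennreal \<bar>poly q u\<bar>) \<le> ennreal I \<longrightarrow>
    \<bar>poly q x\<bar> \<le> C * (I / (b - a)) * (1 + \<bar>x - a\<bar> / (b - a)) ^ k"
proof -
  obtain C where C: "C \<ge> 0" and cb': "\<forall>(q :: real poly) B. degree q < k \<longrightarrow> (\<forall>x\<in>{0..1}. \<bar>poly q x\<bar> \<le> B) \<longrightarrow> (\<forall>j. \<bar>coeff q j\<bar> \<le> C * B)"
    using poly_coeff_bound[of k] by (elim exE conjE)
  note cb = cb'[rule_format]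
  define M where "M = 2 ^ k * real k * real k"
  have M: "M \<ge> 0" by (simp add: M_def)
  show ?thesis
  proof (intro exI[of _ "real k * C * M"] conjI allI impI)
    show "0 \<le> real k * C * M" using C M by simp
    fix q :: "real poly" and a b I x :: real
    assume dq: "degree q < k" and "a < b" and I: "0 \<le> I" and int: "(NN u\<in>{a..b}. ennreal \<bar>poly q u\<bar>) \<le> ennreal I"
    define l where "l = b - a"
    have l: "l > 0" "b = a + l" using \<open>a < b\<close> by (auto simp: l_def)
    have sup: "\<bar>poly q y\<bar> \<le> M * (I / l)" if "y \<in> {a..b}" for y
    proof -
      have "ennreal \<bar>poly q y\<bar> \<le> ennreal (M / (b - a)) * (NN u\<in>{a..b}. ennreal \<bar>poly q u\<bar>)"
        using abs_le_chord_diff_mean[OF k \<open>a < b\<close> that, of "poly q"]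
        by (simp add: chord_diff_def fdiff_poly_eq_0[OF dq] M_def)
      also have "\<dots> \<le> ennreal (M / (b - a)) * ennreal I" by (intro mult_left_mono int) auto
      also have "\<dots> = ennreal (M / (b - a) * I)" using M l(1) by (intro ennreal_mult'[symmetric]) (simp add: l_def)
      also have "M / (b - a) * I = M * (I / l)" by (simp add: l_def)
      finally show ?thesis using M I l(1) by (simp add: ennreal_le_iff)
    qed
    define Q where "Q = pcompose q [:a, l:]"
    have Q: "poly Q y = poly q (a + l * y)" for y by (simp add: Q_def poly_pcompose mult.commute)
    have "degree Q \<le> degree q * degree [:a, l:]" unfolding Q_def by (rule degree_pcompose_le)
    then have dQ: "degree Q < k" using dq l by simp
    have co: "\<bar>coeff Q j\<bar> \<le> C * (M * (I / l))" for j
    proof (rule cb[OF dQ])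
      fix y :: real assume "y \<in> {0..1}"
      then have "a + l * y \<in> {a..b}" using l mult_left_le[of y l] by auto
      then show "\<bar>poly Q y\<bar> \<le> M * (I / l)" unfolding Q by (rule sup)
    qed
    define y where "y = (x - a) / l"
    have "poly q x = poly Q y" using l by (simp add: Q y_def)
    also have "\<dots> = (\<Sum>i\<le>degree Q. coeff Q i * y ^ i)" by (rule poly_altdef)
    also have "\<bar>\<dots>\<bar> \<le> (\<Sum>i\<le>degree Q. C * (M * (I / l)) * (1 + \<bar>y\<bar>) ^ k)"
    proof (rule order.trans[OF sum_abs], rule sum_mono)
      fix i assume "i \<in> {..degree Q}"
      then have "i \<le> k" using dQ by auto
      have "\<bar>y ^ i\<bar> \<le> (1 + \<bar>y\<bar>) ^ i" unfolding power_abs by (rule power_mono) auto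
      also have "\<dots> \<le> (1 + \<bar>y\<bar>) ^ k" using \<open>i \<le> k\<close> by (intro power_increasing) auto
      finally show "\<bar>coeff Q i * y ^ i\<bar> \<le> C * (M * (I / l)) * (1 + \<bar>y\<bar>) ^ k"
        unfolding abs_mult using co C M I l by (intro mult_mono) auto
    qed
    also have "\<dots> = real (Suc (degree Q)) * (C * (M * (I / l)) * (1 + \<bar>y\<bar>) ^ k)" by simp
    also have "\<dots> \<le> real k * (C * (M * (I / l)) * (1 + \<bar>y\<bar>) ^ k)"
      using dQ C M I l by (intro mult_right_mono mult_nonneg_nonneg zero_le_power) auto
    finally show "\<bar>poly q x\<bar> \<le> real k * C * M * (I / (b - a)) * (1 + \<bar>x - a\<bar> / (b - a)) ^ k"
      using l(1) unfolding l_def[symmetric] y_def by (simp add: abs_divide mult.assoc)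
  qed
qed

section \<open>Averages of doubling weights\<close>

definition window_mass :: "(real \<Rightarrow> real) \<Rightarrow> real \<Rightarrow> real \<Rightarrow> real" where
  "window_mass w u d = (LINT v:{u - d..u + d}|lebesgue. w v)"

lemma avg_weight_eq: "avg_weight w n x = window_mass w x (rho n x) / rho n x"
  by (simp add: avg_weight_def window_mass_def)

lemma doubling_weightD:
  assumes "doubling_weight w"
  shows "0 \<le> w x" "x \<notin> {-1..1} \<Longrightarrow> w x = 0" "integrable lebesgue w"
  using assms by (auto simp: doubling_weight_def)

text \<open>Windows are compared only inside \<open>[-1,1]\<close>, because \<open>w\<close>
  vanishes elsewhere.\<close>

lemma window_mass_mono:
  assumes w: "doubling_weight w" and sub: "{u - d..u + d} \<inter> {-1..1} \<subseteq> {v - e..v + e}"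
  shows "window_mass w u d \<le> window_mass w v e"
  unfolding window_mass_def set_lebesgue_integral_def
proof (rule integral_mono)
  show "integrable lebesgue (\<lambda>x. indicat_real {u - d..u + d} x *\<^sub>R w x)"
    "integrable lebesgue (\<lambda>x. indicat_real {v - e..v + e} x *\<^sub>R w x)"
    by (rule integrable_mult_indicator[OF _ doubling_weightD(3)[OF w]]; simp)+
  fix x
  show "indicat_real {u - d..u + d} x *\<^sub>R w x \<le> indicat_real {v - e..v + e} x *\<^sub>R w x"
    using doubling_weightD(1,2)[OF w, of x] sub
    by (cases "x \<in> {-1..1}") (auto simp: indicator_def)
qed

lemma window_mass_nonneg: "doubling_weight w \<Longrightarrow> 0 \<le> window_mass w u d"
  unfolding window_mass_def set_lebesgue_integral_def
  by (rule integral_nonneg_AE) (auto simp: doubling_weightD)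

text \<open>Windows centred in \<open>[-1,1]\<close> may stick out of \<open>[-1,1]\<close>; two applications of the doubling property
  to the truncated window make up for this.\<close>

lemma window_mass_double:
  assumes w: "doubling_weight w"
  shows "\<exists>L\<ge>1. \<forall>u\<in>{-1..1}. \<forall>d\<ge>0. window_mass w u (2 * d) \<le> L * window_mass w u d"
proof -
  obtain L0 where L0: "\<And>c d. 0 \<le> d \<Longrightarrow> {c - d..c + d} \<subseteq> {-1..1} \<Longrightarrow> window_mass w c (2 * d) \<le> L0 * window_mass w c d"
    using w unfolding doubling_weight_def window_mass_def by blast
  define L where "L = max 1 L0"
  have L: "L \<ge> 1" by (simp add: L_def)
  have step: "window_mass w c (2 * d) \<le> L * window_mass w c d" if "0 \<le> d" "{c - d..c + d} \<subseteq> {-1..1}" for c d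
    by (rule order.trans[OF L0[OF that]])
      (use window_mass_nonneg[OF w, of c d] in \<open>auto simp: L_def intro: mult_right_mono\<close>)
  have "window_mass w u (2 * d) \<le> L * L * window_mass w u d" if u: "u \<in> {-1..1}" and d: "d \<ge> 0" for u d
  proof -
    \<comment> \<open>The window and its double are cut back to \<open>[-1,1]\<close> in turn. At
      \<open>u = 1\<close> with small \<open>d\<close> the successive reaches to the left are
      \<open>d\<close>, \<open>3 / 2 * d\<close> and \<open>9 / 4 * d\<close>: one doubling falls
      short of \<open>2 * d\<close>, two suffice.\<close>
    define a b where "a = max (-1) (u - d)" and "b = min 1 (u + d)"
    define c e where "c = (a + b) / 2" and "e = (b - a) / 2"
    define a' b' where "a' = max (-1) (c - 2 * e)" and "b' = min 1 (c + 2 * e)"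
    define c' e' where "c' = (a' + b') / 2" and "e' = (b' - a') / 2"
    have ab: "a \<le> b" "-1 \<le> a" "b \<le> 1" using u d by (auto simp: a_def b_def)
    have ce: "c - e = a" "c + e = b" "c - 2 * e = (3 * a - b) / 2" "c + 2 * e = (3 * b - a) / 2" "0 \<le> e"
      using ab by (auto simp: c_def e_def field_simps)
    have ab': "a' \<le> a" "b \<le> b'" "-1 \<le> a'" "b' \<le> 1" using ab unfolding a'_def b'_def ce by auto
    have ce': "c' - e' = a'" "c' + e' = b'" "c' - 2 * e' = (3 * a' - b') / 2" "c' + 2 * e' = (3 * b' - a') / 2" "0 \<le> e'"
      using ab ab' by (auto simp: c'_def e'_def field_simps)
    have "window_mass w u (2 * d) \<le> window_mass w c' (2 * e')"
    proof (rule window_mass_mono[OF w])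
      show "{u - 2 * d..u + 2 * d} \<inter> {-1..1} \<subseteq> {c' - 2 * e'..c' + 2 * e'}"
      proof
        fix x assume x: "x \<in> {u - 2 * d..u + 2 * d} \<inter> {-1..1}"
        have "(3 * a' - b') / 2 \<le> x" "x \<le> (3 * b' - a') / 2"
        proof -
          have da: "a = -1 \<or> a = u - d" and db: "b = 1 \<or> b = u + d"
            and da': "a' = -1 \<or> a' = (3 * a - b) / 2" and db': "b' = 1 \<or> b' = (3 * b - a) / 2"
            unfolding a_def b_def a'_def b'_def ce by (auto simp: max_def min_def)
          have "a \<le> u" "u \<le> b" using u d by (auto simp: a_def b_def)
          note facts = this ab ab' u d
          have x': "u - 2 * d \<le> x" "x \<le> u + 2 * d" "-1 \<le> x" "x \<le> 1" using x by auto
          from da' da show "(3 * a' - b') / 2 \<le> x"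
            by (elim disjE) (use facts x' in simp_all)
          from db' db show "x \<le> (3 * b' - a') / 2"
            by (elim disjE) (use facts x' in simp_all)
        qed
        then show "x \<in> {c' - 2 * e'..c' + 2 * e'}" using ce' by simp
      qed
    qed
    also have "\<dots> \<le> L * window_mass w c' e'"
      using ce' ab' by (intro step) auto
    also have "window_mass w c' e' \<le> window_mass w c (2 * e)"
      by (rule window_mass_mono[OF w]) (use ce' in \<open>auto simp: a'_def b'_def\<close>)
    also have "window_mass w c (2 * e) \<le> L * window_mass w c e"
      using ce ab by (intro step) auto
    also have "window_mass w c e \<le> window_mass w u d"
      by (rule window_mass_mono[OF w]) (use ce in \<open>auto simp: a_def b_def\<close>)
    finally show ?thesis using L by (simp add: mult.assoc mult_left_mono)
  qed
  moreover have "1 \<le> L * L" using L mult_mono[of 1 L 1 L] by simp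
  ultimately show ?thesis by blast
qed

text \<open>Iterating the doubling inequality about \<open>log 2 c\<close> times gives a power of
  \<open>L\<close>; since \<open>L <= 2 ^ s\<close>, this is a power of \<open>c\<close>. An integer
  \<open>s\<close> is chosen because it becomes an exponent of kernels.\<close>

lemma window_mass_scale:
  assumes w: "doubling_weight w"
  shows "\<exists>C\<ge>0. \<exists>s::nat. \<forall>u\<in>{-1..1}. \<forall>d\<ge>0. \<forall>c\<ge>1. window_mass w u (c * d) \<le> C * c ^ s * window_mass w u d"
proof -
  obtain L where L: "L \<ge> 1" and dbl: "\<And>u d. u \<in> {-1..1} \<Longrightarrow> d \<ge> 0 \<Longrightarrow> window_mass w u (2 * d) \<le> L * window_mass w u d"
    using window_mass_double[OF w] by blast
  obtain s :: nat where s: "L \<le> 2 ^ s"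
    using real_arch_pow[of 2 L] by (auto intro: less_imp_le)
  have it: "window_mass w u (2 ^ j * d) \<le> (2 ^ s) ^ j * window_mass w u d" if u: "u \<in> {-1..1}" and d: "d \<ge> 0" for u d j
  proof (induction j)
    case (Suc j)
    have "window_mass w u (2 ^ Suc j * d) = window_mass w u (2 * (2 ^ j * d))" by (simp add: mult.assoc)
    also have "\<dots> \<le> L * window_mass w u (2 ^ j * d)" using u d by (intro dbl) auto
    also have "\<dots> \<le> 2 ^ s * ((2 ^ s) ^ j * window_mass w u d)"
      using s Suc window_mass_nonneg[OF w] by (intro mult_mono) auto
    finally show ?case by (simp add: mult.assoc)
  qed simp
  have "window_mass w u (c * d) \<le> 2 ^ s * c ^ s * window_mass w u d" if u: "u \<in> {-1..1}" and d: "d \<ge> 0" and l: "c \<ge> 1" for u d c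
  proof -
    define j where "j = nat \<lceil>log 2 c\<rceil>"
    have lg: "log 2 c \<ge> 0" using l by simp
    have j: "log 2 c \<le> real j" "real j \<le> log 2 c + 1" using lg unfolding j_def by linarith+
    have "c = 2 powr log 2 c" using l by simp
    also have "\<dots> \<le> 2 powr real j" using j by simp
    finally have j1: "c \<le> 2 ^ j" by (simp add: powr_realpow)
    have "2 ^ j = 2 powr real j" by (simp add: powr_realpow)
    also have "\<dots> \<le> 2 powr (log 2 c + 1)" using j by simp
    also have "\<dots> = 2 * c" using l by (simp add: powr_add)
    finally have j2: "(2::real) ^ j \<le> 2 * c" .
    have "window_mass w u (c * d) \<le> window_mass w u (2 ^ j * d)"
      by (rule window_mass_mono[OF w]) (use mult_right_mono[OF j1 d] in auto)
    also have "\<dots> \<le> (2 ^ s) ^ j * window_mass w u d" by (rule it[OF u d])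
    also have "(2 ^ s) ^ j = ((2::real) ^ j) ^ s" by (simp only: power_mult[symmetric] mult.commute)
    also have "\<dots> * window_mass w u d \<le> (2 * c) ^ s * window_mass w u d"
      using j2 window_mass_nonneg[OF w] by (intro mult_right_mono power_mono) auto
    finally show ?thesis by (simp add: power_mult_distrib)
  qed
  then show ?thesis by (intro exI[of _ "2 ^ s"] conjI exI[of _ s] ballI allI impI) auto
qed

section \<open>Angular distance, \<open>rho\<close>, and slowly varying averages\<close>

lemma rho_cos: "t \<in> {0..pi} \<Longrightarrow> rho n (cos t) = sin t / real n + 1 / (real n)\<^sup>2"
  by (simp add: rho_def sin_ge_zero sin_squared_eq[symmetric])

lemma rho_pos:
  assumes "n \<ge> 1" "x \<in> {-1..1}"
  shows "0 < rho n x"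
proof -
  have "x\<^sup>2 \<le> 1" using assms by (simp add: abs_square_le_1 abs_le_iff)
  then show ?thesis unfolding rho_def using assms
    by (intro add_nonneg_pos divide_nonneg_pos real_sqrt_ge_zero) auto
qed

lemma abs_sin_diff_le: "\<bar>sin x - sin y\<bar> \<le> \<bar>x - y :: real\<bar>"
proof -
  have "\<bar>sin x - sin y\<bar> = 2 * \<bar>sin ((x - y) / 2)\<bar> * \<bar>cos ((x + y) / 2)\<bar>"
    by (simp add: sin_diff_sin abs_mult)
  also have "\<dots> \<le> 2 * \<bar>(x - y) / 2\<bar> * 1"
    by (intro mult_mono abs_sin_x_le_abs_x) auto
  finally show ?thesis by simp
qed

text \<open>Concavity of sine: its graph lies above the chord from 0 to
  \<open>pi / 2\<close>.\<close>

lemma sin_jordan: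
  assumes "0 \<le> x" "x \<le> pi / 2"
  shows "2 * x / pi \<le> sin x"
proof -
  have "convex_on {0..pi/2} (\<lambda>x. - sin x)"
  proof (rule f''_ge0_imp_convex)
    show "((\<lambda>x. - sin x) has_real_derivative - cos x) (at x)" for x
      by (auto intro!: derivative_eq_intros)
    show "((\<lambda>x. - cos x) has_real_derivative sin x) (at x)" for x
      by (auto intro!: derivative_eq_intros)
    show "0 \<le> sin x" if "x \<in> {0..pi/2}" for x using that by (intro sin_ge_zero) auto
  qed auto
  from convex_onD[OF this, of "2 * x / pi" 0 "pi/2"] assms show ?thesis
    by (simp add: field_simps)
qed

text \<open>On \<open>[0, pi]\<close> the right side is nonnegative, so the half sum dominates the
  half difference there.\<close>

lemma sin_sq_half_sum: "(sin ((\<theta> + t) / 2))\<^sup>2 - (sin ((\<theta> - t) / 2))\<^sup>2 = sin \<theta> * sin (t::real)"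
proof -
  define A B where "A = \<theta> / 2" and "B = t / 2"
  have e: "\<theta> = 2 * A" "t = 2 * B" "(\<theta> + t) / 2 = A + B" "(\<theta> - t) / 2 = A - B"
    by (auto simp: A_def B_def field_simps)
  show ?thesis unfolding e(3,4) unfolding e(1,2) sin_add sin_diff sin_double
    by (simp add: power2_eq_square algebra_simps)
qed

lemma sin_half_sum_ge:
  assumes "\<theta> \<in> {0..pi}" "t \<in> {0..pi}"
  shows "\<bar>sin ((\<theta> - t) / 2)\<bar> \<le> sin ((\<theta> + t) / 2)" "sin \<theta> / 2 \<le> sin ((\<theta> + t) / 2)"
proof -
  have p: "0 \<le> sin ((\<theta> + t) / 2)" using assms by (intro sin_ge_zero) auto
  have "0 \<le> sin \<theta> * sin t" using assms by (auto intro!: mult_nonneg_nonneg sin_ge_zero)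
  then have "(sin ((\<theta> - t) / 2))\<^sup>2 \<le> (sin ((\<theta> + t) / 2))\<^sup>2"
    using sin_sq_half_sum[of \<theta> t] by simp
  then show 1: "\<bar>sin ((\<theta> - t) / 2)\<bar> \<le> sin ((\<theta> + t) / 2)"
    using p by (metis abs_le_square_iff abs_of_nonneg)
  have "sin \<theta> = sin ((\<theta> + t) / 2 + (\<theta> - t) / 2)" by (simp add: field_simps)
  also have "\<dots> \<le> sin ((\<theta> + t) / 2) * 1 + 1 * \<bar>sin ((\<theta> - t) / 2)\<bar>"
  proof -
    have "sin ((\<theta> + t) / 2) * cos ((\<theta> - t) / 2) \<le> sin ((\<theta> + t) / 2) * 1" using p by (intro mult_left_mono) auto
    moreover have "\<bar>cos ((\<theta> + t) / 2) * sin ((\<theta> - t) / 2)\<bar> \<le> 1 * \<bar>sin ((\<theta> - t) / 2)\<bar>"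
      unfolding abs_mult by (intro mult_right_mono) auto
    ultimately show ?thesis unfolding sin_add by linarith
  qed
  finally show "sin \<theta> / 2 \<le> sin ((\<theta> + t) / 2)" using 1 by linarith
qed

text \<open>With \<open>d\<close> the angular distance, the difference of cosines is at most
  \<open>d * sin t + d^2 / 2\<close>. The first term is linear in \<open>n * d\<close> against
  \<open>sin t / n\<close>, the second quadratic against \<open>1 / n^2\<close>; the square of
  \<open>1 + n * d\<close> covers both.\<close>

lemma abs_cos_diff_le_rho:
  assumes \<theta>: "\<theta> \<in> {0..pi}" and t: "t \<in> {0..pi}" and n: "n \<ge> 1"
  shows "\<bar>cos \<theta> - cos t\<bar> \<le> (1 + real n * \<bar>\<theta> - t\<bar>)\<^sup>2 * rho n (cos t)"
proof -
  define d where "d = \<bar>\<theta> - t\<bar>"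
  have d: "d \<ge> 0" by (simp add: d_def)
  have st: "sin t \<ge> 0" using t by (intro sin_ge_zero) auto
  have "sin ((\<theta> + t) / 2) \<le> sin t + d / 2"
    using abs_sin_diff_le[of "(\<theta> + t) / 2" t] by (simp add: d_def field_simps abs_if split: if_splits)
  moreover have "0 \<le> sin ((\<theta> + t) / 2)" using \<theta> t by (intro sin_ge_zero) auto
  ultimately have s: "\<bar>sin ((\<theta> + t) / 2)\<bar> \<le> sin t + d / 2" by simp
  have "\<bar>cos \<theta> - cos t\<bar> = 2 * \<bar>sin ((\<theta> + t) / 2)\<bar> * \<bar>sin ((t - \<theta>) / 2)\<bar>"
    by (simp add: cos_diff_cos abs_mult)
  also have "\<dots> \<le> 2 * (sin t + d / 2) * \<bar>(t - \<theta>) / 2\<bar>"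
    using s d st by (intro mult_mono abs_sin_x_le_abs_x) auto
  also have "\<bar>(t - \<theta>) / 2\<bar> = d / 2" by (simp add: d_def)
  also have "2 * (sin t + d / 2) * (d / 2) = d * sin t + d\<^sup>2 / 2" by (simp add: power2_eq_square algebra_simps)
  also have "\<dots> = (real n * d) * (sin t / real n) + (real n * d)\<^sup>2 / 2 * (1 / (real n)\<^sup>2)"
    using n by (simp add: power_mult_distrib)
  also have "\<dots> \<le> (1 + real n * d)\<^sup>2 * (sin t / real n) + (1 + real n * d)\<^sup>2 * (1 / (real n)\<^sup>2)"
  proof (intro add_mono mult_right_mono)
    have N: "0 \<le> real n * d" using d by simp
    have "N \<le> (1 + N)\<^sup>2 \<and> N\<^sup>2 / 2 \<le> (1 + N)\<^sup>2" if "N \<ge> 0" for N :: real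
      using that zero_le_power2[of N] unfolding power2_sum power_one by linarith
    from this[OF N] show "real n * d \<le> (1 + real n * d)\<^sup>2" "(real n * d)\<^sup>2 / 2 \<le> (1 + real n * d)\<^sup>2"
      by auto
  qed (use st n in auto)
  also have "\<dots> = (1 + real n * d)\<^sup>2 * rho n (cos t)" by (simp add: rho_cos[OF t] algebra_simps)
  finally show ?thesis by (simp add: d_def)
qed

lemma rho_cos_le:
  assumes \<theta>: "\<theta> \<in> {0..pi}" and t: "t \<in> {0..pi}" and n: "n \<ge> 1"
  shows "rho n (cos \<theta>) \<le> (1 + real n * \<bar>\<theta> - t\<bar>) * rho n (cos t)"
proof -
  define N where "N = real n * \<bar>\<theta> - t\<bar>"
  have N: "N \<ge> 0" by (simp add: N_def)
  have st: "sin t \<ge> 0" using t by (intro sin_ge_zero) auto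
  have "sin \<theta> \<le> sin t + \<bar>\<theta> - t\<bar>" using abs_sin_diff_le[of \<theta> t] by linarith
  then have "sin \<theta> / real n \<le> sin t / real n + N * (1 / (real n)\<^sup>2)"
    using n by (simp add: N_def power2_eq_square field_simps)
  then have "rho n (cos \<theta>) \<le> 1 * (sin t / real n) + (1 + N) * (1 / (real n)\<^sup>2)"
    unfolding rho_cos[OF \<theta>] by (simp add: add_divide_distrib)
  also have "\<dots> \<le> (1 + N) * (sin t / real n) + (1 + N) * (1 / (real n)\<^sup>2)"
    using N st by (intro add_mono mult_right_mono) auto
  also have "\<dots> = (1 + N) * rho n (cos t)" by (simp add: rho_cos[OF t] algebra_simps)
  finally show ?thesis by (simp add: N_def)
qed

text \<open>The window at \<open>cos \<theta>\<close> lies in the window at \<open>cos t\<close>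
  enlarged by \<open>2 * T^2\<close>, where \<open>T = 1 + n * |\<theta> - t|\<close>. Doubling
  gives \<open>T ^ (2 * s)\<close>, and the quotient of the two values of \<open>rho\<close> adds
  one power, hence the exponent \<open>2 * s + 1\<close>.\<close>

lemma avg_weight_slow:
  assumes w: "doubling_weight w"
  shows "\<exists>C\<ge>0. \<exists>s::nat. \<forall>n\<ge>1. \<forall>\<theta>\<in>{0..pi}. \<forall>t\<in>{0..pi}.
    avg_weight w n (cos \<theta>) \<le> C * (1 + real n * \<bar>\<theta> - t\<bar>) ^ s * avg_weight w n (cos t)"
proof -
  obtain C s where C: "C \<ge> 0" and sc: "\<forall>u\<in>{-1..1}. \<forall>d\<ge>0. \<forall>c\<ge>1. window_mass w u (c * d) \<le> C * c ^ s * window_mass w u d"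
    using window_mass_scale[OF w] by (elim exE conjE)
  have "avg_weight w n (cos \<theta>) \<le> C * 2 ^ s * (1 + real n * \<bar>\<theta> - t\<bar>) ^ (2 * s + 1) * avg_weight w n (cos t)"
    if n: "n \<ge> 1" and \<theta>: "\<theta> \<in> {0..pi}" and t: "t \<in> {0..pi}" for n \<theta> t
  proof -
    define T where "T = 1 + real n * \<bar>\<theta> - t\<bar>"
    have T: "T \<ge> 1" by (simp add: T_def)
    have T2: "T \<le> T\<^sup>2" "1 \<le> T\<^sup>2" using T by (auto simp: power2_eq_square intro: order.trans[OF T])
    let ?u = "cos t" and ?x = "cos \<theta>"
    have ru: "rho n ?u > 0" and rx: "rho n ?x > 0" using n by (auto intro!: rho_pos)
    have d: "\<bar>?x - ?u\<bar> \<le> T\<^sup>2 * rho n ?u" unfolding T_def by (rule abs_cos_diff_le_rho[OF \<theta> t n])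
    have r: "rho n ?x \<le> T * rho n ?u" unfolding T_def by (rule rho_cos_le[OF \<theta> t n])
    have r': "rho n ?u \<le> T * rho n ?x" unfolding T_def using rho_cos_le[OF t \<theta> n] by (simp add: abs_minus_commute)
    have r2: "rho n ?x \<le> T\<^sup>2 * rho n ?u" using r mult_right_mono[OF T2(1), of "rho n ?u"] ru by linarith
    have "window_mass w ?x (rho n ?x) \<le> window_mass w ?u (2 * T\<^sup>2 * rho n ?u)"
      by (rule window_mass_mono[OF w]) (use d r2 in auto)
    also have "\<dots> \<le> C * (2 * T\<^sup>2) ^ s * window_mass w ?u (rho n ?u)"
      by (rule sc[rule_format]) (use ru T2 in auto)
    finally have m: "window_mass w ?x (rho n ?x) \<le> C * (2 * T\<^sup>2) ^ s * window_mass w ?u (rho n ?u)" .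
    have "avg_weight w n ?x \<le> (C * (2 * T\<^sup>2) ^ s * window_mass w ?u (rho n ?u)) / rho n ?x"
      unfolding avg_weight_eq using m rx by (simp add: divide_right_mono)
    also have "\<dots> = (C * (2 * T\<^sup>2) ^ s * window_mass w ?u (rho n ?u)) * (1 / rho n ?x)" by simp
    also have "\<dots> \<le> (C * (2 * T\<^sup>2) ^ s * window_mass w ?u (rho n ?u)) * (T / rho n ?u)"
    proof (intro mult_left_mono mult_nonneg_nonneg)
      show "1 / rho n ?x \<le> T / rho n ?u" using r' rx ru by (simp add: divide_simps mult.commute)
    qed (use C T window_mass_nonneg[OF w] in auto)
    also have "\<dots> = C * 2 ^ s * T ^ (2 * s + 1) * avg_weight w n ?u"
      by (simp add: avg_weight_eq power_mult_distrib power_mult[symmetric] mult_ac)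
    finally show ?thesis by (simp add: T_def)
  qed
  then show ?thesis using C by (intro exI[of _ "C * 2 ^ s"] conjI exI[of _ "2 * s + 1"] ballI allI impI) auto
qed

lemma avg_weight_nonneg: "doubling_weight w \<Longrightarrow> n \<ge> 1 \<Longrightarrow> x \<in> {-1..1} \<Longrightarrow> 0 \<le> avg_weight w n x"
  unfolding avg_weight_eq by (intro divide_nonneg_pos window_mass_nonneg rho_pos)

lemma rho_antimono:
  assumes "1 \<le> m" "m \<le> n" "x \<in> {-1..1}"
  shows "rho n x \<le> rho m x"
proof -
  have "x\<^sup>2 \<le> 1" using assms by (simp add: abs_square_le_1 abs_le_iff)
  then show ?thesis unfolding rho_def using assms
    by (intro add_mono divide_left_mono power_mono) auto
qed

text \<open>The smaller window carries less mass, so only the normalising factor is lost.\<close>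

lemma avg_weight_le:
  assumes w: "doubling_weight w" and mn: "1 \<le> m" "m \<le> n" and x: "x \<in> {-1..1}"
  shows "avg_weight w n x \<le> rho m x / rho n x * avg_weight w m x"
proof -
  have r: "0 < rho n x" "0 < rho m x" using mn x by (auto intro!: rho_pos)
  have "window_mass w x (rho n x) \<le> window_mass w x (rho m x)"
    using rho_antimono[OF mn x] by (intro window_mass_mono[OF w]) auto
  then show ?thesis unfolding avg_weight_eq using r by (simp add: divide_right_mono)
qed

text \<open>As functions of \<open>n\<close>, the product \<open>n * rho n x\<close> decreases while
  \<open>n^2 * rho n x\<close> increases.\<close>

lemma rho_quotient_le:
  assumes mn: "1 \<le> m" "m \<le> n" and x: "x \<in> {-1..1}"
  shows "rho n x / rho m x \<le> real m / real n" "rho m x / rho n x \<le> (real n / real m)\<^sup>2"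
proof -
  have x2: "sqrt (1 - x\<^sup>2) \<ge> 0" using x by (simp add: abs_square_le_1 abs_le_iff)
  have r: "0 < rho n x" "0 < rho m x" using mn x by (auto intro!: rho_pos)
  have m: "0 < real m" "0 < real n" "real m \<le> real n" using mn by auto
  have "real n * rho n x = sqrt (1 - x\<^sup>2) + 1 / real n"
    using m by (simp add: rho_def power2_eq_square field_simps)
  also have "\<dots> \<le> sqrt (1 - x\<^sup>2) + 1 / real m" using m by (intro add_left_mono divide_left_mono) auto
  also have "\<dots> = real m * rho m x" using m by (simp add: rho_def power2_eq_square field_simps)
  finally show "rho n x / rho m x \<le> real m / real n" using r m by (simp add: field_simps)
  have "(real m)\<^sup>2 * rho m x = real m * sqrt (1 - x\<^sup>2) + 1"
    using m by (simp add: rho_def power2_eq_square field_simps)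
  also have "\<dots> \<le> real n * sqrt (1 - x\<^sup>2) + 1" using m x2 by (intro add_right_mono mult_right_mono) auto
  also have "\<dots> = (real n)\<^sup>2 * rho n x" using m by (simp add: rho_def power2_eq_square field_simps)
  finally show "rho m x / rho n x \<le> (real n / real m)\<^sup>2" using r m by (simp add: field_simps)
qed

section \<open>Kernels and local averages of polynomials\<close>

text \<open>The Dirichlet kernel at a complex argument: Cauchy's estimate requires control of
  polynomials in cosine off the real line.\<close>

definition dir_kernel :: "nat \<Rightarrow> complex \<Rightarrow> complex" where
  "dir_kernel l z = (\<Sum>q\<in>{-int l..int l}. exp (\<i> * of_int q * z))"

lemma dir_kernel_Suc: "dir_kernel (Suc l) z = dir_kernel l z + 2 * cos (of_nat (Suc l) * z)"
proof -
  have "{-int (Suc l)..int (Suc l)} = insert (int (Suc l)) (insert (- int (Suc l)) {-int l..int l})" by auto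
  then have "dir_kernel (Suc l) z = exp (\<i> * of_int (int (Suc l)) * z) + (exp (\<i> * of_int (- int (Suc l)) * z) + dir_kernel l z)"
    unfolding dir_kernel_def by simp
  moreover have "2 * cos (of_nat (Suc l) * z) = exp (\<i> * of_int (int (Suc l)) * z) + exp (\<i> * of_int (- int (Suc l)) * z)"
    by (simp add: cos_exp_eq mult.assoc del: of_nat_Suc)
  ultimately show ?thesis by simp
qed

lemma dir_kernel_eq_cos: "dir_kernel l z = 1 + 2 * (\<Sum>q=1..l. cos (of_nat q * z))"
proof (induction l)
  case 0 then show ?case by (simp add: dir_kernel_def)
next
  case (Suc l) then show ?case by (simp add: dir_kernel_Suc distrib_left)
qed

lemma sin_mult_dir_kernel: "sin (z / 2) * dir_kernel l z = sin (of_nat (2 * l + 1) * z / 2)"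
proof (induction l)
  case 0 then show ?case by (simp add: dir_kernel_def)
next
  case (Suc l)
  define u where "u = of_nat (Suc l) * z"
  have e: "of_nat (2 * Suc l + 1) * z / 2 = u + z / 2" "of_nat (2 * l + 1) * z / 2 = u - z / 2"
    by (auto simp: u_def field_simps)
  show ?case unfolding dir_kernel_Suc distrib_left Suc e u_def[symmetric]
    by (simp add: sin_add sin_diff)
qed

lemma norm_exp_i_le: "norm (exp (\<i> * of_int q * z)) \<le> exp (real_of_int \<bar>q\<bar> * \<bar>Im z\<bar>)"
proof -
  have "Re (\<i> * of_int q * z) = - (of_int q * Im z)" by simp
  also have "\<dots> \<le> \<bar>of_int q * Im z\<bar>" by (rule abs_ge_minus_self)
  finally show ?thesis by (simp add: norm_exp_eq_Re abs_mult)
qed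

lemma norm_dir_kernel_le: "norm (dir_kernel l z) \<le> real (2 * l + 1) * exp (real l * \<bar>Im z\<bar>)"
proof -
  have "norm (dir_kernel l z) \<le> (\<Sum>q\<in>{-int l..int l}. exp (real l * \<bar>Im z\<bar>))"
    unfolding dir_kernel_def
  proof (rule order.trans[OF norm_sum], rule sum_mono)
    fix q assume "q \<in> {-int l..int l}"
    then have "real_of_int \<bar>q\<bar> \<le> real l" by (simp add: abs_le_iff)
    then show "norm (exp (\<i> * of_int q * z)) \<le> exp (real l * \<bar>Im z\<bar>)"
      by (intro order.trans[OF norm_exp_i_le]) (simp add: mult_right_mono)
  qed
  then show ?thesis by (simp add: add.commute)
qed

lemma norm_sin_le: "norm (sin z) \<le> exp \<bar>Im z\<bar>"
proof -
  have "norm (sin z) = norm (exp (\<i> * z) - exp (- (\<i> * z))) / 2"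
    by (simp add: sin_exp_eq norm_divide norm_mult)
  also have "\<dots> \<le> (norm (exp (\<i> * z)) + norm (exp (- (\<i> * z)))) / 2"
    by (intro divide_right_mono norm_triangle_ineq4) auto
  also have "\<dots> \<le> (exp \<bar>Im z\<bar> + exp \<bar>Im z\<bar>) / 2"
    by (intro divide_right_mono add_mono) (auto simp: norm_exp_eq_Re)
  finally show ?thesis by simp
qed

lemma norm_sin_ge_Re: "\<bar>sin (Re z)\<bar> \<le> norm (sin z)"
proof -
  have "1 \<le> cosh (Im z)" by (rule cosh_real_ge_1)
  then have "\<bar>sin (Re z)\<bar> * 1 \<le> \<bar>sin (Re z)\<bar> * cosh (Im z)" by (intro mult_left_mono) auto
  also have "\<dots> = \<bar>Re (sin z)\<bar>" by (simp add: Re_sin cosh_def abs_mult)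
  also have "\<dots> \<le> norm (sin z)" by (rule abs_Re_le_cmod)
  finally show ?thesis by simp
qed

text \<open>From \<open>|sin z|^2 = sin^2 (Re z) + sinh^2 (Im z)\<close> together with
  \<open>y <= sinh y\<close> for \<open>y >= 0\<close>.\<close>

lemma norm_sin_ge_Im: "\<bar>Im z\<bar> \<le> norm (sin z)"
proof -
  define c s x where "c = cosh (Im z)" and "s = sinh (Im z)" and "x = Re z"
  have "Re (sin z) = sin x * c" "Im (sin z) = cos x * s"
    by (auto simp: Re_sin Im_sin cosh_def sinh_def c_def s_def x_def)
  moreover have "c\<^sup>2 = s\<^sup>2 + 1" by (simp add: c_def s_def cosh_square_eq)
  ultimately have "(norm (sin z))\<^sup>2 = (sin x)\<^sup>2 * (s\<^sup>2 + 1) + (cos x)\<^sup>2 * s\<^sup>2"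
    by (simp add: cmod_power2 power_mult_distrib)
  also have "\<dots> = (sin x)\<^sup>2 + ((sin x)\<^sup>2 + (cos x)\<^sup>2) * s\<^sup>2" unfolding distrib_left distrib_right by simp
  finally have "s\<^sup>2 \<le> (norm (sin z))\<^sup>2" by simp
  then have "\<bar>s\<bar> \<le> norm (sin z)" by (simp add: abs_le_square_iff[symmetric])
  moreover have "\<bar>Im z\<bar> \<le> \<bar>s\<bar>"
  proof -
    have g: "y \<le> sinh y" if "y \<ge> 0" for y :: real
    proof -
      have "sinh 0 - 0 \<le> sinh y - y"
        by (rule DERIV_nonneg_imp_nondecreasing[OF that])
          (auto intro!: exI derivative_eq_intros simp: cosh_real_ge_1)
      then show ?thesis by simp
    qed
    show ?thesis using g[of "Im z"] g[of "- Im z"] by (cases "Im z \<ge> 0") (auto simp: s_def)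
  qed
  ultimately show ?thesis by simp
qed

section \<open>Kernels that reproduce trigonometric polynomials\<close>

lemma integral_exp_i:
  "((\<lambda>t. exp (\<i> * of_int j * of_real t)) has_integral (if j = 0 then of_real (2 * pi) else 0)) {-pi..pi}"
proof (cases "j = 0")
  case True
  have "((\<lambda>t. 1 :: complex) has_integral ((pi - (-pi)) *\<^sub>R 1)) {-pi..pi}"
    using has_integral_const_real[of "1 :: complex" "-pi" pi] by simp
  then show ?thesis using True by (simp add: scaleR_conv_of_real mult.commute)
next
  case False
  let ?F = "\<lambda>t::real. exp (\<i> * of_int j * of_real t) / (\<i> * of_int j)"
  have "((\<lambda>t. exp (\<i> * of_int j * of_real t)) has_integral ?F pi - ?F (-pi)) {-pi..pi}"
  proof (rule fundamental_theorem_of_calculus)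
    fix x :: real
    have "((\<lambda>z. exp (\<i> * of_int j * z) / (\<i> * of_int j)) has_field_derivative exp (\<i> * of_int j * of_real x)) (at (of_real x))"
      using False by (auto intro!: derivative_eq_intros)
    then show "(?F has_vector_derivative exp (\<i> * of_int j * of_real x)) (at x within {-pi..pi})"
      by (rule has_vector_derivative_real_field[THEN has_vector_derivative_at_within])
  qed simp
  moreover have "exp (\<i> * of_int j * of_real pi) = exp (\<i> * of_int j * of_real (-pi))"
    by (subst exp_eq) (rule exI[of _ j], simp add: algebra_simps)
  ultimately show ?thesis using False by simp
qed

text \<open>The point \<open>z\<close> is complex although the integral runs over a real period: for
  sums of exponentials, \<open>V (z - t)\<close> splits into products of a function of
  \<open>z\<close> and one of \<open>t\<close>, so orthogonality on the real period recovers values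
  off the axis too.\<close>

definition reproduces :: "(complex \<Rightarrow> complex) \<Rightarrow> (complex \<Rightarrow> complex) \<Rightarrow> bool" where
  "reproduces V g \<longleftrightarrow> (\<forall>z. ((\<lambda>t. V (z - of_real t) * g (of_real t)) has_integral (of_real (2 * pi) * g z)) {-pi..pi})"

lemma reproduces_sum:
  assumes "\<And>i. i \<in> I \<Longrightarrow> reproduces V (g i)"
  shows "reproduces V (\<lambda>z. \<Sum>i\<in>I. c i * g i z)"
  unfolding reproduces_def
proof
  fix z
  show "((\<lambda>t. V (z - of_real t) * (\<Sum>i\<in>I. c i * g i (of_real t))) has_integral (of_real (2 * pi) * (\<Sum>i\<in>I. c i * g i z))) {-pi..pi}"
  proof (cases "finite I")
    case True
    have "((\<lambda>t. \<Sum>i\<in>I. c i * (V (z - of_real t) * g i (of_real t))) has_integral (\<Sum>i\<in>I. c i * (of_real (2 * pi) * g i z))) {-pi..pi}"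
      using assms True unfolding reproduces_def by (intro has_integral_sum has_integral_mult_right) auto
    then show ?thesis by (simp add: sum_distrib_left mult_ac)
  qed simp
qed

definition cexp :: "int \<Rightarrow> complex \<Rightarrow> complex" where
  "cexp j z = exp (\<i> * of_int j * z)"

lemma cexp_diff: "cexp q (z - u) * cexp j u = cexp q z * cexp (j - q) u"
  unfolding cexp_def exp_add[symmetric] by (simp add: algebra_simps)

lemma reproduces_dir_kernel:
  assumes "\<bar>j\<bar> \<le> int N"
  shows "reproduces (dir_kernel N) (cexp j)"
  unfolding reproduces_def
proof
  fix z
  have "((\<lambda>t. \<Sum>q\<in>{-int N..int N}. cexp q z * cexp (j - q) (of_real t)) has_integral
    (\<Sum>q\<in>{-int N..int N}. cexp q z * (if j - q = 0 then of_real (2 * pi) else 0))) {-pi..pi}"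
    unfolding cexp_def by (intro has_integral_sum has_integral_mult_right integral_exp_i) auto
  moreover have "(\<Sum>q\<in>{-int N..int N}. cexp q z * (if j - q = 0 then of_real (2 * pi) else 0)) = of_real (2 * pi) * cexp j z"
  proof -
    have "(\<Sum>q\<in>{-int N..int N}. cexp q z * (if j - q = 0 then of_real (2 * pi) else 0)) =
      (\<Sum>q\<in>{-int N..int N}. if q = j then cexp j z * of_real (2 * pi) else 0)"
      by (intro sum.cong) auto
    then show ?thesis using assms by (simp only: sum.delta' finite_atLeastAtMost_int) (auto simp: mult.commute)
  qed
  moreover have "dir_kernel N (z - of_real t) * cexp j (of_real t) = (\<Sum>q\<in>{-int N..int N}. cexp q z * cexp (j - q) (of_real t))" for t
    unfolding dir_kernel_def sum_distrib_right cexp_def[symmetric] cexp_diff ..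
  ultimately show "((\<lambda>t. dir_kernel N (z - of_real t) * cexp j (of_real t)) has_integral of_real (2 * pi) * cexp j z) {-pi..pi}"
    by simp
qed

text \<open>Multiplication by the normalised Dirichlet kernel averages over the frequencies
  \<open>j - q\<close> with \<open>|q| <= l\<close>. Each of them is still reproduced by
  \<open>V\<close> and contributes the same value, so the average is exact; the price is a loss of
  \<open>l\<close> frequencies.\<close>

lemma reproduces_mult_dir_kernel:
  assumes V: "\<And>j. \<bar>j\<bar> \<le> int (m + l) \<Longrightarrow> reproduces V (cexp j)" and j: "\<bar>j\<bar> \<le> int m"
  shows "reproduces (\<lambda>z. V z * (dir_kernel l z / of_nat (2 * l + 1))) (cexp j)"
  unfolding reproduces_def
proof
  fix z
  let ?c = "1 / of_nat (2 * l + 1) :: complex"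
  have "((\<lambda>t. \<Sum>q\<in>{-int l..int l}. ?c * cexp q z * (V (z - of_real t) * cexp (j - q) (of_real t))) has_integral
    (\<Sum>q\<in>{-int l..int l}. ?c * cexp q z * (of_real (2 * pi) * cexp (j - q) z))) {-pi..pi}"
  proof (intro has_integral_sum has_integral_mult_right)
    fix q assume "q \<in> {-int l..int l}"
    then have "\<bar>j - q\<bar> \<le> int (m + l)" using j by auto
    from V[OF this] show "((\<lambda>t. V (z - of_real t) * cexp (j - q) (of_real t)) has_integral of_real (2 * pi) * cexp (j - q) z) {-pi..pi}"
      unfolding reproduces_def by blast
  qed simp
  moreover have "(\<Sum>q\<in>{-int l..int l}. ?c * cexp q z * (of_real (2 * pi) * cexp (j - q) z)) = of_real (2 * pi) * cexp j z"
  proof -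
    have e: "cexp q z * cexp (j - q) z = cexp j z" for q
      unfolding cexp_def exp_add[symmetric] by (simp add: algebra_simps)
    have "?c * cexp q z * (of_real (2 * pi) * cexp (j - q) z) = ?c * (of_real (2 * pi) * (cexp q z * cexp (j - q) z))" for q
      by (simp only: mult_ac)
    then have "(\<Sum>q\<in>{-int l..int l}. ?c * cexp q z * (of_real (2 * pi) * cexp (j - q) z))
      = (\<Sum>q\<in>{-int l..int l}. ?c * (of_real (2 * pi) * cexp j z))"
      by (simp only: e)
    also have "\<dots> = of_nat (2 * l + 1) * (?c * (of_real (2 * pi) * cexp j z))"
    proof -
      have "card {-int l..int l} = 2 * l + 1" by simp
      then show ?thesis by (simp only: sum_constant)
    qed
    also have "\<dots> = of_real (2 * pi) * cexp j z"
    proof -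
      have "of_nat (2 * l + 1) \<noteq> (0 :: complex)" by (subst of_nat_eq_0_iff) simp
      moreover have "N * (1 / N * X) = X" if "N \<noteq> 0" for N X :: complex using that by simp
      ultimately show ?thesis by blast
    qed
    finally show ?thesis .
  qed
  moreover have "V (z - of_real t) * (dir_kernel l (z - of_real t) / of_nat (2 * l + 1)) * cexp j (of_real t)
    = (\<Sum>q\<in>{-int l..int l}. ?c * cexp q z * (V (z - of_real t) * cexp (j - q) (of_real t)))" for t
  proof -
    have "dir_kernel l (z - of_real t) * cexp j (of_real t) = (\<Sum>q\<in>{-int l..int l}. cexp q z * cexp (j - q) (of_real t))"
      unfolding dir_kernel_def sum_distrib_right cexp_def[symmetric] cexp_diff ..
    then have "V (z - of_real t) * (dir_kernel l (z - of_real t) / of_nat (2 * l + 1)) * cexp j (of_real t)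
      = (V (z - of_real t) * ?c) * (\<Sum>q\<in>{-int l..int l}. cexp q z * cexp (j - q) (of_real t))"
      by (simp add: mult_ac)
    then show ?thesis by (simp add: sum_distrib_left mult_ac)
  qed
  ultimately show "((\<lambda>t. V (z - of_real t) * (dir_kernel l (z - of_real t) / of_nat (2 * l + 1)) * cexp j (of_real t)) has_integral
     of_real (2 * pi) * cexp j z) {-pi..pi}" by simp
qed

text \<open>A kernel of de la Vallee Poussin type. Each normalised factor adds one order of decay
  and costs \<open>m\<close> frequencies, which the larger order \<open>m + M * m\<close> of the
  first factor provides.\<close>

definition vp_kernel :: "nat \<Rightarrow> nat \<Rightarrow> complex \<Rightarrow> complex" where
  "vp_kernel M m z = dir_kernel (m + M * m) z * (dir_kernel m z / of_nat (2 * m + 1)) ^ M"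

lemma reproduces_vp_kernel_cexp:
  assumes "\<bar>j\<bar> \<le> int m"
  shows "reproduces (vp_kernel M m) (cexp j)"
proof -
  have "reproduces (\<lambda>z. dir_kernel (a + M * m) z * (dir_kernel m z / of_nat (2 * m + 1)) ^ M) (cexp j)"
    if "\<bar>j\<bar> \<le> int a" for a j
    using that
  proof (induction M arbitrary: j a)
    case 0 then show ?case by (simp add: reproduces_dir_kernel)
  next
    case (Suc M)
    have "reproduces (\<lambda>z. (dir_kernel (a + m + M * m) z * (dir_kernel m z / of_nat (2 * m + 1)) ^ M) * (dir_kernel m z / of_nat (2 * m + 1))) (cexp j)"
      by (rule reproduces_mult_dir_kernel[where m = a]) (use Suc in auto)
    then show ?case by (simp add: mult_ac add_ac)
  qed
  from this[OF assms] show ?thesis unfolding vp_kernel_def[abs_def] .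
qed

lemma reproduces_vp_kernel_poly:
  assumes "degree p \<le> m"
  shows "reproduces (vp_kernel M m) (\<lambda>z. poly p (cos z))"
proof -
  \<comment> \<open>Powers of cosine are generated together with a free frequency \<open>j\<close>,
    because multiplication by cosine splits \<open>cexp j\<close> into halves of
    \<open>cexp (j + 1)\<close> and \<open>cexp (j - 1)\<close>.\<close>
  have mono: "reproduces (vp_kernel M m) (\<lambda>z. cexp j z * cos z ^ d)" if "\<bar>j\<bar> + int d \<le> int m" for j d
    using that
  proof (induction d arbitrary: j)
    case 0 then show ?case by (simp add: reproduces_vp_kernel_cexp)
  next
    case (Suc d)
    let ?h = "\<lambda>i z. if i = (0::nat) then cexp (j + 1) z * cos z ^ d else cexp (j - 1) z * cos z ^ d"
    have "reproduces (vp_kernel M m) (\<lambda>z. \<Sum>i\<in>{0,1}. (1/2) * ?h i z)"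
    proof (rule reproduces_sum)
      fix i :: nat assume "i \<in> {0, 1}"
      have "reproduces (vp_kernel M m) (\<lambda>z. cexp (j + 1) z * cos z ^ d)" "reproduces (vp_kernel M m) (\<lambda>z. cexp (j - 1) z * cos z ^ d)"
        using Suc.prems by (intro Suc.IH; simp)+
      then show "reproduces (vp_kernel M m) (?h i)" by (cases "i = 0") auto
    qed
    moreover have "cexp j z * cos z ^ Suc d = (\<Sum>i\<in>{0,1}. (1/2) * ?h i z)" for z
    proof -
      have "cexp j z * cos z = (cexp (j + 1) z + cexp (j - 1) z) / 2"
        unfolding cexp_def cos_exp_eq by (simp add: distrib_left exp_add[symmetric] algebra_simps)
      then have "cexp j z * cos z ^ Suc d = (cexp (j + 1) z + cexp (j - 1) z) / 2 * cos z ^ d"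
        by (simp only: power_Suc mult.assoc[symmetric])
      then show ?thesis by (simp add: distrib_right add_divide_distrib)
    qed
    ultimately show ?case by presburger
  qed
  have "reproduces (vp_kernel M m) (\<lambda>z. \<Sum>d\<le>degree p. coeff p d * (cexp 0 z * cos z ^ d))"
    by (intro reproduces_sum mono) (use assms in auto)
  then show ?thesis by (simp add: poly_altdef cexp_def)
qed

text \<open>The distance is taken to \<open>|t|\<close> because integrals of even functions over
  \<open>[-pi, pi]\<close> are folded to \<open>[0, pi]\<close> later. For negative \<open>t\<close>
  the half sum dominates the half difference.\<close>

lemma norm_sin_half_ge:
  assumes a: "Re z \<in> {0..pi}" and t: "t \<in> {-pi..pi}"
  shows "\<bar>Re z - \<bar>t\<bar>\<bar> / pi \<le> norm (sin ((z - of_real t) / 2))"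
proof -
  let ?a = "Re z"
  have J: "\<bar>?a - \<bar>t\<bar>\<bar> / pi \<le> \<bar>sin ((?a - \<bar>t\<bar>) / 2)\<bar>"
  proof -
    have "2 * (\<bar>?a - \<bar>t\<bar>\<bar> / 2) / pi \<le> sin (\<bar>?a - \<bar>t\<bar>\<bar> / 2)"
      using a t by (intro sin_jordan) auto
    also have "\<dots> \<le> \<bar>sin ((?a - \<bar>t\<bar>) / 2)\<bar>"
    proof -
      have "sin \<bar>y\<bar> \<le> \<bar>sin y\<bar>" for y :: real by (cases "y \<ge> 0") auto
      from this[of "(?a - \<bar>t\<bar>) / 2"] show ?thesis by simp
    qed
    finally show ?thesis by simp
  qed
  have "\<bar>sin ((?a - \<bar>t\<bar>) / 2)\<bar> \<le> \<bar>sin ((?a - t) / 2)\<bar>"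
  proof (cases "t \<ge> 0")
    case False
    then have "\<bar>sin ((?a - \<bar>t\<bar>) / 2)\<bar> \<le> sin ((?a + \<bar>t\<bar>) / 2)"
      using sin_half_sum_ge(1)[of ?a "\<bar>t\<bar>"] a t by auto
    then show ?thesis using False by simp
  qed simp
  also have "\<dots> = \<bar>sin (Re ((z - of_real t) / 2))\<bar>" by simp
  also have "\<dots> \<le> norm (sin ((z - of_real t) / 2))" by (rule norm_sin_ge_Re)
  finally show ?thesis using J by linarith
qed

text \<open>Counting terms bounds the kernel near the diagonal, the closed form bounds it away from
  the diagonal, and the sum of the two estimates gives the quotient. In a strip of height
  \<open>B / m\<close> the exponential growth is harmless.\<close>

lemma dir_kernel_decay:
  assumes B: "B \<ge> 0" and m: "m \<ge> 1" and a: "Re z \<in> {0..pi}" and t: "t \<in> {-pi..pi}"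
    and i: "real m * \<bar>Im z\<bar> \<le> B" and th: "real m * \<bar>Re z - \<theta>\<bar> \<le> B"
  shows "norm (dir_kernel m (z - of_real t) / of_nat (2 * m + 1)) \<le> 3 * exp (2 * B) * (1 + B) / (1 + real m * \<bar>\<theta> - \<bar>t\<bar>\<bar>)"
proof -
  define F where "F = norm (dir_kernel m (z - of_real t) / of_nat (2 * m + 1))"
  define d where "d = \<bar>Re z - \<bar>t\<bar>\<bar>"
  have d: "d \<ge> 0" by (simp add: d_def)
  have F0: "F \<ge> 0" by (simp add: F_def)
  have nm: "norm (of_nat (2 * m + 1) :: complex) = 2 * real m + 1"
    by (rule trans[OF norm_of_nat]) simp
  have F1: "F \<le> exp B"
  proof -
    have "norm (dir_kernel m (z - of_real t)) \<le> (2 * real m + 1) * exp (real m * \<bar>Im z\<bar>)"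
      using norm_dir_kernel_le[of m "z - of_real t"] by (simp add: add.commute)
    also have "\<dots> \<le> (2 * real m + 1) * exp B" using i by (intro mult_left_mono) auto
    finally show ?thesis unfolding F_def norm_divide nm by (simp add: divide_le_eq mult.commute)
  qed
  have F2: "real m * d * F \<le> 2 * exp (2 * B)"
  proof -
    have "d / pi * ((2 * real m + 1) * F) \<le> norm (sin ((z - of_real t) / 2)) * norm (dir_kernel m (z - of_real t))"
    proof -
      have "(2 * real m + 1) * F = norm (dir_kernel m (z - of_real t))"
        unfolding F_def norm_divide nm by simp
      then show ?thesis unfolding d_def using norm_sin_half_ge[OF a t] by (simp only: mult_right_mono norm_ge_zero)
    qed
    also have "\<dots> = norm (sin (of_nat (2 * m + 1) * (z - of_real t) / 2))"
      by (simp only: norm_mult[symmetric] sin_mult_dir_kernel)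
    also have "\<dots> \<le> exp \<bar>Im (of_nat (2 * m + 1) * (z - of_real t) / 2)\<bar>" by (rule norm_sin_le)
    also have "Im (of_nat (2 * m + 1) * (z - of_real t) / 2) = (real m + 1/2) * Im z"
    proof -
      have "of_nat (2 * m + 1) = complex_of_real (real (2 * m + 1))" by (simp only: of_real_of_nat_eq)
      then have "Im (of_nat (2 * m + 1) * (z - of_real t) / 2) = real (2 * m + 1) * Im z / 2"
        by (simp only: Im_divide_numeral) (simp add: algebra_simps)
      then show ?thesis by (simp add: algebra_simps)
    qed
    also have "exp \<bar>(real m + 1/2) * Im z\<bar> \<le> exp (2 * B)"
    proof -
      have "\<bar>(real m + 1/2) * Im z\<bar> \<le> (2 * real m) * \<bar>Im z\<bar>"
        unfolding abs_mult using m by (intro mult_right_mono) auto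
      then show ?thesis using i by simp
    qed
    finally have "d / pi * ((2 * real m + 1) * F) \<le> exp (2 * B)" .
    then have "d * ((2 * real m + 1) * F) \<le> pi * exp (2 * B)" by (simp add: field_simps)
    moreover have "d * (2 * real m * F) \<le> d * ((2 * real m + 1) * F)"
      using d F0 by (intro mult_left_mono mult_right_mono) auto
    moreover have "pi * exp (2 * B) \<le> 4 * exp (2 * B)" using pi_less_4 by (intro mult_right_mono) auto
    moreover have "d * (2 * real m * F) = 2 * (real m * d * F)" by simp
    ultimately show ?thesis by linarith
  qed
  \<comment> \<open>Passing from \<open>Re z\<close> to the nearby angle \<open>\<theta>\<close>
    costs the factor \<open>1 + B\<close>.\<close>
  have "(1 + real m * \<bar>\<theta> - \<bar>t\<bar>\<bar>) * F \<le> (1 + B) * (1 + real m * d) * F"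
  proof (rule mult_right_mono[OF _ F0])
    have "real m * \<bar>\<theta> - \<bar>t\<bar>\<bar> \<le> real m * (d + \<bar>Re z - \<theta>\<bar>)" by (intro mult_left_mono) (auto simp: d_def)
    also have "\<dots> \<le> real m * d + B" using th by (simp add: distrib_left)
    finally show "1 + real m * \<bar>\<theta> - \<bar>t\<bar>\<bar> \<le> (1 + B) * (1 + real m * d)"
      using mult_nonneg_nonneg[OF B mult_nonneg_nonneg[of "real m" d]] d by (simp add: algebra_simps)
  qed
  also have "(1 + B) * (1 + real m * d) * F = (1 + B) * (F + real m * d * F)" by (simp add: algebra_simps)
  also have "\<dots> \<le> (1 + B) * (3 * exp (2 * B))"
  proof (intro mult_left_mono)
    have "exp B \<le> exp (2 * B)" using B by simp
    then show "F + real m * d * F \<le> 3 * exp (2 * B)" using F1 F2 by linarith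
  qed (use B in auto)
  finally have "(1 + real m * \<bar>\<theta> - \<bar>t\<bar>\<bar>) * F \<le> 3 * exp (2 * B) * (1 + B)" by (simp add: mult_ac)
  moreover have "0 < 1 + real m * \<bar>\<theta> - \<bar>t\<bar>\<bar>" by (simp add: add_pos_nonneg)
  ultimately show ?thesis unfolding F_def by (simp add: pos_le_divide_eq mult.commute)
qed

text \<open>The first Dirichlet factor is bounded by the number of its terms, of order
  \<open>m\<close>; the \<open>M\<close> normalised factors supply the decay.\<close>

lemma vp_kernel_decay:
  assumes B: "B \<ge> 0"
  shows "\<exists>C\<ge>0. \<forall>m\<ge>1. \<forall>z t \<theta>. Re z \<in> {0..pi} \<longrightarrow> t \<in> {-pi..pi} \<longrightarrow> real m * \<bar>Im z\<bar> \<le> B \<longrightarrow> real m * \<bar>Re z - \<theta>\<bar> \<le> B \<longrightarrow>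
    norm (vp_kernel M m (z - of_real t)) \<le> C * (real m / (1 + real m * \<bar>\<theta> - \<bar>t\<bar>\<bar>) ^ M)"
proof (intro exI conjI allI impI)
  define C1 where "C1 = 3 * exp (2 * B) * (1 + B)"
  define C where "C = (2 * real M + 3) * exp ((1 + real M) * B) * C1 ^ M"
  have C1: "C1 \<ge> 0" using B by (simp add: C1_def)
  show "0 \<le> C" using C1 B by (simp add: C_def)
  fix m :: nat and z :: complex and t \<theta> :: real
  assume m: "m \<ge> 1" and a: "Re z \<in> {0..pi}" and t: "t \<in> {-pi..pi}" and i: "real m * \<bar>Im z\<bar> \<le> B" and th: "real m * \<bar>Re z - \<theta>\<bar> \<le> B"
  have "norm (dir_kernel (m + M * m) (z - of_real t)) \<le> real (2 * (m + M * m) + 1) * exp (real (m + M * m) * \<bar>Im z\<bar>)"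
    using norm_dir_kernel_le[of "m + M * m" "z - of_real t"] by simp
  also have "\<dots> \<le> (real m * (2 * real M + 3)) * exp ((1 + real M) * B)"
  proof (rule mult_mono)
    show "real (2 * (m + M * m) + 1) \<le> real m * (2 * real M + 3)" using m by (simp add: algebra_simps)
    have "real (m + M * m) * \<bar>Im z\<bar> = (1 + real M) * (real m * \<bar>Im z\<bar>)" by (simp add: algebra_simps)
    also have "\<dots> \<le> (1 + real M) * B" using i by (intro mult_left_mono) auto
    finally show "exp (real (m + M * m) * \<bar>Im z\<bar>) \<le> exp ((1 + real M) * B)" by simp
  qed auto
  finally have D: "norm (dir_kernel (m + M * m) (z - of_real t)) \<le> (real m * (2 * real M + 3)) * exp ((1 + real M) * B)" .
  have "norm (vp_kernel M m (z - of_real t)) = norm (dir_kernel (m + M * m) (z - of_real t)) * norm (dir_kernel m (z - of_real t) / of_nat (2 * m + 1)) ^ M"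
    unfolding vp_kernel_def by (simp only: norm_mult norm_power)
  also have "\<dots> \<le> ((real m * (2 * real M + 3)) * exp ((1 + real M) * B)) * (C1 / (1 + real m * \<bar>\<theta> - \<bar>t\<bar>\<bar>)) ^ M"
    using dir_kernel_decay[OF B m a t i th] unfolding C1_def[symmetric] by (intro mult_mono D power_mono) auto
  also have "\<dots> = C * (real m / (1 + real m * \<bar>\<theta> - \<bar>t\<bar>\<bar>) ^ M)" by (simp add: C_def power_divide)
  finally show "norm (vp_kernel M m (z - of_real t)) \<le> C * (real m / (1 + real m * \<bar>\<theta> - \<bar>t\<bar>\<bar>) ^ M)" .
qed

text \<open>Dominates polynomials of degree at most \<open>m\<close> and, after scaling, their derivatives.\<close>

definition loc_avg :: "nat \<Rightarrow> nat \<Rightarrow> (real \<Rightarrow> real) \<Rightarrow> real \<Rightarrow> ennreal" where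
  "loc_avg M m g \<theta> = (NN t\<in>{0..pi}. ennreal (\<bar>g (cos t)\<bar> * (real m / (1 + real m * \<bar>\<theta> - t\<bar>) ^ M)))"

lemma poly_map_of_real: "poly (map_poly of_real q) (of_real x :: complex) = of_real (poly q x)"
  by (induction q) (simp_all add: map_poly_pCons)

lemma nn_integral_even_fold:
  fixes h :: "real \<Rightarrow> ennreal"
  assumes [measurable]: "h \<in> borel_measurable borel" and "c \<ge> 0"
  shows "(NN t\<in>{-c..c}. h \<bar>t\<bar>) \<le> 2 * (NN t\<in>{0..c}. h t)"
proof -
  have "(NN t\<in>{-c..c}. h \<bar>t\<bar>) \<le> (NN t. h t * indicator {0..c} t + h (- t) * indicator {0..c} (- t))"
    by (intro nn_integral_mono) (auto simp: indicator_def)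
  also have "\<dots> = (NN t\<in>{0..c}. h t) + (NN t. h (- t) * indicator {0..c} (- t))"
    by (rule nn_integral_add) auto
  also have "(NN t. h (- t) * indicator {0..c} (- t)) = (NN t\<in>{0..c}. h t)"
    by (subst nn_integral_real_affine[where c = "-1" and t = 0, of "\<lambda>t. h t * indicator {0..c} t"]) auto
  finally show ?thesis by (simp add: mult_2)
qed

text \<open>The reproducing formula at a complex point, with absolute values inside the integral.
  The average on the right is centred at an angle \<open>\<theta>\<close> within
  \<open>B / m\<close> of \<open>Re z\<close>.\<close>

lemma poly_cos_le_loc_avg:
  assumes B: "B \<ge> 0"
  shows "\<exists>C\<ge>0. \<forall>m\<ge>1. \<forall>(q :: real poly) z \<theta>. degree q \<le> m \<longrightarrow> Re z \<in> {0..pi} \<longrightarrow> real m * \<bar>Im z\<bar> \<le> B \<longrightarrow> real m * \<bar>Re z - \<theta>\<bar> \<le> B \<longrightarrow>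
    ennreal (norm (poly (map_poly of_real q) (cos z))) \<le> ennreal C * loc_avg M m (poly q) \<theta>"
proof -
  obtain C where C: "C \<ge> 0" and V: "\<forall>m\<ge>1. \<forall>z t \<theta>. Re z \<in> {0..pi} \<longrightarrow> t \<in> {-pi..pi} \<longrightarrow> real m * \<bar>Im z\<bar> \<le> B \<longrightarrow> real m * \<bar>Re z - \<theta>\<bar> \<le> B \<longrightarrow>
    norm (vp_kernel M m (z - of_real t)) \<le> C * (real m / (1 + real m * \<bar>\<theta> - \<bar>t\<bar>\<bar>) ^ M)"
    using vp_kernel_decay[OF B, of M] by (elim exE conjE)
  show ?thesis
  proof (intro exI[of _ C] conjI allI impI C)
    fix m :: nat and q :: "real poly" and z :: complex and \<theta> :: real
    assume m: "m \<ge> 1" and dq: "degree q \<le> m" and a: "Re z \<in> {0..pi}" and i: "real m * \<bar>Im z\<bar> \<le> B" and th: "real m * \<bar>Re z - \<theta>\<bar> \<le> B"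
    define p where "p = map_poly complex_of_real q"
    have dp: "degree p \<le> m" using dq by (simp add: p_def degree_map_poly)
    define G where "G t = vp_kernel M m (z - of_real t) * poly p (cos (of_real t))" for t :: real
    have hi: "(G has_integral of_real (2 * pi) * poly p (cos z)) {-pi..pi}"
      using reproduces_vp_kernel_poly[OF dp, of M] unfolding reproduces_def G_def by blast
    have contG: "continuous_on {-pi..pi} G"
      unfolding G_def vp_kernel_def dir_kernel_def
      by (intro continuous_intros) (auto simp flip: of_nat_Suc)
    have "integrable lborel (\<lambda>t. indicator {-pi..pi} t *\<^sub>R G t)"
      by (rule borel_integrable_compact) (use contG in auto)
    then have sint: "set_integrable lborel {-pi..pi} G" by (simp add: set_integrable_def)
    have "integral {-pi..pi} G = of_real (2 * pi) * poly p (cos z)" using hi by (rule integral_unique)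
    then have L: "of_real (2 * pi) * poly p (cos z) = (LBINT t:{-pi..pi}. G t)"
      using set_borel_integral_eq_integral(2)[OF sint] by simp
    define h where "h t = ennreal (\<bar>poly q (cos t)\<bar> * (real m / (1 + real m * \<bar>\<theta> - t\<bar>) ^ M))" for t
    have [measurable]: "h \<in> borel_measurable borel" unfolding h_def by measurable
    \<comment> \<open>Division by \<open>2 * pi\<close> is weakened to division by 2, which cancels
      the factor 2 of the folding to \<open>[0, pi]\<close>.\<close>
    have "ennreal (norm (poly p (cos z))) \<le> ennreal (norm (of_real (2 * pi) * poly p (cos z)) / 2)"
    proof (rule ennreal_leI)
      have "1 * norm (poly p (cos z)) \<le> pi * norm (poly p (cos z))"
        using pi_gt3 by (intro mult_right_mono) auto
      then show "norm (poly p (cos z)) \<le> norm (of_real (2 * pi) * poly p (cos z)) / 2" by (simp add: norm_mult)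
    qed
    also have "\<dots> = ennreal (1/2) * ennreal (norm (of_real (2 * pi) * poly p (cos z)))"
      by (subst ennreal_mult[symmetric]) auto
    also have "ennreal (norm (of_real (2 * pi) * poly p (cos z))) \<le> (NN t. ennreal (norm (indicator {-pi..pi} t *\<^sub>R G t)))"
      unfolding L set_lebesgue_integral_def
      by (rule integral_norm_bound_ennreal) (use sint in \<open>simp add: set_integrable_def\<close>)
    also have "\<dots> \<le> (NN t\<in>{-pi..pi}. ennreal C * h \<bar>t\<bar>)"
    proof (rule nn_integral_mono)
      fix t :: real
      show "ennreal (norm (indicator {-pi..pi} t *\<^sub>R G t)) \<le> ennreal C * h \<bar>t\<bar> * indicator {-pi..pi} t"
      proof (cases "t \<in> {-pi..pi}")
        case True
        have "poly p (cos (of_real t)) = of_real (poly q (cos t))"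
          unfolding p_def by (simp only: cos_of_real poly_map_of_real)
        then have "norm (G t) = norm (vp_kernel M m (z - of_real t)) * \<bar>poly q (cos \<bar>t\<bar>)\<bar>"
          unfolding G_def norm_mult by (simp add: abs_if)
        also have "\<dots> \<le> C * (real m / (1 + real m * \<bar>\<theta> - \<bar>t\<bar>\<bar>) ^ M) * \<bar>poly q (cos \<bar>t\<bar>)\<bar>"
          by (intro mult_right_mono V[rule_format]) (use m a True i th in auto)
        finally have "ennreal (norm (G t)) \<le> ennreal (C * (\<bar>poly q (cos \<bar>t\<bar>)\<bar> * (real m / (1 + real m * \<bar>\<theta> - \<bar>t\<bar>\<bar>) ^ M)))"
          by (intro ennreal_leI) (simp add: mult_ac)
        also have "\<dots> = ennreal C * h \<bar>t\<bar>" unfolding h_def using C by (rule ennreal_mult')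
        finally show ?thesis using True by simp
      qed simp
    qed
    also have "\<dots> = ennreal C * (NN t\<in>{-pi..pi}. h \<bar>t\<bar>)" by (rule set_nn_integral_cmult) auto
    also have "\<dots> \<le> ennreal C * (2 * (NN t\<in>{0..pi}. h t))"
      by (intro mult_left_mono nn_integral_even_fold) auto
    also have "ennreal (1/2) * \<dots> = ennreal C * loc_avg M m (poly q) \<theta>"
    proof -
      have "ennreal (1/2) * (ennreal C * (2 * X)) = ennreal C * X" for X
      proof -
        have "ennreal (1/2) * (ennreal C * (2 * X)) = (ennreal (1/2) * 2) * (ennreal C * X)" by (simp only: mult_ac)
        also have "ennreal (1/2) * 2 = ennreal (1/2 * 2)" by (subst ennreal_mult) auto
        finally show ?thesis by simp
      qed
      then show ?thesis unfolding loc_avg_def h_def .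
    qed
    finally show "ennreal (norm (poly (map_poly of_real q) (cos z))) \<le> ennreal C * loc_avg M m (poly q) \<theta>"
      unfolding p_def by (simp add: mult_left_mono)
  qed
qed

section \<open>Discs of radius \<open>rho\<close> and Cauchy's estimate\<close>

lemma norm_sin_sq: "(norm (sin z))\<^sup>2 = (sin (Re z))\<^sup>2 + (sinh (Im z))\<^sup>2"
proof -
  define c s x where "c = cosh (Im z)" and "s = sinh (Im z)" and "x = Re z"
  have "Re (sin z) = sin x * c" "Im (sin z) = cos x * s"
    by (auto simp: Re_sin Im_sin cosh_def sinh_def c_def s_def x_def)
  moreover have "c\<^sup>2 = s\<^sup>2 + 1" by (simp add: c_def s_def cosh_square_eq)
  ultimately have "(norm (sin z))\<^sup>2 = (sin x)\<^sup>2 * (s\<^sup>2 + 1) + (cos x)\<^sup>2 * s\<^sup>2"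
    by (simp add: cmod_power2 power_mult_distrib)
  also have "\<dots> = (sin x)\<^sup>2 + ((sin x)\<^sup>2 + (cos x)\<^sup>2) * s\<^sup>2" unfolding distrib_left distrib_right by simp
  finally show ?thesis by (simp add: s_def x_def)
qed

text \<open>The difference of cosines is twice the product of two sines of modulus \<open>y'\<close>
  and \<open>y\<close>, where \<open>y'\<close> dominates both \<open>y\<close> and
  \<open>sin \<theta> / 2\<close>. With \<open>Y = m * y\<close> and
  \<open>S = m * sin \<theta>\<close> this gives \<open>2 * Y^2 <= c * (S + 1)\<close> and
  \<open>S * Y <= c * (S + 1)\<close>; the second bounds \<open>Y\<close> when
  \<open>S >= 1\<close>, the first when \<open>S < 1\<close>.\<close>

lemma angle_close:
  assumes a: "Re z \<in> {0..pi}" and \<theta>: "\<theta> \<in> {0..pi}" and m: "m \<ge> 1" and c: "c \<ge> 0"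
    and close: "norm (cos z - of_real (cos \<theta>)) \<le> c * rho m (cos \<theta>)"
  shows "real m * \<bar>Re z - \<theta>\<bar> \<le> pi * (2 * c + 1)" "real m * \<bar>Im z\<bar> \<le> 2 * (2 * c + 1)"
proof -
  define y where "y = norm (sin ((z - of_real \<theta>) / 2))"
  define y' where "y' = norm (sin ((z + of_real \<theta>) / 2))"
  have y0: "y \<ge> 0" "y' \<ge> 0" by (auto simp: y_def y'_def)
  have s0: "sin \<theta> \<ge> 0" using \<theta> by (intro sin_ge_zero) auto
  have "norm (cos z - of_real (cos \<theta>)) = norm (cos z - cos (of_real \<theta>))" by (simp add: cos_of_real)
  also have "\<dots> = 2 * y' * norm (sin ((of_real \<theta> - z) / 2))"
    by (simp add: cos_diff_cos norm_mult y'_def)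
  also have "(of_real \<theta> - z) / 2 = - ((z - of_real \<theta>) / 2)" by (simp add: diff_divide_distrib)
  also have "norm (sin (- ((z - of_real \<theta>) / 2))) = y" by (simp only: sin_minus norm_minus_cancel y_def)
  finally have eq: "2 * y' * y \<le> c * rho m (cos \<theta>)" using close by simp
  have "\<bar>sin ((Re z - \<theta>) / 2)\<bar> \<le> sin ((Re z + \<theta>) / 2)" by (rule sin_half_sum_ge(1)[OF a \<theta>])
  then have "(sin ((Re z - \<theta>) / 2))\<^sup>2 \<le> (sin ((Re z + \<theta>) / 2))\<^sup>2"
    by (intro abs_le_square_iff[THEN iffD1]) linarith
  then have "y\<^sup>2 \<le> y'\<^sup>2" unfolding y_def y'_def norm_sin_sq by simp
  then have yy: "y \<le> y'" by (rule power2_le_imp_le) (rule y0)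
  have "sin \<theta> / 2 \<le> sin ((\<theta> + Re z) / 2)" by (rule sin_half_sum_ge(2)[OF \<theta> a])
  also have "\<dots> \<le> \<bar>sin (Re ((z + of_real \<theta>) / 2))\<bar>" by (simp add: add.commute)
  also have "\<dots> \<le> y'" unfolding y'_def by (rule norm_sin_ge_Re)
  finally have ys: "sin \<theta> \<le> 2 * y'" by simp
  define Y S where "Y = real m * y" and "S = real m * sin \<theta>"
  have Y0: "Y \<ge> 0" "S \<ge> 0" using y0 s0 by (auto simp: Y_def S_def)
  have mr: "(real m)\<^sup>2 * rho m (cos \<theta>) = S + 1"
    using m by (simp add: rho_cos[OF \<theta>] S_def power2_eq_square field_simps)
  have m2: "(real m)\<^sup>2 \<ge> 0" by simp
  have "2 * y * y \<le> c * rho m (cos \<theta>)" using eq mult_right_mono[OF yy y0(1)] by linarith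
  from mult_left_mono[OF this m2] have e1: "2 * Y * Y \<le> c * (S + 1)"
    unfolding mr[symmetric] by (simp add: Y_def power2_eq_square mult_ac)
  have "sin \<theta> * y \<le> c * rho m (cos \<theta>)" using eq mult_right_mono[OF ys y0(1)] by linarith
  from mult_left_mono[OF this m2] have e2: "S * Y \<le> c * (S + 1)"
    unfolding mr[symmetric] by (simp add: Y_def S_def power2_eq_square mult_ac)
  have Y: "Y \<le> 2 * c + 1"
  proof (cases "S \<ge> 1")
    case True
    have "S * Y \<le> S * (2 * c)"
    proof -
      have "c * (S + 1) \<le> c * (2 * S)" using True c by (intro mult_left_mono) auto
      then show ?thesis using e2 by (simp add: mult_ac)
    qed
    then show ?thesis using True by simp
  next
    case False
    have "c * (S + 1) \<le> c * 2" using False c by (intro mult_left_mono) auto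
    then have "Y\<^sup>2 \<le> c" using e1 by (simp add: power2_eq_square)
    also have "c \<le> (2 * c + 1)\<^sup>2" using c by (simp add: power2_eq_square algebra_simps)
    finally show ?thesis by (rule power2_le_imp_le) (use c in auto)
  qed
  have "\<bar>Re z - \<bar>\<theta>\<bar>\<bar> / pi \<le> y" unfolding y_def by (rule norm_sin_half_ge[OF a]) (use \<theta> in auto)
  then have "\<bar>Re z - \<theta>\<bar> \<le> pi * y" using \<theta> by (simp add: field_simps)
  then have "real m * \<bar>Re z - \<theta>\<bar> \<le> pi * Y"
    using mult_left_mono[of "\<bar>Re z - \<theta>\<bar>" "pi * y" "real m"] by (simp add: Y_def mult_ac)
  also have "\<dots> \<le> pi * (2 * c + 1)" using Y by (intro mult_left_mono) auto
  finally show "real m * \<bar>Re z - \<theta>\<bar> \<le> pi * (2 * c + 1)" .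
  have "\<bar>Im ((z - of_real \<theta>) / 2)\<bar> \<le> y" unfolding y_def by (rule norm_sin_ge_Im)
  then have "\<bar>Im z\<bar> \<le> 2 * y" by simp
  then have "real m * \<bar>Im z\<bar> \<le> 2 * Y"
    using mult_left_mono[of "\<bar>Im z\<bar>" "2 * y" "real m"] by (simp add: Y_def mult_ac)
  also have "\<dots> \<le> 2 * (2 * c + 1)" using Y by (intro mult_left_mono) auto
  finally show "real m * \<bar>Im z\<bar> \<le> 2 * (2 * c + 1)" .
qed

text \<open>Cosine is even, so the sign of the principal inverse can be chosen to make the real part
  nonnegative.\<close>

lemma ex_cos_eq: "\<exists>z. cos z = (w :: complex) \<and> Re z \<in> {0..pi}"
proof (cases "Re (Arccos w) \<ge> 0")
  case True
  then show ?thesis using Re_Arccos_bounds[of w] by (intro exI[of _ "Arccos w"]) auto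
next
  case False
  then show ?thesis using Re_Arccos_bounds[of w] by (intro exI[of _ "- Arccos w"]) auto
qed

lemma deriv_pow_poly: "(deriv ^^ k) (poly p) = poly ((pderiv ^^ k) (p :: complex poly))"
proof (induction k)
  case (Suc k)
  have "deriv (poly r) = poly (pderiv r)" for r :: "complex poly"
    by (rule ext, rule DERIV_imp_deriv, rule poly_DERIV)
  then show ?case by (simp add: Suc)
qed simp

lemma pderiv_pow_map_of_real: "(pderiv ^^ k) (map_poly complex_of_real q) = map_poly of_real ((pderiv ^^ k) q)"
proof (induction k)
  case (Suc k)
  have "pderiv (map_poly complex_of_real r) = map_poly of_real (pderiv r)" for r
    by (rule poly_eqI) (simp add: coeff_pderiv coeff_map_poly)
  then show ?case by (simp add: Suc)
qed simp

theorem poly_deriv_le_loc_avg: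
  "\<exists>C\<ge>0. \<forall>m\<ge>1. \<forall>(q :: real poly). \<forall>\<theta>\<in>{0..pi}. degree q \<le> m \<longrightarrow>
    ennreal (\<bar>poly ((pderiv ^^ k) q) (cos \<theta>)\<bar> * rho m (cos \<theta>) ^ k) \<le> ennreal C * loc_avg M m (poly q) \<theta>"
proof -
  \<comment> \<open>On the circle of radius \<open>rho\<close> the angular displacement is at most
    \<open>3 * pi\<close> and the imaginary part at most 6, both after scaling by \<open>m\<close>;
    12 covers them.\<close>
  have "0 \<le> (12::real)" by simp
  from poly_cos_le_loc_avg[OF this, of M] obtain C where C: "C \<ge> 0"
    and bd: "\<forall>m\<ge>1. \<forall>(q :: real poly) z \<theta>. degree q \<le> m \<longrightarrow> Re z \<in> {0..pi} \<longrightarrow> real m * \<bar>Im z\<bar> \<le> 12 \<longrightarrow> real m * \<bar>Re z - \<theta>\<bar> \<le> 12 \<longrightarrow>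
    ennreal (norm (poly (map_poly of_real q) (cos z))) \<le> ennreal C * loc_avg M m (poly q) \<theta>"
    by (elim exE conjE)
  show ?thesis
  \<comment> \<open>\<open>C + 1\<close> instead of \<open>C\<close> keeps the factor positive, so
    that the bound is infinite whenever the average is.\<close>
  proof (intro exI[of _ "fact k * (C + 1)"] conjI allI impI ballI)
    show "0 \<le> fact k * (C + 1)" using C by simp
    fix m :: nat and q :: "real poly" and \<theta> :: real
    assume m: "m \<ge> 1" and \<theta>: "\<theta> \<in> {0..pi}" and dq: "degree q \<le> m"
    define p where "p = map_poly complex_of_real q"
    define r where "r = rho m (cos \<theta>)"
    have r: "r > 0" unfolding r_def using m by (intro rho_pos) auto
    show "ennreal (\<bar>poly ((pderiv ^^ k) q) (cos \<theta>)\<bar> * rho m (cos \<theta>) ^ k) \<le> ennreal (fact k * (C + 1)) * loc_avg M m (poly q) \<theta>"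
    proof (cases "loc_avg M m (poly q) \<theta> = \<infinity>")
      case True
      have "fact k * (C + 1) > 0" using C by simp
      then show ?thesis unfolding True using C by (simp add: ennreal_mult_top)
    next
      case False
      define G where "G = enn2real (loc_avg M m (poly q) \<theta>)"
      have G: "loc_avg M m (poly q) \<theta> = ennreal G" "G \<ge> 0" using False by (simp_all add: G_def ennreal_enn2real less_top)
      have circ: "norm (poly p w) \<le> (C + 1) * G" if w: "norm (of_real (cos \<theta>) - w) = r" for w
      proof -
        obtain z where z: "cos z = w" "Re z \<in> {0..pi}" using ex_cos_eq[of w] by blast
        have "norm (cos z - of_real (cos \<theta>)) \<le> 1 * rho m (cos \<theta>)"
          using w z by (simp add: norm_minus_commute r_def)
        from angle_close[OF z(2) \<theta> m _ this] have "real m * \<bar>Re z - \<theta>\<bar> \<le> pi * 3" "real m * \<bar>Im z\<bar> \<le> 6" by auto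
        moreover have "pi * 3 \<le> 12" using pi_less_4 by simp
        ultimately have "ennreal (norm (poly p (cos z))) \<le> ennreal C * ennreal G"
          unfolding p_def G(1)[symmetric] by (intro bd[rule_format]) (use m dq z in auto)
        also have "\<dots> = ennreal (C * G)" using C G by (simp add: ennreal_mult')
        finally have "norm (poly p w) \<le> C * G" using C G z by (simp add: ennreal_le_iff)
        then show ?thesis using G by (simp add: algebra_simps)
      qed
      have "norm ((deriv ^^ k) (poly p) (of_real (cos \<theta>))) \<le> fact k * ((C + 1) * G) / r ^ k"
      proof (rule Cauchy_inequality[OF _ _ r circ])
        show "poly p holomorphic_on ball (complex_of_real (cos \<theta>)) r"
          unfolding holomorphic_on_def field_differentiable_def
          by (intro ballI exI, rule has_field_derivative_at_within, rule poly_DERIV)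
        show "continuous_on (cball (complex_of_real (cos \<theta>)) r) (poly p)"
          by (intro continuous_on_poly continuous_on_id)
      qed
      then have "\<bar>poly ((pderiv ^^ k) q) (cos \<theta>)\<bar> \<le> fact k * ((C + 1) * G) / r ^ k"
        unfolding deriv_pow_poly p_def pderiv_pow_map_of_real poly_map_of_real norm_of_real .
      then have "\<bar>poly ((pderiv ^^ k) q) (cos \<theta>)\<bar> * r ^ k \<le> fact k * (C + 1) * G"
        using r by (simp add: pos_le_divide_eq mult.assoc)
      then have "ennreal (\<bar>poly ((pderiv ^^ k) q) (cos \<theta>)\<bar> * r ^ k) \<le> ennreal (fact k * (C + 1) * G)"
        by (rule ennreal_leI)
      also have "\<dots> = ennreal (fact k * (C + 1)) * ennreal G" using C G by (intro ennreal_mult) auto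
      finally show ?thesis unfolding r_def G(1) .
    qed
  qed
qed

section \<open>Weighted norms\<close>

lemma rho_measurable[measurable]: "rho n \<in> borel_measurable borel"
  unfolding rho_def[abs_def] by measurable

lemma phi_measurable[measurable]: "phi \<in> borel_measurable borel"
  unfolding phi_def[abs_def] by measurable

text \<open>A window mass is a difference of values of the distribution function, which is monotone
  and hence Borel.\<close>

lemma avg_weight_measurable:
  assumes w: "doubling_weight w"
  shows "avg_weight w n \<in> borel_measurable borel"
proof -
  note int = doubling_weightD(3)[OF w]
  define \<Phi> where "\<Phi> y = (LINT u:{..y}|lebesgue. w u)" for y
  have si': "integrable lebesgue (\<lambda>x. indicat_real A x *\<^sub>R w x)" if "A \<in> sets lebesgue" for A
    by (rule integrable_mult_indicator[OF that int])
  then have si: "set_integrable lebesgue A w" if "A \<in> sets lebesgue" for A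
    unfolding set_integrable_def using that .
  have mono: "mono \<Phi>"
  proof (rule monoI)
    fix x y :: real assume "x \<le> y"
    show "\<Phi> x \<le> \<Phi> y"
      unfolding \<Phi>_def set_lebesgue_integral_def
    proof (rule integral_mono)
      show "integrable lebesgue (\<lambda>u. indicat_real {..x} u *\<^sub>R w u)" "integrable lebesgue (\<lambda>u. indicat_real {..y} u *\<^sub>R w u)"
        by (rule si', simp)+
      show "indicat_real {..x} u *\<^sub>R w u \<le> indicat_real {..y} u *\<^sub>R w u" for u
        using \<open>x \<le> y\<close> doubling_weightD(1)[OF w, of u] by (auto simp: indicator_def)
    qed
  qed
  have [measurable]: "\<Phi> \<in> borel_measurable borel" by (rule borel_measurable_mono[OF mono])
  \<comment> \<open>Outside \<open>[-1,1]\<close> the formula for \<open>rho\<close> can become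
    negative; the window is then empty, and the maximum with 0 gives its mass.\<close>
  have win: "window_mass w x d = max 0 (\<Phi> (x + d) - \<Phi> (x - d))" for x d
  proof (cases "d \<ge> 0")
    case False
    then have "{x - d..x + d} = {}" by auto
    moreover have "\<Phi> (x + d) \<le> \<Phi> (x - d)" using False by (intro monoD[OF mono]) auto
    ultimately show ?thesis by (simp add: window_mass_def set_lebesgue_integral_def)
  next
    case True
    have "{..x + d} = {..x - d} \<union> {x - d<..x + d}" using True by auto
    then have "\<Phi> (x + d) = \<Phi> (x - d) + (LINT u:{x - d<..x + d}|lebesgue. w u)"
      unfolding \<Phi>_def by (simp only:, intro set_integral_Un) (auto intro!: si)
    also have "(LINT u:{x - d<..x + d}|lebesgue. w u) = window_mass w x d"
      unfolding window_mass_def set_lebesgue_integral_def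
    proof (rule integral_cong_AE)
      have "AE u in lebesgue. u \<noteq> x - d" by (rule AE_completion) (rule AE_lborel_singleton)
      then show "AE u in lebesgue. indicat_real {x - d<..x + d} u *\<^sub>R w u = indicat_real {x - d..x + d} u *\<^sub>R w u"
        by eventually_elim (auto simp: indicator_def)
    qed (rule borel_measurable_integrable, rule si', simp)+
    finally show ?thesis using window_mass_nonneg[OF w, of x d] by simp
  qed
  show ?thesis unfolding avg_weight_eq[abs_def] win by measurable
qed

text \<open>The relation \<open>norm <= c\<close> for Borel functions, for both exponents at once:
  any exponent other than 1 is read as infinity. Completed measure and essential supremum are
  eliminated in favour of \<open>lborel\<close>.\<close>

definition norm_le :: "ennreal \<Rightarrow> (real \<Rightarrow> real) \<Rightarrow> (real \<Rightarrow> real) \<Rightarrow> ennreal \<Rightarrow> bool" where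
  "norm_le p v g c \<longleftrightarrow> (if p = 1 then (NN x\<in>{-1..1}. ennreal (\<bar>g x\<bar> * v x)) \<le> c
     else AE x in lborel. x \<in> {-1..1} \<longrightarrow> ennreal (\<bar>g x\<bar> * v x) \<le> c)"

lemma AE_lebesgue_on_iff: "(AE x in lebesgue_on {-1..1 :: real}. P x) \<longleftrightarrow> (AE x in lborel. x \<in> {-1..1} \<longrightarrow> P x)"
  by (simp add: AE_restrict_space_iff AE_completion_iff)

lemma wnorm_le_iff:
  assumes p: "p = 1 \<or> p = \<infinity>" and [measurable]: "g \<in> borel_measurable borel" "v \<in> borel_measurable borel"
  shows "wnorm p v g \<le> c \<longleftrightarrow> norm_le p v g c"
proof (cases "p = 1")
  case True
  then show ?thesis
    by (simp add: wnorm_def norm_le_def nn_integral_restrict_space nn_integral_completion)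
next
  case False
  then have p: "p = \<infinity>" using assms(1) by simp
  have [measurable]: "(\<lambda>x. ennreal (\<bar>g x\<bar> * v x)) \<in> borel_measurable (lebesgue_on {-1..1})"
    by (intro measurable_restrict_space1 measurable_completion) measurable
  have "esssup (lebesgue_on {-1..1}) (\<lambda>x. ennreal (\<bar>g x\<bar> * v x)) \<le> c \<longleftrightarrow> (AE x in lebesgue_on {-1..1}. ennreal (\<bar>g x\<bar> * v x) \<le> c)"
  proof
    assume "esssup (lebesgue_on {-1..1}) (\<lambda>x. ennreal (\<bar>g x\<bar> * v x)) \<le> c"
    then show "AE x in lebesgue_on {-1..1}. ennreal (\<bar>g x\<bar> * v x) \<le> c"
      by (intro eventually_mono[OF esssup_AE[where f = "\<lambda>x. ennreal (\<bar>g x\<bar> * v x)" and M = "lebesgue_on {-1..1}"]])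
        (erule order.trans)
  next
    assume "AE x in lebesgue_on {-1..1}. ennreal (\<bar>g x\<bar> * v x) \<le> c"
    then show "esssup (lebesgue_on {-1..1}) (\<lambda>x. ennreal (\<bar>g x\<bar> * v x)) \<le> c" by (intro esssup_I) auto
  qed
  then show ?thesis using p by (simp add: wnorm_def norm_le_def AE_lebesgue_on_iff)
qed

lemma norm_le_mono: "norm_le p v g c \<Longrightarrow> c \<le> c' \<Longrightarrow> norm_le p v g c'"
  unfolding norm_le_def by (auto split: if_splits elim: eventually_mono)

lemma norm_le_scale:
  assumes [measurable]: "g \<in> borel_measurable borel" "h \<in> borel_measurable borel" "v \<in> borel_measurable borel" "v' \<in> borel_measurable borel"
    and K: "K \<ge> 0" and le: "\<And>x. x \<in> {-1..1} \<Longrightarrow> \<bar>g x\<bar> * v x \<le> K * (\<bar>h x\<bar> * v' x)" and h: "norm_le p v' h c"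
  shows "norm_le p v g (ennreal K * c)"
proof -
  have pt: "ennreal (\<bar>g x\<bar> * v x) \<le> ennreal K * ennreal (\<bar>h x\<bar> * v' x)" if "x \<in> {-1..1}" for x
    using ennreal_leI[OF le[OF that]] by (simp only: ennreal_mult'[OF K])
  show ?thesis
  proof (cases "p = 1")
    case True
    have "(NN x\<in>{-1..1}. ennreal (\<bar>g x\<bar> * v x)) \<le> (NN x\<in>{-1..1}. ennreal K * ennreal (\<bar>h x\<bar> * v' x))"
      by (rule set_nn_integral_mono_on) (rule pt)
    also have "\<dots> = ennreal K * (NN x\<in>{-1..1}. ennreal (\<bar>h x\<bar> * v' x))"
      by (rule set_nn_integral_cmult) auto
    also have "\<dots> \<le> ennreal K * c" using h True by (intro mult_left_mono) (auto simp: norm_le_def)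
    finally show ?thesis using True by (simp add: norm_le_def)
  next
    case False
    then have "AE x in lborel. x \<in> {-1..1} \<longrightarrow> ennreal (\<bar>h x\<bar> * v' x) \<le> c" using h by (simp add: norm_le_def)
    then have "AE x in lborel. x \<in> {-1..1} \<longrightarrow> ennreal (\<bar>g x\<bar> * v x) \<le> ennreal K * c"
    proof eventually_elim
      case (elim x)
      then show ?case using order.trans[OF pt mult_left_mono] by simp
    qed
    then show ?thesis using False by (simp add: norm_le_def)
  qed
qed

lemma norm_le_add:
  assumes [measurable]: "g \<in> borel_measurable borel" "h \<in> borel_measurable borel" "v \<in> borel_measurable borel"
    and v: "\<And>x. x \<in> {-1..1} \<Longrightarrow> 0 \<le> v x" and g: "norm_le p v g a" and h: "norm_le p v h b"
  shows "norm_le p v (\<lambda>x. g x + h x) (a + b)"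
proof -
  have pt: "ennreal (\<bar>g x + h x\<bar> * v x) \<le> ennreal (\<bar>g x\<bar> * v x) + ennreal (\<bar>h x\<bar> * v x)" if "x \<in> {-1..1}" for x
  proof -
    have "ennreal (\<bar>g x + h x\<bar> * v x) \<le> ennreal (\<bar>g x\<bar> * v x + \<bar>h x\<bar> * v x)"
      unfolding distrib_right[symmetric] using v[OF that] by (intro ennreal_leI mult_right_mono) auto
    also have "\<dots> = ennreal (\<bar>g x\<bar> * v x) + ennreal (\<bar>h x\<bar> * v x)" using v[OF that] by (intro ennreal_plus) auto
    finally show ?thesis .
  qed
  show ?thesis
  proof (cases "p = 1")
    case True
    have "(NN x\<in>{-1..1}. ennreal (\<bar>g x + h x\<bar> * v x)) \<le> (NN x\<in>{-1..1}. (ennreal (\<bar>g x\<bar> * v x) + ennreal (\<bar>h x\<bar> * v x)))"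
      by (rule set_nn_integral_mono_on) (rule pt)
    also have "\<dots> = (NN x\<in>{-1..1}. ennreal (\<bar>g x\<bar> * v x)) + (NN x\<in>{-1..1}. ennreal (\<bar>h x\<bar> * v x))"
      by (rule set_nn_integral_add) auto
    also have "\<dots> \<le> a + b" using g h True by (intro add_mono) (auto simp: norm_le_def)
    finally show ?thesis using True by (simp add: norm_le_def)
  next
    case False
    then have "AE x in lborel. x \<in> {-1..1} \<longrightarrow> ennreal (\<bar>g x\<bar> * v x) \<le> a" "AE x in lborel. x \<in> {-1..1} \<longrightarrow> ennreal (\<bar>h x\<bar> * v x) \<le> b"
      using g h by (auto simp: norm_le_def)
    then have "AE x in lborel. x \<in> {-1..1} \<longrightarrow> ennreal (\<bar>g x + h x\<bar> * v x) \<le> a + b"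
    proof eventually_elim
      case (elim x)
      then show ?case using order.trans[OF pt add_mono] by simp
    qed
    then show ?thesis using False by (simp add: norm_le_def)
  qed
qed

lemma norm_le_sum:
  assumes "finite I" and [measurable]: "\<And>i. i \<in> I \<Longrightarrow> g i \<in> borel_measurable borel" "v \<in> borel_measurable borel"
    and v: "\<And>x. x \<in> {-1..1} \<Longrightarrow> 0 \<le> v x" and g: "\<And>i. i \<in> I \<Longrightarrow> norm_le p v (g i) (a i)"
  shows "norm_le p v (\<lambda>x. \<Sum>i\<in>I. g i x) (\<Sum>i\<in>I. a i)"
  using assms(1,2,5)
proof (induction I)
  case empty
  then show ?case by (simp add: norm_le_def)
next
  case (insert i I)
  have "norm_le p v (\<lambda>x. g i x + (\<Sum>i\<in>I. g i x)) (a i + (\<Sum>i\<in>I. a i))"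
    by (rule norm_le_add) (use insert assms(3) v in \<open>auto intro!: borel_measurable_sum\<close>)
  then show ?case using insert by simp
qed

section \<open>Nearby points and shifts by multiples of \<open>phi\<close>\<close>

lemma angle_close_real:
  assumes "t \<in> {0..pi}" "\<theta> \<in> {0..pi}" "m \<ge> 1" "c \<ge> 0" "\<bar>cos t - cos \<theta>\<bar> \<le> c * rho m (cos \<theta>)"
  shows "real m * \<bar>t - \<theta>\<bar> \<le> pi * (2 * c + 1)"
proof -
  have "norm (cos (of_real t) - of_real (cos \<theta>) :: complex) = \<bar>cos t - cos \<theta>\<bar>"
    unfolding cos_of_real of_real_diff[symmetric] norm_of_real ..
  then show ?thesis using angle_close(1)[of "of_real t" \<theta> m c] assms by simp
qed

text \<open>Closeness on the scale \<open>rho n x\<close> is closeness of angles on the scale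
  \<open>1 / n\<close>, where the averaged weight changes by a bounded factor.\<close>

lemma avg_weight_close:
  assumes w: "doubling_weight w" and c: "c \<ge> 0"
  shows "\<exists>C\<ge>0. \<forall>n\<ge>1. \<forall>x\<in>{-1..1}. \<forall>y\<in>{-1..1}. \<bar>y - x\<bar> \<le> c * rho n x \<longrightarrow>
    avg_weight w n x \<le> C * avg_weight w n y \<and> avg_weight w n y \<le> C * avg_weight w n x"
proof -
  obtain C s where C: "C \<ge> 0" and sl: "\<forall>n\<ge>1. \<forall>\<theta>\<in>{0..pi}. \<forall>t\<in>{0..pi}.
    avg_weight w n (cos \<theta>) \<le> C * (1 + real n * \<bar>\<theta> - t\<bar>) ^ s * avg_weight w n (cos t)"
    using avg_weight_slow[OF w] by (elim exE conjE)
  define K where "K = C * (1 + pi * (2 * c + 1)) ^ s"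
  have main: "avg_weight w n (cos \<theta>) \<le> K * avg_weight w n (cos t)"
    if "n \<ge> 1" "\<theta> \<in> {0..pi}" "t \<in> {0..pi}" "real n * \<bar>\<theta> - t\<bar> \<le> pi * (2 * c + 1)" for n \<theta> t
  proof -
    have "avg_weight w n (cos \<theta>) \<le> C * (1 + real n * \<bar>\<theta> - t\<bar>) ^ s * avg_weight w n (cos t)"
      using sl that by blast
    also have "\<dots> \<le> K * avg_weight w n (cos t)"
      unfolding K_def using C that avg_weight_nonneg[OF w that(1), of "cos t"]
      by (intro mult_right_mono mult_left_mono power_mono add_left_mono) (auto simp: add_nonneg_nonneg)
    finally show ?thesis .
  qed
  have K0: "K \<ge> 0" using C c by (simp add: K_def)
  show ?thesis
  proof (intro exI[of _ K] conjI allI ballI impI K0)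
    fix n :: nat and x y :: real
    assume n: "n \<ge> 1" and xy: "x \<in> {-1..1}" "y \<in> {-1..1}" and cl: "\<bar>y - x\<bar> \<le> c * rho n x"
    define \<theta> t where "\<theta> = arccos x" and "t = arccos y"
    have \<theta>: "\<theta> \<in> {0..pi}" "cos \<theta> = x" and t: "t \<in> {0..pi}" "cos t = y"
      using xy by (auto simp: \<theta>_def t_def arccos_lbound arccos_ubound)
    have d: "real n * \<bar>t - \<theta>\<bar> \<le> pi * (2 * c + 1)"
      by (rule angle_close_real) (use \<theta> t n c cl in auto)
    show "avg_weight w n x \<le> K * avg_weight w n y" "avg_weight w n y \<le> K * avg_weight w n x"
      using main[OF n \<theta>(1) t(1)] main[OF n t(1) \<theta>(1)] d \<theta> t by (auto simp: abs_minus_commute)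
  qed
qed

text \<open>The points at which the central difference of step \<open>2 c \<phi>(x) / k\<close> is not truncated to zero.\<close>

definition inner_zone :: "real \<Rightarrow> real set" where
  "inner_zone c = {x \<in> {-1..1}. x - c * phi x \<in> {-1..1} \<and> x + c * phi x \<in> {-1..1}}"

lemma phi_sq: "x \<in> {-1..1} \<Longrightarrow> (phi x)\<^sup>2 = (1 - \<bar>x\<bar>) * (1 + \<bar>x\<bar>)"
proof -
  assume "x \<in> {-1..1}"
  then have "(phi x)\<^sup>2 = 1 - x\<^sup>2" unfolding phi_def by (simp add: abs_square_le_1 abs_le_iff)
  also have "\<dots> = (1 - \<bar>x\<bar>) * (1 + \<bar>x\<bar>)" by (simp add: algebra_simps power2_eq_square)
  finally show ?thesis .
qed

lemma phi_nonneg: "x \<in> {-1..1} \<Longrightarrow> 0 \<le> phi x"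
  by (simp add: phi_def abs_square_le_1 abs_le_iff)

lemma phi_pos: "\<bar>x\<bar> < 1 \<Longrightarrow> 0 < phi x"
  by (simp add: phi_def abs_square_less_1)

text \<open>Multiply \<open>c * phi x <= 1 - |x|\<close> by \<open>1 + |x|\<close>, recognise the
  square of \<open>phi x\<close> on the right, and cancel one factor \<open>phi x\<close>.\<close>

lemma inner_zone_phi_ge:
  assumes "x \<in> inner_zone c" "\<bar>x\<bar> < 1" "c > 0"
  shows "c * (1 + \<bar>x\<bar>) \<le> phi x"
proof -
  have x: "x \<in> {-1..1}" "c * phi x \<le> 1 - \<bar>x\<bar>" using assms by (auto simp: inner_zone_def)
  have p: "phi x > 0" using assms by (intro phi_pos)
  have "phi x * (c * (1 + \<bar>x\<bar>)) = (c * phi x) * (1 + \<bar>x\<bar>)" by simp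
  also have "\<dots> \<le> (1 - \<bar>x\<bar>) * (1 + \<bar>x\<bar>)" using x by (intro mult_right_mono) auto
  also have "\<dots> = phi x * phi x" using phi_sq[OF x(1)] by (simp add: power2_eq_square)
  finally show ?thesis using p by simp
qed

lemma inner_zone_measurable[measurable]: "inner_zone c \<in> sets borel"
proof -
  have "inner_zone c = {x \<in> space borel. x \<in> {-1..1} \<and> x - c * phi x \<in> {-1..1} \<and> x + c * phi x \<in> {-1..1}}"
    by (auto simp: inner_zone_def)
  also have "\<dots> \<in> sets borel" by measurable
  finally show ?thesis .
qed

text \<open>The substitution \<open>y = x + \<tau> \<phi>(x)\<close> has Jacobian at least \<open>1/2\<close> on the inner zone.\<close>

lemma shift_integral_le:
  fixes u :: "real \<Rightarrow> ennreal"
  assumes [measurable]: "u \<in> borel_measurable borel" and c: "c > 0" and \<tau>: "\<bar>\<tau>\<bar> \<le> c"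
  shows "(NN x\<in>inner_zone c. u (x + \<tau> * phi x)) \<le> 2 * (NN y\<in>{-1..1}. u y)"
proof -
  \<comment> \<open>Apart from the points 1 and -1, where \<open>phi\<close> vanishes, the inner
    zone is \<open>[-x0, x0]\<close>; for \<open>x0 <= 0\<close> it is a null set.\<close>
  define x0 where "x0 = (1 - c\<^sup>2) / (1 + c\<^sup>2)"
  have c2: "1 + c\<^sup>2 > 0" by (simp add: add_pos_nonneg)
  have x01: "x0 < 1" using c c2 by (simp add: x0_def)
  have key: "c\<^sup>2 * (1 + a) \<le> 1 - a \<longleftrightarrow> a \<le> x0" for a
    using c2 by (simp add: x0_def pos_le_divide_eq algebra_simps)
  have zone: "\<bar>x\<bar> \<le> x0" if x: "x \<in> inner_zone c" "\<bar>x\<bar> < 1" for x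
  proof -
    have xi: "x \<in> {-1..1}" using x by (auto simp: inner_zone_def)
    have "(c * (1 + \<bar>x\<bar>))\<^sup>2 \<le> (phi x)\<^sup>2"
      using inner_zone_phi_ge[OF x c] c by (intro power_mono) auto
    then have "(c\<^sup>2 * (1 + \<bar>x\<bar>)) * (1 + \<bar>x\<bar>) \<le> (1 - \<bar>x\<bar>) * (1 + \<bar>x\<bar>)"
      unfolding phi_sq[OF xi] by (simp add: power2_eq_square mult_ac)
    moreover have "1 + \<bar>x\<bar> > 0" by (simp add: add_pos_nonneg)
    ultimately have "c\<^sup>2 * (1 + \<bar>x\<bar>) \<le> 1 - \<bar>x\<bar>" by (simp only: mult_le_cancel_right_pos)
    then show ?thesis using key by blast
  qed
  have conv: "c * (1 + \<bar>x\<bar>) \<le> phi x" "c * phi x \<le> 1 - \<bar>x\<bar>" "0 < phi x" "x \<in> {-1..1}" if x: "\<bar>x\<bar> \<le> x0" for x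
  proof -
    have x1: "\<bar>x\<bar> < 1" using x x01 by simp
    then show xi: "x \<in> {-1..1}" by auto
    show p: "0 < phi x" by (rule phi_pos[OF x1])
    have "c\<^sup>2 * (1 + \<bar>x\<bar>) \<le> 1 - \<bar>x\<bar>" using x key by blast
    then have "(c\<^sup>2 * (1 + \<bar>x\<bar>)) * (1 + \<bar>x\<bar>) \<le> (1 - \<bar>x\<bar>) * (1 + \<bar>x\<bar>)" by (intro mult_right_mono) auto
    then have "(c * (1 + \<bar>x\<bar>))\<^sup>2 \<le> (phi x)\<^sup>2" unfolding phi_sq[OF xi] by (simp add: power2_eq_square mult_ac)
    then show q: "c * (1 + \<bar>x\<bar>) \<le> phi x" by (rule power2_le_imp_le) (use p in auto)
    have "(c * phi x) * (1 + \<bar>x\<bar>) = (c * (1 + \<bar>x\<bar>)) * phi x" by simp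
    also have "\<dots> \<le> phi x * phi x" using q p by (intro mult_right_mono) auto
    also have "\<dots> = (1 - \<bar>x\<bar>) * (1 + \<bar>x\<bar>)" using phi_sq[OF xi] by (simp add: power2_eq_square)
    finally have "(c * phi x) * (1 + \<bar>x\<bar>) \<le> (1 - \<bar>x\<bar>) * (1 + \<bar>x\<bar>)" .
    moreover have "1 + \<bar>x\<bar> > 0" by (simp add: add_pos_nonneg)
    ultimately show "c * phi x \<le> 1 - \<bar>x\<bar>" by (simp only: mult_le_cancel_right_pos)
  qed
  have AEx: "AE x in lborel. x \<in> inner_zone c \<longrightarrow> \<bar>x\<bar> \<le> x0 \<and> x \<noteq> 0 \<and> \<bar>x\<bar> < 1"
  proof -
    have "AE x in lborel. x \<noteq> (1::real)" "AE x in lborel. x \<noteq> (-1::real)" "AE x in lborel. x \<noteq> (0::real)"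
      by (rule AE_lborel_singleton)+
    then show ?thesis
    proof eventually_elim
      case (elim x)
      show ?case
      proof
        assume x: "x \<in> inner_zone c"
        then have "\<bar>x\<bar> < 1" using elim by (auto simp: inner_zone_def)
        then show "\<bar>x\<bar> \<le> x0 \<and> x \<noteq> 0 \<and> \<bar>x\<bar> < 1" using zone[OF x] elim by auto
      qed
    qed
  qed
  show ?thesis
  proof (cases "x0 > 0")
    case False
    have "(NN x\<in>inner_zone c. u (x + \<tau> * phi x)) = (NN (x::real). 0)"
      by (rule nn_integral_cong_AE) (use AEx False in \<open>auto elim!: eventually_mono simp: indicator_def\<close>)
    then show ?thesis by simp
  next
    case True
    define \<psi> where "\<psi> x = x + \<tau> * phi x" for x
    define \<psi>' where "\<psi>' x = 1 - \<tau> * x / phi x" for x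
    have der: "(\<psi> has_real_derivative \<psi>' x) (at x)" if "x \<in> {-x0..x0}" for x
    proof -
      have "x\<^sup>2 < 1" using that x01 by (simp add: abs_square_less_1 abs_less_iff)
      then show ?thesis unfolding \<psi>_def \<psi>'_def phi_def
        by (auto intro!: derivative_eq_intros simp: field_simps)
    qed
    \<comment> \<open>Here
      \<open>|\<tau> * x| <= c * |x| <= c * (1 + |x|) / 2 <= phi x / 2\<close>.\<close>
    have pos: "\<psi>' x \<ge> 1/2" if "x \<in> {-x0..x0}" for x
    proof -
      have ax: "\<bar>x\<bar> \<le> x0" using that by auto
      have "\<bar>\<tau> * x\<bar> \<le> c * \<bar>x\<bar>" unfolding abs_mult using \<tau> by (intro mult_right_mono) auto
      also have "\<dots> \<le> phi x / 2"
      proof -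
        have "c * \<bar>x\<bar> \<le> c" using ax x01 c by simp
        then have "2 * (c * \<bar>x\<bar>) \<le> c * (1 + \<bar>x\<bar>)" by (simp add: algebra_simps)
        then show ?thesis using conv(1)[OF ax] by simp
      qed
      finally have "\<tau> * x \<le> phi x / 2" by simp
      then have "\<tau> * x / phi x \<le> 1/2" using conv(3)[OF ax] by (simp add: pos_divide_le_eq)
      then show ?thesis by (simp add: \<psi>'_def)
    qed
    have cont: "continuous_on {-x0..x0} \<psi>'"
    proof -
      have "\<forall>x\<in>{-x0..x0}. sqrt (1 - x\<^sup>2) \<noteq> 0"
      proof
        fix x assume "x \<in> {-x0..x0}"
        then have "\<bar>x\<bar> \<le> x0" by auto
        from conv(3)[OF this] show "sqrt (1 - x\<^sup>2) \<noteq> 0" by (simp add: phi_def)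
      qed
      then show ?thesis unfolding \<psi>'_def phi_def by (intro continuous_intros) auto
    qed
    have sub: "(NN y\<in>{\<psi> (-x0)..\<psi> x0}. u y) = (NN x. u (\<psi> x) * ennreal (\<psi>' x) * indicator {-x0..x0} x)"
      by (rule nn_integral_substitution_aux[OF _ _ der cont]) (use pos True in \<open>auto intro: order.trans[of 0 "1/2"]\<close>)
    have "(NN x\<in>inner_zone c. u (x + \<tau> * phi x)) \<le> (NN x. 2 * (u (\<psi> x) * ennreal (\<psi>' x) * indicator {-x0..x0} x))"
    proof (rule nn_integral_mono_AE)
      show "AE x in lborel. u (x + \<tau> * phi x) * indicator (inner_zone c) x \<le> 2 * (u (\<psi> x) * ennreal (\<psi>' x) * indicator {-x0..x0} x)"
        using AEx
      proof eventually_elim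
        case (elim x)
        show ?case
        proof (cases "x \<in> inner_zone c")
          case True
          then have x: "x \<in> {-x0..x0}" using elim by (auto simp: abs_le_iff)
          have "1 \<le> 2 * ennreal (\<psi>' x)"
          proof -
            have "1 \<le> ennreal (2 * \<psi>' x)" using pos[OF x] by simp
            also have "\<dots> = 2 * ennreal (\<psi>' x)" by (subst ennreal_mult') auto
            finally show ?thesis .
          qed
          from mult_right_mono[OF this, of "u (\<psi> x)"] show ?thesis using True x by (simp add: \<psi>_def mult_ac)
        qed simp
      qed
    qed
    also have "\<dots> = 2 * (NN y\<in>{\<psi> (-x0)..\<psi> x0}. u y)"
    proof -
      have [measurable]: "\<psi> \<in> borel_measurable borel" "\<psi>' \<in> borel_measurable borel" unfolding \<psi>_def[abs_def] \<psi>'_def[abs_def] by measurable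
      show ?thesis unfolding sub by (rule nn_integral_cmult) measurable
    qed
    also have "\<dots> \<le> 2 * (NN y\<in>{-1..1}. u y)"
    proof (intro mult_left_mono nn_set_integral_set_mono)
      have ab: "\<bar>\<tau> * phi x\<bar> \<le> 1 - \<bar>x\<bar>" if "\<bar>x\<bar> \<le> x0" for x
      proof -
        have "\<bar>\<tau> * phi x\<bar> \<le> c * phi x" unfolding abs_mult using \<tau> conv(3)[OF that] by (simp add: mult_right_mono)
        then show ?thesis using conv(2)[OF that] by simp
      qed
      show "{\<psi> (-x0)..\<psi> x0} \<subseteq> {-1..1}" using ab[of x0] ab[of "-x0"] True by (auto simp: \<psi>_def)
    qed auto
    finally show ?thesis .
  qed
qed

section \<open>Decaying kernels and the substitution \<open>x = cos t\<close>\<close>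

lemma nn_integral_decay_le:
  assumes r: "r > 0"
  shows "(NN x. ennreal (1 / (1 + \<bar>x - c\<bar> / r)\<^sup>2)) \<le> ennreal (2 * r)"
proof -
  define h where "h y = ennreal (1 / (1 + y)\<^sup>2)" for y :: real
  have [measurable]: "h \<in> borel_measurable borel" unfolding h_def by measurable
  have half: "(NN y. h y * indicator {0..} y) = 1"
  proof -
    have "(NN y. ennreal (1 / (1 + y)\<^sup>2) * indicator {0..} y) = ennreal (0 - (- 1 / (1 + 0)))"
    proof (rule nn_integral_FTC_atLeast)
      show "((\<lambda>y. - 1 / (1 + y)) has_real_derivative 1 / (1 + x)\<^sup>2) (at x)" if "0 \<le> x" for x :: real
        using that by (auto intro!: derivative_eq_intros simp: power2_eq_square)
      show "((\<lambda>y::real. - 1 / (1 + y)) \<longlongrightarrow> 0) at_top" by real_asymp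
    qed auto
    then show ?thesis by (simp add: h_def)
  qed
  have "(NN x. ennreal (1 / (1 + \<bar>x - c\<bar> / r)\<^sup>2)) = ennreal r * (NN y. h \<bar>y\<bar>)"
    using r by (subst nn_integral_real_affine[where c = r and t = c]) (auto simp: h_def abs_mult)
  also have "(NN y. h \<bar>y\<bar>) \<le> (NN y. h y * indicator {0..} y + h (- y) * indicator {0..} (- y))"
    by (intro nn_integral_mono) (auto simp: indicator_def)
  also have "\<dots> = (NN y. h y * indicator {0..} y) + (NN y. h (- y) * indicator {0..} (- y))"
    by (rule nn_integral_add) auto
  also have "(NN y. h (- y) * indicator {0..} (- y)) = (NN y. h y * indicator {0..} y)"
    by (subst nn_integral_real_affine[where c = "-1" and t = 0, of "\<lambda>y. h y * indicator {0..} y"]) auto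
  also have "ennreal r * ((NN y. h y * indicator {0..} y) + (NN y. h y * indicator {0..} y)) = ennreal (2 * r)"
    using r unfolding half by (simp add: ennreal_mult mult.commute)
  finally show ?thesis by (simp add: mult_left_mono)
qed

lemma nn_integral_angle_decay_le:
  assumes "m \<ge> 1"
  shows "(NN t\<in>{0..pi}. ennreal (real m / (1 + real m * \<bar>\<theta> - t\<bar>)\<^sup>2)) \<le> 2"
proof -
  have "(NN t\<in>{0..pi}. ennreal (real m / (1 + real m * \<bar>\<theta> - t\<bar>)\<^sup>2))
    \<le> (NN t. ennreal (real m) * ennreal (1 / (1 + \<bar>t - \<theta>\<bar> / (1 / real m))\<^sup>2))"
    by (intro nn_integral_mono) (auto simp: indicator_def ennreal_mult'[symmetric] abs_minus_commute mult.commute)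
  also have "\<dots> = ennreal (real m) * (NN t. ennreal (1 / (1 + \<bar>t - \<theta>\<bar> / (1 / real m))\<^sup>2))"
    by (rule nn_integral_cmult) measurable
  also have "\<dots> \<le> ennreal (real m) * ennreal (2 * (1 / real m))"
    using assms by (intro mult_left_mono nn_integral_decay_le) auto
  also have "\<dots> = ennreal (real m * (2 * (1 / real m)))" by (rule ennreal_mult'[symmetric]) simp
  also have "\<dots> = 2" using assms by simp
  finally show ?thesis .
qed

text \<open>The substitution is carried out for the increasing map \<open>- cos\<close>, hence the
  two reflections of \<open>u\<close>.\<close>

lemma nn_integral_cos_subst:
  assumes [measurable]: "u \<in> borel_measurable borel"
  shows "(NN t\<in>{0..pi}. u (cos t) * ennreal (sin t)) = (NN x\<in>{-1..1}. u x)"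
proof -
  have "(NN y. u (- y) * indicator {- cos 0..- cos pi} y) = (NN t. u (- (- cos t)) * ennreal (sin t) * indicator {0..pi} t)"
    by (rule nn_integral_substitution_aux[of "\<lambda>y. u (- y)" 0 pi "\<lambda>t. - cos t" sin])
      (auto intro!: derivative_eq_intros continuous_intros sin_ge_zero)
  moreover have "(NN x\<in>{-1..1}. u x) = (NN y. u (- y) * indicator {-1..1} y)"
    by (subst nn_integral_real_affine[where c = "-1" and t = 0]) (auto intro!: nn_integral_cong simp: indicator_def)
  ultimately show ?thesis by simp
qed

text \<open>Null sets in \<open>x\<close> pull back to null sets in \<open>t\<close> because the
  Jacobian \<open>sin t\<close> is positive inside the interval.\<close>

lemma AE_cos:
  assumes [measurable]: "Measurable.pred borel P" and ae: "AE x in lborel. x \<in> {-1..1} \<longrightarrow> P x"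
  shows "AE t in lborel. t \<in> {0..pi} \<longrightarrow> P (cos t)"
proof -
  define u :: "real \<Rightarrow> ennreal" where "u x = indicator {x. \<not> P x} x" for x
  have [measurable]: "u \<in> borel_measurable borel" unfolding u_def by measurable
  have "(NN x\<in>{-1..1}. u x) = (NN (x::real). 0)"
    by (rule nn_integral_cong_AE, use ae in eventually_elim) (auto simp: u_def indicator_def)
  then have "(NN t\<in>{0..pi}. u (cos t) * ennreal (sin t)) = 0" by (simp add: nn_integral_cos_subst)
  then have "AE t in lborel. u (cos t) * ennreal (sin t) * indicator {0..pi} t = 0"
    by (subst (asm) nn_integral_0_iff_AE) auto
  moreover have "AE t in lborel. t \<noteq> (0::real)" "AE t in lborel. t \<noteq> pi" by (rule AE_lborel_singleton)+
  ultimately show ?thesis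
  proof eventually_elim
    case (elim t)
    show ?case
    proof
      assume t: "t \<in> {0..pi}"
      then have "sin t > 0" using elim by (intro sin_gt_zero) auto
      then show "P (cos t)" using elim t by (auto simp: u_def indicator_def split: if_splits)
    qed
  qed
qed

lemma loc_avg_close:
  assumes B: "real m * \<bar>\<theta>' - \<theta>\<bar> \<le> B" and [measurable]: "g \<in> borel_measurable borel"
  shows "loc_avg M m g \<theta>' \<le> ennreal ((1 + B) ^ M) * loc_avg M m g \<theta>"
proof -
  have B0: "B \<ge> 0" using B by (rule order.trans[rotated]) simp
  have "loc_avg M m g \<theta>' \<le> (NN t. ennreal ((1 + B) ^ M) * (ennreal (\<bar>g (cos t)\<bar> * (real m / (1 + real m * \<bar>\<theta> - t\<bar>) ^ M)) * indicator {0..pi} t))"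
    unfolding loc_avg_def
  proof (rule nn_integral_mono)
    fix t
    define a b where "a = 1 + real m * \<bar>\<theta> - t\<bar>" and "b = 1 + real m * \<bar>\<theta>' - t\<bar>"
    have ab: "a > 0" "b > 0" by (auto simp: a_def b_def add_pos_nonneg)
    have "real m * \<bar>\<theta> - t\<bar> \<le> real m * (\<bar>\<theta>' - \<theta>\<bar> + \<bar>\<theta>' - t\<bar>)" by (intro mult_left_mono) auto
    then have "a \<le> B + b" using B by (simp add: a_def b_def distrib_left)
    also have "\<dots> \<le> (1 + B) * b" using B0 by (simp add: b_def algebra_simps)
    finally have "a ^ M \<le> ((1 + B) * b) ^ M" using ab by (intro power_mono) auto
    then have "1 / b ^ M \<le> (1 + B) ^ M * (1 / a ^ M)"
      unfolding power_mult_distrib using ab by (simp add: field_simps)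
    from mult_left_mono[OF this, of "\<bar>g (cos t)\<bar> * real m"]
    have "\<bar>g (cos t)\<bar> * (real m / b ^ M) \<le> (1 + B) ^ M * (\<bar>g (cos t)\<bar> * (real m / a ^ M))"
      by (simp add: mult_ac)
    from ennreal_leI[OF this] have "ennreal (\<bar>g (cos t)\<bar> * (real m / b ^ M)) \<le> ennreal ((1 + B) ^ M) * ennreal (\<bar>g (cos t)\<bar> * (real m / a ^ M))"
      using B0 by (simp only: ennreal_mult' zero_le_power add_nonneg_nonneg zero_le_one)
    from mult_right_mono[OF this, of "indicator {0..pi} t"]
    show "ennreal (\<bar>g (cos t)\<bar> * (real m / (1 + real m * \<bar>\<theta>' - t\<bar>) ^ M)) * indicator {0..pi} t
      \<le> ennreal ((1 + B) ^ M) * (ennreal (\<bar>g (cos t)\<bar> * (real m / (1 + real m * \<bar>\<theta> - t\<bar>) ^ M)) * indicator {0..pi} t)"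
      unfolding a_def b_def by (simp add: mult.assoc)
  qed
  also have "\<dots> = ennreal ((1 + B) ^ M) * loc_avg M m g \<theta>"
    unfolding loc_avg_def by (rule nn_integral_cmult) measurable
  finally show ?thesis .
qed

lemma loc_avg_measurable[measurable (raw)]:
  assumes [measurable]: "g \<in> borel_measurable borel" "h \<in> borel_measurable N"
  shows "(\<lambda>x. loc_avg M m g (h x)) \<in> borel_measurable N"
  unfolding loc_avg_def by measurable

lemma arccos_measurable_cong:
  "(\<lambda>x. arccos (max (-1) (min 1 x))) \<in> borel_measurable borel"
  by (intro borel_measurable_continuous_onI continuous_on_arccos continuous_intros) auto

text \<open>Clamping the argument makes the inverse cosine continuous on the whole line, hence Borel
  measurable.\<close>

definition ang :: "real \<Rightarrow> real" where
  "ang x = arccos (max (-1) (min 1 x))"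

lemma ang_measurable[measurable]: "ang \<in> borel_measurable borel"
  unfolding ang_def[abs_def] by (rule arccos_measurable_cong)

lemma ang: "ang x \<in> {0..pi}" "x \<in> {-1..1} \<Longrightarrow> cos (ang x) = x" "t \<in> {0..pi} \<Longrightarrow> ang (cos t) = t"
  by (auto simp: ang_def arccos_lbound arccos_ubound arccos_cos)

text \<open>Distances in \<open>x\<close>, measured in units of \<open>rho\<close>, are at most
  quadratic in the angular factor. A fourth power in the angle therefore yields a square in
  \<open>x\<close>, which is integrable.\<close>

lemma decay_compare:
  assumes "m \<ge> 1" "\<theta> \<in> {0..pi}" "t \<in> {0..pi}"
  shows "1 / (1 + real m * \<bar>\<theta> - t\<bar>) ^ 4 \<le> 4 * (1 / (1 + \<bar>cos \<theta> - cos t\<bar> / rho m (cos t))\<^sup>2)"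
proof -
  define T D where "T = 1 + real m * \<bar>\<theta> - t\<bar>" and "D = 1 + \<bar>cos \<theta> - cos t\<bar> / rho m (cos t)"
  have r: "rho m (cos t) > 0" using assms by (intro rho_pos) auto
  have T: "T \<ge> 1" by (simp add: T_def)
  have D: "D \<ge> 1" using r by (simp add: D_def)
  have "\<bar>cos \<theta> - cos t\<bar> \<le> T\<^sup>2 * rho m (cos t)" unfolding T_def by (rule abs_cos_diff_le_rho) (use assms in auto)
  then have "D \<le> 1 + T\<^sup>2" using r by (simp add: D_def pos_divide_le_eq)
  also have "\<dots> \<le> 2 * T\<^sup>2" using T by simp
  finally have "D\<^sup>2 \<le> (2 * T\<^sup>2)\<^sup>2" using D by (intro power_mono) auto
  then have "D\<^sup>2 \<le> 4 * T ^ 4" by (simp add: power_mult_distrib power_mult[symmetric])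
  then show ?thesis using T D unfolding T_def[symmetric] D_def[symmetric] by (simp add: field_simps)
qed

section \<open>Differences of polynomials\<close>

text \<open>For \<open>p = 1\<close> the integral of \<open>\<bar>q (cos t)\<bar> w (cos t)\<close> against \<open>dt / m\<close> is not obviously
  controlled near the endpoints; there it is absorbed into the full integral, because the kernel bound shows
  that only a small proportion of the mass can sit close to \<open>t = 0\<close> and \<open>t = \<pi>\<close>.\<close>

lemma sin_small_measure:
  assumes "\<delta> \<ge> 0"
  shows "emeasure lborel {t \<in> {0..pi}. sin t < \<delta>} \<le> ennreal (4 * \<delta>)"
proof -
  have sub: "{t \<in> {0..pi}. sin t < \<delta>} \<subseteq> {0..2 * \<delta>} \<union> {pi - 2 * \<delta>..pi}"
  proof
    fix t assume t: "t \<in> {t \<in> {0..pi}. sin t < \<delta>}"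
    show "t \<in> {0..2 * \<delta>} \<union> {pi - 2 * \<delta>..pi}"
    proof (cases "t \<le> pi / 2")
      case True
      have "2 * t / pi \<le> sin t" using t True by (intro sin_jordan) auto
      then have "2 * t \<le> pi * \<delta>" using t by (simp add: pos_divide_le_eq mult.commute) (smt (verit) mult_left_mono pi_gt_zero)
      moreover have "pi * \<delta> \<le> 4 * \<delta>" using pi_less_4 assms by (intro mult_right_mono) auto
      ultimately show ?thesis using t by auto
    next
      case False
      have "2 * (pi - t) / pi \<le> sin (pi - t)" using t False by (intro sin_jordan) auto
      then have "2 * (pi - t) \<le> pi * \<delta>" using t by (simp add: pos_divide_le_eq mult.commute) (smt (verit) mult_left_mono pi_gt_zero)
      moreover have "pi * \<delta> \<le> 4 * \<delta>" using pi_less_4 assms by (intro mult_right_mono) auto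
      ultimately show ?thesis using t by auto
    qed
  qed
  have "emeasure lborel {t \<in> {0..pi}. sin t < \<delta>} \<le> emeasure lborel ({0..2 * \<delta>} \<union> {pi - 2 * \<delta>..pi})"
    by (rule emeasure_mono[OF sub]) auto
  also have "\<dots> \<le> emeasure lborel {0..2 * \<delta>} + emeasure lborel {pi - 2 * \<delta>..pi}"
    by (rule emeasure_subadditive) auto
  also have "\<dots> = ennreal (2 * \<delta>) + ennreal (2 * \<delta>)" using assms by simp
  also have "\<dots> = ennreal (4 * \<delta>)" using assms by (subst ennreal_plus[symmetric]) auto
  finally show ?thesis .
qed

text \<open>The constants of slow variation are parameters because the exponent \<open>s\<close>
  enters the kernels.\<close>

locale slow_weight =
  fixes w :: "real \<Rightarrow> real" and C :: real and s :: nat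
  assumes w: "doubling_weight w" and C: "C \<ge> 0"
    and slow: "\<And>n \<theta> t. n \<ge> 1 \<Longrightarrow> \<theta> \<in> {0..pi} \<Longrightarrow> t \<in> {0..pi} \<Longrightarrow>
      avg_weight w n (cos \<theta>) \<le> C * (1 + real n * \<bar>\<theta> - t\<bar>) ^ s * avg_weight w n (cos t)"
begin

abbreviation "aw \<equiv> avg_weight w"

lemma aw_meas[measurable]: "aw n \<in> borel_measurable borel"
  by (rule avg_weight_measurable[OF w])

lemma aw_nonneg: "n \<ge> 1 \<Longrightarrow> 0 \<le> aw n (cos t)"
  by (rule avg_weight_nonneg[OF w]) auto

text \<open>The exponent \<open>s + 4\<close> is split: \<open>s\<close> powers pay for moving the
  weight from \<open>\<theta>\<close> to \<open>t\<close>, four remain for integration.\<close>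

lemma kernel_weight:
  assumes "m \<ge> 1" "\<theta> \<in> {0..pi}" "t \<in> {0..pi}" and a: "a \<ge> 0"
  shows "a / (1 + real m * \<bar>\<theta> - t\<bar>) ^ (s + 4) * aw m (cos \<theta>)
     \<le> C * (a / (1 + real m * \<bar>\<theta> - t\<bar>) ^ 4 * aw m (cos t))"
proof -
  define T where "T = 1 + real m * \<bar>\<theta> - t\<bar>"
  have T: "T \<ge> 1" by (simp add: T_def)
  have "a / T ^ (s + 4) * aw m (cos \<theta>) \<le> a / T ^ (s + 4) * (C * T ^ s * aw m (cos t))"
    unfolding T_def using slow[OF assms(1-3)] a by (intro mult_left_mono) auto
  also have "\<dots> = C * (a / T ^ 4 * aw m (cos t))"
    using T by (simp add: power_add field_simps)
  finally show ?thesis unfolding T_def .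
qed

abbreviation wavg :: "nat \<Rightarrow> (real \<Rightarrow> real) \<Rightarrow> real \<Rightarrow> ennreal" where
  "wavg m g x \<equiv> loc_avg (s + 4) m g (ang x) * ennreal (aw m x)"

lemma wavg_le:
  assumes m: "m \<ge> 1" and x: "x \<in> {-1..1}" and [measurable]: "g \<in> borel_measurable borel"
  shows "wavg m g x \<le> ennreal C * (NN t\<in>{0..pi}. ennreal (\<bar>g (cos t)\<bar> * aw m (cos t)) *
    ennreal (real m / (1 + real m * \<bar>ang x - t\<bar>) ^ 4))"
proof -
  have "wavg m g x = (NN t\<in>{0..pi}. ennreal (\<bar>g (cos t)\<bar> * (real m / (1 + real m * \<bar>ang x - t\<bar>) ^ (s + 4))) * ennreal (aw m x))"
    unfolding loc_avg_def by (subst nn_integral_multc[symmetric]) (auto simp: mult_ac)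
  also have "\<dots> \<le> (NN t\<in>{0..pi}. ennreal C * (ennreal (\<bar>g (cos t)\<bar> * aw m (cos t)) *
    ennreal (real m / (1 + real m * \<bar>ang x - t\<bar>) ^ 4)))"
  proof (rule set_nn_integral_mono_on)
    fix t assume t: "t \<in> {0..pi}"
    have "ennreal (\<bar>g (cos t)\<bar> * (real m / (1 + real m * \<bar>ang x - t\<bar>) ^ (s + 4))) * ennreal (aw m x)
      = ennreal (\<bar>g (cos t)\<bar> * real m / (1 + real m * \<bar>ang x - t\<bar>) ^ (s + 4) * aw m (cos (ang x)))"
      using ang(2)[OF x] by (subst ennreal_mult'[symmetric]) auto
    also have "\<dots> \<le> ennreal (C * (\<bar>g (cos t)\<bar> * real m / (1 + real m * \<bar>ang x - t\<bar>) ^ 4 * aw m (cos t)))"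
      by (rule ennreal_leI, rule kernel_weight[OF m ang(1) t]) simp
    also have "\<dots> = ennreal C * (ennreal (\<bar>g (cos t)\<bar> * aw m (cos t)) * ennreal (real m / (1 + real m * \<bar>ang x - t\<bar>) ^ 4))"
      using C aw_nonneg[OF m, of t] by (simp add: ennreal_mult'[symmetric] mult_ac)
    finally show "ennreal (\<bar>g (cos t)\<bar> * (real m / (1 + real m * \<bar>ang x - t\<bar>) ^ (s + 4))) * ennreal (aw m x)
      \<le> ennreal C * (ennreal (\<bar>g (cos t)\<bar> * aw m (cos t)) * ennreal (real m / (1 + real m * \<bar>ang x - t\<bar>) ^ 4))" .
  qed
  also have "\<dots> = ennreal C * (NN t\<in>{0..pi}. ennreal (\<bar>g (cos t)\<bar> * aw m (cos t)) *
    ennreal (real m / (1 + real m * \<bar>ang x - t\<bar>) ^ 4))"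
    by (rule set_nn_integral_cmult) auto
  finally show ?thesis .
qed

text \<open>Null sets transfer from \<open>x\<close> to \<open>t\<close> by \<open>AE_cos\<close>,
  and the remaining kernel has total mass at most 2.\<close>

lemma wavg_sup:
  assumes m: "m \<ge> 1" and [measurable]: "g \<in> borel_measurable borel"
    and le: "AE x in lborel. x \<in> {-1..1} \<longrightarrow> ennreal (\<bar>g x\<bar> * aw m x) \<le> c"
    and x: "x \<in> {-1..1}"
  shows "wavg m g x \<le> ennreal (2 * C) * c"
proof -
  have "AE t in lborel. t \<in> {0..pi} \<longrightarrow> ennreal (\<bar>g (cos t)\<bar> * aw m (cos t)) \<le> c"
    by (rule AE_cos[OF _ le]) measurable
  then have "(NN t\<in>{0..pi}. ennreal (\<bar>g (cos t)\<bar> * aw m (cos t)) * ennreal (real m / (1 + real m * \<bar>ang x - t\<bar>) ^ 4))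
    \<le> (NN t. c * (ennreal (real m / (1 + real m * \<bar>ang x - t\<bar>)\<^sup>2) * indicator {0..pi} t))"
  proof (intro nn_integral_mono_AE, eventually_elim)
    case (elim t)
    have "1 * (1 + real m * \<bar>ang x - t\<bar>)\<^sup>2 \<le> (1 + real m * \<bar>ang x - t\<bar>)\<^sup>2 * (1 + real m * \<bar>ang x - t\<bar>)\<^sup>2"
      by (rule mult_right_mono) (auto intro: one_le_power)
    then have "(1 + real m * \<bar>ang x - t\<bar>)\<^sup>2 \<le> (1 + real m * \<bar>ang x - t\<bar>) ^ 4"
      by (simp add: power_add[symmetric])
    then have "real m / (1 + real m * \<bar>ang x - t\<bar>) ^ 4 \<le> real m / (1 + real m * \<bar>ang x - t\<bar>)\<^sup>2"
      by (intro divide_left_mono mult_pos_pos zero_less_power) (auto simp: add_pos_nonneg)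
    then show ?case using elim
      by (cases "t \<in> {0..pi}") (auto intro!: mult_mono ennreal_leI)
  qed
  also have "\<dots> = c * (NN t\<in>{0..pi}. ennreal (real m / (1 + real m * \<bar>ang x - t\<bar>)\<^sup>2))"
    by (rule nn_integral_cmult) measurable
  also have "\<dots> \<le> c * 2" by (intro mult_left_mono nn_integral_angle_decay_le m) auto
  finally have "wavg m g x \<le> ennreal C * (c * 2)"
    by (intro order.trans[OF wavg_le[OF m x] mult_left_mono]) auto
  also have "\<dots> = ennreal (2 * C) * c" using C by (simp add: ennreal_mult' mult_ac)
  finally show ?thesis .
qed

text \<open>For \<open>m >= 1\<close> the density \<open>m * rho m (cos t)\<close> equals
  \<open>sin t + 1 / m\<close>. Compared with \<open>dx\<close>, that is \<open>sin t dt\<close>,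
  the extra \<open>1 / m\<close> matters only near the end points.\<close>

definition angmass :: "nat \<Rightarrow> (real \<Rightarrow> real) \<Rightarrow> ennreal" where
  "angmass m g = (NN t\<in>{0..pi}. ennreal (\<bar>g (cos t)\<bar> * aw m (cos t)) * ennreal (real m * rho m (cos t)))"

text \<open>After Fubini the kernel is integrated in \<open>x\<close>. It is concentrated on a scale
  \<open>rho m (cos t)\<close> around \<open>cos t\<close>, which yields the factor
  \<open>m * rho m (cos t)\<close>.\<close>

lemma wavg_integral_le:
  assumes m: "m \<ge> 1" and [measurable]: "g \<in> borel_measurable borel"
  shows "(NN x\<in>{-1..1}. wavg m g x) \<le> ennreal (8 * C) * angmass m g"
proof -
  let ?G = "\<lambda>t. ennreal (\<bar>g (cos t)\<bar> * aw m (cos t))"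
  let ?k = "\<lambda>x t. ennreal (real m / (1 + real m * \<bar>ang x - t\<bar>) ^ 4)"
  have "(NN x\<in>{-1..1}. wavg m g x) \<le> (NN x\<in>{-1..1}. ennreal C * (NN t\<in>{0..pi}. ?G t * ?k x t))"
    by (rule set_nn_integral_mono_on, rule wavg_le[OF m]) auto
  also have "\<dots> = ennreal C * (NN x\<in>{-1..1}. (NN t\<in>{0..pi}. ?G t * ?k x t))"
    by (rule set_nn_integral_cmult) measurable
  also have "(NN x\<in>{-1..1}. (NN t\<in>{0..pi}. ?G t * ?k x t))
    = (NN t\<in>{0..pi}. (NN x\<in>{-1..1}. ?G t * ?k x t))"
    by (rule set_nn_integral_swap) measurable
  also have "ennreal C * \<dots> \<le> ennreal C * (NN t\<in>{0..pi}. 8 * (?G t * ennreal (real m * rho m (cos t))))"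
  proof (intro mult_left_mono set_nn_integral_mono_on)
    fix t assume t: "t \<in> {0..pi}"
    have r: "rho m (cos t) > 0" using m by (intro rho_pos) auto
    have "(NN x\<in>{-1..1}. ?k x t) \<le> (NN x. ennreal (4 * real m) * ennreal (1 / (1 + \<bar>x - cos t\<bar> / rho m (cos t))\<^sup>2))"
    proof (rule nn_integral_mono)
      fix x
      show "?k x t * indicator {-1..1} x \<le> ennreal (4 * real m) * ennreal (1 / (1 + \<bar>x - cos t\<bar> / rho m (cos t))\<^sup>2)"
      proof (cases "x \<in> {-1..1}")
        case True
        have "real m * (1 / (1 + real m * \<bar>ang x - t\<bar>) ^ 4) \<le> real m * (4 * (1 / (1 + \<bar>cos (ang x) - cos t\<bar> / rho m (cos t))\<^sup>2))"
          by (intro mult_left_mono decay_compare m ang(1) t) simp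
        then have "?k x t \<le> ennreal (4 * real m * (1 / (1 + \<bar>x - cos t\<bar> / rho m (cos t))\<^sup>2))"
          using ang(2)[OF True] by (intro ennreal_leI) (simp add: mult_ac)
        also have "\<dots> = ennreal (4 * real m) * ennreal (1 / (1 + \<bar>x - cos t\<bar> / rho m (cos t))\<^sup>2)"
          by (rule ennreal_mult') simp
        finally show ?thesis using True by simp
      qed simp
    qed
    also have "\<dots> = ennreal (4 * real m) * (NN x. ennreal (1 / (1 + \<bar>x - cos t\<bar> / rho m (cos t))\<^sup>2))"
      by (rule nn_integral_cmult) measurable
    also have "\<dots> \<le> ennreal (4 * real m) * ennreal (2 * rho m (cos t))"
      by (intro mult_left_mono nn_integral_decay_le r) simp
    also have "\<dots> = ennreal (8 * (real m * rho m (cos t)))" by (subst ennreal_mult'[symmetric]) (auto simp: mult_ac)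
    also have "\<dots> = 8 * ennreal (real m * rho m (cos t))" by (subst ennreal_mult') auto
    finally have K: "(NN x\<in>{-1..1}. ?k x t) \<le> 8 * ennreal (real m * rho m (cos t))" .
    have "(NN x\<in>{-1..1}. ?G t * ?k x t) = ?G t * (NN x\<in>{-1..1}. ?k x t)"
      by (rule set_nn_integral_cmult) measurable
    also have "\<dots> \<le> ?G t * (8 * ennreal (real m * rho m (cos t)))" by (intro mult_left_mono K) simp
    finally show "(NN x\<in>{-1..1}. ?G t * ?k x t) \<le> 8 * (?G t * ennreal (real m * rho m (cos t)))"
      by (simp add: mult_ac)
  qed simp
  also have "\<dots> = ennreal C * (8 * angmass m g)"
    unfolding angmass_def by (subst set_nn_integral_cmult) auto
  also have "\<dots> = ennreal (8 * C) * angmass m g"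
    using C by (simp add: ennreal_mult' mult_ac)
  finally show ?thesis .
qed

text \<open>Finiteness is what permits half of \<open>angmass\<close> to be absorbed in the next
  estimate.\<close>

lemma angmass_poly_finite:
  assumes m: "m \<ge> 1"
  shows "angmass m (poly q) < \<infinity>"
proof -
  have "compact ((\<lambda>t. poly q (cos t)) ` {0..pi})"
    by (intro compact_continuous_image continuous_intros) auto
  then have "bounded ((\<lambda>t. poly q (cos t)) ` {0..pi})" by (rule compact_imp_bounded)
  then obtain B where "\<forall>y\<in>(\<lambda>t. poly q (cos t)) ` {0..pi}. norm y \<le> B" unfolding bounded_iff by (elim exE)
  then have B: "\<bar>poly q (cos t)\<bar> \<le> B" if "t \<in> {0..pi}" for t using that by simp
  define W where "W = C * (1 + real m * pi) ^ s * aw m (cos 0)"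
  have "angmass m (poly q) \<le> (NN t\<in>{0..pi}. ennreal (B * W) * ennreal (real m * 2))"
    unfolding angmass_def
  proof (rule set_nn_integral_mono_on, rule mult_mono)
    fix t assume t: "t \<in> {0..pi}"
    have B0: "0 \<le> B" using B[OF t] by simp
    have "aw m (cos t) \<le> C * (1 + real m * \<bar>t - 0\<bar>) ^ s * aw m (cos 0)"
      by (rule slow) (use m t in auto)
    also have "\<dots> \<le> W" unfolding W_def using C t aw_nonneg[OF m, of 0]
      by (intro mult_right_mono mult_left_mono power_mono add_left_mono) auto
    finally have "\<bar>poly q (cos t)\<bar> * aw m (cos t) \<le> B * W"
      using B[OF t] B0 aw_nonneg[OF m, of t] by (intro mult_mono) auto
    then show "ennreal (\<bar>poly q (cos t)\<bar> * aw m (cos t)) \<le> ennreal (B * W)" by (rule ennreal_leI)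
    have "sin t / real m \<le> 1" using m by (simp add: divide_le_eq order.trans[OF sin_le_one])
    moreover have "1 / (real m)\<^sup>2 \<le> 1" using m by (simp add: divide_le_eq one_le_power)
    ultimately have "rho m (cos t) \<le> 2" unfolding rho_cos[OF t] by linarith
    then show "ennreal (real m * rho m (cos t)) \<le> ennreal (real m * 2)" by (intro ennreal_leI mult_left_mono) auto
  qed auto
  also have "\<dots> < \<infinity>" by (simp add: nn_integral_cmult_indicator ennreal_mult_less_top ennreal_mult''[symmetric])
  finally show ?thesis .
qed

text \<open>On the set \<open>Z\<close> near the end points, domination bounds the integrand by a
  multiple of \<open>J <= m * angmass\<close>, while \<open>Z\<close> has measure at most
  \<open>4 * \<epsilon> / m\<close>; its share is at most
  \<open>8 * C1 * C * \<epsilon> <= 1 / 2\<close> of the whole. Off \<open>Z\<close> the surplus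
  \<open>1 / m\<close> is at most \<open>sin t / \<epsilon>\<close>.\<close>

lemma angmass_le_aux:
  assumes m: "m \<ge> 1" and C1: "C1 \<ge> 0"
    and dom: "\<And>t. t \<in> {0..pi} \<Longrightarrow> ennreal \<bar>poly q (cos t)\<bar> \<le> ennreal C1 * loc_avg (s + 4) m (poly q) t"
    and \<epsilon>: "0 < \<epsilon>" "\<epsilon> \<le> 1" "16 * C1 * C * \<epsilon> \<le> 1"
  shows "angmass m (poly q) \<le> ennreal (2 * (1 + 1 / \<epsilon>)) * (NN x\<in>{-1..1}. ennreal (\<bar>poly q x\<bar> * aw m x))"
proof -
  let ?G = "\<lambda>t. ennreal (\<bar>poly q (cos t)\<bar> * aw m (cos t))"
  define N where "N = (NN x\<in>{-1..1}. ennreal (\<bar>poly q x\<bar> * aw m x))"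
  define Z where "Z = {t \<in> {0..pi}. sin t < \<epsilon> / real m}"
  have [measurable]: "Z \<in> sets borel"
  proof -
    have "Z = {t \<in> space borel. t \<in> {0..pi} \<and> sin t < \<epsilon> / real m}" by (auto simp: Z_def)
    also have "\<dots> \<in> sets borel" by measurable
    finally show ?thesis .
  qed
  have mr: "real m * rho m (cos t) = sin t + 1 / real m" if "t \<in> {0..pi}" for t
    using m unfolding rho_cos[OF that] by (simp add: power2_eq_square field_simps)
  define J where "J = (NN t\<in>{0..pi}. ?G t)"
  have J: "J \<le> ennreal (real m) * angmass m (poly q)"
  proof -
    have "J \<le> (NN t\<in>{0..pi}. ennreal (real m) * (?G t * ennreal (real m * rho m (cos t))))"
      unfolding J_def
    proof (rule set_nn_integral_mono_on)
      fix t assume t: "t \<in> {0..pi}"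
      have "1 \<le> real m * (real m * rho m (cos t))"
        unfolding mr[OF t] using m t sin_ge_zero[of t] by (simp add: distrib_left)
      then have "1 \<le> ennreal (real m * (real m * rho m (cos t)))" by simp
      also have "\<dots> = ennreal (real m) * ennreal (real m * rho m (cos t))" by (rule ennreal_mult') simp
      finally have "?G t * 1 \<le> ?G t * (ennreal (real m) * ennreal (real m * rho m (cos t)))" by (rule mult_left_mono) simp
      then show "?G t \<le> ennreal (real m) * (?G t * ennreal (real m * rho m (cos t)))" by (simp add: mult_ac)
    qed
    also have "\<dots> = ennreal (real m) * angmass m (poly q)"
      unfolding angmass_def by (rule set_nn_integral_cmult) measurable
    finally show ?thesis .
  qed
  have inZ: "(NN t\<in>Z. ?G t * ennreal (real m * rho m (cos t))) \<le> ennreal (1/2) * angmass m (poly q)"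
  proof -
    have "?G t * ennreal (real m * rho m (cos t)) \<le> ennreal (2 * C1 * C) * J" if t: "t \<in> Z" for t
    proof -
      have t': "t \<in> {0..pi}" "sin t < \<epsilon> / real m" using t by (auto simp: Z_def)
      have x: "cos t \<in> {-1..1}" by simp
      have "real m * rho m (cos t) \<le> 2 / real m"
      proof -
        have "\<epsilon> / real m \<le> 1 / real m" using \<epsilon> m by (intro divide_right_mono) auto
        then show ?thesis unfolding mr[OF t'(1)] using t'(2) by simp
      qed
      moreover have "?G t \<le> ennreal C1 * wavg m (poly q) (cos t)"
      proof -
        have "?G t = ennreal \<bar>poly q (cos t)\<bar> * ennreal (aw m (cos t))" by (rule ennreal_mult') simp
        also have "\<dots> \<le> ennreal C1 * loc_avg (s + 4) m (poly q) t * ennreal (aw m (cos t))"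
          by (intro mult_right_mono dom t') simp
        finally show ?thesis using ang(3)[OF t'(1)] by (simp add: mult.assoc)
      qed
      ultimately have "?G t * ennreal (real m * rho m (cos t)) \<le> (ennreal C1 * wavg m (poly q) (cos t)) * ennreal (2 / real m)"
        by (intro mult_mono ennreal_leI) auto
      also have "wavg m (poly q) (cos t) \<le> ennreal C * (NN u\<in>{0..pi}. ?G u * ennreal (real m / (1 + real m * \<bar>ang (cos t) - u\<bar>) ^ 4))"
        by (rule wavg_le[OF m x]) measurable
      also have "(NN u\<in>{0..pi}. ?G u * ennreal (real m / (1 + real m * \<bar>ang (cos t) - u\<bar>) ^ 4)) \<le> (NN u\<in>{0..pi}. ennreal (real m) * ?G u)"
      proof (rule set_nn_integral_mono_on)
        fix u
        have "1 \<le> (1 + real m * \<bar>ang (cos t) - u\<bar>) ^ 4" by (rule one_le_power) simp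
        then have "real m / (1 + real m * \<bar>ang (cos t) - u\<bar>) ^ 4 \<le> real m / 1"
          by (intro divide_left_mono) linarith+
        then have "?G u * ennreal (real m / (1 + real m * \<bar>ang (cos t) - u\<bar>) ^ 4) \<le> ?G u * ennreal (real m)"
          by (intro mult_left_mono ennreal_leI) auto
        then show "?G u * ennreal (real m / (1 + real m * \<bar>ang (cos t) - u\<bar>) ^ 4) \<le> ennreal (real m) * ?G u" by (simp add: mult.commute)
      qed
      also have "\<dots> = ennreal (real m) * J" unfolding J_def by (rule set_nn_integral_cmult) measurable
      finally have "?G t * ennreal (real m * rho m (cos t)) \<le> ennreal C1 * (ennreal C * (ennreal (real m) * J)) * ennreal (2 / real m)"
        by (simp add: mult_left_mono mult_right_mono)
      also have "\<dots> = (ennreal C1 * ennreal C * ennreal (real m) * ennreal (2 / real m)) * J" by (simp only: mult_ac)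
      also have "ennreal C1 * ennreal C * ennreal (real m) * ennreal (2 / real m) = ennreal (C1 * C * real m * (2 / real m))"
        using C1 C by (simp only: ennreal_mult' mult_nonneg_nonneg of_nat_0_le_iff)
      also have "C1 * C * real m * (2 / real m) = 2 * C1 * C" using m by simp
      finally show ?thesis .
    qed
    then have "(NN t\<in>Z. ?G t * ennreal (real m * rho m (cos t))) \<le> (NN t\<in>Z. ennreal (2 * C1 * C) * J)"
      by (rule set_nn_integral_mono_on)
    also have "\<dots> = ennreal (2 * C1 * C) * J * emeasure lborel Z"
      by (rule nn_integral_cmult_indicator) simp
    also have "\<dots> \<le> ennreal (2 * C1 * C) * (ennreal (real m) * angmass m (poly q)) * ennreal (4 * (\<epsilon> / real m))"
      using sin_small_measure[of "\<epsilon> / real m"] \<epsilon> unfolding Z_def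
      by (intro mult_mono mult_left_mono J) auto
    also have "\<dots> = (ennreal (2 * C1 * C) * ennreal (real m) * ennreal (4 * (\<epsilon> / real m))) * angmass m (poly q)" by (simp only: mult_ac)
    also have "ennreal (2 * C1 * C) * ennreal (real m) * ennreal (4 * (\<epsilon> / real m)) = ennreal (2 * C1 * C * real m * (4 * (\<epsilon> / real m)))"
      using C1 C by (simp only: ennreal_mult' mult_nonneg_nonneg of_nat_0_le_iff zero_le_numeral)
    also have "2 * C1 * C * real m * (4 * (\<epsilon> / real m)) = 8 * C1 * C * \<epsilon>" using m by simp
    also have "ennreal (8 * C1 * C * \<epsilon>) * angmass m (poly q) \<le> ennreal (1/2) * angmass m (poly q)"
      using \<epsilon>(3) by (intro mult_right_mono ennreal_leI) auto
    finally show ?thesis .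
  qed
  have outZ: "(NN t\<in>{0..pi} - Z. ?G t * ennreal (real m * rho m (cos t))) \<le> ennreal (1 + 1 / \<epsilon>) * N"
  proof -
    have "(NN t\<in>{0..pi} - Z. ?G t * ennreal (real m * rho m (cos t))) \<le> (NN t\<in>{0..pi} - Z. ennreal (1 + 1 / \<epsilon>) * (?G t * ennreal (sin t)))"
    proof (rule set_nn_integral_mono_on)
      fix t assume "t \<in> {0..pi} - Z"
      then have t: "t \<in> {0..pi}" "\<epsilon> / real m \<le> sin t" by (auto simp: Z_def)
      have "1 / real m = 1 / \<epsilon> * (\<epsilon> / real m)" using \<epsilon> by simp
      also have "\<dots> \<le> 1 / \<epsilon> * sin t" using t \<epsilon> by (intro mult_left_mono) auto
      finally have "real m * rho m (cos t) \<le> (1 + 1 / \<epsilon>) * sin t"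
        unfolding mr[OF t(1)] by (simp add: algebra_simps)
      then have "ennreal (real m * rho m (cos t)) \<le> ennreal (1 + 1 / \<epsilon>) * ennreal (sin t)"
        using \<epsilon> by (subst ennreal_mult'[symmetric]) (auto intro: ennreal_leI)
      from mult_left_mono[OF this, of "?G t"]
      show "?G t * ennreal (real m * rho m (cos t)) \<le> ennreal (1 + 1 / \<epsilon>) * (?G t * ennreal (sin t))" by (simp add: mult_ac)
    qed
    also have "\<dots> \<le> (NN t\<in>{0..pi}. ennreal (1 + 1 / \<epsilon>) * (?G t * ennreal (sin t)))"
      by (rule nn_set_integral_set_mono) auto
    also have "\<dots> = ennreal (1 + 1 / \<epsilon>) * (NN t\<in>{0..pi}. ?G t * ennreal (sin t))"
      by (rule set_nn_integral_cmult) measurable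
    also have "(NN t\<in>{0..pi}. ?G t * ennreal (sin t)) = N"
      unfolding N_def by (rule nn_integral_cos_subst) measurable
    finally show ?thesis .
  qed
  define A where "A = angmass m (poly q)"
  have fin: "A < \<infinity>" unfolding A_def by (rule angmass_poly_finite[OF m])
  have "A \<le> (NN t. ?G t * ennreal (real m * rho m (cos t)) * indicator Z t + ?G t * ennreal (real m * rho m (cos t)) * indicator ({0..pi} - Z) t)"
    unfolding A_def angmass_def by (rule nn_integral_mono) (auto simp: indicator_def)
  also have "\<dots> = (NN t\<in>Z. ?G t * ennreal (real m * rho m (cos t))) + (NN t\<in>{0..pi} - Z. ?G t * ennreal (real m * rho m (cos t)))"
    by (rule nn_integral_add) measurable
  also have "\<dots> \<le> ennreal (1/2) * A + ennreal (1 + 1 / \<epsilon>) * N"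
    unfolding A_def by (rule add_mono[OF inZ outZ])
  \<comment> \<open>\<open>A\<close> is finite, so half of it can be subtracted; an infinite
    \<open>N\<close> makes the claim trivial.\<close>
  finally have main: "A \<le> ennreal (1/2) * A + ennreal (1 + 1 / \<epsilon>) * N" .
  show ?thesis unfolding A_def[symmetric] N_def[symmetric]
  proof (cases "N = \<infinity>")
    case True
    have "2 * (1 + 1 / \<epsilon>) > 0" using \<epsilon> by (simp add: add_pos_nonneg)
    then show "A \<le> ennreal (2 * (1 + 1 / \<epsilon>)) * N" unfolding True by (simp add: ennreal_mult_top)
  next
    case False
    define a n where "a = enn2real A" and "n = enn2real N"
    have a: "A = ennreal a" "a \<ge> 0" and n: "N = ennreal n" "n \<ge> 0"
      using fin False by (simp_all add: a_def n_def ennreal_enn2real less_top)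
    have e0: "1 + 1 / \<epsilon> \<ge> 0" using \<epsilon> by simp
    define e where "e = 1 + 1 / \<epsilon>"
    have "ennreal (1/2 * a + e * n) = ennreal (1/2) * ennreal a + ennreal e * ennreal n"
    proof -
      have "ennreal (1/2 * a) = ennreal (1/2) * ennreal a" using a(2) by (rule ennreal_mult'')
      moreover have "ennreal (e * n) = ennreal e * ennreal n" using n(2) by (rule ennreal_mult'')
      moreover have "ennreal (1/2 * a + e * n) = ennreal (1/2 * a) + ennreal (e * n)"
        using a(2) n(2) e0 by (intro ennreal_plus) (auto simp: e_def)
      ultimately show ?thesis by (simp only:)
    qed
    then have "ennreal a \<le> ennreal (1/2 * a + e * n)" using main unfolding a(1) n(1) e_def by (simp only:)
    then have "a \<le> 1/2 * a + e * n" by (subst (asm) ennreal_le_iff) (use a(2) n(2) e0 in \<open>auto simp: e_def\<close>)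
    then have "a \<le> 2 * e * n" by linarith
    then have "ennreal a \<le> ennreal (2 * e * n)" by (rule ennreal_leI)
    also have "\<dots> = ennreal (2 * (1 + 1 / \<epsilon>)) * ennreal n" unfolding e_def using n(2) by (rule ennreal_mult'')
    finally show "A \<le> ennreal (2 * (1 + 1 / \<epsilon>)) * N" unfolding a n .
  qed
qed

end

lemma central_difference_measurable[measurable (raw)]:
  assumes [measurable]: "g \<in> borel_measurable borel" "h \<in> borel_measurable N" "x \<in> borel_measurable N"
  shows "(\<lambda>z. central_difference k (h z) g (x z)) \<in> borel_measurable N"
  unfolding central_difference_eq_fdiff by measurable

definition norm_leE :: "ennreal \<Rightarrow> (real \<Rightarrow> ennreal) \<Rightarrow> ennreal \<Rightarrow> bool" where
  "norm_leE p F c \<longleftrightarrow> (if p = 1 then (NN x\<in>{-1..1}. F x) \<le> c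
     else AE x in lborel. x \<in> {-1..1} \<longrightarrow> F x \<le> c)"

lemma norm_le_eq_norm_leE: "norm_le p v g c \<longleftrightarrow> norm_leE p (\<lambda>x. ennreal (\<bar>g x\<bar> * v x)) c"
  by (simp add: norm_le_def norm_leE_def)

lemma norm_leE_scale:
  assumes [measurable]: "H \<in> borel_measurable borel"
    and le: "\<And>x. x \<in> {-1..1} \<Longrightarrow> F x \<le> K * H x" and H: "norm_leE p H c"
  shows "norm_leE p F (K * c)"
proof (cases "p = 1")
  case True
  have "(NN x\<in>{-1..1}. F x) \<le> (NN x\<in>{-1..1}. K * H x)"
    by (rule set_nn_integral_mono_on) (rule le)
  also have "\<dots> = K * (NN x\<in>{-1..1}. H x)" by (rule set_nn_integral_cmult) auto
  also have "\<dots> \<le> K * c" using H True by (intro mult_left_mono) (auto simp: norm_leE_def)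
  finally show ?thesis using True by (simp add: norm_leE_def)
next
  case False
  then have "AE x in lborel. x \<in> {-1..1} \<longrightarrow> H x \<le> c" using H by (simp add: norm_leE_def)
  then have "AE x in lborel. x \<in> {-1..1} \<longrightarrow> F x \<le> K * c"
  proof eventually_elim
    case (elim x)
    then show ?case using order.trans[OF le mult_left_mono] by simp
  qed
  then show ?thesis using False by (simp add: norm_leE_def)
qed

lemma loc_avg_poly_finite: "loc_avg M m (poly q) \<theta> < \<infinity>"
proof -
  have "compact ((\<lambda>t. poly q (cos t)) ` {0..pi})"
    by (intro compact_continuous_image continuous_intros) auto
  then have "bounded ((\<lambda>t. poly q (cos t)) ` {0..pi})" by (rule compact_imp_bounded)
  then obtain B where "\<forall>y\<in>(\<lambda>t. poly q (cos t)) ` {0..pi}. norm y \<le> B" unfolding bounded_iff by (elim exE)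
  then have B: "\<bar>poly q (cos t)\<bar> \<le> B" if "t \<in> {0..pi}" for t using that by simp
  have "loc_avg M m (poly q) \<theta> \<le> (NN t\<in>{0..pi}. ennreal (B * real m))"
    unfolding loc_avg_def
  proof (rule set_nn_integral_mono_on, rule ennreal_leI, rule mult_mono)
    fix t assume t: "t \<in> {0..pi}"
    show "\<bar>poly q (cos t)\<bar> \<le> B" by (rule B[OF t])
    then show "0 \<le> B" by linarith
    have "1 \<le> (1 + real m * \<bar>\<theta> - t\<bar>) ^ M" by (rule one_le_power) simp
    then have "real m / (1 + real m * \<bar>\<theta> - t\<bar>) ^ M \<le> real m / 1" by (intro divide_left_mono) linarith+
    then show "real m / (1 + real m * \<bar>\<theta> - t\<bar>) ^ M \<le> real m" by simp
  qed simp
  also have "\<dots> < \<infinity>" by (simp add: nn_integral_cmult_indicator ennreal_mult''[symmetric])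
  finally show ?thesis .
qed

context slow_weight
begin

lemma wavg_bound:
  "\<exists>K\<ge>0. \<forall>m\<ge>1. \<forall>q p c. degree q \<le> m \<longrightarrow> norm_le p (aw m) (poly q) c \<longrightarrow>
     norm_leE p (wavg m (poly q)) (ennreal K * c)"
proof -
  obtain C1 where C1: "C1 \<ge> 0" and dom: "\<forall>m\<ge>1. \<forall>(q :: real poly). \<forall>\<theta>\<in>{0..pi}. degree q \<le> m \<longrightarrow>
    ennreal (\<bar>poly ((pderiv ^^ 0) q) (cos \<theta>)\<bar> * rho m (cos \<theta>) ^ 0) \<le> ennreal C1 * loc_avg (s + 4) m (poly q) \<theta>"
    using poly_deriv_le_loc_avg[of 0 "s + 4"] by (elim exE conjE)
  \<comment> \<open>The added 1 covers \<open>C1 * C = 0\<close> and gives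
    \<open>\<epsilon> <= 1\<close>.\<close>
  define \<epsilon> where "\<epsilon> = 1 / (16 * C1 * C + 1)"
  have pos: "16 * C1 * C + 1 > 0" using C1 C by (simp add: add_nonneg_pos)
  have \<epsilon>: "0 < \<epsilon>" "\<epsilon> \<le> 1" "16 * C1 * C * \<epsilon> \<le> 1"
    using C1 C pos by (auto simp: \<epsilon>_def divide_le_eq)
  define K where "K = 2 * C + 8 * C * (2 * (1 + 1 / \<epsilon>))"
  have e0: "0 \<le> 2 * (1 + 1 / \<epsilon>)" using \<epsilon> by simp
  show ?thesis
  proof (intro exI[of _ K] conjI allI impI)
    show "0 \<le> K" unfolding K_def using C e0 \<epsilon> by (intro add_nonneg_nonneg mult_nonneg_nonneg) auto
    fix m q p c assume m: "m \<ge> (1::nat)" and dq: "degree q \<le> m" and nl: "norm_le p (aw m) (poly q) c"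
    show "norm_leE p (wavg m (poly q)) (ennreal K * c)"
    proof (cases "p = 1")
      case True
      have "(NN x\<in>{-1..1}. wavg m (poly q) x) \<le> ennreal (8 * C) * angmass m (poly q)"
        by (rule wavg_integral_le[OF m]) measurable
      also have "\<dots> \<le> ennreal (8 * C) * (ennreal (2 * (1 + 1 / \<epsilon>)) * (NN x\<in>{-1..1}. ennreal (\<bar>poly q x\<bar> * aw m x)))"
      proof (intro mult_left_mono angmass_le_aux[OF m C1 _ \<epsilon>])
        fix t assume "t \<in> {0..pi}"
        with dom[rule_format, OF m this dq] show "ennreal \<bar>poly q (cos t)\<bar> \<le> ennreal C1 * loc_avg (s + 4) m (poly q) t" by simp
      qed auto
      also have "\<dots> \<le> ennreal (8 * C) * (ennreal (2 * (1 + 1 / \<epsilon>)) * c)"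
        using nl True by (intro mult_left_mono) (auto simp: norm_le_def)
      also have "\<dots> = ennreal (8 * C * (2 * (1 + 1 / \<epsilon>))) * c"
        using C e0 by (simp only: ennreal_mult' mult_nonneg_nonneg zero_le_numeral mult.assoc)
      also have "\<dots> \<le> ennreal K * c" using C by (intro mult_right_mono ennreal_leI) (auto simp: K_def)
      finally show ?thesis using True by (simp add: norm_leE_def)
    next
      case False
      then have ae: "AE x in lborel. x \<in> {-1..1} \<longrightarrow> ennreal (\<bar>poly q x\<bar> * aw m x) \<le> c"
        using nl by (simp add: norm_le_def)
      have "wavg m (poly q) x \<le> ennreal K * c" if "x \<in> {-1..1}" for x
      proof -
        have "wavg m (poly q) x \<le> ennreal (2 * C) * c" by (rule wavg_sup[OF m _ ae that]) measurable
        also have "\<dots> \<le> ennreal K * c"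
        proof -
          have "0 \<le> 8 * C * (2 * (1 + 1 / \<epsilon>))" using C e0 by (intro mult_nonneg_nonneg) auto
          then show ?thesis by (intro mult_right_mono ennreal_leI) (auto simp: K_def)
        qed
        finally show ?thesis .
      qed
      then show ?thesis using False by (simp add: norm_leE_def)
    qed
  qed
qed

text \<open>The difference is \<open>\<sigma> ^ k\<close> times a derivative at a point
  \<open>\<xi>\<close> within \<open>k / 2 * \<sigma>\<close> of \<open>x\<close>. Both
  \<open>rho\<close> and the local average change only by bounded factors between
  \<open>\<xi>\<close> and \<open>x\<close>.\<close>

lemma central_difference_poly_pointwise:
  assumes k: "k \<ge> 1"
  shows "\<exists>K\<ge>0. \<forall>m\<ge>1. \<forall>n\<ge>m. \<forall>h>0. h \<le> 1 / real n \<longrightarrow> (\<forall>q. degree q \<le> m \<longrightarrow> (\<forall>x\<in>{-1..1}.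
    ennreal (\<bar>central_difference k (h * phi x) (poly q) x\<bar> * aw n x)
      \<le> ennreal (K * (real m / real n) ^ (k - 1)) * wavg m (poly q) x))"
proof -
  obtain C1 where C1: "C1 \<ge> 0" and dom: "\<forall>m\<ge>1. \<forall>(q :: real poly). \<forall>\<theta>\<in>{0..pi}. degree q \<le> m \<longrightarrow>
    ennreal (\<bar>poly ((pderiv ^^ k) q) (cos \<theta>)\<bar> * rho m (cos \<theta>) ^ k) \<le> ennreal C1 * loc_avg (s + 4) m (poly q) \<theta>"
    using poly_deriv_le_loc_avg[of k "s + 4"] by (elim exE conjE)
  \<comment> \<open>A bound for the angular displacement, scaled by \<open>m\<close>, that belongs
    to a distance of \<open>k / 2 * rho m x\<close>.\<close>
  define B where "B = pi * (2 * (real k / 2) + 1)"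
  have B: "B \<ge> 0" by (simp add: B_def)
  define K where "K = (1 + B) ^ k * (C1 * (1 + B) ^ (s + 4))"
  have K: "K \<ge> 0" using B C1 by (simp add: K_def)
  show ?thesis
  proof (intro exI[of _ K] conjI allI ballI impI K)
    fix m n :: nat and h :: real and q :: "real poly" and x :: real
    assume m: "1 \<le> m" and mn: "m \<le> n" and h: "0 < h" "h \<le> 1 / real n" and dq: "degree q \<le> m" and x: "x \<in> {-1..1}"
    define \<sigma> where "\<sigma> = h * phi x"
    have ph: "phi x \<ge> 0" by (rule phi_nonneg[OF x])
    have \<sigma>0: "\<sigma> \<ge> 0" using h ph by (simp add: \<sigma>_def)
    have n: "n \<ge> 1" using m mn by simp
    have rn: "rho n x > 0" and rm: "rho m x > 0" using n m x by (auto intro: rho_pos)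
    have "\<sigma> \<le> 1 / real n * phi x" unfolding \<sigma>_def using h ph by (intro mult_right_mono) auto
    also have "\<dots> \<le> rho n x" by (simp add: rho_def phi_def)
    finally have \<sigma>n: "\<sigma> \<le> rho n x" .
    have \<sigma>m: "\<sigma> \<le> rho m x" using \<sigma>n rho_antimono[OF m mn x] by simp
    show "ennreal (\<bar>central_difference k (h * phi x) (poly q) x\<bar> * aw n x)
      \<le> ennreal (K * (real m / real n) ^ (k - 1)) * wavg m (poly q) x"
    \<comment> \<open>The step vanishes where \<open>phi\<close> does, and the mean value form
      requires a positive step; a zero step gives a zero difference because
      \<open>k >= 1\<close>.\<close>
    proof (cases "x - real k * \<sigma> / 2 \<in> {-1..1} \<and> x + real k * \<sigma> / 2 \<in> {-1..1} \<and> \<sigma> > 0")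
      case False
      then have "central_difference k (h * phi x) (poly q) x = 0"
        using \<sigma>0 k unfolding central_difference_eq_fdiff \<sigma>_def[symmetric]
        by (cases "\<sigma> = 0") (auto simp: fdiff_zero)
      then show ?thesis by simp
    next
      case True
      define L where "L = enn2real (loc_avg (s + 4) m (poly q) (ang x))"
      have L: "loc_avg (s + 4) m (poly q) (ang x) = ennreal L" "L \<ge> 0"
        using loc_avg_poly_finite[of "s + 4" m q "ang x"] by (simp_all add: L_def ennreal_enn2real)
      have cd: "central_difference k (h * phi x) (poly q) x = fdiff k \<sigma> (poly q) (x - real k * \<sigma> / 2)"
        using True unfolding central_difference_eq_fdiff \<sigma>_def[symmetric] by simp
      have der: "\<bar>poly ((pderiv ^^ k) q) \<xi>\<bar> \<le> K * L / rho m x ^ k"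
        if \<xi>: "x - real k * \<sigma> / 2 \<le> \<xi>" "\<xi> \<le> x - real k * \<sigma> / 2 + real k * \<sigma>" for \<xi>
      proof -
        have "x - real k * \<sigma> / 2 + real k * \<sigma> = x + real k * \<sigma> / 2" by (simp add: field_simps)
        then have \<xi>': "\<xi> \<le> x + real k * \<sigma> / 2" using \<xi>(2) by linarith
        have \<xi>1: "\<xi> \<in> {-1..1}" using \<xi>(1) \<xi>' True unfolding atLeastAtMost_iff by linarith
        have "\<bar>\<xi> - x\<bar> \<le> real k * \<sigma> / 2" using \<xi>(1) \<xi>' by linarith
        also have "real k * \<sigma> / 2 = real k / 2 * \<sigma>" by simp
        also have "\<dots> \<le> real k / 2 * rho m x" using \<sigma>m by (intro mult_left_mono) auto
        finally have close: "\<bar>cos (ang \<xi>) - cos (ang x)\<bar> \<le> real k / 2 * rho m (cos (ang x))"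
          using ang(2)[OF \<xi>1] ang(2)[OF x] by simp
        have d: "real m * \<bar>ang \<xi> - ang x\<bar> \<le> B"
          unfolding B_def by (rule angle_close_real[OF ang(1) ang(1) m _ close]) simp
        have r: "rho m x \<le> (1 + B) * rho m \<xi>"
        proof -
          have "rho m (cos (ang x)) \<le> (1 + real m * \<bar>ang x - ang \<xi>\<bar>) * rho m (cos (ang \<xi>))"
            by (rule rho_cos_le[OF ang(1) ang(1) m])
          also have "\<dots> \<le> (1 + B) * rho m (cos (ang \<xi>))"
            using d rho_pos[of m "cos (ang \<xi>)"] m by (intro mult_right_mono) (auto simp: abs_minus_commute)
          finally show ?thesis using ang(2)[OF \<xi>1] ang(2)[OF x] by simp
        qed
        have "ennreal (\<bar>poly ((pderiv ^^ k) q) \<xi>\<bar> * rho m \<xi> ^ k) \<le> ennreal C1 * loc_avg (s + 4) m (poly q) (ang \<xi>)"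
          using dom[rule_format, OF m ang(1)[of \<xi>] dq] ang(2)[OF \<xi>1] by simp
        also have "\<dots> \<le> ennreal C1 * (ennreal ((1 + B) ^ (s + 4)) * loc_avg (s + 4) m (poly q) (ang x))"
          by (intro mult_left_mono loc_avg_close d) auto
        also have "\<dots> = ennreal (C1 * (1 + B) ^ (s + 4) * L)"
          using C1 L B by (simp add: ennreal_mult' mult.assoc)
        finally have q1: "\<bar>poly ((pderiv ^^ k) q) \<xi>\<bar> * rho m \<xi> ^ k \<le> C1 * (1 + B) ^ (s + 4) * L"
          using C1 L B by (subst (asm) ennreal_le_iff) auto
        have "\<bar>poly ((pderiv ^^ k) q) \<xi>\<bar> * rho m x ^ k \<le> \<bar>poly ((pderiv ^^ k) q) \<xi>\<bar> * ((1 + B) * rho m \<xi>) ^ k"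
          using r rm by (intro mult_left_mono power_mono) auto
        also have "\<dots> = (1 + B) ^ k * (\<bar>poly ((pderiv ^^ k) q) \<xi>\<bar> * rho m \<xi> ^ k)" by (simp add: power_mult_distrib mult_ac)
        also have "\<dots> \<le> (1 + B) ^ k * (C1 * (1 + B) ^ (s + 4) * L)" using B by (intro mult_left_mono q1) auto
        also have "\<dots> = K * L" by (simp add: K_def mult_ac)
        finally show ?thesis using rm by (simp add: pos_le_divide_eq)
      qed
      have "\<bar>central_difference k (h * phi x) (poly q) x\<bar> \<le> \<sigma> ^ k * (K * L / rho m x ^ k)"
        unfolding cd using True der by (intro fdiff_poly_abs_le) auto
      also have "\<dots> \<le> rho n x ^ k * (K * L / rho m x ^ k)"
        using \<sigma>0 \<sigma>n K L rm by (intro mult_right_mono power_mono) auto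
      also have "\<dots> = K * L * (rho n x / rho m x) ^ k" by (simp add: power_divide)
      finally have b1: "\<bar>central_difference k (h * phi x) (poly q) x\<bar> \<le> K * L * (rho n x / rho m x) ^ k" .
      have b2: "aw n x \<le> rho m x / rho n x * aw m x" by (rule avg_weight_le[OF w m mn x])
      have awn: "aw n x \<ge> 0" "aw m x \<ge> 0" using avg_weight_nonneg[OF w] n m x by auto
      have "\<bar>central_difference k (h * phi x) (poly q) x\<bar> * aw n x
        \<le> (K * L * (rho n x / rho m x) ^ k) * (rho m x / rho n x * aw m x)"
        using b1 b2 awn K L rn rm by (intro mult_mono) auto
      also have "\<dots> = (K * (rho n x / rho m x) ^ (k - 1)) * (L * aw m x)"
      proof -
        have "(rho n x / rho m x) ^ k = (rho n x / rho m x) ^ (k - 1) * (rho n x / rho m x)"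
          using k by (cases k) auto
        then show ?thesis using rn rm by simp
      qed
      also have "\<dots> \<le> (K * (real m / real n) ^ (k - 1)) * (L * aw m x)"
        using rho_quotient_le(1)[OF m mn x] K L awn rn rm by (intro mult_right_mono mult_left_mono power_mono) auto
      finally have "ennreal (\<bar>central_difference k (h * phi x) (poly q) x\<bar> * aw n x)
        \<le> ennreal ((K * (real m / real n) ^ (k - 1)) * (L * aw m x))" by (rule ennreal_leI)
      also have "\<dots> = ennreal (K * (real m / real n) ^ (k - 1)) * ennreal (L * aw m x)"
        using K by (intro ennreal_mult') simp
      also have "ennreal (L * aw m x) = wavg m (poly q) x"
        unfolding L(1) using L(2) by (rule ennreal_mult')
      finally show ?thesis .
    qed
  qed
qed

lemma central_difference_poly_norm:
  assumes k: "k \<ge> 1"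
  shows "\<exists>K\<ge>0. \<forall>m\<ge>1. \<forall>n\<ge>m. \<forall>h>0. h \<le> 1 / real n \<longrightarrow> (\<forall>q p c. degree q \<le> m \<longrightarrow> norm_le p (aw m) (poly q) c \<longrightarrow>
    norm_le p (aw n) (\<lambda>x. central_difference k (h * phi x) (poly q) x) (ennreal (K * (real m / real n) ^ (k - 1)) * c))"
proof -
  obtain K1 where K1: "K1 \<ge> 0" and b1: "\<forall>m\<ge>1. \<forall>q p c. degree q \<le> m \<longrightarrow> norm_le p (aw m) (poly q) c \<longrightarrow>
     norm_leE p (wavg m (poly q)) (ennreal K1 * c)"
    using wavg_bound by (elim exE conjE)
  obtain K2 where K2: "K2 \<ge> 0" and b2: "\<forall>m\<ge>1. \<forall>n\<ge>m. \<forall>h>0. h \<le> 1 / real n \<longrightarrow> (\<forall>q. degree q \<le> m \<longrightarrow> (\<forall>x\<in>{-1..1}.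
    ennreal (\<bar>central_difference k (h * phi x) (poly q) x\<bar> * aw n x)
      \<le> ennreal (K2 * (real m / real n) ^ (k - 1)) * wavg m (poly q) x))"
    using central_difference_poly_pointwise[OF k] by (elim exE conjE)
  show ?thesis
  proof (intro exI[of _ "K2 * K1"] conjI allI impI)
    show "0 \<le> K2 * K1" using K1 K2 by simp
    fix m n :: nat and h :: real and q p c
    assume m: "1 \<le> m" and mn: "m \<le> n" and h: "0 < h" "h \<le> 1 / real n" and dq: "degree q \<le> m"
      and nl: "norm_le p (aw m) (poly q) c"
    have "norm_leE p (\<lambda>x. ennreal (\<bar>central_difference k (h * phi x) (poly q) x\<bar> * aw n x))
      (ennreal (K2 * (real m / real n) ^ (k - 1)) * (ennreal K1 * c))"
      by (rule norm_leE_scale[OF _ b2[rule_format, OF m mn h dq] b1[rule_format, OF m dq nl]]) measurable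
    also have "ennreal (K2 * (real m / real n) ^ (k - 1)) * (ennreal K1 * c) = ennreal (K2 * K1 * (real m / real n) ^ (k - 1)) * c"
      using K1 K2 by (simp add: ennreal_mult' mult_ac)
    finally show "norm_le p (aw n) (\<lambda>x. central_difference k (h * phi x) (poly q) x) (ennreal (K2 * K1 * (real m / real n) ^ (k - 1)) * c)"
      unfolding norm_le_eq_norm_leE .
  qed
qed

end

section \<open>Boundedness of differences in the weighted norms\<close>

lemma fdiff_abs_le_sum: "\<bar>fdiff k h g x\<bar> \<le> (\<Sum>i=0..k. 2 ^ k * \<bar>g (x + real i * h)\<bar>)"
  unfolding fdiff_def
proof (rule order.trans[OF sum_abs], intro sum_mono)
  fix i
  have "real (k choose i) \<le> 2 ^ k" using binomial_le_pow2[of k i] by simp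
  then show "\<bar>real (k choose i) * (-1) ^ (k - i) * g (x + real i * h)\<bar> \<le> 2 ^ k * \<bar>g (x + real i * h)\<bar>"
    by (simp add: abs_mult power_abs mult_right_mono)
qed

context slow_weight
begin

text \<open>The weight at \<open>x\<close> and at the shifted point are comparable. In the mean norm
  the rest is the change of variables \<open>x + \<tau> * phi x\<close>; in the sup norm the same
  change of variables shows that null sets pull back to null sets.\<close>

lemma shifted_norm_le:
  assumes c0: "c0 \<ge> 0"
  shows "\<exists>K\<ge>0. \<forall>n\<ge>1. \<forall>d>0. \<forall>\<tau>. d \<le> c0 / real n \<longrightarrow> \<bar>\<tau>\<bar> \<le> d \<longrightarrow> (\<forall>g\<in>borel_measurable borel. \<forall>p c.
    norm_le p (aw n) g c \<longrightarrow>
    norm_le p (aw n) (\<lambda>x. indicat_real (inner_zone d) x * g (x + \<tau> * phi x)) (ennreal K * c))"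
proof -
  obtain K where K: "K \<ge> 0" and cl: "\<forall>n\<ge>1. \<forall>x\<in>{-1..1}. \<forall>y\<in>{-1..1}. \<bar>y - x\<bar> \<le> c0 * rho n x \<longrightarrow>
    aw n x \<le> K * aw n y \<and> aw n y \<le> K * aw n x"
    using avg_weight_close[OF w c0] by (elim exE conjE)
  show ?thesis
  proof (intro exI[of _ "2 * K"] conjI allI ballI impI)
    show "0 \<le> 2 * K" using K by simp
    fix n :: nat and d \<tau> :: real and g :: "real \<Rightarrow> real" and p c
    assume n: "1 \<le> n" and d: "0 < d" "d \<le> c0 / real n" and \<tau>: "\<bar>\<tau>\<bar> \<le> d" and g[measurable]: "g \<in> borel_measurable borel"
      and nl: "norm_le p (aw n) g c"
    define u where "u y = ennreal (\<bar>g y\<bar> * aw n y)" for y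
    have [measurable]: "u \<in> borel_measurable borel" unfolding u_def by measurable
    have pt: "ennreal (\<bar>indicat_real (inner_zone d) x * g (x + \<tau> * phi x)\<bar> * aw n x)
      \<le> ennreal K * u (x + \<tau> * phi x) * indicator (inner_zone d) x" if x: "x \<in> {-1..1}" for x
    proof (cases "x \<in> inner_zone d")
      case True
      define y where "y = x + \<tau> * phi x"
      have ph: "phi x \<ge> 0" by (rule phi_nonneg[OF x])
      have dx: "\<bar>\<tau> * phi x\<bar> \<le> d * phi x" unfolding abs_mult using \<tau> ph by (intro mult_mono) auto
      then have y: "y \<in> {-1..1}" using True by (auto simp: y_def inner_zone_def abs_le_iff)
      have "\<bar>y - x\<bar> \<le> d * phi x" using dx by (simp add: y_def)
      also have "\<dots> \<le> c0 / real n * phi x" using d ph by (intro mult_right_mono) auto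
      also have "\<dots> = c0 * (phi x / real n)" by simp
      also have "\<dots> \<le> c0 * rho n x" using c0 by (intro mult_left_mono) (auto simp: rho_def phi_def)
      finally have aw: "aw n x \<le> K * aw n y" using cl n x y by blast
      have "\<bar>g y\<bar> * aw n x \<le> \<bar>g y\<bar> * (K * aw n y)" by (intro mult_left_mono aw) auto
      then have "ennreal (\<bar>g y\<bar> * aw n x) \<le> ennreal (K * (\<bar>g y\<bar> * aw n y))"
        by (intro ennreal_leI) (simp add: mult_ac)
      also have "\<dots> = ennreal K * u y" unfolding u_def using K by (rule ennreal_mult')
      finally show ?thesis using True by (simp add: y_def)
    qed simp
    show "norm_le p (aw n) (\<lambda>x. indicat_real (inner_zone d) x * g (x + \<tau> * phi x)) (ennreal (2 * K) * c)"
    proof (cases "p = 1")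
      case True
      have "(NN x\<in>{-1..1}. ennreal (\<bar>indicat_real (inner_zone d) x * g (x + \<tau> * phi x)\<bar> * aw n x))
        \<le> (NN x\<in>{-1..1}. ennreal K * u (x + \<tau> * phi x) * indicator (inner_zone d) x)"
        by (rule set_nn_integral_mono_on) (rule pt)
      also have "\<dots> \<le> (NN x\<in>inner_zone d. ennreal K * u (x + \<tau> * phi x))"
        by (rule nn_integral_mono) (auto simp: indicator_def)
      also have "\<dots> = ennreal K * (NN x\<in>inner_zone d. u (x + \<tau> * phi x))"
        by (rule set_nn_integral_cmult) auto
      also have "\<dots> \<le> ennreal K * (2 * (NN y\<in>{-1..1}. u y))"
        by (intro mult_left_mono shift_integral_le d \<tau>) auto
      also have "\<dots> \<le> ennreal K * (2 * c)"
        using nl True unfolding u_def by (intro mult_left_mono) (auto simp: norm_le_def)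
      also have "\<dots> = ennreal (2 * K) * c" using K by (simp add: ennreal_mult' mult_ac)
      finally show ?thesis using True by (simp add: norm_le_def)
    next
      case False
      then have ae: "AE y in lborel. y \<in> {-1..1} \<longrightarrow> u y \<le> c" using nl by (simp add: norm_le_def u_def)
      \<comment> \<open>The indicator of the exceptional null set is integrated along the
        shift.\<close>
      define b :: "real \<Rightarrow> ennreal" where "b y = indicator {y. \<not> u y \<le> c} y" for y
      have [measurable]: "b \<in> borel_measurable borel" unfolding b_def by measurable
      have "(NN y\<in>{-1..1}. b y) = (NN (y::real). 0)"
        by (rule nn_integral_cong_AE, use ae in eventually_elim) (auto simp: b_def indicator_def)
      then have "(NN x\<in>inner_zone d. b (x + \<tau> * phi x)) = 0"
        using shift_integral_le[of b d \<tau>] d \<tau> by simp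
      then have "AE x in lborel. b (x + \<tau> * phi x) * indicator (inner_zone d) x = 0"
        by (subst (asm) nn_integral_0_iff_AE) auto
      then have "AE x in lborel. x \<in> {-1..1} \<longrightarrow> ennreal (\<bar>indicat_real (inner_zone d) x * g (x + \<tau> * phi x)\<bar> * aw n x) \<le> ennreal (2 * K) * c"
      proof eventually_elim
        case (elim x)
        show ?case
        proof
          assume x: "x \<in> {-1..1}"
          have "ennreal K * u (x + \<tau> * phi x) * indicator (inner_zone d) x \<le> ennreal K * c"
            using elim by (auto simp: b_def indicator_def intro!: mult_left_mono split: if_splits)
          also have "\<dots> \<le> ennreal (2 * K) * c" using K by (intro mult_right_mono ennreal_leI) auto
          finally show "ennreal (\<bar>indicat_real (inner_zone d) x * g (x + \<tau> * phi x)\<bar> * aw n x) \<le> ennreal (2 * K) * c"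
            using pt[OF x] by (rule order.trans[rotated])
        qed
      qed
      then show ?thesis using False by (simp add: norm_le_def)
    qed
  qed
qed

text \<open>A difference combines \<open>k + 1\<close> shifts by \<open>\<tau> i * phi x\<close>
  with \<open>|\<tau> i| <= k * h / 2\<close>, and it is truncated to zero outside the inner
  zone.\<close>

lemma central_difference_norm_le:
  assumes k: "k \<ge> 1"
  shows "\<exists>K\<ge>0. \<forall>n\<ge>1. \<forall>h>0. h \<le> 1 / real n \<longrightarrow> (\<forall>g\<in>borel_measurable borel. \<forall>p c.
    norm_le p (aw n) g c \<longrightarrow>
    norm_le p (aw n) (\<lambda>x. central_difference k (h * phi x) g x) (ennreal K * c))"
proof -
  have "0 \<le> real k / 2" by simp
  from shifted_norm_le[OF this] obtain K where K: "K \<ge> 0" and sh: "\<forall>n\<ge>1. \<forall>d>0. \<forall>\<tau>. d \<le> real k / 2 / real n \<longrightarrow> \<bar>\<tau>\<bar> \<le> d \<longrightarrow> (\<forall>g\<in>borel_measurable borel. \<forall>p c.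
    norm_le p (aw n) g c \<longrightarrow>
    norm_le p (aw n) (\<lambda>x. indicat_real (inner_zone d) x * g (x + \<tau> * phi x)) (ennreal K * c))"
    by (elim exE conjE)
  show ?thesis
  proof (intro exI[of _ "2 ^ k * ((real k + 1) * K)"] conjI allI ballI impI)
    show "0 \<le> 2 ^ k * ((real k + 1) * K)" using K by simp
    fix n :: nat and h :: real and g :: "real \<Rightarrow> real" and p c
    assume n: "1 \<le> n" and h: "0 < h" "h \<le> 1 / real n" and g[measurable]: "g \<in> borel_measurable borel"
      and nl: "norm_le p (aw n) g c"
    define d where "d = real k * h / 2"
    have d: "d > 0" "d \<le> real k / 2 / real n"
    proof -
      show "d > 0" using k h by (simp add: d_def)
      have "real k / 2 * h \<le> real k / 2 * (1 / real n)" using h by (intro mult_left_mono) auto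
      then show "d \<le> real k / 2 / real n" by (simp add: d_def)
    qed
    define \<tau> where "\<tau> i = (real i - real k / 2) * h" for i
    have \<tau>: "\<bar>\<tau> i\<bar> \<le> d" if "i \<le> k" for i
    proof -
      have "real i \<le> real k" using that by simp
      then have "\<bar>real i - real k / 2\<bar> \<le> real k / 2" by linarith
      then have "\<bar>real i - real k / 2\<bar> * h \<le> real k / 2 * h" using h by (intro mult_right_mono) auto
      then show ?thesis using h by (simp add: \<tau>_def d_def abs_mult)
    qed
    define G where "G i x = \<bar>indicat_real (inner_zone d) x * g (x + \<tau> i * phi x)\<bar>" for i x
    have Gm[measurable]: "G i \<in> borel_measurable borel" for i unfolding G_def[abs_def] by measurable
    have "norm_le p (aw n) (G i) (ennreal K * c)" if "i \<in> {0..k}" for i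
    proof -
      have "norm_le p (aw n) (\<lambda>x. indicat_real (inner_zone d) x * g (x + \<tau> i * phi x)) (ennreal K * c)"
        using sh[rule_format, OF n d \<tau> g nl] that by auto
      then show ?thesis unfolding norm_le_def G_def abs_abs .
    qed
    then have S: "norm_le p (aw n) (\<lambda>x. \<Sum>i=0..k. G i x) (\<Sum>i=0..k. ennreal K * c)"
      by (intro norm_le_sum) (auto intro!: avg_weight_nonneg[OF w n])
    have "norm_le p (aw n) (\<lambda>x. central_difference k (h * phi x) g x) (ennreal (2 ^ k) * (\<Sum>i=0..k. ennreal K * c))"
    proof (rule norm_le_scale[OF _ _ _ _ _ _ S])
      fix x :: real assume x: "x \<in> {-1..1}"
      have "\<bar>central_difference k (h * phi x) g x\<bar> \<le> 2 ^ k * \<bar>\<Sum>i=0..k. G i x\<bar>"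
      proof (cases "x \<in> inner_zone d")
        case False
        then have "central_difference k (h * phi x) g x = 0"
          using x unfolding central_difference_def inner_zone_def d_def by (auto simp: mult.assoc)
        then show ?thesis by simp
      next
        case True
        have "\<bar>central_difference k (h * phi x) g x\<bar> \<le> \<bar>fdiff k (h * phi x) g (x - real k * (h * phi x) / 2)\<bar>"
          unfolding central_difference_eq_fdiff by simp
        also have "\<dots> \<le> (\<Sum>i=0..k. 2 ^ k * \<bar>g (x - real k * (h * phi x) / 2 + real i * (h * phi x))\<bar>)"
          by (rule fdiff_abs_le_sum)
        also have "\<dots> = (\<Sum>i=0..k. 2 ^ k * G i x)"
        proof (intro sum.cong refl)
          fix i
          have e: "x - real k * (h * phi x) / 2 + real i * (h * phi x) = x + \<tau> i * phi x"
            by (simp add: \<tau>_def algebra_simps)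
          show "2 ^ k * \<bar>g (x - real k * (h * phi x) / 2 + real i * (h * phi x))\<bar> = 2 ^ k * G i x"
            unfolding e using True by (simp add: G_def)
        qed
        also have "\<dots> = 2 ^ k * (\<Sum>i=0..k. G i x)" by (simp add: sum_distrib_left)
        also have "\<dots> \<le> 2 ^ k * \<bar>\<Sum>i=0..k. G i x\<bar>" by simp
        finally show ?thesis .
      qed
      then show "\<bar>central_difference k (h * phi x) g x\<bar> * aw n x \<le> 2 ^ k * (\<bar>\<Sum>i=0..k. G i x\<bar> * aw n x)"
        using avg_weight_nonneg[OF w n x] by (simp add: mult.assoc[symmetric] mult_right_mono)
    qed (auto intro!: borel_measurable_sum)
    also have "ennreal (2 ^ k) * (\<Sum>i=0..k. ennreal K * c) = ennreal (2 ^ k * ((real k + 1) * K)) * c"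
    proof -
      have "(\<Sum>i=0..k. ennreal K * c) = ennreal (real k + 1) * (ennreal K * c)"
        by (subst sum_constant) (simp add: ennreal_of_nat_eq_real_of_nat add.commute del: sum_constant)
      then have "ennreal (2 ^ k) * (\<Sum>i=0..k. ennreal K * c) = (ennreal (2 ^ k) * (ennreal (real k + 1) * ennreal K)) * c"
        by (simp only: mult.assoc)
      also have "ennreal (2 ^ k) * (ennreal (real k + 1) * ennreal K) = ennreal (2 ^ k * ((real k + 1) * K))"
        by (subst ennreal_mult'[symmetric], simp, subst ennreal_mult'[symmetric]) auto
      finally show ?thesis .
    qed
    finally show "norm_le p (aw n) (\<lambda>x. central_difference k (h * phi x) g x) (ennreal (2 ^ k * ((real k + 1) * K)) * c)" .
  qed
qed

end

section \<open>From approximation to smoothness\<close>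

lemma central_difference_add:
  "central_difference k h (\<lambda>y. f y + g y) x = central_difference k h f x + central_difference k h g x"
  by (simp add: central_difference_eq_fdiff fdiff_add)

lemma central_difference_sum:
  "central_difference k h (\<lambda>y. \<Sum>i\<in>I. f i y) x = (\<Sum>i\<in>I. central_difference k h (f i) x)"
proof (induction I rule: infinite_finite_induct)
  case (insert i I)
  then show ?case by (simp add: central_difference_add)
qed (simp_all add: central_difference_eq_fdiff fdiff_def)

text \<open>Read backwards the sum is geometric with ratio \<open>2 powr - \<beta>\<close>, so the
  last term dominates.\<close>

lemma sum_geometric_powr_le:
  fixes \<beta> :: real
  assumes \<beta>: "\<beta> > 0"
  shows "(\<Sum>i\<in>{a..b}. (2::real) powr (\<beta> * real i)) \<le> 2 powr (\<beta> * real b) / (1 - 2 powr - \<beta>)"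
proof -
  define q where "q = 2 powr - \<beta>"
  have q: "0 < q" "q < 1" using \<beta> by (auto simp: q_def powr_less_one)
  have "(\<Sum>i\<in>{a..b}. (2::real) powr (\<beta> * real i)) \<le> (\<Sum>i\<in>{..b}. (2::real) powr (\<beta> * real i))"
    by (rule sum_mono2) auto
  also have "\<dots> = (\<Sum>i\<in>{..b}. 2 powr (\<beta> * real (b - i)))"
    by (rule sum.reindex_bij_witness[of _ "\<lambda>i. b - i" "\<lambda>i. b - i"]) auto
  also have "\<dots> = (\<Sum>i\<in>{..b}. 2 powr (\<beta> * real b) * q ^ i)"
  proof (intro sum.cong refl)
    fix i assume "i \<in> {..b}"
    then have "\<beta> * real (b - i) = \<beta> * real b + real i * (- \<beta>)" by (simp add: of_nat_diff algebra_simps)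
    moreover have "2 powr (real i * (- \<beta>)) = q ^ i"
      by (simp add: q_def powr_realpow[symmetric] powr_powr mult.commute)
    ultimately show "2 powr (\<beta> * real (b - i)) = 2 powr (\<beta> * real b) * q ^ i" by (simp only: powr_add)
  qed
  also have "\<dots> = 2 powr (\<beta> * real b) * (\<Sum>i\<in>{..b}. q ^ i)" by (simp add: sum_distrib_left)
  also have "\<dots> \<le> 2 powr (\<beta> * real b) * (1 / (1 - q))"
  proof (intro mult_left_mono)
    have "(\<Sum>i\<in>{..b}. q ^ i) = (1 - q ^ Suc b) / (1 - q)" using q by (simp add: sum_gp0)
    also have "\<dots> \<le> 1 / (1 - q)" using q by (intro divide_right_mono) auto
    finally show "(\<Sum>i\<in>{..b}. q ^ i) \<le> 1 / (1 - q)" .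
  qed simp
  finally show ?thesis by (simp add: q_def)
qed

lemma ex_dyadic:
  fixes n :: nat
  assumes "n \<ge> 1"
  shows "\<exists>J. 2 ^ J \<le> n \<and> n < 2 ^ Suc J"
proof -
  define J where "J = (LEAST j. n < 2 ^ Suc j)"
  have ex: "\<exists>j. n < 2 ^ Suc j" by (rule exI[of _ n], rule less_le_trans[OF less_exp]) simp
  have 1: "n < 2 ^ Suc J" unfolding J_def by (rule LeastI_ex[OF ex])
  have "2 ^ J \<le> n"
  proof (cases J)
    case 0 then show ?thesis using assms by simp
  next
    case (Suc j)
    then have "\<not> n < 2 ^ Suc j" unfolding J_def by (metis lessI not_less_Least)
    then show ?thesis unfolding Suc by (simp only: not_less)
  qed
  with 1 show ?thesis by blast
qed

context slow_weight
begin

lemma poly_norm_le_finite: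
  assumes m: "m \<ge> 1"
  shows "\<exists>c\<ge>0. norm_le p (aw m) (poly q) (ennreal c)"
proof -
  have "compact (poly q ` {-1..1})" by (intro compact_continuous_image continuous_intros) auto
  then have "bounded (poly q ` {-1..1})" by (rule compact_imp_bounded)
  then obtain B where "\<forall>y\<in>poly q ` {-1..1}. norm y \<le> B" unfolding bounded_iff by (elim exE)
  then have B: "\<bar>poly q x\<bar> \<le> B" if "x \<in> {-1..1}" for x using that by simp
  have B0: "B \<ge> 0" using B[of 0] by auto
  define W where "W = C * (1 + real m * pi) ^ s * aw m (cos 0)"
  have W0: "W \<ge> 0" unfolding W_def using C aw_nonneg[OF m, of 0] by simp
  have pt: "\<bar>poly q x\<bar> * aw m x \<le> B * W" if x: "x \<in> {-1..1}" for x
  proof -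
    have "aw m (cos (ang x)) \<le> C * (1 + real m * \<bar>ang x - 0\<bar>) ^ s * aw m (cos 0)"
      by (rule slow) (use m ang(1)[of x] in auto)
    also have "\<dots> \<le> W" unfolding W_def using C ang(1)[of x] aw_nonneg[OF m, of 0]
      by (intro mult_right_mono mult_left_mono power_mono add_left_mono) auto
    finally show ?thesis using B[OF x] B0 avg_weight_nonneg[OF w m x] ang(2)[OF x] by (intro mult_mono) auto
  qed
  have "norm_le p (aw m) (poly q) (ennreal (2 * (B * W)))"
  proof (cases "p = 1")
    case True
    have "(NN x\<in>{-1..1}. ennreal (\<bar>poly q x\<bar> * aw m x)) \<le> (NN (x::real)\<in>{-1..1}. ennreal (B * W))"
      by (rule set_nn_integral_mono_on, rule ennreal_leI, rule pt)
    also have "\<dots> = ennreal (B * W) * 2" by (simp add: nn_integral_cmult_indicator)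
    also have "\<dots> = ennreal (2 * (B * W))" using B0 W0 by (subst ennreal_mult') (auto simp: mult.commute)
    finally show ?thesis using True by (simp add: norm_le_def)
  next
    case False
    have "ennreal (\<bar>poly q x\<bar> * aw m x) \<le> ennreal (2 * (B * W))" if "x \<in> {-1..1}" for x
      using pt[OF that] mult_nonneg_nonneg[OF B0 W0] by (intro ennreal_leI) linarith
    then show ?thesis using False by (simp add: norm_le_def)
  qed
  then show ?thesis using B0 W0 by (intro exI[of _ "2 * (B * W)"]) auto
qed

text \<open>The weight grows at most by the quotient of the values of \<open>rho\<close>, hence by
  the square of \<open>n / m\<close>.\<close>

lemma norm_le_refine:
  assumes mn: "1 \<le> m" "m \<le> n" and Q: "(real n / real m)\<^sup>2 \<le> Q" and [measurable]: "g \<in> borel_measurable borel"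
    and nl: "norm_le p (aw m) g c"
  shows "norm_le p (aw n) g (ennreal Q * c)"
proof (rule norm_le_scale[OF _ _ _ _ _ _ nl])
  show "Q \<ge> 0" using Q by (rule order.trans[rotated]) simp
  fix x :: real assume x: "x \<in> {-1..1}"
  have n: "1 \<le> n" using mn by simp
  have "aw n x \<le> rho m x / rho n x * aw m x" by (rule avg_weight_le[OF w mn x])
  also have "\<dots> \<le> Q * aw m x"
    using rho_quotient_le(2)[OF mn x] Q avg_weight_nonneg[OF w mn(1) x] by (intro mult_right_mono) auto
  finally have "\<bar>g x\<bar> * aw n x \<le> \<bar>g x\<bar> * (Q * aw m x)" by (intro mult_left_mono) auto
  then show "\<bar>g x\<bar> * aw n x \<le> Q * (\<bar>g x\<bar> * aw m x)" by (simp add: mult_ac)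
qed auto

theorem inverse_rate:
  assumes r: "r \<ge> 1" and \<alpha>: "0 < \<alpha>" "\<alpha> < real r" and f[measurable]: "f \<in> borel_measurable borel" and E: "E \<ge> 0"
    and P: "\<And>n. n \<ge> n0 \<Longrightarrow> degree (P n) < n \<and> norm_le p (aw n) (\<lambda>x. f x - poly (P n) x) (ennreal (E * real n powr - \<alpha>))"
  shows "\<exists>D\<ge>0. \<exists>N. \<forall>n\<ge>N. \<forall>h>0. h \<le> 1 / real n \<longrightarrow>
    norm_le p (aw n) (\<lambda>x. central_difference (r + 1) (h * phi x) f x) (ennreal (D * real n powr - \<alpha>))"
proof -
  define k where "k = r + 1"
  have k: "k \<ge> 1" "k - 1 = r" by (auto simp: k_def)
  obtain K1 where K1: "K1 \<ge> 0" and cd1: "\<forall>n\<ge>1. \<forall>h>0. h \<le> 1 / real n \<longrightarrow> (\<forall>g\<in>borel_measurable borel. \<forall>p c.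
    norm_le p (aw n) g c \<longrightarrow>
    norm_le p (aw n) (\<lambda>x. central_difference k (h * phi x) g x) (ennreal K1 * c))"
    using central_difference_norm_le[OF k(1)] by (elim exE conjE)
  obtain K2 where K2: "K2 \<ge> 0" and cd2: "\<forall>m\<ge>1. \<forall>n\<ge>m. \<forall>h>0. h \<le> 1 / real n \<longrightarrow> (\<forall>q p c. degree q \<le> m \<longrightarrow> norm_le p (aw m) (poly q) c \<longrightarrow>
    norm_le p (aw n) (\<lambda>x. central_difference k (h * phi x) (poly q) x) (ennreal (K2 * (real m / real n) ^ (k - 1)) * c))"
    using central_difference_poly_norm[OF k(1)] by (elim exE conjE)
  \<comment> \<open>Since \<open>n0 < 2 ^ n0\<close>, the number \<open>n0\<close> itself is a
    sufficient dyadic level.\<close>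
  define j0 where "j0 = n0"
  have j0: "2 ^ j \<ge> n0" if "j \<ge> j0" for j :: nat
    using that less_exp[of j] unfolding j0_def by linarith
  have m1: "(1::nat) \<le> 2 ^ j" for j by simp
  define \<beta> where "\<beta> = real r - \<alpha>"
  have \<beta>: "\<beta> > 0" using \<alpha> by (simp add: \<beta>_def)
  obtain c0 where c0: "c0 \<ge> 0" "norm_le p (aw (2 ^ j0)) (poly (P (2 ^ j0))) (ennreal c0)"
    using poly_norm_le_finite[OF m1] by blast
  \<comment> \<open>\<open>Q j\<close> is the difference of the approximants at levels
    \<open>j + 1\<close> and \<open>j\<close>; the error of the latter is larger by
    \<open>2 powr \<alpha>\<close>, and its weight changes by the factor 4.\<close>
  define E' where "E' = E + 4 * (E * 2 powr \<alpha>)"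
  have E': "E' \<ge> 0" using E by (simp add: E'_def)
  \<comment> \<open>The summands belong, in this order, to the error at the last dyadic level, to
    the dyadic blocks, and to the initial polynomial.\<close>
  define D where "D = K1 * (4 * (E * 2 powr \<alpha>)) + K2 * E' / (1 - 2 powr - \<beta>) + K2 * (2 ^ j0) ^ r * c0"
  have g: "1 - 2 powr - \<beta> > 0" using \<beta> by (simp add: powr_less_one)
  have D: "D \<ge> 0" unfolding D_def using K1 K2 E E' c0 g by (intro add_nonneg_nonneg mult_nonneg_nonneg divide_nonneg_pos) auto
  define Q where "Q j = P (2 ^ Suc j) - P (2 ^ j)" for j
  have Q: "norm_le p (aw (2 ^ Suc j)) (poly (Q j)) (ennreal (E' * 2 powr (- \<alpha> * real (Suc j))))" "degree (Q j) \<le> 2 ^ Suc j"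
    if j: "j \<ge> j0" for j
  proof -
    let ?m = "2 ^ Suc j :: nat" and ?l = "2 ^ j :: nat"
    have Pm: "degree (P ?m) < ?m" "norm_le p (aw ?m) (\<lambda>x. f x - poly (P ?m) x) (ennreal (E * real ?m powr - \<alpha>))"
      using P[OF j0[of "Suc j"]] j by auto
    have Pl: "degree (P ?l) < ?l" "norm_le p (aw ?l) (\<lambda>x. f x - poly (P ?l) x) (ennreal (E * real ?l powr - \<alpha>))"
      using P[OF j0[OF j]] by auto
    have pw: "real (2 ^ i) powr - \<alpha> = 2 powr (- \<alpha> * real i)" for i :: nat
      by (simp add: powr_powr powr_realpow[symmetric] mult.commute)
    have dl: "(?l :: nat) \<le> ?m" by simp
    have "norm_le p (aw ?m) (\<lambda>x. f x - poly (P ?l) x) (ennreal 4 * ennreal (E * real ?l powr - \<alpha>))"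
      by (rule norm_le_refine[OF m1 dl _ _ Pl(2)]) auto
    moreover have "norm_le p (aw ?m) (\<lambda>x. poly (P ?m) x - f x) (ennreal (E * real ?m powr - \<alpha>))"
      using Pm(2) unfolding norm_le_def by (simp only: abs_minus_commute)
    ultimately have "norm_le p (aw ?m) (\<lambda>x. (poly (P ?m) x - f x) + (f x - poly (P ?l) x))
      (ennreal (E * real ?m powr - \<alpha>) + ennreal 4 * ennreal (E * real ?l powr - \<alpha>))"
      by (intro norm_le_add) (auto intro!: avg_weight_nonneg[OF w])
    moreover have "ennreal (E * real ?m powr - \<alpha>) + ennreal 4 * ennreal (E * real ?l powr - \<alpha>) = ennreal (E' * 2 powr (- \<alpha> * real (Suc j)))"
    proof -
      have "2 powr (- \<alpha> * real j) = 2 powr (\<alpha> + - \<alpha> * real (Suc j))" by (simp add: algebra_simps)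
      also have "\<dots> = 2 powr \<alpha> * 2 powr (- \<alpha> * real (Suc j))" by (rule powr_add)
      finally have "E * 2 powr (- \<alpha> * real (Suc j)) + 4 * (E * 2 powr (- \<alpha> * real j)) = E' * 2 powr (- \<alpha> * real (Suc j))"
        by (simp add: E'_def algebra_simps)
      moreover have "ennreal 4 * ennreal (E * 2 powr (- \<alpha> * real j)) = ennreal (4 * (E * 2 powr (- \<alpha> * real j)))"
        by (rule ennreal_mult'[symmetric]) simp
      ultimately show ?thesis unfolding pw using E by (metis ennreal_plus mult_nonneg_nonneg powr_ge_zero zero_le_numeral)
    qed
    moreover have "(\<lambda>x. (poly (P ?m) x - f x) + (f x - poly (P ?l) x)) = poly (Q j)" by (simp add: Q_def fun_eq_iff)
    ultimately show "norm_le p (aw ?m) (poly (Q j)) (ennreal (E' * 2 powr (- \<alpha> * real (Suc j))))" by simp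
    show "degree (Q j) \<le> ?m" unfolding Q_def using Pm(1) Pl(1) by (intro degree_diff_le) auto
  qed
  show ?thesis
  proof (intro exI[of _ D] conjI exI[of _ "2 ^ j0"] allI impI D)
    fix n :: nat and h :: real assume n: "2 ^ j0 \<le> n" and h: "0 < h" "h \<le> 1 / real n"
    have n1: "n \<ge> 1" using n m1[of j0] by linarith
    obtain J where J: "2 ^ J \<le> n" "n < 2 ^ Suc J" using ex_dyadic[OF n1] by blast
    have J0: "j0 \<le> J"
    proof (rule ccontr)
      assume "\<not> j0 \<le> J"
      then have "(2::nat) ^ Suc J \<le> 2 ^ j0" by (intro power_increasing) auto
      then show False using J n by linarith
    qed
    have Jn: "real (2 ^ J) powr - \<alpha> \<le> 2 powr \<alpha> * real n powr - \<alpha>"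
    proof -
      have "real n < real (2 ^ Suc J)" using J(2) by (simp only: of_nat_less_iff)
      then have "real n \<le> 2 * real (2 ^ J)" by simp
      then have "(2 * real (2 ^ J)) powr - \<alpha> \<le> real n powr - \<alpha>" using n1 \<alpha> by (intro powr_mono2') auto
      then have "2 powr - \<alpha> * real (2 ^ J) powr - \<alpha> \<le> real n powr - \<alpha>" by (simp add: powr_mult)
      then have "2 powr \<alpha> * (2 powr - \<alpha> * real (2 ^ J) powr - \<alpha>) \<le> 2 powr \<alpha> * real n powr - \<alpha>" by (rule mult_left_mono) simp
      moreover have "2 powr \<alpha> * 2 powr - \<alpha> = 1" by (simp add: powr_add[symmetric])
      ultimately show ?thesis by (simp only: mult.assoc[symmetric] mult_1_left)
    qed
    define c where "c g x = central_difference k (h * phi x) g x" for g x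
    have cm[measurable]: "c g \<in> borel_measurable borel" if [measurable]: "g \<in> borel_measurable borel" for g
      unfolding c_def[abs_def] by measurable
    have t1: "norm_le p (aw n) (c (\<lambda>x. f x - poly (P (2 ^ J)) x)) (ennreal (K1 * (4 * (E * 2 powr \<alpha>)) * real n powr - \<alpha>))"
    proof -
      have "norm_le p (aw (2 ^ J)) (\<lambda>x. f x - poly (P (2 ^ J)) x) (ennreal (E * real (2 ^ J) powr - \<alpha>))"
        using P[OF j0[OF J0]] by blast
      then have "norm_le p (aw n) (\<lambda>x. f x - poly (P (2 ^ J)) x) (ennreal 4 * ennreal (E * real (2 ^ J) powr - \<alpha>))"
      proof (rule norm_le_refine[OF m1 J(1), rotated 2])
        have "real n < real (2 ^ Suc J)" using J(2) by (simp only: of_nat_less_iff)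
        then have "real n / real (2 ^ J) \<le> 2" by (simp add: divide_le_eq)
        then have "(real n / real (2 ^ J))\<^sup>2 \<le> 2\<^sup>2" by (intro power_mono) auto
        then show "(real n / real (2 ^ J))\<^sup>2 \<le> 4" by simp
      qed measurable
      from cd1[rule_format, OF n1 h _ this]
      have "norm_le p (aw n) (c (\<lambda>x. f x - poly (P (2 ^ J)) x)) (ennreal K1 * (ennreal 4 * ennreal (E * real (2 ^ J) powr - \<alpha>)))"
        unfolding c_def[abs_def] by measurable
      then show ?thesis
      proof (rule norm_le_mono)
        have "ennreal K1 * (ennreal 4 * ennreal (E * real (2 ^ J) powr - \<alpha>)) = ennreal (K1 * (4 * (E * real (2 ^ J) powr - \<alpha>)))"
          using K1 by (simp only: ennreal_mult' zero_le_numeral)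
        also have "\<dots> \<le> ennreal (K1 * (4 * (E * (2 powr \<alpha> * real n powr - \<alpha>))))"
          using K1 E Jn by (intro ennreal_leI mult_left_mono) auto
        finally show "ennreal K1 * (ennreal 4 * ennreal (E * real (2 ^ J) powr - \<alpha>)) \<le> ennreal (K1 * (4 * (E * 2 powr \<alpha>)) * real n powr - \<alpha>)"
          by (simp only: mult.assoc)
      qed
    qed
    have n0': "real n > 0" using n1 by simp
    \<comment> \<open>The gain \<open>n powr - r\<close> of the differences is set against the
      growth \<open>n powr \<beta>\<close> of the dyadic sum, with
      \<open>\<beta> = r - \<alpha> > 0\<close>.\<close>
    have npow: "real n powr - \<alpha> = real n powr \<beta> * (1 / real n) ^ r"
    proof -
      have "real n powr - \<alpha> = real n powr (\<beta> + - real r)" by (simp add: \<beta>_def)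
      also have "\<dots> = real n powr \<beta> * real n powr - real r" by (rule powr_add)
      also have "real n powr - real r = (1 / real n) ^ r" using n0' by (simp add: powr_minus powr_realpow power_one_over inverse_eq_divide)
      finally show ?thesis .
    qed
    have t2: "norm_le p (aw n) (\<lambda>x. \<Sum>j\<in>{j0..<J}. c (poly (Q j)) x) (ennreal (K2 * E' / (1 - 2 powr - \<beta>) * real n powr - \<alpha>))"
    proof -
      have "norm_le p (aw n) (\<lambda>x. \<Sum>j\<in>{j0..<J}. c (poly (Q j)) x)
        (\<Sum>j\<in>{j0..<J}. ennreal (K2 * (real (2 ^ Suc j) / real n) ^ r) * ennreal (E' * 2 powr (- \<alpha> * real (Suc j))))"
      proof (rule norm_le_sum)
        fix j assume j: "j \<in> {j0..<J}"
        have "(2::nat) ^ Suc j \<le> 2 ^ J" using j by (intro power_increasing) auto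
        then have le: "(2::nat) ^ Suc j \<le> n" using J(1) by linarith
        show "norm_le p (aw n) (c (poly (Q j))) (ennreal (K2 * (real (2 ^ Suc j) / real n) ^ r) * ennreal (E' * 2 powr (- \<alpha> * real (Suc j))))"
          using cd2[rule_format, OF m1 le h Q(2) Q(1)] j unfolding c_def[abs_def] k(2) by auto
      qed (auto intro!: avg_weight_nonneg[OF w n1])
      then show ?thesis
      proof (rule norm_le_mono)
        have trm: "ennreal (K2 * (real (2 ^ Suc j) / real n) ^ r) * ennreal (E' * 2 powr (- \<alpha> * real (Suc j)))
          = ennreal (K2 * E' * (1 / real n) ^ r * 2 powr (\<beta> * real (Suc j)))" for j
        proof -
          have e1: "(real (2 ^ Suc j) / real n) ^ r = 2 powr (real r * real (Suc j)) * (1 / real n) ^ r"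
          proof -
            have "real (2 ^ Suc j) ^ r = 2 powr (real r * real (Suc j))"
              by (simp add: powr_realpow[symmetric] powr_powr mult.commute del: power_Suc)
            then show ?thesis by (simp add: power_divide)
          qed
          have e2: "2 powr (real r * real (Suc j)) * 2 powr (- \<alpha> * real (Suc j)) = 2 powr (\<beta> * real (Suc j))"
            by (simp only: powr_add[symmetric] \<beta>_def) (simp add: algebra_simps)
          have "K2 * (real (2 ^ Suc j) / real n) ^ r * (E' * 2 powr (- \<alpha> * real (Suc j))) = K2 * E' * (1 / real n) ^ r * 2 powr (\<beta> * real (Suc j))"
            unfolding e1 e2[symmetric] by (simp only: mult_ac)
          moreover have "0 \<le> K2 * (real (2 ^ Suc j) / real n) ^ r" using K2 by simp
          ultimately show ?thesis by (metis ennreal_mult')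
        qed
        have "(\<Sum>j\<in>{j0..<J}. ennreal (K2 * (real (2 ^ Suc j) / real n) ^ r) * ennreal (E' * 2 powr (- \<alpha> * real (Suc j))))
          = ennreal (\<Sum>j\<in>{j0..<J}. K2 * E' * (1 / real n) ^ r * 2 powr (\<beta> * real (Suc j)))"
          unfolding trm using K2 E' by (intro sum_ennreal) auto
        also have "\<dots> \<le> ennreal (K2 * E' / (1 - 2 powr - \<beta>) * real n powr - \<alpha>)"
        proof (rule ennreal_leI)
          have "(\<Sum>j\<in>{j0..<J}. 2 powr (\<beta> * real (Suc j))) = (\<Sum>i\<in>{Suc j0..J}. 2 powr (\<beta> * real i))"
            by (rule sum.reindex_bij_witness[of _ "\<lambda>i. i - 1" Suc]) auto
          also have "\<dots> \<le> 2 powr (\<beta> * real J) / (1 - 2 powr - \<beta>)" by (rule sum_geometric_powr_le[OF \<beta>])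
          also have "\<dots> \<le> real n powr \<beta> / (1 - 2 powr - \<beta>)"
          proof (rule divide_right_mono)
            have "2 powr (\<beta> * real J) = real (2 ^ J) powr \<beta>" by (simp add: powr_powr powr_realpow[symmetric] mult.commute)
            also have "\<dots> \<le> real n powr \<beta>" using J(1) \<beta> by (intro powr_mono2) (auto simp del: of_nat_power simp flip: of_nat_le_iff)
            finally show "2 powr (\<beta> * real J) \<le> real n powr \<beta>" .
          qed (use g in simp)
          finally have "K2 * E' * (1 / real n) ^ r * (\<Sum>j\<in>{j0..<J}. 2 powr (\<beta> * real (Suc j))) \<le> K2 * E' * (1 / real n) ^ r * (real n powr \<beta> / (1 - 2 powr - \<beta>))"
            using K2 E' by (intro mult_left_mono) auto
          also have "\<dots> = K2 * E' / (1 - 2 powr - \<beta>) * real n powr - \<alpha>" unfolding npow by simp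
          finally show "(\<Sum>j\<in>{j0..<J}. K2 * E' * (1 / real n) ^ r * 2 powr (\<beta> * real (Suc j))) \<le> K2 * E' / (1 - 2 powr - \<beta>) * real n powr - \<alpha>"
            by (simp only: sum_distrib_left)
        qed
        finally show "(\<Sum>j\<in>{j0..<J}. ennreal (K2 * (real (2 ^ Suc j) / real n) ^ r) * ennreal (E' * 2 powr (- \<alpha> * real (Suc j))))
          \<le> ennreal (K2 * E' / (1 - 2 powr - \<beta>) * real n powr - \<alpha>)" .
      qed
    qed
    have t3: "norm_le p (aw n) (c (poly (P (2 ^ j0)))) (ennreal (K2 * (2 ^ j0) ^ r * c0 * real n powr - \<alpha>))"
    proof -
      have dP: "degree (P (2 ^ j0)) \<le> 2 ^ j0" using P[OF j0[of j0]] by auto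
      have "norm_le p (aw n) (c (poly (P (2 ^ j0)))) (ennreal (K2 * (real (2 ^ j0) / real n) ^ r) * ennreal c0)"
        using cd2[rule_format, OF m1 n h dP c0(2)] unfolding c_def[abs_def] k(2) .
      then show ?thesis
      proof (rule norm_le_mono)
        \<comment> \<open>The fixed initial polynomial even has the better order
          \<open>n powr - r\<close>.\<close>
        have "(1 / real n) ^ r * 1 \<le> (1 / real n) ^ r * real n powr \<beta>"
          using n1 \<beta> by (intro mult_left_mono ge_one_powr_ge_zero) auto
        then have "(1 / real n) ^ r \<le> real n powr - \<alpha>" unfolding npow by (simp add: mult.commute)
        then have "K2 * (2 ^ j0) ^ r * c0 * (1 / real n) ^ r \<le> K2 * (2 ^ j0) ^ r * c0 * real n powr - \<alpha>"
          using K2 c0 by (intro mult_left_mono) auto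
        then have "ennreal (K2 * (real (2 ^ j0) / real n) ^ r * c0) \<le> ennreal (K2 * (2 ^ j0) ^ r * c0 * real n powr - \<alpha>)"
          by (intro ennreal_leI) (simp add: power_divide mult_ac)
        then show "ennreal (K2 * (real (2 ^ j0) / real n) ^ r) * ennreal c0 \<le> ennreal (K2 * (2 ^ j0) ^ r * c0 * real n powr - \<alpha>)"
          using K2 by (subst ennreal_mult'[symmetric]) auto
      qed
    qed
    have tele: "f x = (f x - poly (P (2 ^ J)) x) + ((\<Sum>j\<in>{j0..<J}. poly (Q j) x) + poly (P (2 ^ j0)) x)" for x
      using sum_Suc_diff'[OF J0, of "\<lambda>j. poly (P (2 ^ j)) x"] by (simp add: Q_def)
    have "c f = (\<lambda>x. c (\<lambda>x. f x - poly (P (2 ^ J)) x) x + ((\<Sum>j\<in>{j0..<J}. c (poly (Q j)) x) + c (poly (P (2 ^ j0))) x))"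
    proof
      fix x
      have "c f x = central_difference k (h * phi x) (\<lambda>x. (f x - poly (P (2 ^ J)) x) + ((\<Sum>j\<in>{j0..<J}. poly (Q j) x) + poly (P (2 ^ j0)) x)) x"
        unfolding c_def by (rule arg_cong[of _ _ "\<lambda>g. central_difference k (h * phi x) g x"]) (rule ext, rule tele)
      then show "c f x = c (\<lambda>x. f x - poly (P (2 ^ J)) x) x + ((\<Sum>j\<in>{j0..<J}. c (poly (Q j)) x) + c (poly (P (2 ^ j0))) x)"
        unfolding c_def central_difference_add central_difference_sum .
    qed
    moreover have "norm_le p (aw n) (\<lambda>x. c (\<lambda>x. f x - poly (P (2 ^ J)) x) x + ((\<Sum>j\<in>{j0..<J}. c (poly (Q j)) x) + c (poly (P (2 ^ j0))) x))
      (ennreal (K1 * (4 * (E * 2 powr \<alpha>)) * real n powr - \<alpha>) + (ennreal (K2 * E' / (1 - 2 powr - \<beta>) * real n powr - \<alpha>) + ennreal (K2 * (2 ^ j0) ^ r * c0 * real n powr - \<alpha>)))"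
      by (intro norm_le_add t1 t2 t3) (auto intro!: avg_weight_nonneg[OF w n1] borel_measurable_sum)
    moreover have "ennreal (K1 * (4 * (E * 2 powr \<alpha>)) * real n powr - \<alpha>) + (ennreal (K2 * E' / (1 - 2 powr - \<beta>) * real n powr - \<alpha>) + ennreal (K2 * (2 ^ j0) ^ r * c0 * real n powr - \<alpha>)) = ennreal (D * real n powr - \<alpha>)"
    proof -
      define A1 A2 A3 where "A1 = K1 * (4 * (E * 2 powr \<alpha>)) * real n powr - \<alpha>" and "A2 = K2 * E' / (1 - 2 powr - \<beta>) * real n powr - \<alpha>"
        and "A3 = K2 * (2 ^ j0) ^ r * c0 * real n powr - \<alpha>"
      have "0 \<le> A1" "0 \<le> A2" "0 \<le> A3" unfolding A1_def A2_def A3_def using K1 K2 E E' c0 g by auto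
      then have "ennreal A1 + (ennreal A2 + ennreal A3) = ennreal (A1 + (A2 + A3))" by simp
      also have "A1 + (A2 + A3) = D * real n powr - \<alpha>" by (simp only: A1_def A2_def A3_def D_def distrib_right add.assoc)
      finally show ?thesis unfolding A1_def A2_def A3_def .
    qed
    ultimately have "norm_le p (aw n) (c f) (ennreal (D * real n powr - \<alpha>))" by simp
    then show "norm_le p (aw n) (\<lambda>x. central_difference (r + 1) (h * phi x) f x) (ennreal (D * real n powr - \<alpha>))"
      unfolding c_def[abs_def] k_def .
  qed
qed

end

section \<open>Polynomials approximating a jump\<close>

definition even_trig :: "nat \<Rightarrow> (real \<Rightarrow> real) \<Rightarrow> bool" where
  "even_trig d g \<longleftrightarrow> (\<exists>a. \<forall>t. g t = (\<Sum>q\<le>d. a q * cos (real q * t)))"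

lemma even_trig_cos: "q \<le> d \<Longrightarrow> even_trig d (\<lambda>t. cos (real q * t))"
  unfolding even_trig_def by (intro exI[of _ "\<lambda>i. if i = q then 1 else 0"]) (auto simp: if_distrib[of "\<lambda>x. x * _"] cong: if_cong)

lemma even_trig_cmult: "even_trig d g \<Longrightarrow> even_trig d (\<lambda>t. c * g t)"
proof -
  assume "even_trig d g"
  then obtain a where "\<forall>t. g t = (\<Sum>q\<le>d. a q * cos (real q * t))" unfolding even_trig_def by (elim exE)
  then show ?thesis unfolding even_trig_def
    by (intro exI[of _ "\<lambda>q. c * a q"]) (simp add: sum_distrib_left mult.assoc)
qed

lemma even_trig_add: "even_trig d g \<Longrightarrow> even_trig d h \<Longrightarrow> even_trig d (\<lambda>t. g t + h t)"
proof -
  assume "even_trig d g" "even_trig d h"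
  then obtain a b where "\<forall>t. g t = (\<Sum>q\<le>d. a q * cos (real q * t))" "\<forall>t. h t = (\<Sum>q\<le>d. b q * cos (real q * t))"
    unfolding even_trig_def by (elim exE)
  then show ?thesis unfolding even_trig_def
    by (intro exI[of _ "\<lambda>q. a q + b q"]) (simp add: sum.distrib distrib_right)
qed

lemma even_trig_sum:
  "(\<And>i. i \<in> I \<Longrightarrow> even_trig d (g i)) \<Longrightarrow> even_trig d (\<lambda>t. \<Sum>i\<in>I. g i t)"
proof (induction I rule: infinite_finite_induct)
  case (insert i I)
  then show ?case by (simp add: even_trig_add)
qed (auto simp: even_trig_def intro: exI[of _ "\<lambda>_. 0"])

lemma even_trig_mult_cos:
  assumes "even_trig d g"
  shows "even_trig (Suc d) (\<lambda>t. cos t * g t)"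
proof -
  obtain a where a: "\<forall>t. g t = (\<Sum>q\<le>d. a q * cos (real q * t))" using assms unfolding even_trig_def by (elim exE)
  have c: "cos t * cos (real q * t) = 1/2 * cos (real (Suc q) * t) + 1/2 * cos (real (if q = 0 then 1 else q - 1) * t)" for q t
  proof (cases "q = 0")
    case False
    then have "cos (real (Suc q) * t) + cos (real (q - 1) * t) = cos (real q * t + t) + cos (real q * t - t)"
      by (simp add: of_nat_diff algebra_simps)
    then show ?thesis using False by (simp add: cos_add cos_diff)
  qed simp
  have "even_trig (Suc d) (\<lambda>t. \<Sum>q\<le>d. a q * (1/2 * cos (real (Suc q) * t) + 1/2 * cos (real (if q = 0 then 1 else q - 1) * t)))"
    by (intro even_trig_sum even_trig_cmult even_trig_add even_trig_cos) auto
  moreover have "cos t * g t = (\<Sum>q\<le>d. a q * (1/2 * cos (real (Suc q) * t) + 1/2 * cos (real (if q = 0 then 1 else q - 1) * t)))" for t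
    unfolding c[symmetric] a[rule_format] sum_distrib_left by (intro sum.cong) auto
  ultimately show ?thesis by presburger
qed

lemma even_trig_mono: "even_trig d g \<Longrightarrow> d \<le> e \<Longrightarrow> even_trig e g"
proof -
  assume "even_trig d g" and de: "d \<le> e"
  then obtain a where a: "\<forall>t. g t = (\<Sum>q\<le>d. a q * cos (real q * t))" unfolding even_trig_def by (elim exE)
  have "even_trig e (\<lambda>t. \<Sum>q\<le>d. a q * cos (real q * t))"
    using de by (intro even_trig_sum even_trig_cmult even_trig_cos) auto
  then show ?thesis using a by presburger
qed

lemma even_trig_poly_cos: "degree p \<le> d \<Longrightarrow> even_trig d (\<lambda>t. poly p (cos t))"
proof -
  assume dp: "degree p \<le> d"
  have pow: "even_trig i (\<lambda>t. cos t ^ i)" for i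
  proof (induction i)
    case 0
    show ?case using even_trig_cos[of 0 0] by simp
  next
    case (Suc i)
    then show ?case using even_trig_mult_cos[of i "\<lambda>t. cos t ^ i"] by simp
  qed
  have "even_trig d (\<lambda>t. \<Sum>i\<le>degree p. coeff p i * cos t ^ i)"
    using dp by (intro even_trig_sum even_trig_cmult even_trig_mono[OF pow]) auto
  then show ?thesis by (simp add: poly_altdef)
qed

text \<open>Chebyshev polynomials, through their three-term recursion.\<close>

lemma cos_mult_eq_poly: "\<exists>p :: real poly. degree p \<le> q \<and> (\<forall>t. poly p (cos t) = cos (real q * t))"
proof (induction q rule: less_induct)
  case (less q)
  consider "q = 0" | "q = 1" | i where "q = Suc (Suc i)" by (metis One_nat_def not0_implies_Suc)
  then show ?case
  proof cases
    case 1 then show ?thesis by (intro exI[of _ 1]) auto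
  next
    case 2 then show ?thesis by (intro exI[of _ "[:0, 1:]"]) auto
  next
    case (3 i)
    obtain p1 :: "real poly" where p1: "degree p1 \<le> Suc i" "\<forall>t. poly p1 (cos t) = cos (real (Suc i) * t)" using less[of "Suc i"] 3 by auto
    obtain p0 :: "real poly" where p0: "degree p0 \<le> i" "\<forall>t. poly p0 (cos t) = cos (real i * t)" using less[of i] 3 by auto
    have "poly ([:0, 2:] * p1 - p0) (cos t) = cos (real q * t)" for t
    proof -
      have "cos (real q * t) + cos (real i * t) = cos (real (Suc i) * t + t) + cos (real (Suc i) * t - t)"
        using 3 by (simp add: algebra_simps)
      then show ?thesis using p1(2) p0(2) by (simp add: cos_add cos_diff)
    qed
    moreover have "degree ([:0, 2:] * p1 - p0) \<le> q"
    proof (rule degree_diff_le)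
      have "degree ([:0, 2:] * p1) \<le> degree [:0, 2 :: real:] + degree p1" by (rule degree_mult_le)
      then show "degree ([:0, 2:] * p1) \<le> q" using p1(1) 3 by simp
    qed (use p0(1) 3 in simp)
    ultimately show ?thesis by blast
  qed
qed

lemma trig_nat_period: "sin (real q * (2 * pi)) = 0" "cos (real q * (2 * pi)) = 1"
  using sin_npi[of "2 * q"] cos_npi[of "2 * q"] by (simp_all add: mult_ac)

text \<open>The primitive is periodic only up to a linear term. The difference
  \<open>A (\<theta> + \<tau>) - A (\<theta> - \<tau>)\<close> is even in \<open>\<theta>\<close>,
  and the linear term contributes a constant to it, so it is a polynomial in cosine.\<close>

lemma even_trig_primitive:
  assumes "even_trig d g"
  shows "\<exists>A. (\<forall>t. (A has_real_derivative g t) (at t)) \<and> (\<forall>t. A (t + 2 * pi) - A t = A (2 * pi) - A 0) \<and>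
    (\<forall>\<tau>. \<exists>p :: real poly. degree p \<le> d \<and> (\<forall>\<theta>. poly p (cos \<theta>) = A (\<theta> + \<tau>) - A (\<theta> - \<tau>)))"
proof -
  obtain a where a: "\<forall>t. g t = (\<Sum>q\<le>d. a q * cos (real q * t))" using assms unfolding even_trig_def by (elim exE)
  define S where "S q t = (if q = 0 then t else sin (real q * t) / real q)" for q t
  define A where "A t = (\<Sum>q\<le>d. a q * S q t)" for t
  have "(S q has_real_derivative cos (real q * t)) (at t)" for q t
    unfolding S_def[abs_def] by (cases "q = 0") (auto intro!: derivative_eq_intros)
  then have "(A has_real_derivative g t) (at t)" for t
    unfolding A_def[abs_def] a[rule_format] by (intro DERIV_sum DERIV_cmult)
  moreover have "A (t + 2 * pi) - A t = A (2 * pi) - A 0" for t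
  proof -
    have "S q (t + 2 * pi) - S q t = S q (2 * pi) - S q 0" for q
    proof (cases "q = 0")
      case False
      have "sin (real q * t + real q * (2 * pi)) = sin (real q * t)" "sin (real q * (2 * pi)) = 0"
        using trig_nat_period[of q] by (auto simp: sin_add)
      moreover have "real q * (t + 2 * pi) = real q * t + real q * (2 * pi)" by (rule distrib_left)
      ultimately show ?thesis using False by (simp add: S_def)
    qed (simp add: S_def)
    then show ?thesis by (simp add: A_def sum_subtractf[symmetric] right_diff_distrib[symmetric])
  qed
  moreover have "\<exists>p :: real poly. degree p \<le> d \<and> (\<forall>\<theta>. poly p (cos \<theta>) = A (\<theta> + \<tau>) - A (\<theta> - \<tau>))" for \<tau>
  proof -
    have "\<exists>p :: real poly. degree p \<le> q \<and> (\<forall>t. poly p (cos t) = cos (real q * t))" for q by (rule cos_mult_eq_poly)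
    then obtain p :: "nat \<Rightarrow> real poly" where p: "\<And>q. degree (p q) \<le> q" "\<And>q t. poly (p q) (cos t) = cos (real q * t)" by metis
    define P where "P = (\<Sum>q\<le>d. smult (a q * (2 * S q \<tau>)) (p q))"
    have "degree P \<le> d" unfolding P_def
      by (intro degree_sum_le) (auto intro: order.trans[OF degree_smult_le] order.trans[OF p(1)])
    moreover have "poly P (cos \<theta>) = A (\<theta> + \<tau>) - A (\<theta> - \<tau>)" for \<theta>
    proof -
      have "S q (\<theta> + \<tau>) - S q (\<theta> - \<tau>) = 2 * S q \<tau> * cos (real q * \<theta>)" for q
        by (cases "q = 0") (auto simp: S_def distrib_left right_diff_distrib sin_add sin_diff diff_divide_distrib[symmetric])
      then show ?thesis
        by (simp add: P_def A_def poly_sum p(2) sum_subtractf[symmetric] right_diff_distrib[symmetric] mult.assoc)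
    qed
    ultimately show ?thesis by blast
  qed
  ultimately show ?thesis by blast
qed

text \<open>The Dirichlet kernel normalised to the value 1 at 0. It can be negative; its even powers
  are the positive kernels that are integrated below.\<close>

definition fejer :: "nat \<Rightarrow> real \<Rightarrow> real" where
  "fejer m t = (1 + 2 * (\<Sum>q=1..m. cos (real q * t))) / (2 * real m + 1)"

lemma fejer_eq: "complex_of_real (fejer m t) = dir_kernel m (of_real t) / of_nat (2 * m + 1)"
proof -
  have "cos (of_nat q * complex_of_real t) = of_real (cos (real q * t))" for q
    by (simp add: cos_of_real[symmetric])
  then show ?thesis by (simp add: fejer_def dir_kernel_eq_cos add.commute)
qed

lemma fejer_decay:
  assumes m: "m \<ge> 1" and t: "t \<in> {-pi..pi}"
  shows "\<bar>fejer m t\<bar> \<le> 3 / (1 + real m * \<bar>t\<bar>)"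
proof -
  have "norm (dir_kernel m (0 - of_real (-t)) / of_nat (2 * m + 1)) \<le> 3 * exp (2 * 0) * (1 + 0) / (1 + real m * \<bar>0 - \<bar>-t\<bar>\<bar>)"
    by (rule dir_kernel_decay) (use m t in auto)
  then have "norm (complex_of_real (fejer m t)) \<le> 3 / (1 + real m * \<bar>t\<bar>)"
    unfolding fejer_eq by simp
  then show ?thesis by simp
qed

lemma fejer_periodic: "fejer m (t - 2 * pi) = fejer m t"
proof -
  have "cos (real q * (t - 2 * pi)) = cos (real q * t)" for q
  proof -
    have "real q * (t - 2 * pi) = real q * t - real q * (2 * pi)" by (rule right_diff_distrib)
    then show ?thesis using trig_nat_period[of q] by (simp add: cos_diff)
  qed
  then show ?thesis by (simp add: fejer_def)
qed

text \<open>On this range every cosine in the sum is at least \<open>cos (pi / 3)\<close>.\<close>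

lemma fejer_ge:
  assumes m: "m \<ge> 1" and t: "0 \<le> t" "t \<le> 1 / real m"
  shows "1 / 2 \<le> fejer m t"
proof -
  have "1 / 2 \<le> cos (real q * t)" if q: "q \<in> {1..m}" for q
  proof -
    have "real q * t \<le> real m * (1 / real m)" using q t by (intro mult_mono) auto
    then have "real q * t \<le> 1" using m by simp
    also have "1 \<le> pi / 3" using pi_gt3 by simp
    finally have "cos (pi / 3) \<le> cos (real q * t)" using t pi_gt3 by (intro cos_monotone_0_pi_le) auto
    then show ?thesis by (simp add: cos_60)
  qed
  then have "(\<Sum>q=1..m. 1 / 2) \<le> (\<Sum>q=1..m. cos (real q * t))" by (rule sum_mono)
  then have "real m / 2 \<le> (\<Sum>q=1..m. cos (real q * t))" by simp
  then show ?thesis by (simp add: fejer_def pos_le_divide_eq)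
qed

lemma fejer_poly: "\<exists>p :: real poly. degree p \<le> m \<and> (\<forall>t. poly p (cos t) = fejer m t)"
proof -
  have "\<exists>p :: real poly. degree p \<le> q \<and> (\<forall>t. poly p (cos t) = cos (real q * t))" for q by (rule cos_mult_eq_poly)
  then obtain p :: "nat \<Rightarrow> real poly" where p: "\<And>q. degree (p q) \<le> q" "\<And>q t. poly (p q) (cos t) = cos (real q * t)" by metis
  define P where "P = smult (1 / (2 * real m + 1)) (1 + smult 2 (\<Sum>q=1..m. p q))"
  have "degree (\<Sum>q=1..m. p q) \<le> m" by (intro degree_sum_le) (auto intro: order.trans[OF p(1)])
  then have "degree P \<le> m" unfolding P_def
    by (intro order.trans[OF degree_smult_le] degree_add_le) auto
  moreover have "poly P (cos t) = fejer m t" for t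
    by (simp add: P_def poly_sum p(2) fejer_def)
  ultimately show ?thesis by blast
qed

text \<open>The mass of the kernel \<open>g\<close>, an even power of \<open>fejer\<close>, is
  concentrated at multiples of \<open>2 * pi\<close>. The interval from
  \<open>\<theta> - \<tau>\<close> to \<open>\<theta> + \<tau>\<close> contains 0 or misses it
  according to whether \<open>\<theta>\<close> is below or above \<open>\<tau>\<close>, so one minus
  the normalised integral of \<open>g\<close> over it imitates the jump. The error is the share of
  the mass at distance at least \<open>|\<theta> - \<tau>|\<close> from those multiples.\<close>

lemma step_poly:
  fixes M :: nat
  shows "\<exists>C\<ge>0. \<exists>K::nat. \<forall>n\<ge>1. \<forall>\<tau>\<in>{0..pi}. \<exists>P :: real poly. degree P \<le> K * n \<and>
    (\<forall>\<theta>\<in>{0..pi}. \<bar>poly P (cos \<theta>) - (if \<tau> < \<theta> then 1 else 0)\<bar> \<le> C / (1 + real n * \<bar>\<theta> - \<tau>\<bar>) ^ M)"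
proof -
  \<comment> \<open>Of the exponent \<open>2 * D = 2 * M + 2\<close>, two powers make the tail
    integrable. The number \<open>c\<close> bounds \<open>g\<close> from below on
    \<open>[0, 1 / n]\<close>, so the total mass is at least \<open>c / n\<close>.\<close>
  define D where "D = M + 1"
  define c :: real where "c = (1 / 2) ^ (2 * D)"
  have c0: "c > 0" by (simp add: c_def)
  have "\<exists>P :: real poly. degree P \<le> (2 * D) * n \<and>
    (\<forall>\<theta>\<in>{0..pi}. \<bar>poly P (cos \<theta>) - (if \<tau> < \<theta> then 1 else 0)\<bar> \<le> (2 * 9 ^ D / c) / (1 + real n * \<bar>\<theta> - \<tau>\<bar>) ^ M)"
    if n: "n \<ge> 1" and \<tau>: "\<tau> \<in> {0..pi}" for n \<tau>
  proof -
    define g where "g t = fejer n t ^ (2 * D)" for t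
    have g0: "0 \<le> g t" for t unfolding g_def by (simp add: power_mult)
    obtain p :: "real poly" where p: "degree p \<le> n" "\<forall>t. poly p (cos t) = fejer n t"
      using fejer_poly[of n] by (elim exE conjE)
    have "degree (p ^ (2 * D)) \<le> degree p * (2 * D)" by (rule degree_power_le)
    also have "\<dots> \<le> (2 * D) * n" using p(1) by simp
    finally have "even_trig ((2 * D) * n) (\<lambda>t. poly (p ^ (2 * D)) (cos t))" by (rule even_trig_poly_cos)
    then have et: "even_trig ((2 * D) * n) g" by (simp only: poly_power p(2)[rule_format] g_def[symmetric])
    obtain A where A: "\<forall>t. (A has_real_derivative g t) (at t)" "\<forall>t. A (t + 2 * pi) - A t = A (2 * pi) - A 0"
      "\<forall>\<tau>. \<exists>p :: real poly. degree p \<le> (2 * D) * n \<and> (\<forall>\<theta>. poly p (cos \<theta>) = A (\<theta> + \<tau>) - A (\<theta> - \<tau>))"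
      using even_trig_primitive[OF et] by (elim exE conjE)
    have mono: "A x \<le> A y" if "x \<le> y" for x y
      using that A(1) g0 by (intro DERIV_nonneg_imp_nondecreasing[of x y A]) blast+
    define I where "I = A (2 * pi) - A 0"
    have n0: "real n > 0" using n by simp
    have "A 0 - c * 0 \<le> A (1 / real n) - c * (1 / real n)"
    proof (rule DERIV_nonneg_imp_nondecreasing[of 0 "1 / real n" "\<lambda>t. A t - c * t"])
      fix t assume t: "0 \<le> t" "t \<le> 1 / real n"
      have "c \<le> g t" unfolding c_def g_def using fejer_ge[OF n t] by (intro power_mono) auto
      then show "\<exists>y. ((\<lambda>t. A t - c * t) has_real_derivative y) (at t) \<and> 0 \<le> y"
        using A(1) by (intro exI[of _ "g t - c"]) (auto intro!: derivative_eq_intros)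
    qed (use n0 in simp)
    moreover have "1 / real n \<le> 1" using n by simp
    then have "1 / real n \<le> 2 * pi" using pi_gt3 by linarith
    then have "A (1 / real n) \<le> A (2 * pi)" by (rule mono)
    ultimately have I: "c / real n \<le> I" by (simp add: I_def)
    have I0: "I > 0" using I c0 n0 by (smt (verit) divide_pos_pos)
    have tail: "A (2 * pi - \<delta>) - A \<delta> \<le> (2 * 9 ^ D / c) / (1 + real n * \<delta>) ^ M * I" if \<delta>: "0 \<le> \<delta>" "\<delta> \<le> pi" for \<delta>
    proof -
      define B where "B = 9 ^ D / (1 + real n * \<delta>) ^ (2 * M)"
      have B0: "0 \<le> B" using \<delta> by (simp add: B_def)
      \<comment> \<open>A primitive of \<open>B\<close> times the sum of two inverse squares,
        centred at 0 and at \<open>2 * pi\<close>; this sum majorises \<open>g\<close> between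
        \<open>\<delta>\<close> and \<open>2 * pi - \<delta>\<close>.\<close>
      define H where "H t = B * ((1 / real n) / (1 + real n * (2 * pi - t)) - (1 / real n) / (1 + real n * t))" for t
      have H1: "(H has_real_derivative B * (1 / (1 + real n * (2 * pi - t))\<^sup>2 + 1 / (1 + real n * t)\<^sup>2)) (at t)"
        if t: "\<delta> \<le> t" "t \<le> 2 * pi - \<delta>" for t
      proof -
        have a: "1 + real n * (2 * pi - t) > 0" "1 + real n * t > 0" using t \<delta> by (auto intro!: add_pos_nonneg)
        have "((\<lambda>t. (1 / real n) / (1 + real n * (2 * pi - t))) has_real_derivative 1 / (1 + real n * (2 * pi - t))\<^sup>2) (at t)"
          using a n0 by (auto intro!: derivative_eq_intros simp: power2_eq_square divide_simps)
        moreover have "((\<lambda>t. (1 / real n) / (1 + real n * t)) has_real_derivative - (1 / (1 + real n * t)\<^sup>2)) (at t)"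
          using a n0 by (auto intro!: derivative_eq_intros simp: power2_eq_square divide_simps)
        ultimately have "((\<lambda>t. B * ((1 / real n) / (1 + real n * (2 * pi - t)) - (1 / real n) / (1 + real n * t))) has_real_derivative
            B * (1 / (1 + real n * (2 * pi - t))\<^sup>2 - - (1 / (1 + real n * t)\<^sup>2))) (at t)"
          by (intro DERIV_cmult DERIV_diff)
        then show ?thesis by (simp add: H_def[abs_def])
      qed
      have half: "g t \<le> B / (1 + real n * \<bar>s\<bar>)\<^sup>2" if s: "s \<in> {-pi..pi}" "\<bar>s\<bar> \<ge> \<delta>" and gs: "fejer n t = fejer n s" for t s
      proof -
        have "g t = \<bar>fejer n s\<bar> ^ (2 * D)" unfolding g_def gs by (rule power_even_abs[symmetric]) simp
        also have "\<dots> \<le> (3 / (1 + real n * \<bar>s\<bar>)) ^ (2 * D)" using fejer_decay[OF n s(1)] by (intro power_mono) auto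
        also have "\<dots> = 9 ^ D / ((1 + real n * \<bar>s\<bar>) ^ (2 * M) * (1 + real n * \<bar>s\<bar>)\<^sup>2)"
          by (simp add: power_divide power_mult D_def power2_eq_square)
        also have "\<dots> \<le> 9 ^ D / ((1 + real n * \<delta>) ^ (2 * M) * (1 + real n * \<bar>s\<bar>)\<^sup>2)"
          using s \<delta> n0 by (intro divide_left_mono mult_right_mono power_mono mult_pos_pos zero_less_power add_pos_nonneg) auto
        finally show ?thesis by (simp add: B_def)
      qed
      have gB: "g t \<le> B * (1 / (1 + real n * (2 * pi - t))\<^sup>2 + 1 / (1 + real n * t)\<^sup>2)"
        if t: "\<delta> \<le> t" "t \<le> 2 * pi - \<delta>" for t
      proof (cases "t \<le> pi")
        case True
        have "g t \<le> B / (1 + real n * \<bar>t\<bar>)\<^sup>2" by (rule half) (use t \<delta> True in auto)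
        moreover have "0 \<le> B / (1 + real n * (2 * pi - t))\<^sup>2" using B0 by simp
        moreover have "\<bar>t\<bar> = t" using t \<delta> by simp
        ultimately show ?thesis by (simp add: distrib_left)
      next
        case False
        have "g t \<le> B / (1 + real n * \<bar>t - 2 * pi\<bar>)\<^sup>2" by (rule half) (use t \<delta> False fejer_periodic[of n t] in auto)
        moreover have "0 \<le> B / (1 + real n * t)\<^sup>2" using B0 by simp
        moreover have "\<bar>t - 2 * pi\<bar> = 2 * pi - t" using t \<delta> by simp
        ultimately show ?thesis by (simp add: distrib_left)
      qed
      have "H \<delta> - A \<delta> \<le> H (2 * pi - \<delta>) - A (2 * pi - \<delta>)"
      proof (rule DERIV_nonneg_imp_nondecreasing[of \<delta> "2 * pi - \<delta>" "\<lambda>t. H t - A t"])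
        fix t assume t: "\<delta> \<le> t" "t \<le> 2 * pi - \<delta>"
        show "\<exists>y. ((\<lambda>t. H t - A t) has_real_derivative y) (at t) \<and> 0 \<le> y"
          using DERIV_diff[OF H1[OF t] A(1)[rule_format, of t]] gB[OF t]
          by (intro exI[of _ "B * (1 / (1 + real n * (2 * pi - t))\<^sup>2 + 1 / (1 + real n * t)\<^sup>2) - g t"]) simp
      qed (use \<delta> in simp)
      then have "A (2 * pi - \<delta>) - A \<delta> \<le> H (2 * pi - \<delta>) - H \<delta>" by simp
      also have "\<dots> = 2 * B * (1 / real n) * (1 / (1 + real n * \<delta>) - 1 / (1 + real n * (2 * pi - \<delta>)))"
        by (simp add: H_def algebra_simps)
      also have "\<dots> \<le> 2 * B * (1 / real n) * 1"
      proof (rule mult_left_mono)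
        have "1 / (1 + real n * \<delta>) \<le> 1" "0 \<le> 1 / (1 + real n * (2 * pi - \<delta>))" using \<delta> by (auto simp: divide_le_eq intro!: add_pos_nonneg)
        then show "1 / (1 + real n * \<delta>) - 1 / (1 + real n * (2 * pi - \<delta>)) \<le> 1" by linarith
      qed (use B0 in simp)
      also have "\<dots> = (2 * B / c) * (c / real n)" using c0 by simp
      also have "\<dots> \<le> (2 * B / c) * I" using I B0 c0 by (intro mult_left_mono) auto
      also have "\<dots> \<le> (2 * (9 ^ D / (1 + real n * \<delta>) ^ M) / c) * I"
      proof -
        have "(1 + real n * \<delta>) ^ M \<le> (1 + real n * \<delta>) ^ (2 * M)" using \<delta> by (intro power_increasing) auto
        then have "B \<le> 9 ^ D / (1 + real n * \<delta>) ^ M" unfolding B_def using \<delta>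
          by (intro divide_left_mono) (auto intro!: mult_pos_pos zero_less_power add_pos_nonneg)
        then show ?thesis using I0 c0 by (intro mult_right_mono divide_right_mono mult_left_mono) auto
      qed
      finally show ?thesis by (simp add: divide_divide_eq_left mult.commute)
    qed
    obtain R :: "real poly" where R: "degree R \<le> (2 * D) * n" "\<forall>\<theta>. poly R (cos \<theta>) = A (\<theta> + \<tau>) - A (\<theta> - \<tau>)"
      using A(3)[rule_format, of \<tau>] by (elim exE conjE)
    define P where "P = 1 - smult (1 / I) R"
    have "degree P \<le> (2 * D) * n" unfolding P_def
      by (intro degree_diff_le order.trans[OF degree_smult_le] R(1)) auto
    moreover have "\<bar>poly P (cos \<theta>) - (if \<tau> < \<theta> then 1 else 0)\<bar> \<le> (2 * 9 ^ D / c) / (1 + real n * \<bar>\<theta> - \<tau>\<bar>) ^ M"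
      if \<theta>: "\<theta> \<in> {0..pi}" for \<theta>
    proof -
      define \<delta> where "\<delta> = \<bar>\<theta> - \<tau>\<bar>"
      have \<delta>: "0 \<le> \<delta>" "\<delta> \<le> pi" using \<theta> \<tau> by (auto simp: \<delta>_def)
      have Pv: "poly P (cos \<theta>) = 1 - (A (\<theta> + \<tau>) - A (\<theta> - \<tau>)) / I" by (simp add: P_def R(2))
      have m: "A \<delta> \<le> A (\<theta> + \<tau>)" "A (\<theta> + \<tau>) \<le> A (2 * pi - \<delta>)"
        using \<theta> \<tau> by (auto intro!: mono simp: \<delta>_def)
      have "\<bar>poly P (cos \<theta>) - (if \<tau> < \<theta> then 1 else 0)\<bar> * I \<le> A (2 * pi - \<delta>) - A \<delta>"
      proof (cases "\<tau> < \<theta>")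
        case True
        then have "\<theta> - \<tau> = \<delta>" by (simp add: \<delta>_def)
        then have "poly P (cos \<theta>) - 1 = - ((A (\<theta> + \<tau>) - A \<delta>) / I)" by (simp add: Pv)
        then show ?thesis using True m I0 by (simp add: abs_mult)
      next
        case False
        \<comment> \<open>The left end of the interval is nonpositive here; shifting it by a period
          turns the missing mass into an integral from \<open>\<theta> + \<tau>\<close> to
          \<open>2 * pi - \<delta>\<close>.\<close>
        then have "\<theta> - \<tau> + 2 * pi = 2 * pi - \<delta>" by (simp add: \<delta>_def)
        then have "A (\<theta> - \<tau>) = A (2 * pi - \<delta>) - I" using A(2)[rule_format, of "\<theta> - \<tau>"] by (simp add: I_def)
        then have "poly P (cos \<theta>) = (A (2 * pi - \<delta>) - A (\<theta> + \<tau>)) / I" using I0 by (simp add: Pv field_simps)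
        then show ?thesis using False m I0 by (simp add: abs_mult)
      qed
      also have "\<dots> \<le> (2 * 9 ^ D / c) / (1 + real n * \<delta>) ^ M * I" by (rule tail[OF \<delta>])
      finally show ?thesis using I0 unfolding \<delta>_def by (rule mult_right_le_imp_le)
    qed
    ultimately show ?thesis by blast
  qed
  moreover have "0 \<le> 2 * 9 ^ D / c" using c0 by simp
  ultimately show ?thesis by blast
qed

section \<open>Local approximation and blending\<close>

text \<open>At the midpoint \<open>m\<close> both \<open>\<delta> / pi <= sin m\<close> and
  \<open>sin t <= 3 * sin m\<close> hold; their combination bounds the bracket by
  \<open>2 * sin m\<close>, and Jordan's inequality handles the outer factor.\<close>

lemma cos_diff_ge:
  assumes t: "0 \<le> t1" "t1 \<le> t" "t \<le> t2" "t2 \<le> pi"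
  shows "(t2 - t1) / pi * (sin t / 3 + (t2 - t1) / pi) \<le> cos t1 - cos t2"
proof -
  define \<delta> m where "\<delta> = t2 - t1" and "m = (t1 + t2) / 2"
  have \<delta>: "0 \<le> \<delta>" "\<delta> \<le> pi" using t by (auto simp: \<delta>_def)
  have h: "\<delta> / pi \<le> sin (\<delta> / 2)" using sin_jordan[of "\<delta> / 2"] \<delta> by simp
  have "\<bar>sin ((t2 - t1) / 2)\<bar> \<le> sin ((t2 + t1) / 2)" by (rule sin_half_sum_ge) (use t in auto)
  then have m1: "\<delta> / pi \<le> sin m" using h by (simp add: \<delta>_def m_def add.commute)
  have "\<bar>sin t - sin m\<bar> \<le> \<bar>t - m\<bar>" by (rule abs_sin_diff_le)
  also have "\<dots> \<le> \<delta> / 2" using t by (simp add: \<delta>_def m_def abs_le_iff field_simps)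
  finally have "sin t \<le> sin m + \<delta> / 2" by (simp only: abs_le_iff) linarith
  also have "\<delta> \<le> pi * sin m" using m1 by (simp add: pos_divide_le_eq mult.commute)
  also have "pi * sin m \<le> 4 * sin m"
    using m1 \<delta> pi_less_4 by (intro mult_right_mono) (auto intro: order.trans[OF _ m1])
  finally have m2: "sin t \<le> 3 * sin m" by simp
  have "cos t1 - cos t2 = 2 * sin m * sin (\<delta> / 2)"
    unfolding cos_diff_cos by (simp add: m_def \<delta>_def)
  moreover have "(sin t / 3 + \<delta> / pi) * (\<delta> / pi) \<le> (2 * sin m) * sin (\<delta> / 2)"
  proof (rule mult_mono)
    show "sin t / 3 + \<delta> / pi \<le> 2 * sin m" using m1 m2 by simp
    have "0 \<le> sin m" using m1 \<delta> by (intro order.trans[OF _ m1]) simp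
    then show "0 \<le> 2 * sin m" by simp
  qed (use h \<delta> in auto)
  ultimately show ?thesis by (simp add: \<delta>_def mult.commute)
qed

text \<open>The constant is \<open>7^2\<close>, from the spacing
  \<open>pi / (7 * n)\<close>.\<close>

lemma cos_diff_ge_rho:
  assumes t: "0 \<le> t1" "t1 \<le> t" "t \<le> t2" "t2 \<le> pi" and n: "n \<ge> 1" and d: "pi / (7 * real n) \<le> t2 - t1"
  shows "rho n (cos t) \<le> 49 * (cos t1 - cos t2)"
proof -
  define q where "q = (t2 - t1) / pi"
  have q: "1 / (7 * real n) \<le> q" using d by (simp add: q_def pos_le_divide_eq)
  have s: "0 \<le> sin t" using t by (intro sin_ge_zero) auto
  have "1 / (7 * real n) * (sin t / 3 + 1 / (7 * real n)) \<le> q * (sin t / 3 + q)"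
    using q s n by (intro mult_mono add_mono) (auto intro: order.trans[OF _ q] add_nonneg_nonneg)
  also have "\<dots> \<le> cos t1 - cos t2" unfolding q_def by (rule cos_diff_ge[OF t])
  finally have a: "1 / (7 * real n) * (sin t / 3 + 1 / (7 * real n)) \<le> cos t1 - cos t2" .
  have "rho n (cos t) = sin t / real n + 1 / (real n)\<^sup>2" using t by (intro rho_cos) auto
  also have "\<dots> \<le> 49 * (1 / (7 * real n) * (sin t / 3 + 1 / (7 * real n)))"
    using n s by (simp add: field_simps power2_eq_square)
  also have "\<dots> \<le> 49 * (cos t1 - cos t2)" using a by (rule mult_left_mono) simp
  finally show ?thesis .
qed

text \<open>Writing \<open>y + h\<close> and \<open>y - h\<close> as cosines of \<open>m - d\<close>
  and \<open>m + d\<close> gives \<open>h = sin m * sin d\<close> and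
  \<open>y = cos m * cos d\<close>, so \<open>sin m <= phi y\<close> and
  \<open>h <= phi y * d\<close>. The assumption \<open>k >= 2\<close> places both points on the arc
  from \<open>t1\<close> to \<open>t2\<close>, which bounds \<open>d\<close>.\<close>

lemma chord_step_le:
  assumes t: "0 \<le> t1" "t1 \<le> t2" "t2 \<le> pi" "t2 - t1 \<le> 1 / real n" and k: "k \<ge> 2" and h: "0 \<le> h"
    and y: "cos t2 \<le> y - real k * h / 2" "y + real k * h / 2 \<le> cos t1"
  shows "h \<le> phi y / real n"
proof -
  have "2 * h \<le> real k * h" using k h by (intro mult_right_mono) auto
  then have y': "cos t2 \<le> y - h" "y + h \<le> cos t1" using y by auto
  define \<alpha> \<beta> where "\<alpha> = arccos (y + h)" and "\<beta> = arccos (y - h)"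
  have r: "-1 \<le> y - h" "y + h \<le> 1" "y - h \<le> 1" "-1 \<le> y + h"
    using y' h cos_ge_minus_one[of t2] cos_le_one[of t1] by linarith+
  have ca: "cos \<alpha> = y + h" "cos \<beta> = y - h" using r by (auto simp: \<alpha>_def \<beta>_def)
  have "arccos (cos t1) \<le> \<alpha>" unfolding \<alpha>_def using y' r cos_le_one by (intro arccos_le_arccos) auto
  then have a: "t1 \<le> \<alpha>" using t by (simp add: arccos_cos)
  have "\<beta> \<le> arccos (cos t2)" unfolding \<beta>_def using y' r cos_ge_minus_one by (intro arccos_le_arccos) auto
  then have b: "\<beta> \<le> t2" using t by (simp add: arccos_cos)
  have ab: "\<alpha> \<le> \<beta>" unfolding \<alpha>_def \<beta>_def using r h by (intro arccos_le_arccos) auto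
  define m d where "m = (\<alpha> + \<beta>) / 2" and "d = (\<beta> - \<alpha>) / 2"
  have d0: "0 \<le> d" using ab by (simp add: d_def)
  have "2 * d \<le> 1 / real n" using a b t by (simp add: d_def)
  also have "1 / real n = 2 * (1 / real n / 2)" by simp
  finally have dn: "d \<le> 1 / real n" using d0 by simp
  have "2 * h = cos \<alpha> - cos \<beta>" by (simp add: ca)
  also have "\<dots> = 2 * sin m * sin d" unfolding cos_diff_cos by (simp add: m_def d_def)
  finally have hm: "h = sin m * sin d" by simp
  have "2 * y = cos \<alpha> + cos \<beta>" by (simp add: ca)
  also have "\<dots> = 2 * cos m * cos d"
  proof -
    have "cos ((\<alpha> - \<beta>) / 2) = cos d" unfolding d_def by (metis cos_minus minus_diff_eq minus_divide_left)
    then show ?thesis unfolding cos_plus_cos by (simp add: m_def)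
  qed
  finally have ym: "y = cos m * cos d" by simp
  have sm: "0 \<le> sin m" using a b t ab by (intro sin_ge_zero) (auto simp: m_def)
  have "(cos d)\<^sup>2 \<le> 1" using sin_cos_squared_add[of d] by (metis le_add_same_cancel2 zero_le_power2)
  then have "(cos m)\<^sup>2 * (cos d)\<^sup>2 \<le> (cos m)\<^sup>2 * 1" by (intro mult_left_mono) auto
  moreover have "y\<^sup>2 = (cos m)\<^sup>2 * (cos d)\<^sup>2" by (simp add: ym power_mult_distrib)
  ultimately have "(sin m)\<^sup>2 \<le> 1 - y\<^sup>2" using sin_cos_squared_add[of m] by linarith
  then have "sqrt ((sin m)\<^sup>2) \<le> phi y" unfolding phi_def by (rule real_sqrt_le_mono)
  then have sp: "sin m \<le> phi y" using sm by simp
  have "sin d \<le> d" using d0 by (rule sin_x_le_x)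
  then have "h \<le> sin m * d" unfolding hm using sm by (intro mult_left_mono)
  also have "\<dots> \<le> phi y * (1 / real n)" using sp dn sm d0 by (intro mult_mono) auto
  finally show ?thesis by simp
qed

text \<open>The change of variables from the end points of a chord to its midpoint and relative step.\<close>

lemma chord_transform:
  fixes \<Psi> :: "real \<Rightarrow> real \<Rightarrow> ennreal"
  assumes [measurable]: "(\<lambda>(y, h). \<Psi> y h) \<in> borel_measurable (borel \<Otimes>\<^sub>M borel)"
    and t: "0 \<le> t1" "t2 \<le> pi" "t2 - t1 \<le> 1 / real n" "pi / (7 * real n) \<le> t2 - t1" and k: "k \<ge> 2" and n: "n \<ge> 1"
    and ab: "a = cos t2" "b = cos t1"
  shows "(NN x\<in>{a..b}. (NN u\<in>{a..b}. \<Psi> ((x + u) / 2) (\<bar>u - x\<bar> / real k)))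
    \<le> ennreal (98 * real k * real n * (b - a)) * (NN s\<in>{0<..1 / real n}. (NN y\<in>{a..b}. \<Psi> y (s * phi y)))"
proof -
  have "0 \<le> pi / (7 * real n)" by simp
  then have t12: "t1 \<le> t2" using t(4) by linarith
  have meas[measurable]: "(\<lambda>x. \<Psi> (g x) (h x)) \<in> borel_measurable M"
    if "g \<in> borel_measurable M" "h \<in> borel_measurable M" for g h and M :: "'z measure"
    using measurable_compose[OF measurable_Pair[OF that] assms(1)] by simp
  have measp[measurable]: "(\<lambda>x. \<Psi> (g x) (h x)) \<in> borel_measurable (borel \<Otimes>\<^sub>M borel)"
    if "g \<in> borel_measurable (borel \<Otimes>\<^sub>M borel)" "h \<in> borel_measurable (borel \<Otimes>\<^sub>M borel)"
    for g h :: "real \<times> real \<Rightarrow> real"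
    using measurable_compose[OF measurable_Pair[OF that] assms(1)] by simp
  \<comment> \<open>Midpoint and signed length as coordinates; the two indicators keep both ends of
    the chord in the interval.\<close>
  define G :: "real \<Rightarrow> real \<Rightarrow> ennreal" where
    "G y v = \<Psi> y (\<bar>v\<bar> / real k) * indicator {a..b} (y - v / 2) * indicator {a..b} (y + v / 2)" for y v
  have [measurable]: "(\<lambda>z. G (fst z) (snd z)) \<in> borel_measurable (borel \<Otimes>\<^sub>M borel)"
    unfolding G_def by measurable
  have [measurable]: "G y \<in> borel_measurable borel" for y unfolding G_def[abs_def] by measurable
  have "(NN x\<in>{a..b}. (NN u\<in>{a..b}. \<Psi> ((x + u) / 2) (\<bar>u - x\<bar> / real k)))
    = (NN x. (NN v. \<Psi> ((x + (x + v)) / 2) (\<bar>x + v - x\<bar> / real k) * indicator {a..b} (x + v) * indicator {a..b} x))"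
  proof (rule nn_integral_cong)
    fix x :: real
    have "(NN u\<in>{a..b}. \<Psi> ((x + u) / 2) (\<bar>u - x\<bar> / real k))
      = (NN v. \<Psi> ((x + (x + v)) / 2) (\<bar>x + v - x\<bar> / real k) * indicator {a..b} (x + v))"
      by (subst nn_integral_real_affine[where c = 1 and t = x]) auto
    then show "(NN u\<in>{a..b}. \<Psi> ((x + u) / 2) (\<bar>u - x\<bar> / real k)) * indicator {a..b} x
      = (NN v. \<Psi> ((x + (x + v)) / 2) (\<bar>x + v - x\<bar> / real k) * indicator {a..b} (x + v) * indicator {a..b} x)"
      by (simp add: nn_integral_multc)
  qed
  also have "\<dots> = (NN v. (NN x. \<Psi> ((x + (x + v)) / 2) (\<bar>x + v - x\<bar> / real k) * indicator {a..b} (x + v) * indicator {a..b} x))"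
    by (rule lborel_pair.Fubini') measurable
  also have "\<dots> = (NN v. (NN y. G y v))"
  proof (rule nn_integral_cong)
    fix v :: real
    have e: "- v / 2 + y = y - v / 2" "y - v / 2 + v = y + v / 2" "(y - v / 2 + (y + v / 2)) / 2 = y" "y - v / 2 + v - (y - v / 2) = v" for y
      by (simp_all add: field_simps)
    have "(NN x. \<Psi> ((x + (x + v)) / 2) (\<bar>x + v - x\<bar> / real k) * indicator {a..b} (x + v) * indicator {a..b} x)
      = (NN y. \<Psi> ((- v / 2 + y + (- v / 2 + y + v)) / 2) (\<bar>- v / 2 + y + v - (- v / 2 + y)\<bar> / real k)
           * indicator {a..b} (- v / 2 + y + v) * indicator {a..b} (- v / 2 + y))"
      by (subst nn_integral_real_affine[where c = 1 and t = "- v / 2"]) auto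
    also have "\<dots> = (NN y. G y v)" unfolding e G_def by (simp add: mult_ac)
    finally show "(NN x. \<Psi> ((x + (x + v)) / 2) (\<bar>x + v - x\<bar> / real k) * indicator {a..b} (x + v) * indicator {a..b} x)
      = (NN y. G y v)" .
  qed
  also have "\<dots> = (NN y. (NN v. G y v))"
    by (rule lborel_pair.Fubini') (simp add: case_prod_beta')
  also have "\<dots> \<le> (NN y. ennreal (98 * real k * real n * (b - a)) * (NN s\<in>{0<..1 / real n}. \<Psi> y (s * phi y)) * indicator {a..b} y)"
  proof (rule nn_integral_mono)
    fix y :: real
    show "(NN v. G y v) \<le> ennreal (98 * real k * real n * (b - a)) * (NN s\<in>{0<..1 / real n}. \<Psi> y (s * phi y)) * indicator {a..b} y"
    proof (cases "y \<in> {a..b}")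
      case False
      then have "G y v = 0" for v by (auto simp: G_def indicator_def)
      then show ?thesis by simp
    next
      case True
      have y1: "y \<in> {-1..1}" using True cos_ge_minus_one[of t2] cos_le_one[of t1] unfolding ab atLeastAtMost_iff by linarith
      define c where "c = real k * phi y"
      have c0: "0 \<le> c" using phi_nonneg[OF y1] by (simp add: c_def)
      \<comment> \<open>For a fixed midpoint the lengths are at most \<open>c / n\<close> by
        \<open>chord_step_le\<close>; the signed length is split into its two orientations.\<close>
      define H where "H v = \<Psi> y (v / real k) * indicator {0<..c / real n} v" for v
      have [measurable]: "H \<in> borel_measurable borel" unfolding H_def[abs_def] by measurable
      have GH: "G y v \<le> H v + H (- v)" if "v \<noteq> 0" for v
      proof (cases "G y v = 0")
        case False
        then have i: "y - v / 2 \<in> {a..b}" "y + v / 2 \<in> {a..b}" by (auto simp: G_def indicator_def split: if_splits)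
        have kv: "real k * (\<bar>v\<bar> / real k) = \<bar>v\<bar>" using k by simp
        have "\<bar>v\<bar> / real k \<le> phi y / real n"
        proof (rule chord_step_le[OF t(1) _ t(2,3) k])
          show "t1 \<le> t2" by (rule t12)
          show "cos t2 \<le> y - real k * (\<bar>v\<bar> / real k) / 2" "y + real k * (\<bar>v\<bar> / real k) / 2 \<le> cos t1"
            unfolding kv using i by (auto simp: ab abs_if)
        qed simp
        then have "\<bar>v\<bar> \<le> c / real n" using k by (simp add: c_def pos_divide_le_eq mult_ac)
        moreover have "G y v = \<Psi> y (\<bar>v\<bar> / real k)" using i by (simp add: G_def)
        ultimately show ?thesis using that by (cases "v > 0") (auto simp: H_def)
      qed simp
      have "(NN v. G y v) \<le> (NN v. H v + H (- v))"
        using AE_lborel_singleton[of "0::real"] by (intro nn_integral_mono_AE) (auto elim!: eventually_mono intro: GH)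
      also have "\<dots> = (NN v. H v) + (NN v. H (- v))" by (intro nn_integral_add) auto
      also have "(NN v. H (- v)) = (NN v. H v)"
        by (subst nn_integral_real_affine[where c = "-1" and t = 0 and f = H]) auto
      also have "(NN v. H v) \<le> ennreal c * (NN s\<in>{0<..1 / real n}. \<Psi> y (s * phi y))"
      proof (cases "c = 0")
        case True
        then show ?thesis by (simp add: H_def)
      next
        case False
        then have c: "c > 0" using c0 by simp
        have "(NN v. H v) = ennreal c * (NN s. H (c * s))"
          using c by (subst nn_integral_real_affine[where c = c and t = 0]) auto
        also have "(NN s. H (c * s)) = (NN s\<in>{0<..1 / real n}. \<Psi> y (s * phi y))"
        proof (rule nn_integral_cong)
          fix s
          have "c * s \<le> c / real n \<longleftrightarrow> s \<le> 1 / real n" using c n by (simp add: field_simps)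
          moreover have "c * s / real k = s * phi y" using k by (simp add: c_def)
          ultimately show "H (c * s) = \<Psi> y (s * phi y) * indicator {0<..1 / real n} s"
            using c by (simp add: H_def indicator_def zero_less_mult_iff)
        qed
        finally show ?thesis by simp
      qed
      finally have "(NN v. G y v) \<le> 2 * ennreal c * (NN s\<in>{0<..1 / real n}. \<Psi> y (s * phi y))"
        by (simp add: mult_2 distrib_right add_mono)
      also have "2 * ennreal c = ennreal (2 * c)" using c0 by (simp add: ennreal_mult)
      \<comment> \<open>The 2 counts the orientations, and 49 comes from
        \<open>cos_diff_ge_rho\<close>, since \<open>phi y / n <= rho n y\<close>.\<close>
      also have "2 * c \<le> 98 * real k * real n * (b - a)"
      proof -
        have "arccos y \<le> arccos (cos t2)" "arccos (cos t1) \<le> arccos y"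
          using True y1 cos_le_one cos_ge_minus_one by (auto simp: ab intro!: arccos_le_arccos)
        then have "rho n (cos (arccos y)) \<le> 49 * (cos t1 - cos t2)"
          using t t12 n by (intro cos_diff_ge_rho) (auto simp: arccos_cos)
        then have "phi y / real n \<le> 49 * (b - a)" using y1 n by (simp add: rho_def phi_def ab) (smt (verit) divide_nonneg_nonneg zero_le_power2)
        then have "phi y \<le> 49 * real n * (b - a)" using n by (simp add: pos_divide_le_eq mult_ac)
        then have "2 * real k * phi y \<le> 2 * real k * (49 * real n * (b - a))" by (intro mult_left_mono) auto
        then show ?thesis by (simp add: c_def)
      qed
      finally show ?thesis using True by (simp add: mult_right_mono ennreal_leI)
    qed
  qed
  also have "\<dots> = ennreal (98 * real k * real n * (b - a)) * (NN y\<in>{a..b}. (NN s\<in>{0<..1 / real n}. \<Psi> y (s * phi y)))"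
    by (simp only: mult.assoc) (rule nn_integral_cmult, measurable)
  also have "(NN y\<in>{a..b}. (NN s\<in>{0<..1 / real n}. \<Psi> y (s * phi y)))
    = (NN s\<in>{0<..1 / real n}. (NN y\<in>{a..b}. \<Psi> y (s * phi y)))"
    by (rule set_nn_integral_swap) measurable
  finally show ?thesis .
qed

section \<open>Nodes and panels in the angle\<close>

definition node :: "nat \<Rightarrow> nat \<Rightarrow> real" where
  "node n j = real j * pi / (7 * real n)"

lemma node_mono: "i \<le> j \<Longrightarrow> node n i \<le> node n j"
  by (simp add: node_def divide_right_mono mult_right_mono)

lemma node_Suc: "node n (Suc j) - node n j = pi / (7 * real n)"
  by (simp add: node_def diff_divide_distrib[symmetric] algebra_simps)

lemma node_0: "node n 0 = 0" by (simp add: node_def)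

lemma node_last: "n \<ge> 1 \<Longrightarrow> node n (7 * n) = pi" by (simp add: node_def)

lemma node_in: "n \<ge> 1 \<Longrightarrow> j \<le> 7 * n \<Longrightarrow> node n j \<in> {0..pi}"
  using node_mono[of 0 j n] node_mono[of j "7 * n" n] by (simp add: node_0 node_last)

text \<open>Because panels overlap, a panel \<open>i\<close> can be chosen such that precisely the
  jumps below \<open>i\<close> are switched on, also near the ends: jumps run from 1 to
  \<open>7 * n - 2\<close>, panels from 1 to \<open>7 * n - 1\<close>.\<close>

lemma node_locate:
  assumes n: "n \<ge> 1" and \<theta>: "\<theta> \<in> {0..pi}"
  shows "\<exists>i\<in>{1..<7 * n}. \<theta> \<in> {node n (i - 1)..node n (i + 1)} \<and>
    (\<forall>j\<in>{1..<7 * n - 1}. node n j < \<theta> \<longleftrightarrow> j < i)"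
proof -
  define S where "S = {j\<in>{0..7 * n - 2}. j = 0 \<or> node n j < \<theta>}"
  have S: "finite S" "0 \<in> S" by (auto simp: S_def)
  define m where "m = Max S"
  have m: "m \<in> S" using S by (auto simp: m_def intro: Max_in)
  have mx: "j \<le> m" if "j \<in> S" for j using that S by (simp add: m_def)
  have i: "m + 1 \<in> {1..<7 * n}" using m n by (auto simp: S_def)
  have "node n j < \<theta> \<longleftrightarrow> j < m + 1" if j: "j \<in> {1..<7 * n - 1}" for j
  proof
    assume "node n j < \<theta>"
    then have "j \<in> S" using j by (auto simp: S_def)
    then show "j < m + 1" using mx by fastforce
  next
    assume "j < m + 1"
    then have "node n j \<le> node n m" "m \<noteq> 0" using j by (auto intro: node_mono)
    then show "node n j < \<theta>" using m by (auto simp: S_def)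
  qed
  moreover have "node n m \<le> \<theta>" using m \<theta> by (auto simp: S_def node_0)
  moreover have "\<theta> \<le> node n (m + 2)"
  proof (cases "m = 7 * n - 2")
    case True
    then have "m + 2 = 7 * n" using n by simp
    then show ?thesis using node_last[OF n] \<theta> by simp
  next
    case False
    then have "m + 1 \<in> {0..7 * n - 2}" using m by (auto simp: S_def)
    moreover have "m + 1 \<notin> S" using mx[of "m + 1"] by auto
    ultimately have "\<theta> \<le> node n (m + 1)" by (auto simp: S_def)
    also have "\<dots> \<le> node n (m + 2)" by (rule node_mono) simp
    finally show ?thesis .
  qed
  ultimately show ?thesis using i by (intro bexI[of _ "m + 1"]) auto
qed

definition panel :: "nat \<Rightarrow> nat \<Rightarrow> real set" where
  "panel n j = {cos (node n (j + 1))..cos (node n (j - 1))}"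

lemma panel_measurable[measurable]: "panel n j \<in> sets borel" by (simp add: panel_def)

text \<open>The number 7 exceeds \<open>2 * pi\<close>, so two neighbouring cells together have
  angular length at most \<open>1 / n\<close>.\<close>

lemma panel_nodes:
  assumes n: "n \<ge> 1" and j: "j \<in> {1..<7 * n}"
  shows "0 \<le> node n (j - 1)" "node n (j - 1) \<le> node n (j + 1)" "node n (j + 1) \<le> pi" "node n (j + 1) - node n (j - 1) \<le> 1 / real n"
    "pi / (7 * real n) \<le> node n (j + 1) - node n (j - 1)" "node n j \<in> {0..pi}"
    "node n j - node n (j - 1) = pi / (7 * real n)" "node n (j + 1) - node n j = pi / (7 * real n)"
proof -
  have n0: "real n > 0" using n by simp
  have 1: "node n (j + 1) - node n j = pi / (7 * real n)" using node_Suc by simp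
  have 2: "node n j - node n (j - 1) = pi / (7 * real n)" using node_Suc[of n "j - 1"] j by simp
  have "2 * (pi / (7 * real n)) \<le> 1 / real n" using n0 pi_less_4 pi_approx by (simp add: field_simps)
  then show "node n (j + 1) - node n (j - 1) \<le> 1 / real n" using 1 2 by linarith
  have "0 \<le> pi / (7 * real n)" by simp
  then show "pi / (7 * real n) \<le> node n (j + 1) - node n (j - 1)" "node n (j - 1) \<le> node n (j + 1)" using 1 2 by linarith+
  show "node n j - node n (j - 1) = pi / (7 * real n)" "node n (j + 1) - node n j = pi / (7 * real n)" using 1 2 by auto
  show "node n j \<in> {0..pi}" using j by (intro node_in[OF n]) auto
  show "0 \<le> node n (j - 1)" using node_mono[of 0 "j - 1" n] by (simp add: node_0)
  show "node n (j + 1) \<le> pi" using node_in[OF n, of "j + 1"] j by auto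
qed

text \<open>The third estimate serves to compare panel \<open>j + 1\<close> with \<open>rho\<close>
  at node \<open>j\<close>.\<close>

lemma panel_length:
  assumes n: "n \<ge> 1" and j: "j \<in> {1..<7 * n}"
  shows "cos (node n (j + 1)) < cos (node n (j - 1))"
    "cos (node n (j - 1)) - cos (node n (j + 1)) \<le> 8 * rho n (cos (node n j))"
    "j \<ge> 2 \<Longrightarrow> cos (node n (j - 1)) - cos (node n (j + 1)) \<le> 4 * rho n (cos (node n (j - 1)))"
proof -
  note N = panel_nodes[OF n j]
  have n0: "real n > 0" using n by simp
  have "0 < pi / (7 * real n)" using n0 by simp
  then have "node n (j - 1) < node n (j + 1)" using N by linarith
  then show "cos (node n (j + 1)) < cos (node n (j - 1))" using N by (intro cos_monotone_0_pi) auto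
  have r0: "0 < rho n (cos (node n i))" for i using n by (intro rho_pos) auto
  have *: "\<bar>cos x - cos y\<bar> \<le> 4 * rho n (cos y)" if "x \<in> {0..pi}" "y \<in> {0..pi}" "\<bar>x - y\<bar> \<le> 1 / real n" "0 < rho n (cos y)" for x y
  proof -
    have "\<bar>cos x - cos y\<bar> \<le> (1 + real n * \<bar>x - y\<bar>)\<^sup>2 * rho n (cos y)" by (rule abs_cos_diff_le_rho[OF that(1,2) n])
    also have "\<dots> \<le> 2\<^sup>2 * rho n (cos y)" using that n0 by (intro mult_right_mono power_mono) (auto simp: pos_le_divide_eq mult.commute)
    finally show ?thesis by simp
  qed
  have "\<bar>cos (node n (j - 1)) - cos (node n j)\<bar> \<le> 4 * rho n (cos (node n j))"
    "\<bar>cos (node n (j + 1)) - cos (node n j)\<bar> \<le> 4 * rho n (cos (node n j))"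
    "\<bar>cos (node n (j + 1)) - cos (node n (j - 1))\<bar> \<le> 4 * rho n (cos (node n (j - 1)))"
    using N \<open>0 < pi / (7 * real n)\<close> by (intro * r0; simp only: atLeastAtMost_iff abs_le_iff; linarith)+
  then show "cos (node n (j - 1)) - cos (node n (j + 1)) \<le> 8 * rho n (cos (node n j))"
    "cos (node n (j - 1)) - cos (node n (j + 1)) \<le> 4 * rho n (cos (node n (j - 1)))" by linarith+
qed

lemma panel_ang:
  assumes n: "n \<ge> 1" and j: "j \<in> {1..<7 * n}" and y: "y \<in> panel n j"
  shows "y \<in> {-1..1}" "ang y \<in> {node n (j - 1)..node n (j + 1)}" "real n * \<bar>ang y - node n j\<bar> \<le> 1"
proof -
  note N = panel_nodes[OF n j]
  have y': "cos (node n (j + 1)) \<le> y" "y \<le> cos (node n (j - 1))" using y by (auto simp: panel_def)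
  show y1: "y \<in> {-1..1}" using y' cos_ge_minus_one[of "node n (j + 1)"] cos_le_one[of "node n (j - 1)"]
    unfolding atLeastAtMost_iff by linarith
  then have a: "ang y = arccos y" by (simp add: ang_def)
  have "arccos y \<le> arccos (cos (node n (j + 1)))" "arccos (cos (node n (j - 1))) \<le> arccos y"
    using y' y1 by (auto intro!: arccos_le_arccos)
  then show b: "ang y \<in> {node n (j - 1)..node n (j + 1)}" using N by (auto simp: a arccos_cos)
  have "\<bar>ang y - node n j\<bar> \<le> pi / (7 * real n)" using b N by (auto simp: abs_le_iff; linarith)
  then have "real n * \<bar>ang y - node n j\<bar> \<le> real n * (pi / (7 * real n))" by (rule mult_left_mono) simp
  also have "\<dots> \<le> 1" using n pi_less_4 by simp
  finally show "real n * \<bar>ang y - node n j\<bar> \<le> 1" .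
qed

lemma cos_in_panel:
  assumes n: "n \<ge> 1" and j: "j \<in> {1..<7 * n}" and \<theta>: "\<theta> \<in> {node n (j - 1)..node n (j + 1)}"
  shows "cos \<theta> \<in> panel n j"
  using panel_nodes[OF n j] \<theta> by (auto simp: panel_def intro!: cos_monotone_0_pi_le)

lemma card_near_le: "finite {j :: nat. \<bar>real j - c\<bar> \<le> 1}" "card {j :: nat. \<bar>real j - c\<bar> \<le> 1} \<le> 3"
proof -
  have sub: "{j :: nat. \<bar>real j - c\<bar> \<le> 1} \<subseteq> {nat \<lceil>c - 1\<rceil>..nat \<lceil>c - 1\<rceil> + 2}"
  proof
    fix j :: nat assume "j \<in> {j. \<bar>real j - c\<bar> \<le> 1}"
    then have j: "\<bar>real j - c\<bar> \<le> 1" by simp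
    then have "c - 1 \<le> of_int (int j)" by simp
    then have "\<lceil>c - 1\<rceil> \<le> int j" by (rule iffD2[OF ceiling_le_iff])
    moreover have "of_int (int j) - 2 \<le> c - 1" using j by simp
    then have "int j - 2 \<le> \<lceil>c - 1\<rceil>" using le_of_int_ceiling[of "c - 1"] by linarith
    ultimately show "j \<in> {nat \<lceil>c - 1\<rceil>..nat \<lceil>c - 1\<rceil> + 2}" by auto
  qed
  then show "finite {j :: nat. \<bar>real j - c\<bar> \<le> 1}" by (rule finite_subset) simp
  have "card {j :: nat. \<bar>real j - c\<bar> \<le> 1} \<le> card {nat \<lceil>c - 1\<rceil>..nat \<lceil>c - 1\<rceil> + 2}" using sub by (intro card_mono) auto
  then show "card {j :: nat. \<bar>real j - c\<bar> \<le> 1} \<le> 3" by simp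
qed

text \<open>An angle in panel \<open>j\<close> is within one cell of node \<open>j\<close>, so at
  most three indices qualify.\<close>

lemma panel_overlap:
  assumes n: "n \<ge> 1"
  shows "(\<Sum>j\<in>{1..<7 * n}. indicator (panel n j) y) \<le> (3 :: ennreal) * indicator {-1..1} y"
proof (cases "\<exists>j\<in>{1..<7 * n}. y \<in> panel n j")
  case True
  then have y: "y \<in> {-1..1}" using panel_ang(1)[OF n] by blast
  define c where "c = ang y * (7 * real n) / pi"
  have sub: "{j\<in>{1..<7 * n}. y \<in> panel n j} \<subseteq> {j. \<bar>real j - c\<bar> \<le> 1}"
  proof clarify
    fix j assume j: "j \<in> {1..<7 * n}" "y \<in> panel n j"
    have "\<bar>ang y - node n j\<bar> \<le> pi / (7 * real n)"
      using panel_ang(2)[OF n j] panel_nodes(7,8)[OF n j(1)] by (auto simp: abs_le_iff; linarith)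
    then have "\<bar>ang y - node n j\<bar> * (7 * real n / pi) \<le> pi / (7 * real n) * (7 * real n / pi)" by (rule mult_right_mono) simp
    then have "\<bar>(ang y - node n j) * (7 * real n / pi)\<bar> \<le> 1" using n by (simp add: abs_mult)
    moreover have "(ang y - node n j) * (7 * real n / pi) = c - real j" using n by (simp add: c_def node_def field_simps)
    ultimately have "\<bar>c - real j\<bar> \<le> 1" by (simp only:)
    then show "\<bar>real j - c\<bar> \<le> 1" by (simp add: abs_minus_commute)
  qed
  have "(\<Sum>j\<in>{1..<7 * n}. indicator (panel n j) y :: ennreal) = (\<Sum>j\<in>{j\<in>{1..<7 * n}. y \<in> panel n j}. 1)"
    by (intro sum.mono_neutral_cong_right) auto
  also have "\<dots> = of_nat (card {j\<in>{1..<7 * n}. y \<in> panel n j})" by simp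
  also have "card {j\<in>{1..<7 * n}. y \<in> panel n j} \<le> 3"
    using card_mono[OF card_near_le(1) sub] card_near_le(2)[of c] by simp
  then have "of_nat (card {j\<in>{1..<7 * n}. y \<in> panel n j}) \<le> (of_nat 3 :: ennreal)" by (rule of_nat_mono)
  finally show ?thesis using y by simp
next
  case False
  then have "(\<Sum>j\<in>{1..<7 * n}. indicator (panel n j) y :: ennreal) = 0" by (intro sum.neutral) auto
  then show ?thesis by simp
qed

text \<open>Telescoping against \<open>x / (1 + |x|)\<close>, which stays in \<open>[-1,1]\<close>
  and whose derivative is \<open>1 / (1 + |x|)^2\<close>.\<close>

lemma sum_inverse_square_le: "(\<Sum>j<N. 1 / (1 + \<bar>real j - c\<bar>)\<^sup>2) \<le> 8"
proof -
  define H :: "real \<Rightarrow> real" where "H x = x / (1 + \<bar>x\<bar>)" for x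
  have Hb: "\<bar>H x\<bar> \<le> 1" for x by (simp add: H_def)
  have step: "1 / (1 + \<bar>x\<bar>)\<^sup>2 \<le> 4 * (H (x + 1) - H x)" for x
  proof -
    consider "x \<ge> 0" | "x \<le> -1" | "-1 < x" "x < 0" by linarith
    then show ?thesis
    proof cases
      case 1
      then have "H (x + 1) - H x = 1 / ((2 + x) * (1 + x))" by (simp add: H_def divide_simps) (simp add: algebra_simps)
      moreover have "1 / (1 + x)\<^sup>2 \<le> 4 / ((2 + x) * (1 + x))"
        using 1 by (simp add: divide_simps power2_eq_square)
      ultimately show ?thesis using 1 by simp
    next
      case 2
      then have "H (x + 1) - H x = 1 / ((- x) * (1 - x))" by (simp add: H_def divide_simps) (simp add: algebra_simps)
      moreover have "1 / (1 - x)\<^sup>2 \<le> 4 / ((- x) * (1 - x))"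
        using 2 by (simp add: divide_simps power2_eq_square) (simp add: algebra_simps)
      ultimately show ?thesis using 2 by simp
    next
      case 3
      have "(x + 1) / 2 \<le> (x + 1) / (2 + x)" "- x / 2 \<le> - x / (1 - x)"
        using 3 by (intro divide_left_mono; simp)+
      moreover have "H (x + 1) = (x + 1) / (2 + x)" "H x = - (- x / (1 - x))" using 3 by (auto simp: H_def)
      ultimately have "(x + 1) / 2 \<le> H (x + 1)" "- x / 2 \<le> - H x" by simp_all
      then have "1 \<le> 4 * (H (x + 1) - H x)" by argo
      then show ?thesis by (rule order.trans[rotated]) simp
    qed
  qed
  have "(\<Sum>j<N. 1 / (1 + \<bar>real j - c\<bar>)\<^sup>2) \<le> (\<Sum>j<N. 4 * (H (real (Suc j) - c) - H (real j - c)))"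
    using step[of "real _ - c"] by (intro sum_mono) (simp add: algebra_simps)
  also have "\<dots> = 4 * (H (real N - c) - H (real 0 - c))"
    unfolding sum_distrib_left[symmetric] by (subst sum_lessThan_telescope) simp
  also have "\<dots> \<le> 8" using Hb[of "real N - c", unfolded abs_le_iff] Hb[of "real 0 - c", unfolded abs_le_iff] by argo
  finally show ?thesis .
qed

text \<open>The constant is 9 times 8: the cell width \<open>pi / (7 * n)\<close> exceeds
  \<open>1 / (3 * n)\<close>, which costs \<open>3^2\<close>.\<close>

lemma sum_node_decay_le:
  assumes n: "n \<ge> 1"
  shows "(\<Sum>j\<in>{1..<7 * n - 1}. 1 / (1 + real n * \<bar>\<theta> - node n j\<bar>) ^ 4) \<le> 72"
proof -
  define c where "c = 7 * real n * \<theta> / pi"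
  have le: "1 / (1 + real n * \<bar>\<theta> - node n j\<bar>) ^ 4 \<le> 9 * (1 / (1 + \<bar>real j - c\<bar>)\<^sup>2)" for j
  proof -
    have "node n j - \<theta> = (real j - c) * (pi / (7 * real n))" using n by (simp add: node_def c_def field_simps)
    then have "\<bar>node n j - \<theta>\<bar> = \<bar>real j - c\<bar> * (pi / (7 * real n))" by (simp only: abs_mult) simp
    then have "\<bar>\<theta> - node n j\<bar> = \<bar>real j - c\<bar> * (pi / (7 * real n))" by (simp only: abs_minus_commute)
    then have "real n * \<bar>\<theta> - node n j\<bar> = \<bar>real j - c\<bar> * (pi / 7)" using n by simp
    moreover have "\<bar>real j - c\<bar> * (1 / 3) \<le> \<bar>real j - c\<bar> * (pi / 7)" using pi_gt3 by (intro mult_left_mono) auto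
    ultimately have a: "(1 + \<bar>real j - c\<bar>) / 3 \<le> 1 + real n * \<bar>\<theta> - node n j\<bar>" by simp
    have "1 / (1 + real n * \<bar>\<theta> - node n j\<bar>) ^ 4 \<le> 1 / (1 + real n * \<bar>\<theta> - node n j\<bar>) ^ 2"
      by (intro divide_left_mono power_increasing mult_pos_pos zero_less_power add_pos_nonneg) auto
    also have "\<dots> \<le> 1 / ((1 + \<bar>real j - c\<bar>) / 3)\<^sup>2"
      using a by (intro divide_left_mono power_mono mult_pos_pos zero_less_power add_pos_nonneg) auto
    finally show ?thesis by (simp add: power_divide)
  qed
  have "(\<Sum>j\<in>{1..<7 * n - 1}. 1 / (1 + real n * \<bar>\<theta> - node n j\<bar>) ^ 4) \<le> (\<Sum>j\<in>{1..<7 * n - 1}. 9 * (1 / (1 + \<bar>real j - c\<bar>)\<^sup>2))"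
    by (rule sum_mono) (rule le)
  also have "\<dots> \<le> (\<Sum>j<7 * n. 9 * (1 / (1 + \<bar>real j - c\<bar>)\<^sup>2))" by (rule sum_mono2) auto
  also have "\<dots> = 9 * (\<Sum>j<7 * n. 1 / (1 + \<bar>real j - c\<bar>)\<^sup>2)" by (rule sum_distrib_left[symmetric])
  also have "\<dots> \<le> 72" using sum_inverse_square_le[of c "7 * n"] by simp
  finally show ?thesis .
qed

text \<open>A chord traversed backwards gives the same absolute value, and the central difference at
  the midpoint is not truncated because both ends lie in \<open>[-1,1]\<close>.\<close>

lemma chord_diff_eq_central:
  assumes k: "k \<ge> 1" and xu: "x \<in> {-1..1}" "u \<in> {-1..1}"
  shows "chord_diff k f x u = \<bar>central_difference k (\<bar>u - x\<bar> / real k) f ((x + u) / 2)\<bar>"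
proof (cases "x \<le> u")
  case True
  then have e: "(x + u) / 2 - real k * (\<bar>u - x\<bar> / real k) / 2 = x" "(x + u) / 2 + real k * (\<bar>u - x\<bar> / real k) / 2 = u"
    using k by (simp_all add: field_simps)
  show ?thesis unfolding central_difference_eq_fdiff e using xu True by (simp add: chord_diff_def)
next
  case False
  then have e: "(x + u) / 2 - real k * (\<bar>u - x\<bar> / real k) / 2 = u" "(x + u) / 2 + real k * (\<bar>u - x\<bar> / real k) / 2 = x"
    using k by (simp_all add: field_simps)
  have "fdiff k (- ((x - u) / real k)) f (u + real k * ((x - u) / real k)) = (-1) ^ k * fdiff k ((x - u) / real k) f u"
    by (rule fdiff_reflect)
  then have "\<bar>fdiff k ((u - x) / real k) f x\<bar> = \<bar>fdiff k ((x - u) / real k) f u\<bar>"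
    using k by (simp add: minus_divide_left abs_mult)
  then show ?thesis unfolding central_difference_eq_fdiff e using xu False by (simp add: chord_diff_def)
qed

context slow_weight begin

lemma panel_weight:
  assumes n: "n \<ge> 1" and j: "j \<in> {1..<7 * n}" and y: "y \<in> panel n j"
  shows "aw n (cos (node n j)) \<le> C * 2 ^ s * aw n y"
    "aw n y \<le> C * 2 ^ s * aw n (cos (node n j))"
proof -
  note A = panel_ang[OF n j y]
  have y': "cos (ang y) = y" by (rule ang(2)[OF A(1)])
  have nj: "node n j \<in> {0..pi}" by (rule panel_nodes[OF n j])
  have "(1 + real n * \<bar>ang y - node n j\<bar>) ^ s \<le> 2 ^ s" using A(3) by (intro power_mono) auto
  then have le: "C * (1 + real n * \<bar>ang y - node n j\<bar>) ^ s * aw n (cos t) \<le> C * 2 ^ s * aw n (cos t)" for t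
    using C aw_nonneg[OF n] by (intro mult_right_mono mult_left_mono) auto
  show "aw n y \<le> C * 2 ^ s * aw n (cos (node n j))"
    using order.trans[OF slow[OF n ang(1)[of y] nj] le] by (simp add: y')
  have "aw n (cos (node n j)) \<le> C * (1 + real n * \<bar>ang y - node n j\<bar>) ^ s * aw n (cos (ang y))"
    using slow[OF n nj ang(1)[of y]] by (simp only: abs_minus_commute)
  then show "aw n (cos (node n j)) \<le> C * 2 ^ s * aw n y"
    using order.trans[OF _ le[of "ang y"]] by (simp add: y')
qed

end

section \<open>Blending the local polynomials\<close>

locale local_approx = slow_weight w C s for w C s +
  fixes k n :: nat and f :: "real \<Rightarrow> real" and Cw Cg Cs :: real and K :: nat
  assumes k: "k \<ge> 2" and n: "n \<ge> 1" and f[measurable]: "f \<in> borel_measurable borel"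
    and fin: "(NN x\<in>{-1..1}. ennreal \<bar>f x\<bar>) < \<infinity>" and cpos: "Cw \<ge> 0" "Cg \<ge> 0" "Cs \<ge> 0"
    and whitney: "\<And>a b e. a < b \<Longrightarrow> (NN x\<in>{a..b}. ennreal \<bar>f x\<bar>) < \<infinity> \<Longrightarrow> e > 0 \<Longrightarrow>
      \<exists>p. degree p < k \<and> (NN x\<in>{a..b}. ennreal \<bar>f x - poly p x\<bar>) \<le> ennreal (Cw / (b - a)) * chord_mean k f a b + ennreal e"
    and growth: "\<And>(q :: real poly) a b I x. degree q < k \<Longrightarrow> a < b \<Longrightarrow> 0 \<le> I \<Longrightarrow> (NN u\<in>{a..b}. ennreal \<bar>poly q u\<bar>) \<le> ennreal I \<Longrightarrow>
      \<bar>poly q x\<bar> \<le> Cg * (I / (b - a)) * (1 + \<bar>x - a\<bar> / (b - a)) ^ k"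
    and step: "\<And>\<tau>. \<tau> \<in> {0..pi} \<Longrightarrow> \<exists>P :: real poly. degree P \<le> K * n \<and>
      (\<forall>\<theta>\<in>{0..pi}. \<bar>poly P (cos \<theta>) - (if \<tau> < \<theta> then 1 else 0)\<bar> \<le> Cs / (1 + real n * \<bar>\<theta> - \<tau>\<bar>) ^ (2 * k + s + 4))"
begin

abbreviation "wn \<equiv> avg_weight w n"
abbreviation "nd \<equiv> node n"
abbreviation "v j \<equiv> wn (cos (nd j))"
abbreviation "r j \<equiv> rho n (cos (nd j))"
abbreviation "lo j \<equiv> cos (nd (j + 1))"
abbreviation "hi j \<equiv> cos (nd (j - 1))"
abbreviation "T j \<theta> \<equiv> 1 + real n * \<bar>\<theta> - nd j\<bar>"
definition "S = {1..<7 * n}"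
definition "S' = {1..<7 * n - 1}"
definition "B = C * 2 ^ s"
text \<open>The constants of growth, overlap length, jump error and weight variation, collected for
  \<open>glue\<close>. None of them involves \<open>n\<close>, so the final bound is
  uniform.\<close>

definition "G = Cg * 49 * 197 ^ k * C * Cs * (1 + B)"
definition "D = B + G"

lemma nonneg: "0 \<le> B" "0 \<le> G" "0 \<le> D" "G \<le> D" "B \<le> D"
  using C cpos by (auto simp: B_def G_def D_def)

lemma k1: "k \<ge> 1" using k by simp

lemma v0: "0 \<le> v j" by (rule aw_nonneg[OF n])

lemma r0: "0 < r j" by (rule rho_pos[OF n]) auto

lemma wn0: "x \<in> {-1..1} \<Longrightarrow> 0 \<le> wn x" by (rule avg_weight_nonneg[OF w n])

lemma S_iff: "j \<in> S \<longleftrightarrow> j \<in> {1..<7 * n}" by (simp add: S_def)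

lemma S'_iff: "j \<in> S' \<longleftrightarrow> j \<in> S \<and> j + 1 \<in> S" by (auto simp: S_def S'_def)

lemma panel_eq: "panel n j = {lo j..hi j}" by (simp add: panel_def)

lemma v_le: "j \<in> S \<Longrightarrow> y \<in> panel n j \<Longrightarrow> v j \<le> B * wn y"
  and le_v: "j \<in> S \<Longrightarrow> y \<in> panel n j \<Longrightarrow> wn y \<le> B * v j"
  unfolding B_def S_iff by (intro panel_weight[OF n]; assumption)+

lemma v_Suc_le:
  assumes j: "j \<in> S'"
  shows "v j \<le> B * v (j + 1)"
proof (rule le_v)
  show "j + 1 \<in> S" using j by (simp add: S'_iff)
  then show "cos (nd j) \<in> panel n (j + 1)" unfolding S_iff
    using node_mono[of j "j + 1 + 1" n] by (intro cos_in_panel[OF n]) auto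
qed

text \<open>The two polynomials are compared on the overlap of neighbouring panels, where both
  approximate \<open>f\<close>, and \<open>growth\<close> extrapolates the comparison. Distances are
  quadratic in the angular factor, hence the exponent \<open>2 * k\<close>; 197 is
  \<open>1 + 4 * 49\<close>.\<close>

lemma jump_le:
  assumes j: "j \<in> S'" and deg: "degree p < k" "degree p' < k" and e: "0 \<le> e" "0 \<le> e'" and \<theta>: "\<theta> \<in> {0..pi}"
    and p: "(NN u\<in>panel n j. ennreal \<bar>f u - poly p u\<bar>) \<le> ennreal e" "(NN u\<in>panel n (j + 1). ennreal \<bar>f u - poly p' u\<bar>) \<le> ennreal e'"
  shows "\<bar>poly (p' - p) (cos \<theta>)\<bar> \<le> Cg * (49 * (e + e') / r j) * (197 ^ k * T j \<theta> ^ (2 * k))"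
proof -
  define a b I t where "a = lo j" and "b = cos (nd j)" and "I = e + e'" and "t = T j \<theta>"
  have jS: "j \<in> {1..<7 * n}" "j + 1 \<in> {1..<7 * n}" using j by (auto simp: S'_iff S_iff)
  note N = panel_nodes[OF n jS(1)] and N1 = panel_nodes(6)[OF n jS(2)]
  have le: "nd j \<le> nd (j + 1)" by (rule node_mono) simp
  have rb: "r j \<le> 49 * (b - a)" "rho n a \<le> 49 * (b - a)"
    unfolding a_def b_def using N N1 le n by (intro cos_diff_ge_rho; simp)+
  have ab: "a < b" using rb r0[of j] by simp
  have sub: "{a..b} \<subseteq> panel n j" "{a..b} \<subseteq> panel n (j + 1)"
    using cos_in_panel[OF n jS(1), of "nd j"] cos_in_panel[OF n jS(2), of "nd (j + 1)"] node_mono[of "j - 1" j n] node_mono[of "j + 1" "j + 1 + 1" n] le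
    by (auto simp: panel_def a_def b_def)
  have "(NN u\<in>{a..b}. ennreal \<bar>poly (p' - p) u\<bar>) \<le> (NN u\<in>{a..b}. ennreal \<bar>f u - poly p u\<bar> + ennreal \<bar>f u - poly p' u\<bar>)"
    by (intro set_nn_integral_mono_on) (simp add: ennreal_plus[symmetric] del: ennreal_plus)
  also have "\<dots> = (NN u\<in>{a..b}. ennreal \<bar>f u - poly p u\<bar>) + (NN u\<in>{a..b}. ennreal \<bar>f u - poly p' u\<bar>)"
    by (rule set_nn_integral_add) auto
  also have "\<dots> \<le> ennreal e + ennreal e'"
    using sub by (intro add_mono order.trans[OF nn_integral_mono p(1)] order.trans[OF nn_integral_mono p(2)]) (auto simp: indicator_def)
  finally have "(NN u\<in>{a..b}. ennreal \<bar>poly (p' - p) u\<bar>) \<le> ennreal I" using e by (simp add: I_def)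
  then have g: "\<bar>poly (p' - p) (cos \<theta>)\<bar> \<le> Cg * (I / (b - a)) * (1 + \<bar>cos \<theta> - a\<bar> / (b - a)) ^ k"
    using e by (intro growth degree_diff_less deg ab) (auto simp: I_def)
  have t1: "t \<ge> 1" by (simp add: t_def)
  have n0: "real n > 0" using n by simp
  have T2: "1 + real n * \<bar>\<theta> - nd (j + 1)\<bar> \<le> 2 * t"
  proof -
    have "\<bar>\<theta> - nd (j + 1)\<bar> \<le> \<bar>\<theta> - nd j\<bar> + pi / (7 * real n)"
      using N(8) le by linarith
    then have "real n * \<bar>\<theta> - nd (j + 1)\<bar> \<le> real n * (\<bar>\<theta> - nd j\<bar> + pi / (7 * real n))" using n0 by (intro mult_left_mono) auto
    also have "\<dots> = real n * \<bar>\<theta> - nd j\<bar> + pi / 7" using n0 by (simp add: distrib_left)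
    finally have "1 + real n * \<bar>\<theta> - nd (j + 1)\<bar> \<le> t + pi / 7" by (simp add: t_def)
    also have "pi / 7 \<le> t" using t1 pi_less_4 by linarith
    finally show ?thesis by simp
  qed
  have "\<bar>cos \<theta> - a\<bar> \<le> (1 + real n * \<bar>\<theta> - nd (j + 1)\<bar>)\<^sup>2 * rho n a"
    unfolding a_def by (rule abs_cos_diff_le_rho[OF \<theta> N1 n])
  also have "\<dots> \<le> (2 * t)\<^sup>2 * (49 * (b - a))"
    using T2 rb rho_pos[OF n, of a] by (intro mult_mono power_mono) (auto simp: a_def intro: less_imp_le)
  finally have "\<bar>cos \<theta> - a\<bar> / (b - a) \<le> 196 * t\<^sup>2" using ab by (simp add: pos_divide_le_eq power_mult_distrib algebra_simps)
  moreover have "1 \<le> t\<^sup>2" using t1 by simp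
  ultimately have "1 + \<bar>cos \<theta> - a\<bar> / (b - a) \<le> 197 * t\<^sup>2" by linarith
  then have "(1 + \<bar>cos \<theta> - a\<bar> / (b - a)) ^ k \<le> (197 * t\<^sup>2) ^ k" using ab by (intro power_mono) auto
  also have "\<dots> = 197 ^ k * t ^ (2 * k)" by (simp add: power_mult_distrib power_mult)
  finally have g1: "(1 + \<bar>cos \<theta> - a\<bar> / (b - a)) ^ k \<le> 197 ^ k * t ^ (2 * k)" .
  have "I / (b - a) \<le> I / (r j / 49)" using rb r0[of j] ab e by (intro divide_left_mono mult_pos_pos) (auto simp: I_def)
  then have "I / (b - a) \<le> 49 * I / r j" by (simp add: mult.commute)
  then show ?thesis unfolding t_def[symmetric] I_def[symmetric]
    using g1 cpos e r0[of j] ab by (intro order.trans[OF g] mult_mono mult_left_mono) (auto simp: I_def)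
qed

text \<open>With exact jumps, the sum of the differences \<open>p (j + 1) - p j\<close> telescopes
  to the polynomial of the panel found by \<open>node_locate\<close>. The error of an approximate
  jump beats the growth \<open>T ^ (2 * k)\<close> and the weight change \<open>T ^ s\<close>, and
  leaves \<open>T ^ 4\<close> in the denominator.\<close>

lemma glue:
  assumes "\<forall>j\<in>S. degree (p j) < k \<and> 0 \<le> b j \<and> ennreal (v j) * (NN x\<in>panel n j. ennreal \<bar>f x - poly (p j) x\<bar>) \<le> ennreal (b j)"
  shows "\<exists>P :: real poly. degree P \<le> (k + K) * n \<and> (\<forall>x\<in>{-1..1}. \<exists>i\<in>S. x \<in> panel n i \<and>
    \<bar>f x - poly P x\<bar> * wn x \<le> D * (v i * \<bar>f x - poly (p i) x\<bar>) + D * (\<Sum>j\<in>S'. (b j + b (j + 1)) / r j * (1 / T j (ang x) ^ 4)))"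
proof -
  note deg = assms[rule_format, THEN conjunct1] and b0 = assms[rule_format, THEN conjunct2, THEN conjunct1]
    and b = assms[rule_format, THEN conjunct2, THEN conjunct2]
  \<comment> \<open>The hypothesis bounds only the product of the local error with
    \<open>v j\<close>, which may vanish; the error itself is finite because \<open>f\<close> is
    integrable, so it can be used as a real number.\<close>
  define e where "e j = enn2real (NN x\<in>panel n j. ennreal \<bar>f x - poly (p j) x\<bar>)" for j
  have e0: "0 \<le> e j" for j by (simp add: e_def)
  have ee: "(NN x\<in>panel n j. ennreal \<bar>f x - poly (p j) x\<bar>) = ennreal (e j)" if j: "j \<in> S" for j
  proof -
    have "continuous_on {-1..1} (poly (p j))" by (intro continuous_intros)
    then have "bounded (poly (p j) ` {-1..1})" by (intro compact_imp_bounded compact_continuous_image) auto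
    then obtain M where M: "\<forall>x\<in>{-1..1}. \<bar>poly (p j) x\<bar> \<le> M" unfolding bounded_iff by auto
    have "(NN x\<in>panel n j. ennreal \<bar>f x - poly (p j) x\<bar>) \<le> (NN x\<in>{-1..1}. ennreal \<bar>f x\<bar> + ennreal M)"
    proof (rule nn_integral_mono)
      fix x :: real
      show "ennreal \<bar>f x - poly (p j) x\<bar> * indicator (panel n j) x \<le> (ennreal \<bar>f x\<bar> + ennreal M) * indicator {-1..1} x"
      proof (cases "x \<in> panel n j")
        case True
        then have x: "x \<in> {-1..1}" by (rule panel_ang(1)[OF n j[unfolded S_iff]])
        then have "\<bar>poly (p j) x\<bar> \<le> M" using M by blast
        then have "0 \<le> M" "\<bar>f x - poly (p j) x\<bar> \<le> \<bar>f x\<bar> + M" by auto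
        then have "ennreal \<bar>f x - poly (p j) x\<bar> \<le> ennreal (\<bar>f x\<bar> + M)" by (intro ennreal_leI)
        also have "\<dots> = ennreal \<bar>f x\<bar> + ennreal M" using \<open>0 \<le> M\<close> by (intro ennreal_plus) auto
        finally show ?thesis using True x by simp
      qed simp
    qed
    also have "\<dots> = (NN x\<in>{-1..1}. ennreal \<bar>f x\<bar>) + (NN (x::real)\<in>{-1..1}. ennreal M)" by (rule set_nn_integral_add) auto
    also have "\<dots> < \<infinity>" using fin by (simp add: nn_integral_cmult_indicator ennreal_mult_less_top)
    finally show ?thesis by (simp add: e_def)
  qed
  have ev: "e j * v j \<le> b j" if j: "j \<in> S" for j
  proof -
    have "ennreal (v j * e j) = ennreal (v j) * ennreal (e j)" using v0 e0 by (intro ennreal_mult) auto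
    also have "\<dots> \<le> ennreal (b j)" using b[OF j] by (simp only: ee[OF j])
    finally show ?thesis using b0[OF j] by (simp add: ennreal_le_iff mult.commute)
  qed
  have "\<forall>j\<in>S. \<exists>P :: real poly. degree P \<le> K * n \<and>
    (\<forall>\<theta>\<in>{0..pi}. \<bar>poly P (cos \<theta>) - (if nd j < \<theta> then 1 else 0)\<bar> \<le> Cs / T j \<theta> ^ (2 * k + s + 4))"
    using panel_nodes(6)[OF n] by (intro ballI step) (auto simp: S_iff)
  from bchoice[OF this] obtain R :: "nat \<Rightarrow> real poly" where R: "\<forall>j\<in>S. degree (R j) \<le> K * n \<and>
    (\<forall>\<theta>\<in>{0..pi}. \<bar>poly (R j) (cos \<theta>) - (if nd j < \<theta> then 1 else 0)\<bar> \<le> Cs / T j \<theta> ^ (2 * k + s + 4))" by (elim exE)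
  define q where "q j = p (j + 1) - p j" for j
  define P where "P = p 1 + (\<Sum>j\<in>S'. q j * R j)"
  have "degree P \<le> (k + K) * n"
  proof -
    have kn: "k \<le> k * n" using n by simp
    have "degree (q j * R j) \<le> (k + K) * n" if j: "j \<in> S'" for j
    proof -
      have "degree (q j) < k" unfolding q_def using j by (intro degree_diff_less deg) (auto simp: S'_iff)
      then have "degree (q j) + degree (R j) \<le> k * n + K * n" using R j order.trans[OF less_imp_le kn] by (intro add_mono) (auto simp: S'_iff)
      then show ?thesis using degree_mult_le[of "q j" "R j"] by (simp add: distrib_right)
    qed
    moreover have "degree (p 1) \<le> (k + K) * n" using order.trans[OF less_imp_le[OF deg[of 1]] kn] n by (auto simp: distrib_right S_iff)
    ultimately show ?thesis unfolding P_def by (intro degree_add_le degree_sum_le) (auto simp: S'_def)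
  qed
  moreover have "\<exists>i\<in>S. x \<in> panel n i \<and>
    \<bar>f x - poly P x\<bar> * wn x \<le> D * (v i * \<bar>f x - poly (p i) x\<bar>) + D * (\<Sum>j\<in>S'. (b j + b (j + 1)) / r j * (1 / T j (ang x) ^ 4))"
    (is "\<exists>i\<in>S. _ \<and> _ \<le> _ + D * sum ?Z S'") if x: "x \<in> {-1..1}" for x
  proof -
    define \<theta> where "\<theta> = ang x"
    have \<theta>: "\<theta> \<in> {0..pi}" "cos \<theta> = x" using ang x by (auto simp: \<theta>_def)
    obtain i where "i \<in> {1..<7 * n}" "\<theta> \<in> {nd (i - 1)..nd (i + 1)}" "\<forall>j\<in>S'. nd j < \<theta> \<longleftrightarrow> j < i"
      using node_locate[OF n \<theta>(1)] unfolding S'_def by (elim bexE conjE)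
    then have i: "i \<in> S" "x \<in> panel n i" "\<forall>j\<in>S'. nd j < \<theta> \<longleftrightarrow> j < i" using cos_in_panel[OF n, of i \<theta>] \<theta>(2) by (auto simp: S_iff)
    define \<sigma> where "\<sigma> j = (if nd j < \<theta> then 1 else 0 :: real)" for j
    \<comment> \<open>Only the indices below \<open>i\<close> survive, by the choice of
      \<open>i\<close>.\<close>
    have "(\<Sum>j\<in>S'. poly (q j) x * \<sigma> j) = (\<Sum>j\<in>{1..<i}. poly (q j) x)"
      using i by (intro sum.mono_neutral_cong_right) (auto simp: S'_def S_def \<sigma>_def)
    also have "\<dots> = (\<Sum>j\<in>{1..<i}. poly (p (Suc j)) x - poly (p j) x)" by (simp add: q_def)
    also have "\<dots> = poly (p i) x - poly (p 1) x" using i by (intro sum_Suc_diff') (auto simp: S_def)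
    finally have pi: "poly (p i) x - poly P x = - (\<Sum>j\<in>S'. poly (q j) x * (poly (R j) x - \<sigma> j))"
      by (simp add: P_def poly_sum right_diff_distrib sum_subtractf)
    have wx: "0 \<le> wn x" by (rule wn0[OF x])
    have term_le: "\<bar>poly (q j) x * (poly (R j) x - \<sigma> j)\<bar> * wn x \<le> G * ?Z j" if j: "j \<in> S'" for j
    proof -
      define I t where "I = e j + e (j + 1)" and "t = T j \<theta>"
      have I0: "0 \<le> I" using e0 by (simp add: I_def)
      have jS: "j \<in> S" "j + 1 \<in> S" using j by (auto simp: S'_iff)
      have t1: "t \<ge> 1" by (simp add: t_def)
      have "\<bar>poly (q j) x\<bar> \<le> Cg * (49 * I / r j) * (197 ^ k * t ^ (2 * k))"
        unfolding q_def I_def t_def \<theta>(2)[symmetric] by (rule jump_le[OF j deg deg e0 e0 \<theta>(1)]) (simp_all add: jS[simplified] ee)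
      moreover have "\<bar>poly (R j) x - \<sigma> j\<bar> \<le> Cs / t ^ (2 * k + s + 4)" using R jS(1) \<theta> unfolding \<sigma>_def t_def by blast
      moreover have "wn x \<le> C * t ^ s * v j"
        unfolding t_def \<theta>(2)[symmetric] by (rule slow[OF n \<theta>(1)]) (use panel_nodes(6)[OF n] jS S_iff in blast)
      ultimately have "\<bar>poly (q j) x\<bar> * \<bar>poly (R j) x - \<sigma> j\<bar> * wn x
        \<le> Cg * (49 * I / r j) * (197 ^ k * t ^ (2 * k)) * (Cs / t ^ (2 * k + s + 4)) * (C * t ^ s * v j)"
        using wx cpos I0 r0[of j] t1 by (intro mult_mono) auto
      also have "\<dots> = (Cg * 49 * 197 ^ k * C * Cs) * (I * v j) / r j * (t ^ (2 * k) * t ^ s / t ^ (2 * k + s + 4))" by simp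
      also have "t ^ (2 * k) * t ^ s / t ^ (2 * k + s + 4) = 1 / t ^ 4"
        using t1 by (simp add: power_add[symmetric]) (simp add: power_add)
      also have "(Cg * 49 * 197 ^ k * C * Cs) * (I * v j) / r j * (1 / t ^ 4)
        \<le> (Cg * 49 * 197 ^ k * C * Cs) * ((1 + B) * (b j + b (j + 1))) / r j * (1 / t ^ 4)"
      proof -
        \<comment> \<open>The error on panel \<open>j + 1\<close> has to be paired with the weight
          at its own node, at the cost of \<open>B\<close>.\<close>
        have "e (j + 1) * v j \<le> e (j + 1) * (B * v (j + 1))" using e0 by (intro mult_left_mono v_Suc_le[OF j])
        also have "\<dots> = B * (e (j + 1) * v (j + 1))" by simp
        also have "\<dots> \<le> B * b (j + 1)" using ev[OF jS(2)] nonneg by (intro mult_left_mono)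
        finally have "I * v j \<le> b j + B * b (j + 1)" using ev[OF jS(1)] by (simp add: I_def distrib_right)
        also have "\<dots> \<le> (1 + B) * (b j + b (j + 1))" using b0[OF jS(1)] b0[OF jS(2)] nonneg by (simp add: algebra_simps)
        finally show ?thesis using cpos C r0[of j] t1 by (intro mult_right_mono divide_right_mono mult_left_mono) auto
      qed
      also have "\<dots> = G * ?Z j" by (simp add: G_def t_def \<theta>_def)
      finally show ?thesis by (simp only: abs_mult)
    qed
    have "\<bar>poly (p i) x - poly P x\<bar> * wn x \<le> (\<Sum>j\<in>S'. \<bar>poly (q j) x * (poly (R j) x - \<sigma> j)\<bar>) * wn x"
      unfolding pi abs_minus by (intro mult_right_mono sum_abs wx)
    also have "\<dots> \<le> (\<Sum>j\<in>S'. G * ?Z j)" unfolding sum_distrib_right by (rule sum_mono) (rule term_le)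
    also have "\<dots> \<le> D * sum ?Z S'" unfolding sum_distrib_left[symmetric] using b0 r0 nonneg
      by (intro mult_right_mono sum_nonneg mult_nonneg_nonneg divide_nonneg_nonneg add_nonneg_nonneg) (auto simp: S'_iff intro: less_imp_le)
    finally have 2: "\<bar>poly (p i) x - poly P x\<bar> * wn x \<le> D * sum ?Z S'" .
    have "wn x \<le> D * v i" using le_v[OF i(1,2)] nonneg v0[of i] by (meson mult_right_mono order.trans)
    then have "\<bar>f x - poly (p i) x\<bar> * wn x \<le> \<bar>f x - poly (p i) x\<bar> * (D * v i)" by (rule mult_left_mono) simp
    then have "\<bar>f x - poly (p i) x\<bar> * wn x \<le> D * (v i * \<bar>f x - poly (p i) x\<bar>)" by (simp only: mult_ac)
    moreover have "\<bar>f x - poly P x\<bar> * wn x \<le> (\<bar>f x - poly (p i) x\<bar> + \<bar>poly (p i) x - poly P x\<bar>) * wn x" using wx by (intro mult_right_mono) auto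
    ultimately have "\<bar>f x - poly P x\<bar> * wn x \<le> D * (v i * \<bar>f x - poly (p i) x\<bar>) + D * sum ?Z S'" using 2 by (simp only: distrib_right)
    then show ?thesis using i by blast
  qed
  ultimately show ?thesis by blast
qed

end

context local_approx begin

lemma lo_less_hi: "j \<in> S \<Longrightarrow> lo j < hi j"
  unfolding S_iff by (rule panel_length(1)[OF n])

lemma panel_sub: "j \<in> S \<Longrightarrow> x \<in> panel n j \<Longrightarrow> x \<in> {-1..1}"
  unfolding S_iff by (rule panel_ang(1)[OF n])

text \<open>The slack in Whitney's inequality is divided by \<open>1 + v j\<close> beforehand, so
  that it is at most \<open>e\<close> after multiplication by the weight.\<close>

lemma panel_whitney:
  assumes j: "j \<in> S" and e: "e > 0"
  shows "\<exists>p. degree p < k \<and> ennreal (v j) * (NN x\<in>panel n j. ennreal \<bar>f x - poly p x\<bar>) \<le>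
    ennreal (Cw / (hi j - lo j)) * (ennreal (v j) * chord_mean k f (lo j) (hi j)) + ennreal e"
proof -
  have "(NN x\<in>panel n j. ennreal \<bar>f x\<bar>) \<le> (NN x\<in>{-1..1}. ennreal \<bar>f x\<bar>)"
    using panel_sub[OF j] by (intro nn_integral_mono) (auto simp: indicator_def)
  then have fin': "(NN x\<in>{lo j..hi j}. ennreal \<bar>f x\<bar>) < \<infinity>" using fin unfolding panel_eq by (rule le_less_trans)
  define d where "d = e / (1 + v j)"
  have d: "d > 0" using e v0[of j] by (simp add: d_def)
  let ?c = "chord_mean k f (lo j) (hi j)"
  obtain p where p: "degree p < k" "(NN x\<in>{lo j..hi j}. ennreal \<bar>f x - poly p x\<bar>) \<le> ennreal (Cw / (hi j - lo j)) * ?c + ennreal d"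
    using whitney[OF lo_less_hi[OF j] fin' d] by (elim exE conjE)
  have "ennreal (v j) * (NN x\<in>panel n j. ennreal \<bar>f x - poly p x\<bar>) \<le> ennreal (v j) * (ennreal (Cw / (hi j - lo j)) * ?c + ennreal d)"
    unfolding panel_eq by (rule mult_left_mono[OF p(2)]) simp
  also have "\<dots> = ennreal (Cw / (hi j - lo j)) * (ennreal (v j) * ?c) + ennreal (v j) * ennreal d" by (simp only: distrib_left mult_ac)
  also have "\<dots> \<le> ennreal (Cw / (hi j - lo j)) * (ennreal (v j) * ?c) + ennreal e"
  proof (intro add_left_mono)
    have "e * (v j / (1 + v j)) \<le> e * 1" using e v0[of j] by (intro mult_left_mono) auto
    then have "v j * d \<le> e" by (simp add: d_def mult_ac)
    then show "ennreal (v j) * ennreal d \<le> ennreal e" using v0[of j] d by (subst ennreal_mult[symmetric]) (auto intro: ennreal_leI)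
  qed
  finally show ?thesis using p(1) by blast
qed

lemma panel_transform:
  assumes "(\<lambda>(y, h). \<Psi> y h) \<in> borel_measurable (borel \<Otimes>\<^sub>M borel)" and j: "j \<in> S"
  shows "(NN x\<in>panel n j. (NN u\<in>panel n j. \<Psi> ((x + u) / 2) (\<bar>u - x\<bar> / real k)))
    \<le> ennreal (98 * real k * real n * (hi j - lo j)) * (NN t\<in>{0<..1 / real n}. (NN y\<in>panel n j. \<Psi> y (t * phi y)))"
  unfolding panel_eq
  by (rule chord_transform[where ?t1.0 = "nd (j - 1)" and ?t2.0 = "nd (j + 1)", OF assms(1)])
    (use panel_nodes[OF n j[unfolded S_iff]] k n in auto)

text \<open>The step is averaged over \<open>(0, 1 / n]\<close> before summing over panels: for each
  single step the panels add up to at most three copies of the whole norm, whereas local suprema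
  could not be summed. The factor \<open>n\<close> in \<open>c\<close> undoes the length
  \<open>1 / n\<close> of the range of steps.\<close>

lemma jackson_one:
  assumes \<Omega>: "\<Omega> \<ge> 0" and \<epsilon>: "\<epsilon> > 0"
    and cd: "\<And>h. 0 < h \<Longrightarrow> h \<le> 1 / real n \<Longrightarrow> (NN x\<in>{-1..1}. ennreal (\<bar>central_difference k (h * phi x) f x\<bar> * wn x)) \<le> ennreal \<Omega>"
  shows "\<exists>P :: real poly. degree P \<le> (k + K) * n \<and>
    (NN x\<in>{-1..1}. ennreal (\<bar>f x - poly P x\<bar> * wn x)) \<le> ennreal (17 * D * ((294 * Cw * real k * B + 1) * (\<Omega> + \<epsilon>)))"
proof -
  define X where "X y t = ennreal \<bar>central_difference k (t * phi y) f y\<bar>" for y t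
  have Xm[measurable]: "(\<lambda>(t, y). X y t) \<in> borel_measurable (borel \<Otimes>\<^sub>M borel)" "(\<lambda>y. X y t) \<in> borel_measurable borel" for t
    unfolding X_def case_prod_beta' by measurable
  define Y where "Y j = (NN t\<in>{0<..1 / real n}. (NN y\<in>panel n j. X y t * ennreal (wn y)))" for j
  \<comment> \<open>There are fewer than \<open>7 * n\<close> panels, so slacks of size
    \<open>\<eta>\<close> add up to at most \<open>\<epsilon>\<close>.\<close>
  define c \<eta> where "c = 98 * Cw * real k * real n * B" and "\<eta> = \<epsilon> / (7 * real n)"
  have c0: "0 \<le> c" "0 < \<eta>" using cpos nonneg \<epsilon> n by (auto simp: c_def \<eta>_def)
  have ex: "\<forall>j\<in>S. \<exists>p. degree p < k \<and> ennreal (v j) * (NN u\<in>panel n j. ennreal \<bar>f u - poly p u\<bar>) \<le> ennreal c * Y j + ennreal \<eta>"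
  proof
    fix j assume j: "j \<in> S"
    define l where "l = hi j - lo j"
    have l: "l > 0" using lo_less_hi[OF j] by (simp add: l_def)
    obtain p where p: "degree p < k" "ennreal (v j) * (NN x\<in>panel n j. ennreal \<bar>f x - poly p x\<bar>) \<le>
        ennreal (Cw / l) * (ennreal (v j) * chord_mean k f (lo j) (hi j)) + ennreal \<eta>"
      using panel_whitney[OF j c0(2)] unfolding l_def by (elim exE conjE)
    let ?X = "NN t\<in>{0<..1 / real n}. (NN y\<in>panel n j. X y t)"
    have "chord_mean k f (lo j) (hi j) = (NN x\<in>panel n j. (NN u\<in>panel n j. ennreal \<bar>central_difference k (\<bar>u - x\<bar> / real k) f ((x + u) / 2)\<bar>))"
      unfolding chord_mean_def panel_eq[symmetric] using panel_sub[OF j]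
      by (intro nn_integral_cong) (auto simp: indicator_def chord_diff_eq_central[OF k1] intro!: nn_integral_cong)
    also have "\<dots> \<le> ennreal (98 * real k * real n * l) * ?X"
      unfolding X_def l_def by (rule panel_transform[OF _ j]) measurable
    finally have cm: "ennreal (v j) * chord_mean k f (lo j) (hi j) \<le> ennreal (98 * real k * real n * l) * (ennreal (v j) * ?X)"
      by (subst mult.left_commute) (rule mult_left_mono, simp_all)
    have vX: "ennreal (v j) * ?X \<le> ennreal B * Y j"
    proof -
      have "ennreal (v j) * ?X = (NN t\<in>{0<..1 / real n}. (NN y\<in>panel n j. ennreal (v j) * X y t))"
        by (subst set_nn_integral_cmult, measurable) (intro set_nn_integral_cmult[symmetric], measurable)
      also have "\<dots> \<le> (NN t\<in>{0<..1 / real n}. (NN y\<in>panel n j. ennreal B * (X y t * ennreal (wn y))))"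
      proof (intro set_nn_integral_mono_on)
        fix t y assume y: "y \<in> panel n j"
        have "ennreal (v j) \<le> ennreal B * ennreal (wn y)"
          using v_le[OF j y] nonneg wn0[OF panel_sub[OF j y]] by (simp add: ennreal_mult[symmetric] ennreal_leI)
        then have "ennreal (v j) * X y t \<le> ennreal B * ennreal (wn y) * X y t" by (rule mult_right_mono) simp
        then show "ennreal (v j) * X y t \<le> ennreal B * (X y t * ennreal (wn y))" by (simp only: mult_ac)
      qed
      also have "\<dots> = ennreal B * Y j" unfolding Y_def
        by (subst set_nn_integral_cmult, measurable) (intro set_nn_integral_cmult, measurable)
      finally show ?thesis .
    qed
    have "ennreal (Cw / l) * (ennreal (v j) * chord_mean k f (lo j) (hi j)) \<le> ennreal (Cw / l) * (ennreal (98 * real k * real n * l) * (ennreal B * Y j))"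
      by (intro mult_left_mono order.trans[OF cm] vX) auto
    also have "\<dots> = ennreal (Cw / l * (98 * real k * real n * l) * B) * Y j"
      using cpos l nonneg by (subst (1 2) ennreal_mult) (auto simp: mult.assoc)
    also have "Cw / l * (98 * real k * real n * l) * B = c" using l by (simp add: c_def)
    finally show "\<exists>p. degree p < k \<and> ennreal (v j) * (NN u\<in>panel n j. ennreal \<bar>f u - poly p u\<bar>) \<le> ennreal c * Y j + ennreal \<eta>"
      using p by (intro exI[of _ p] conjI order.trans[OF p(2)] add_right_mono)
  qed
  obtain p :: "nat \<Rightarrow> real poly" where p: "\<forall>j\<in>S. degree (p j) < k \<and> ennreal (v j) * (NN u\<in>panel n j. ennreal \<bar>f u - poly (p j) u\<bar>) \<le> ennreal c * Y j + ennreal \<eta>"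
    using bchoice[OF ex] by (elim exE)
  have sumY: "(\<Sum>j\<in>S. Y j) \<le> ennreal (3 * \<Omega> / real n)"
  proof -
    have "(\<Sum>j\<in>S. Y j) = (NN t\<in>{0<..1 / real n}. (\<Sum>j\<in>S. \<integral>\<^sup>+y\<in>panel n j. X y t * ennreal (wn y) \<partial>lborel))"
      unfolding Y_def by (rule set_nn_integral_sum[symmetric]) measurable
    also have "\<dots> \<le> (NN t\<in>{0<..1 / real n}. ennreal (3 * \<Omega>))"
    proof (rule set_nn_integral_mono_on)
      fix t assume t: "t \<in> {0<..1 / real n}"
      have "(\<Sum>j\<in>S. \<integral>\<^sup>+y\<in>panel n j. X y t * ennreal (wn y) \<partial>lborel)
        = (NN y. (\<Sum>j\<in>S. X y t * ennreal (wn y) * indicator (panel n j) y))"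
        by (rule nn_integral_sum[symmetric]) measurable
      also have "\<dots> \<le> (NN y. 3 * (X y t * ennreal (wn y) * indicator {-1..1} y))"
      proof (rule nn_integral_mono)
        fix y
        have "(\<Sum>j\<in>S. X y t * ennreal (wn y) * indicator (panel n j) y) = X y t * ennreal (wn y) * (\<Sum>j\<in>S. indicator (panel n j) y)"
          by (rule sum_distrib_left[symmetric])
        also have "\<dots> \<le> X y t * ennreal (wn y) * (3 * indicator {-1..1} y)"
          unfolding S_def by (rule mult_left_mono[OF panel_overlap[OF n]]) simp
        finally show "(\<Sum>j\<in>S. X y t * ennreal (wn y) * indicator (panel n j) y) \<le> 3 * (X y t * ennreal (wn y) * indicator {-1..1} y)"
          by (simp only: mult_ac)
      qed
      also have "\<dots> = 3 * (NN y\<in>{-1..1}. X y t * ennreal (wn y))" by (rule nn_integral_cmult) measurable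
      also have "(NN y\<in>{-1..1}. X y t * ennreal (wn y)) = (NN x\<in>{-1..1}. ennreal (\<bar>central_difference k (t * phi x) f x\<bar> * wn x))"
        by (intro nn_integral_cong) (auto simp: indicator_def X_def ennreal_mult'' wn0)
      also have "3 * \<dots> \<le> 3 * ennreal \<Omega>" using cd t by (intro mult_left_mono) auto
      also have "\<dots> = ennreal (3 * \<Omega>)" using \<Omega> by (simp add: ennreal_mult)
      finally show "(\<Sum>j\<in>S. \<integral>\<^sup>+y\<in>panel n j. X y t * ennreal (wn y) \<partial>lborel) \<le> ennreal (3 * \<Omega>)" .
    qed
    also have "\<dots> = ennreal (3 * \<Omega>) * ennreal (1 / real n)" by (simp add: nn_integral_cmult_indicator)
    also have "\<dots> = ennreal (3 * \<Omega> * (1 / real n))" using \<Omega> by (intro ennreal_mult[symmetric]) auto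
    finally show ?thesis by simp
  qed
  define \<beta> where "\<beta> = (294 * Cw * real k * B + 1) * (\<Omega> + \<epsilon>)"
  have \<beta>0: "0 \<le> \<beta>" using cpos nonneg \<Omega> \<epsilon> by (simp add: \<beta>_def)
  define V where "V j = ennreal (v j) * (NN u\<in>panel n j. ennreal \<bar>f u - poly (p j) u\<bar>)" for j
  have "(\<Sum>j\<in>S. V j) \<le> (\<Sum>j\<in>S. ennreal c * Y j + ennreal \<eta>)" unfolding V_def using p by (intro sum_mono) auto
  also have "\<dots> = ennreal c * (\<Sum>j\<in>S. Y j) + (\<Sum>j\<in>S. ennreal \<eta>)" by (simp only: sum.distrib sum_distrib_left)
  also have "\<dots> \<le> ennreal c * ennreal (3 * \<Omega> / real n) + ennreal \<epsilon>"
  proof (intro add_mono mult_left_mono sumY)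
    have "real (card S) * \<eta> \<le> 7 * real n * \<eta>" using c0 n by (intro mult_right_mono) (auto simp: S_def)
    also have "\<dots> = \<epsilon>" using n by (simp add: \<eta>_def)
    finally show "(\<Sum>j\<in>S. ennreal \<eta>) \<le> ennreal \<epsilon>" using c0 by (subst sum_ennreal) (auto intro: ennreal_leI)
  qed simp
  also have "\<dots> = ennreal (c * (3 * \<Omega> / real n) + \<epsilon>)" using c0 \<Omega> \<epsilon> by (subst ennreal_mult[symmetric], simp, simp, subst ennreal_plus, auto)
  also have "c * (3 * \<Omega> / real n) + \<epsilon> = 294 * Cw * real k * B * \<Omega> + \<epsilon>" using n by (simp add: c_def)
  also have "\<dots> \<le> 294 * Cw * real k * B * (\<Omega> + \<epsilon>) + (\<Omega> + \<epsilon>)" using cpos nonneg \<Omega> \<epsilon> by (intro add_mono mult_left_mono) auto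
  also have "\<dots> = \<beta>" by (simp add: \<beta>_def distrib_right)
  finally have sumV: "(\<Sum>j\<in>S. V j) \<le> ennreal \<beta>" by (simp add: ennreal_leI)
  define b where "b j = enn2real (V j)" for j
  have b0: "0 \<le> b j" for j by (simp add: b_def)
  have Vb: "V j = ennreal (b j)" if "j \<in> S" for j
  proof -
    have "V j \<le> (\<Sum>j\<in>S. V j)" using that by (intro member_le_sum) (auto simp: S_def)
    also have "\<dots> < \<infinity>" using sumV by (rule le_less_trans) simp
    finally show ?thesis by (simp add: b_def)
  qed
  have "(\<Sum>j\<in>S. V j) = (\<Sum>j\<in>S. ennreal (b j))" by (rule sum.cong) (auto simp: Vb)
  then have "ennreal (\<Sum>j\<in>S. b j) \<le> ennreal \<beta>" using sumV b0 by (simp add: sum_ennreal)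
  then have sumb: "(\<Sum>j\<in>S. b j) \<le> \<beta>" using \<beta>0 by (simp add: ennreal_le_iff)
  have H: "\<forall>j\<in>S. degree (p j) < k \<and> 0 \<le> b j \<and> ennreal (v j) * (NN x\<in>panel n j. ennreal \<bar>f x - poly (p j) x\<bar>) \<le> ennreal (b j)"
    using p b0 Vb by (simp add: V_def)
  obtain P :: "real poly" where P: "degree P \<le> (k + K) * n" "\<forall>x\<in>{-1..1}. \<exists>i\<in>S. x \<in> panel n i \<and>
    \<bar>f x - poly P x\<bar> * wn x \<le> D * (v i * \<bar>f x - poly (p i) x\<bar>) + D * (\<Sum>j\<in>S'. (b j + b (j + 1)) / r j * (1 / T j (ang x) ^ 4))"
    using glue[OF H] by (elim exE conjE)
  \<comment> \<open>The angular kernel is replaced by one in \<open>x\<close> with integral at most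
    \<open>2 * r j\<close>, which cancels the division by \<open>r j\<close>.\<close>
  define Z where "Z j x = 4 * D * (b j + b (j + 1)) / r j * (1 / (1 + \<bar>x - cos (nd j)\<bar> / r j)\<^sup>2)" for j x
  have Z0: "0 \<le> Z j x" for j x unfolding Z_def using nonneg b0 r0[of j] by (intro mult_nonneg_nonneg divide_nonneg_nonneg) auto
  have [measurable]: "Z j \<in> borel_measurable borel" for j unfolding Z_def[abs_def] by measurable
  define U where "U i x = ennreal (D * v i) * ennreal \<bar>f x - poly (p i) x\<bar> * indicator (panel n i) x" for i x
  have [measurable]: "U i \<in> borel_measurable borel" for i unfolding U_def[abs_def] by measurable
  have "(NN x\<in>{-1..1}. ennreal (\<bar>f x - poly P x\<bar> * wn x)) \<le> (NN x. (\<Sum>i\<in>S. U i x) + (\<Sum>j\<in>S'. ennreal (Z j x)))"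
  proof (rule nn_integral_mono)
    fix x :: real
    show "ennreal (\<bar>f x - poly P x\<bar> * wn x) * indicator {-1..1} x \<le> (\<Sum>i\<in>S. U i x) + (\<Sum>j\<in>S'. ennreal (Z j x))"
    proof (cases "x \<in> {-1..1}")
      case True
      obtain i where i: "i \<in> S" "x \<in> panel n i" "\<bar>f x - poly P x\<bar> * wn x \<le>
        D * (v i * \<bar>f x - poly (p i) x\<bar>) + D * (\<Sum>j\<in>S'. (b j + b (j + 1)) / r j * (1 / T j (ang x) ^ 4))"
        using P(2)[rule_format, OF True] by (elim bexE conjE)
      have "\<bar>f x - poly P x\<bar> * wn x \<le> D * v i * \<bar>f x - poly (p i) x\<bar> + D * (\<Sum>j\<in>S'. (b j + b (j + 1)) / r j * (1 / T j (ang x) ^ 4))"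
        using i(3) by (simp only: mult.assoc)
      also have "D * (\<Sum>j\<in>S'. (b j + b (j + 1)) / r j * (1 / T j (ang x) ^ 4))
        \<le> D * (\<Sum>j\<in>S'. (b j + b (j + 1)) / r j * (4 * (1 / (1 + \<bar>x - cos (nd j)\<bar> / r j)\<^sup>2)))"
      proof (intro mult_left_mono[OF _ nonneg(3)] sum_mono mult_left_mono)
        fix j assume "j \<in> S'"
        then have "nd j \<in> {0..pi}" by (intro node_in[OF n]) (auto simp: S'_def)
        from decay_compare[OF n ang(1)[of x] this]
        show "1 / T j (ang x) ^ 4 \<le> 4 * (1 / (1 + \<bar>x - cos (nd j)\<bar> / r j)\<^sup>2)" by (simp add: ang(2)[OF True])
        show "0 \<le> (b j + b (j + 1)) / r j" using b0 r0[of j] by simp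
      qed
      also have "\<dots> = (\<Sum>j\<in>S'. Z j x)" unfolding Z_def sum_distrib_left by (intro sum.cong refl) simp
      finally have "ennreal (\<bar>f x - poly P x\<bar> * wn x) \<le> ennreal (D * v i * \<bar>f x - poly (p i) x\<bar> + (\<Sum>j\<in>S'. Z j x))" by (simp add: ennreal_leI)
      also have "\<dots> = ennreal (D * v i * \<bar>f x - poly (p i) x\<bar>) + (\<Sum>j\<in>S'. ennreal (Z j x))"
        using Z0 nonneg v0 by (subst ennreal_plus) (auto intro: sum_nonneg)
      also have "ennreal (D * v i * \<bar>f x - poly (p i) x\<bar>) = U i x" using i(2) nonneg v0[of i] by (simp add: U_def ennreal_mult)
      also have "\<dots> \<le> (\<Sum>i\<in>S. U i x)" using i(1) by (intro member_le_sum) (auto simp: S_def)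
      finally show ?thesis using True by (simp add: add_right_mono)
    qed simp
  qed
  also have "\<dots> = (NN x. (\<Sum>i\<in>S. U i x)) + (NN x. (\<Sum>j\<in>S'. ennreal (Z j x)))"
    by (rule nn_integral_add) measurable
  also have "\<dots> = (\<Sum>i\<in>S. \<integral>\<^sup>+x. U i x \<partial>lborel) + (\<Sum>j\<in>S'. \<integral>\<^sup>+x. ennreal (Z j x) \<partial>lborel)"
    by (subst nn_integral_sum; (measurable)?)+
  also have "\<dots> \<le> ennreal (D * \<beta>) + ennreal (16 * D * \<beta>)"
  proof (rule add_mono)
    have "(NN x. U i x) = ennreal (D * b i)" if i: "i \<in> S" for i
    proof -
      have "(NN x. U i x) = ennreal (D * v i) * (NN x\<in>panel n i. ennreal \<bar>f x - poly (p i) x\<bar>)"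
        unfolding U_def by (rule set_nn_integral_cmult) measurable
      also have "\<dots> = ennreal D * V i" using nonneg v0[of i] by (simp add: V_def ennreal_mult mult.assoc)
      finally show ?thesis using Vb[OF i] nonneg b0 by (simp add: ennreal_mult)
    qed
    then have "(\<Sum>i\<in>S. \<integral>\<^sup>+x. U i x \<partial>lborel) = (\<Sum>i\<in>S. ennreal (D * b i))" by simp
    also have "\<dots> = ennreal (\<Sum>i\<in>S. D * b i)" using nonneg b0 by (intro sum_ennreal) auto
    also have "\<dots> \<le> ennreal (D * \<beta>)" using sumb nonneg unfolding sum_distrib_left[symmetric] by (intro ennreal_leI mult_left_mono) auto
    finally show "(\<Sum>i\<in>S. \<integral>\<^sup>+x. U i x \<partial>lborel) \<le> ennreal (D * \<beta>)" .
  next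
    have "(NN x. ennreal (Z j x)) \<le> ennreal (8 * D * (b j + b (j + 1)))" for j
    proof -
      have c0: "0 \<le> 4 * D * (b j + b (j + 1)) / r j" using nonneg b0 r0[of j] by (intro mult_nonneg_nonneg divide_nonneg_nonneg) auto
      have "(NN x. ennreal (Z j x)) = (NN x. ennreal (4 * D * (b j + b (j + 1)) / r j) * ennreal (1 / (1 + \<bar>x - cos (nd j)\<bar> / r j)\<^sup>2))"
        unfolding Z_def using c0 by (intro nn_integral_cong ennreal_mult) auto
      also have "\<dots> = ennreal (4 * D * (b j + b (j + 1)) / r j) * (NN x. ennreal (1 / (1 + \<bar>x - cos (nd j)\<bar> / r j)\<^sup>2))"
        by (rule nn_integral_cmult) measurable
      also have "\<dots> \<le> ennreal (4 * D * (b j + b (j + 1)) / r j) * ennreal (2 * r j)"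
        by (intro mult_left_mono nn_integral_decay_le[OF r0]) simp
      also have "\<dots> = ennreal (4 * D * (b j + b (j + 1)) / r j * (2 * r j))" using c0 r0[of j] by (intro ennreal_mult[symmetric]) auto
      also have "4 * D * (b j + b (j + 1)) / r j * (2 * r j) = 8 * D * (b j + b (j + 1))" using r0[of j] by simp
      finally show ?thesis .
    qed
    then have "(\<Sum>j\<in>S'. \<integral>\<^sup>+x. ennreal (Z j x) \<partial>lborel) \<le> (\<Sum>j\<in>S'. ennreal (8 * D * (b j + b (j + 1))))" by (rule sum_mono)
    also have "\<dots> = ennreal (\<Sum>j\<in>S'. 8 * D * (b j + b (j + 1)))" using nonneg b0 by (intro sum_ennreal) auto
    also have "\<dots> \<le> ennreal (16 * D * \<beta>)"
    proof (rule ennreal_leI)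
      have "(\<Sum>j\<in>S'. b (j + 1)) = (\<Sum>j\<in>(\<lambda>j. j + 1) ` S'. b j)" by (subst sum.reindex) (auto simp: inj_on_def)
      also have "\<dots> \<le> (\<Sum>j\<in>S. b j)" using b0 by (intro sum_mono2) (auto simp: S_def S'_def)
      finally have 1: "(\<Sum>j\<in>S'. b (j + 1)) \<le> \<beta>" using sumb by simp
      have "(\<Sum>j\<in>S'. b j) \<le> (\<Sum>j\<in>S. b j)" using b0 by (intro sum_mono2) (auto simp: S_def S'_def)
      then have 2: "(\<Sum>j\<in>S'. b j) \<le> \<beta>" using sumb by simp
      have "(\<Sum>j\<in>S'. 8 * D * (b j + b (j + 1))) = 8 * D * ((\<Sum>j\<in>S'. b j) + (\<Sum>j\<in>S'. b (j + 1)))"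
        by (simp only: sum_distrib_left[symmetric] sum.distrib)
      also have "\<dots> \<le> 8 * D * (\<beta> + \<beta>)" using 1 2 nonneg by (intro mult_left_mono add_mono) auto
      finally show "(\<Sum>j\<in>S'. 8 * D * (b j + b (j + 1))) \<le> 16 * D * \<beta>" by simp
    qed
    finally show "(\<Sum>j\<in>S'. \<integral>\<^sup>+x. ennreal (Z j x) \<partial>lborel) \<le> ennreal (16 * D * \<beta>)" .
  qed
  \<comment> \<open>The local errors count once; each jump counts \<open>4 * 2\<close> times for
    each of its two panels, which gives 16.\<close>
  also have "\<dots> = ennreal (17 * D * \<beta>)" using nonneg \<beta>0 by (subst ennreal_plus[symmetric]) auto
  finally show ?thesis using P(1) unfolding \<beta>_def by blast
qed

text \<open>A bound that holds almost everywhere for each single step becomes, by Fubini and the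
  chord transformation, a bound for almost all chords of a panel. Pointwise control then comes from
  \<open>approx_pointwise\<close>.\<close>

lemma jackson_inf:
  assumes \<Omega>: "\<Omega> \<ge> 0" and \<epsilon>: "\<epsilon> > 0"
    and cd: "\<And>h. 0 < h \<Longrightarrow> h \<le> 1 / real n \<Longrightarrow> AE x in lborel. x \<in> {-1..1} \<longrightarrow> ennreal (\<bar>central_difference k (h * phi x) f x\<bar> * wn x) \<le> ennreal \<Omega>"
  shows "\<exists>P :: real poly. degree P \<le> (k + K) * n \<and> (AE x in lborel. x \<in> {-1..1} \<longrightarrow>
    ennreal (\<bar>f x - poly P x\<bar> * wn x) \<le> ennreal (D * ((B + (2 ^ k * real k * real k + 864) * (Cw * B + 1)) * (\<Omega> + \<epsilon>))))"
proof -
  define \<kappa> where "\<kappa> = 2 ^ k * real k * real k"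
  have \<kappa>: "\<kappa> \<ge> 0" by (simp add: \<kappa>_def)
  \<comment> \<open>The indicator of the exceptional pairs: its integral over midpoints vanishes for
    every step, hence so does its integral over all chords of a panel.\<close>
  define \<Psi> where "\<Psi> y h = (if \<Omega> < \<bar>central_difference k h f y\<bar> * wn y then 1 else 0 :: ennreal)" for y h
  have \<Psi>m[measurable]: "(\<lambda>(y, h). \<Psi> y h) \<in> borel_measurable (borel \<Otimes>\<^sub>M borel)"
    unfolding \<Psi>_def case_prod_beta' by measurable
  have \<Psi>0: "(NN y\<in>A. \<Psi> y (t * phi y)) = 0" if t: "t \<in> {0<..1 / real n}" and A: "A \<subseteq> {-1..1}" for t A
  proof -
    have "AE y in lborel. y \<in> {-1..1} \<longrightarrow> ennreal (\<bar>central_difference k (t * phi y) f y\<bar> * wn y) \<le> ennreal \<Omega>"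
      using cd t by auto
    then have "AE y in lborel. \<Psi> y (t * phi y) * indicator A y = 0"
    proof (rule eventually_mono)
      fix y assume y: "y \<in> {-1..1} \<longrightarrow> ennreal (\<bar>central_difference k (t * phi y) f y\<bar> * wn y) \<le> ennreal \<Omega>"
      show "\<Psi> y (t * phi y) * indicator A y = 0"
      proof (cases "y \<in> A")
        case True
        then have "ennreal (\<bar>central_difference k (t * phi y) f y\<bar> * wn y) \<le> ennreal \<Omega>" using y A by auto
        then have "\<bar>central_difference k (t * phi y) f y\<bar> * wn y \<le> \<Omega>" using \<Omega> by (simp add: ennreal_le_iff)
        then show ?thesis by (simp add: \<Psi>_def)
      qed simp
    qed
    then have "(NN y\<in>A. \<Psi> y (t * phi y)) = (\<integral>\<^sup>+y. 0 \<partial>(lborel :: real measure))"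
      by (intro nn_integral_cong_AE) simp
    then show ?thesis by simp
  qed
  \<comment> \<open>After multiplication by the weight at the node, \<open>\<Omega>1\<close> bounds
    the chord differences, \<open>\<gamma>\<close> the mean local error per unit length, and
    \<open>\<Lambda>\<close> the pointwise local error.\<close>
  define \<Omega>1 where "\<Omega>1 = B * \<Omega>"
  define \<gamma> where "\<gamma> = Cw * \<Omega>1 + \<epsilon>"
  define \<Lambda> where "\<Lambda> = \<Omega>1 + \<kappa> * \<gamma>"
  have \<Omega>1: "0 \<le> \<Omega>1" using nonneg \<Omega> by (simp add: \<Omega>1_def)
  have \<gamma>: "0 \<le> \<gamma>" using cpos \<Omega>1 \<epsilon> by (simp add: \<gamma>_def)
  have \<Lambda>: "0 \<le> \<Lambda>" using \<kappa> \<Omega>1 \<gamma> by (simp add: \<Lambda>_def)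
  define len where "len j = hi j - lo j" for j
  have ex: "\<forall>j\<in>S. \<exists>p. degree p < k \<and> ennreal (v j) * (NN u\<in>panel n j. ennreal \<bar>f u - poly p u\<bar>) \<le> ennreal (\<gamma> * len j) \<and> (AE x in lborel. x \<in> panel n j \<longrightarrow> v j * \<bar>f x - poly p x\<bar> \<le> \<Lambda>)"
  proof
    fix j assume j: "j \<in> S"
    define a b where "a = lo j" and "b = hi j"
    have J: "panel n j = {a..b}" by (simp add: panel_eq a_def b_def)
    have ab: "a < b" unfolding a_def b_def by (rule lo_less_hi[OF j])
    have len: "len j = b - a" by (simp add: len_def a_def b_def)
    have e: "\<epsilon> * (b - a) > 0" using \<epsilon> ab by simp
    obtain p where p: "degree p < k" "ennreal (v j) * (NN x\<in>{a..b}. ennreal \<bar>f x - poly p x\<bar>) \<le>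
        ennreal (Cw / (b - a)) * (ennreal (v j) * chord_mean k f a b) + ennreal (\<epsilon> * (b - a))"
      using panel_whitney[OF j e] unfolding a_def[symmetric] b_def[symmetric] J by (elim exE conjE)
    have sub: "x \<in> {-1..1}" if "x \<in> {a..b}" for x using panel_sub[OF j] that J by blast
    have "(NN x\<in>{a..b}. (NN u\<in>{a..b}. \<Psi> ((x + u) / 2) (\<bar>u - x\<bar> / real k)))
      \<le> ennreal (98 * real k * real n * (b - a)) * (NN t\<in>{0<..1 / real n}. (NN y\<in>{a..b}. \<Psi> y (t * phi y)))"
      using panel_transform[OF \<Psi>m j] unfolding J a_def[symmetric] b_def[symmetric] .
    also have "(NN t\<in>{0<..1 / real n}. (NN y\<in>{a..b}. \<Psi> y (t * phi y))) \<le> (NN t\<in>{0<..1 / real n}. 0)"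
      using sub by (intro set_nn_integral_mono_on) (simp add: \<Psi>0 subset_eq)
    finally have z: "(NN x\<in>{a..b}. (NN u\<in>{a..b}. \<Psi> ((x + u) / 2) (\<bar>u - x\<bar> / real k))) = 0"
      by (simp add: mult_left_mono)
    have \<Psi>p[measurable]: "(\<lambda>z. \<Psi> ((fst z + snd z) / 2) (\<bar>snd z - fst z\<bar> / real k)) \<in> borel_measurable (borel \<Otimes>\<^sub>M borel)"
      "(\<lambda>u. \<Psi> ((x + u) / 2) (\<bar>u - x\<bar> / real k)) \<in> borel_measurable borel" for x
      unfolding \<Psi>_def by measurable
    have "(\<lambda>x. (NN u\<in>{a..b}. \<Psi> ((x + u) / 2) (\<bar>u - x\<bar> / real k)) * indicator {a..b} x) \<in> borel_measurable lborel"
      unfolding \<Psi>_def by measurable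
    then have "AE x in lborel. (NN u\<in>{a..b}. \<Psi> ((x + u) / 2) (\<bar>u - x\<bar> / real k)) * indicator {a..b} x = 0"
      using z by (simp only: nn_integral_0_iff_AE)
    then have ch: "AE x in lborel. x \<in> {a..b} \<longrightarrow> ennreal (v j) * (NN u\<in>{a..b}. ennreal (chord_diff k f x u)) \<le> ennreal (\<Omega>1 * (b - a))"
    proof (rule eventually_mono, intro impI)
      fix x assume x0: "(NN u\<in>{a..b}. \<Psi> ((x + u) / 2) (\<bar>u - x\<bar> / real k)) * indicator {a..b} x = 0" and x: "x \<in> {a..b}"
      have "(NN u\<in>{a..b}. \<Psi> ((x + u) / 2) (\<bar>u - x\<bar> / real k)) = 0" using x0 x by simp
      then have ae: "AE u in lborel. \<Psi> ((x + u) / 2) (\<bar>u - x\<bar> / real k) * indicator {a..b} u = 0"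
        by (subst (asm) nn_integral_0_iff_AE) measurable
      have "ennreal (v j) * (NN u\<in>{a..b}. ennreal (chord_diff k f x u)) = (NN u\<in>{a..b}. ennreal (v j) * ennreal (chord_diff k f x u))"
        by (rule set_nn_integral_cmult[symmetric]) measurable
      also have "\<dots> \<le> (NN u\<in>{a..b}. ennreal \<Omega>1)"
      proof (rule nn_integral_mono_AE, use ae in \<open>rule eventually_mono\<close>)
        fix u assume u: "\<Psi> ((x + u) / 2) (\<bar>u - x\<bar> / real k) * indicator {a..b} u = 0"
        show "ennreal (v j) * ennreal (chord_diff k f x u) * indicator {a..b} u \<le> ennreal \<Omega>1 * indicator {a..b} u"
        proof (cases "u \<in> {a..b}")
          case True
          have "\<Psi> ((x + u) / 2) (\<bar>u - x\<bar> / real k) = 0" using u True by simp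
          then have "\<bar>central_difference k (\<bar>u - x\<bar> / real k) f ((x + u) / 2)\<bar> * wn ((x + u) / 2) \<le> \<Omega>"
            by (simp add: \<Psi>_def split: if_splits)
          then have c: "chord_diff k f x u * wn ((x + u) / 2) \<le> \<Omega>" using chord_diff_eq_central[OF k1 sub[OF x] sub[OF True], of f] by simp
          have c0: "0 \<le> chord_diff k f x u" by (simp add: chord_diff_def)
          have "(x + u) / 2 \<in> panel n j" using x True J by auto
          then have "v j \<le> B * wn ((x + u) / 2)" by (rule v_le[OF j])
          then have "v j * chord_diff k f x u \<le> B * wn ((x + u) / 2) * chord_diff k f x u" using c0 by (rule mult_right_mono)
          also have "\<dots> = B * (chord_diff k f x u * wn ((x + u) / 2))" by simp
          also have "\<dots> \<le> \<Omega>1" unfolding \<Omega>1_def using c nonneg(1) by (rule mult_left_mono)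
          finally have "ennreal (v j * chord_diff k f x u) \<le> ennreal \<Omega>1" by (rule ennreal_leI)
          then show ?thesis using True v0[of j] c0 by (simp add: ennreal_mult)
        qed simp
      qed
      also have "\<dots> = ennreal \<Omega>1 * ennreal (b - a)" using ab by (simp add: nn_integral_cmult_indicator)
      also have "\<dots> = ennreal (\<Omega>1 * (b - a))" using \<Omega>1 ab by (intro ennreal_mult[symmetric]) auto
      finally show "ennreal (v j) * (NN u\<in>{a..b}. ennreal (chord_diff k f x u)) \<le> ennreal (\<Omega>1 * (b - a))" .
    qed
    have cm: "ennreal (v j) * chord_mean k f a b \<le> ennreal (\<Omega>1 * (b - a) * (b - a))"
    proof -
      have "ennreal (v j) * chord_mean k f a b = (NN x\<in>{a..b}. ennreal (v j) * (NN u\<in>{a..b}. ennreal (chord_diff k f x u)))"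
        unfolding chord_mean_def by (rule set_nn_integral_cmult[symmetric]) measurable
      also have "\<dots> \<le> (NN x\<in>{a..b}. ennreal (\<Omega>1 * (b - a)))"
        by (rule nn_integral_mono_AE, use ch in \<open>rule eventually_mono\<close>) (auto simp: indicator_def)
      also have "\<dots> = ennreal (\<Omega>1 * (b - a)) * ennreal (b - a)" using ab by (simp add: nn_integral_cmult_indicator)
      also have "\<dots> = ennreal (\<Omega>1 * (b - a) * (b - a))" using \<Omega>1 ab by (intro ennreal_mult[symmetric]) auto
      finally show ?thesis .
    qed
    have vp: "ennreal (v j) * (NN u\<in>{a..b}. ennreal \<bar>f u - poly p u\<bar>) \<le> ennreal (\<gamma> * (b - a))"
    proof -
      note p(2)
      also have "ennreal (Cw / (b - a)) * (ennreal (v j) * chord_mean k f a b) + ennreal (\<epsilon> * (b - a))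
        \<le> ennreal (Cw / (b - a)) * ennreal (\<Omega>1 * (b - a) * (b - a)) + ennreal (\<epsilon> * (b - a))"
        by (intro add_mono mult_left_mono cm) auto
      also have "ennreal (Cw / (b - a)) * ennreal (\<Omega>1 * (b - a) * (b - a)) = ennreal (Cw / (b - a) * (\<Omega>1 * (b - a) * (b - a)))"
        using cpos \<Omega>1 ab by (intro ennreal_mult[symmetric]) auto
      also have "Cw / (b - a) * (\<Omega>1 * (b - a) * (b - a)) = Cw * \<Omega>1 * (b - a)" using ab by simp
      also have "ennreal (Cw * \<Omega>1 * (b - a)) + ennreal (\<epsilon> * (b - a)) = ennreal (Cw * \<Omega>1 * (b - a) + \<epsilon> * (b - a))"
        using cpos \<Omega>1 \<epsilon> ab by (intro ennreal_plus[symmetric]) auto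
      also have "Cw * \<Omega>1 * (b - a) + \<epsilon> * (b - a) = \<gamma> * (b - a)" by (simp add: \<gamma>_def distrib_right)
      finally show ?thesis .
    qed
    have "AE x in lborel. x \<in> panel n j \<longrightarrow> v j * \<bar>f x - poly p x\<bar> \<le> \<Lambda>"
      unfolding J
    proof (use ch in \<open>rule eventually_mono\<close>, intro impI)
      fix x assume x': "x \<in> {a..b} \<longrightarrow> ennreal (v j) * (NN u\<in>{a..b}. ennreal (chord_diff k f x u)) \<le> ennreal (\<Omega>1 * (b - a))"
        and x: "x \<in> {a..b}"
      have "ennreal (v j) * ennreal \<bar>f x - poly p x\<bar> \<le> ennreal (v j) * (ennreal (1 / (b - a)) * (NN u\<in>{a..b}. ennreal (chord_diff k f x u))
          + ennreal (\<kappa> / (b - a)) * (NN u\<in>{a..b}. ennreal \<bar>f u - poly p u\<bar>))"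
        unfolding \<kappa>_def by (rule mult_left_mono[OF approx_pointwise[OF k1 ab x f p(1)]]) simp
      also have "\<dots> = ennreal (1 / (b - a)) * (ennreal (v j) * (NN u\<in>{a..b}. ennreal (chord_diff k f x u)))
          + ennreal (\<kappa> / (b - a)) * (ennreal (v j) * (NN u\<in>{a..b}. ennreal \<bar>f u - poly p u\<bar>))" by (simp only: distrib_left mult_ac)
      also have "\<dots> \<le> ennreal (1 / (b - a)) * ennreal (\<Omega>1 * (b - a)) + ennreal (\<kappa> / (b - a)) * ennreal (\<gamma> * (b - a))"
        using x x' vp by (intro add_mono mult_left_mono) auto
      also have "ennreal (1 / (b - a)) * ennreal (\<Omega>1 * (b - a)) = ennreal (1 / (b - a) * (\<Omega>1 * (b - a)))"
        using \<Omega>1 ab by (intro ennreal_mult[symmetric]) auto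
      also have "1 / (b - a) * (\<Omega>1 * (b - a)) = \<Omega>1" using ab by simp
      also have "ennreal (\<kappa> / (b - a)) * ennreal (\<gamma> * (b - a)) = ennreal (\<kappa> / (b - a) * (\<gamma> * (b - a)))"
        using \<kappa> \<gamma> ab by (intro ennreal_mult[symmetric]) auto
      also have "\<kappa> / (b - a) * (\<gamma> * (b - a)) = \<kappa> * \<gamma>" using ab by simp
      also have "ennreal \<Omega>1 + ennreal (\<kappa> * \<gamma>) = ennreal \<Lambda>" unfolding \<Lambda>_def using \<Omega>1 \<kappa> \<gamma> by (intro ennreal_plus[symmetric]) auto
      also have "ennreal (v j) * ennreal \<bar>f x - poly p x\<bar> = ennreal (v j * \<bar>f x - poly p x\<bar>)" using v0 by (intro ennreal_mult[symmetric]) auto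
      finally show "v j * \<bar>f x - poly p x\<bar> \<le> \<Lambda>" using \<Lambda> by (simp add: ennreal_le_iff)
    qed
    then show "\<exists>p. degree p < k \<and> ennreal (v j) * (NN u\<in>panel n j. ennreal \<bar>f u - poly p u\<bar>) \<le> ennreal (\<gamma> * len j) \<and> (AE x in lborel. x \<in> panel n j \<longrightarrow> v j * \<bar>f x - poly p x\<bar> \<le> \<Lambda>)"
      using p(1) vp unfolding J len by blast
  qed
  obtain p :: "nat \<Rightarrow> real poly" where p': "\<forall>j\<in>S. degree (p j) < k \<and> ennreal (v j) * (NN u\<in>panel n j. ennreal \<bar>f u - poly (p j) u\<bar>) \<le> ennreal (\<gamma> * len j) \<and> (AE x in lborel. x \<in> panel n j \<longrightarrow> v j * \<bar>f x - poly (p j) x\<bar> \<le> \<Lambda>)"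
    using bchoice[OF ex] by (elim exE)
  have H: "\<forall>j\<in>S. degree (p j) < k \<and> 0 \<le> \<gamma> * len j \<and> ennreal (v j) * (NN x\<in>panel n j. ennreal \<bar>f x - poly (p j) x\<bar>) \<le> ennreal (\<gamma> * len j)"
    using p' \<gamma> lo_less_hi by (simp add: len_def less_imp_le)
  obtain P :: "real poly" where P: "degree P \<le> (k + K) * n" "\<forall>x\<in>{-1..1}. \<exists>i\<in>S. x \<in> panel n i \<and>
    \<bar>f x - poly P x\<bar> * wn x \<le> D * (v i * \<bar>f x - poly (p i) x\<bar>) + D * (\<Sum>j\<in>S'. (\<gamma> * len j + \<gamma> * len (j + 1)) / r j * (1 / T j (ang x) ^ 4))"
    using glue[OF H] by (elim exE conjE)
  have "AE x in lborel. \<forall>i\<in>S. x \<in> panel n i \<longrightarrow> v i * \<bar>f x - poly (p i) x\<bar> \<le> \<Lambda>"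
    by (rule AE_finite_allI) (use p' in \<open>auto simp: S_def\<close>)
  then have "AE x in lborel. x \<in> {-1..1} \<longrightarrow> ennreal (\<bar>f x - poly P x\<bar> * wn x) \<le> ennreal (D * ((B + (\<kappa> + 864) * (Cw * B + 1)) * (\<Omega> + \<epsilon>)))"
  proof (rule eventually_mono, intro impI ennreal_leI)
    fix x :: real assume xi: "\<forall>i\<in>S. x \<in> panel n i \<longrightarrow> v i * \<bar>f x - poly (p i) x\<bar> \<le> \<Lambda>" and x: "x \<in> {-1..1}"
    obtain i where i: "i \<in> S" "x \<in> panel n i" "\<bar>f x - poly P x\<bar> * wn x \<le>
        D * (v i * \<bar>f x - poly (p i) x\<bar>) + D * (\<Sum>j\<in>S'. (\<gamma> * len j + \<gamma> * len (j + 1)) / r j * (1 / T j (ang x) ^ 4))"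
      using P(2)[rule_format, OF x] by (elim bexE conjE)
    \<comment> \<open>Panel lengths are comparable to \<open>rho\<close>: the constants 8 and 4 add
      up to 12, and \<open>12 * 72 = 864\<close> appears in the claim.\<close>
    have "(\<Sum>j\<in>S'. (\<gamma> * len j + \<gamma> * len (j + 1)) / r j * (1 / T j (ang x) ^ 4)) \<le> (\<Sum>j\<in>S'. 12 * \<gamma> * (1 / T j (ang x) ^ 4))"
    proof (intro sum_mono mult_right_mono)
      fix j assume j: "j \<in> S'"
      have "len j \<le> 8 * r j" unfolding len_def using j by (intro panel_length(2)[OF n]) (auto simp: S'_def)
      moreover have "len (j + 1) \<le> 4 * r j"
        unfolding len_def using panel_length(3)[OF n, of "j + 1"] j by (auto simp: S'_def)
      ultimately have "\<gamma> * (len j + len (j + 1)) \<le> \<gamma> * (12 * r j)" using \<gamma> by (intro mult_left_mono) auto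
      then show "(\<gamma> * len j + \<gamma> * len (j + 1)) / r j \<le> 12 * \<gamma>" using r0[of j] by (simp add: pos_divide_le_eq distrib_left mult_ac)
    qed simp
    also have "\<dots> = 12 * \<gamma> * (\<Sum>j\<in>S'. 1 / T j (ang x) ^ 4)" by (simp only: sum_distrib_left)
    also have "\<dots> \<le> 12 * \<gamma> * 72" unfolding S'_def using \<gamma> by (intro mult_left_mono sum_node_decay_le[OF n]) auto
    finally have "\<bar>f x - poly P x\<bar> * wn x \<le> D * \<Lambda> + D * (12 * \<gamma> * 72)"
      using xi i(1,2) nonneg by (intro order.trans[OF i(3)] add_mono mult_left_mono) auto
    also have "\<dots> = D * (\<Omega>1 + (\<kappa> + 864) * \<gamma>)" by (simp add: \<Lambda>_def algebra_simps)
    also have "\<dots> \<le> D * (B * (\<Omega> + \<epsilon>) + (\<kappa> + 864) * ((Cw * B + 1) * (\<Omega> + \<epsilon>)))"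
    proof -
      have "Cw * B * \<Omega> + \<epsilon> \<le> Cw * B * (\<Omega> + \<epsilon>) + 1 * (\<Omega> + \<epsilon>)"
        using cpos nonneg \<Omega> \<epsilon> by (intro add_mono mult_left_mono) auto
      then have "\<gamma> \<le> (Cw * B + 1) * (\<Omega> + \<epsilon>)" by (simp add: \<gamma>_def \<Omega>1_def distrib_right mult.assoc)
      then show ?thesis unfolding \<Omega>1_def using nonneg \<epsilon> \<kappa> by (intro add_mono mult_left_mono) auto
    qed
    also have "\<dots> = D * ((B + (\<kappa> + 864) * (Cw * B + 1)) * (\<Omega> + \<epsilon>))" by (simp only: distrib_right mult.assoc)
    finally show "\<bar>f x - poly P x\<bar> * wn x \<le> D * ((B + (\<kappa> + 864) * (Cw * B + 1)) * (\<Omega> + \<epsilon>))" .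
  qed
  then show ?thesis using P(1) unfolding \<kappa>_def by blast
qed

end

section \<open>From smoothness to approximation\<close>

context slow_weight begin

lemma jackson:
  assumes k: "k \<ge> 2" and f: "f \<in> borel_measurable borel" and fin: "(NN x\<in>{-1..1}. ennreal \<bar>f x\<bar>) < \<infinity>"
  shows "\<exists>D\<ge>0. \<exists>K. \<forall>n\<ge>1. \<forall>\<Omega>\<ge>0. \<forall>\<epsilon>>0.
    (\<forall>h>0. h \<le> 1 / real n \<longrightarrow> norm_le p (aw n) (\<lambda>x. central_difference k (h * phi x) f x) (ennreal \<Omega>)) \<longrightarrow>
    (\<exists>P :: real poly. degree P \<le> K * n \<and> norm_le p (aw n) (\<lambda>x. f x - poly P x) (ennreal (D * (\<Omega> + \<epsilon>))))"
proof -
  have k1: "k \<ge> 1" using k by simp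
  obtain Cw where Cw: "Cw \<ge> 0" and whitney: "\<forall>f\<in>borel_measurable borel. \<forall>a b. a < b \<longrightarrow> (NN x\<in>{a..b}. ennreal \<bar>f x\<bar>) < \<infinity> \<longrightarrow> (\<forall>e>0. \<exists>p. degree p < k \<and>
    (NN x\<in>{a..b}. ennreal \<bar>f x - poly p x\<bar>) \<le> ennreal (Cw / (b - a)) * chord_mean k f a b + ennreal e)"
    using whitney_L1[OF k1] by (elim exE conjE)
  obtain Cg where Cg: "Cg \<ge> 0" and growth: "\<forall>(q :: real poly) a b I x. degree q < k \<longrightarrow> a < b \<longrightarrow> 0 \<le> I \<longrightarrow>
    (NN u\<in>{a..b}. ennreal \<bar>poly q u\<bar>) \<le> ennreal I \<longrightarrow> \<bar>poly q x\<bar> \<le> Cg * (I / (b - a)) * (1 + \<bar>x - a\<bar> / (b - a)) ^ k"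
    using poly_growth[OF k1] by (elim exE conjE)
  obtain Cs K where Cs: "Cs \<ge> 0" and step: "\<forall>n\<ge>1. \<forall>\<tau>\<in>{0..pi}. \<exists>P :: real poly. degree P \<le> K * n \<and>
    (\<forall>\<theta>\<in>{0..pi}. \<bar>poly P (cos \<theta>) - (if \<tau> < \<theta> then 1 else 0)\<bar> \<le> Cs / (1 + real n * \<bar>\<theta> - \<tau>\<bar>) ^ (2 * k + s + 4))"
    using step_poly[of "2 * k + s + 4"] by (elim exE conjE)
  \<comment> \<open>All constants are obtained before \<open>n\<close> is fixed, so the instances of
    the locale for different \<open>n\<close> share them.\<close>
  have loc: "local_approx w C s k n f Cw Cg Cs K" if "n \<ge> 1" for n
    by (intro local_approx.intro slow_weight_axioms local_approx_axioms.intro k that f fin Cw Cg Cs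
      whitney[rule_format, OF f] growth[rule_format] step[rule_format]) 
  define B where "B = local_approx.B C s"
  define D where "D = local_approx.D C s k Cg Cs"
  define D1 where "D1 = (if p = 1 then 17 * D * (294 * Cw * real k * B + 1) else D * (B + (2 ^ k * real k * real k + 864) * (Cw * B + 1)))"
  have nonneg: "0 \<le> B" "0 \<le> D" unfolding B_def D_def using local_approx.nonneg[OF loc[OF order_refl]] by auto
  have "\<exists>P :: real poly. degree P \<le> (k + K) * n \<and> norm_le p (aw n) (\<lambda>x. f x - poly P x) (ennreal (D1 * (\<Omega> + \<epsilon>)))"
    if n: "n \<ge> 1" and e: "\<Omega> \<ge> 0" "\<epsilon> > 0"
      and cd: "\<forall>h>0. h \<le> 1 / real n \<longrightarrow> norm_le p (aw n) (\<lambda>x. central_difference k (h * phi x) f x) (ennreal \<Omega>)" for n \<Omega> \<epsilon>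
  proof (cases "p = 1")
    case True
    have "\<exists>P :: real poly. degree P \<le> (k + K) * n \<and> (NN x\<in>{-1..1}. ennreal (\<bar>f x - poly P x\<bar> * aw n x)) \<le>
        ennreal (17 * D * ((294 * Cw * real k * B + 1) * (\<Omega> + \<epsilon>)))"
      unfolding B_def D_def by (rule local_approx.jackson_one[OF loc[OF n] e]) (use cd in \<open>simp add: norm_le_def True\<close>)
    then show ?thesis by (simp add: norm_le_def D1_def True mult.assoc)
  next
    case False
    have "\<exists>P :: real poly. degree P \<le> (k + K) * n \<and> (AE x in lborel. x \<in> {-1..1} \<longrightarrow> ennreal (\<bar>f x - poly P x\<bar> * aw n x) \<le>
        ennreal (D * ((B + (2 ^ k * real k * real k + 864) * (Cw * B + 1)) * (\<Omega> + \<epsilon>))))"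
      unfolding B_def D_def by (rule local_approx.jackson_inf[OF loc[OF n] e]) (use cd in \<open>simp add: norm_le_def False\<close>)
    then show ?thesis by (simp add: norm_le_def D1_def False mult.assoc)
  qed
  moreover have "D1 \<ge> 0" using nonneg Cw by (simp add: D1_def)
  ultimately show ?thesis by blast
qed

text \<open>The polynomials of \<open>jackson\<close> have degree up to \<open>K * m\<close>; with
  \<open>m\<close> about \<open>n / (K + 1)\<close> this is below \<open>n\<close>. The change of
  weight from \<open>m\<close> to \<open>n\<close> costs \<open>(n / m)^2\<close>, which stays
  bounded.\<close>

theorem direct_rate:
  assumes r: "r \<ge> 1" and \<alpha>: "0 < \<alpha>" and f[measurable]: "f \<in> borel_measurable borel" and E: "E \<ge> 0"
    and fin: "(NN x\<in>{-1..1}. ennreal \<bar>f x\<bar>) < \<infinity>"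
    and cd: "\<And>n h. n \<ge> n0 \<Longrightarrow> 0 < h \<Longrightarrow> h \<le> 1 / real n \<Longrightarrow>
      norm_le p (aw n) (\<lambda>x. central_difference (r + 1) (h * phi x) f x) (ennreal (E * real n powr - \<alpha>))"
  shows "\<exists>D\<ge>0. \<exists>N. \<forall>n\<ge>N. \<exists>P :: real poly. degree P < n \<and> norm_le p (aw n) (\<lambda>x. f x - poly P x) (ennreal (D * real n powr - \<alpha>))"
proof -
  have r2: "r + 1 \<ge> 2" using r by simp
  obtain D K where D: "D \<ge> 0" and J: "\<forall>n\<ge>1. \<forall>\<Omega>\<ge>0. \<forall>\<epsilon>>0.
    (\<forall>h>0. h \<le> 1 / real n \<longrightarrow> norm_le p (aw n) (\<lambda>x. central_difference (r + 1) (h * phi x) f x) (ennreal \<Omega>)) \<longrightarrow>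
    (\<exists>P :: real poly. degree P \<le> K * n \<and> norm_le p (aw n) (\<lambda>x. f x - poly P x) (ennreal (D * (\<Omega> + \<epsilon>))))"
    using jackson[OF r2 f fin, of p] by (elim exE conjE)
  define k where "k = K + 1"
  define Q where "Q = (2 * real k)\<^sup>2"
  define D1 where "D1 = Q * (D * (E + 1) * (2 * real k) powr \<alpha>)"
  have "\<exists>P :: real poly. degree P < n \<and> norm_le p (aw n) (\<lambda>x. f x - poly P x) (ennreal (D1 * real n powr - \<alpha>))"
    if n: "n \<ge> k * (n0 + 1)" for n
  proof -
    define m where "m = n div k"
    have k0: "k > 0" by (simp add: k_def)
    have "k * (n0 + 1) div k \<le> n div k" using n by (rule div_le_mono)
    then have m: "n0 + 1 \<le> m" using k0 by (simp add: m_def)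
    have m1: "m \<ge> 1" using m by simp
    have km: "k * m \<le> n" by (simp add: m_def)
    have Kn: "K * m < n" using km m1 by (simp add: k_def)
    have mn: "m \<le> n" by (simp add: m_def)
    have "n < k * (m + 1)" unfolding m_def using k0 by (metis dividend_less_times_div mult.commute Suc_eq_plus1 mult_Suc_right add.commute)
    also have "\<dots> \<le> k * (2 * m)" using m1 by simp
    finally have "real n \<le> 2 * real k * real m" by (metis less_imp_le mult.assoc mult.left_commute of_nat_le_iff of_nat_mult of_nat_numeral)
    then have nm: "real n / real m \<le> 2 * real k" using m1 by (simp add: pos_divide_le_eq)
    have mp: "real m powr - \<alpha> > 0" using m1 by simp
    \<comment> \<open>The free slack is set to the target order itself, which is positive also when
      \<open>E = 0\<close>.\<close>
    have "\<exists>P :: real poly. degree P \<le> K * m \<and> norm_le p (aw m) (\<lambda>x. f x - poly P x) (ennreal (D * (E * real m powr - \<alpha> + real m powr - \<alpha>)))"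
      using J[rule_format, OF m1, of "E * real m powr - \<alpha>" "real m powr - \<alpha>"] cd[of m] m mp E by simp
    then obtain P :: "real poly" where P: "degree P \<le> K * m" "norm_le p (aw m) (\<lambda>x. f x - poly P x) (ennreal (D * (E * real m powr - \<alpha> + real m powr - \<alpha>)))"
      by (elim exE conjE)
    have "norm_le p (aw n) (\<lambda>x. f x - poly P x) (ennreal Q * ennreal (D * (E * real m powr - \<alpha> + real m powr - \<alpha>)))"
    proof (rule norm_le_refine[OF m1 mn _ _ P(2)])
      show "(real n / real m)\<^sup>2 \<le> Q" unfolding Q_def using nm by (intro power_mono) auto
    qed measurable
    moreover have "ennreal Q * ennreal (D * (E * real m powr - \<alpha> + real m powr - \<alpha>)) \<le> ennreal (D1 * real n powr - \<alpha>)"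
    proof -
      have "real m powr - \<alpha> \<le> (2 * real k) powr \<alpha> * real n powr - \<alpha>"
      proof -
        have n0: "real n > 0" using mn m1 by simp
        have "real n / (2 * real k) \<le> real m" using nm m1 k0 by (simp add: field_simps)
        then have "real m powr - \<alpha> \<le> (real n / (2 * real k)) powr - \<alpha>" using n0 k0 \<alpha> by (intro powr_mono2') auto
        also have "\<dots> = (2 * real k) powr \<alpha> * real n powr - \<alpha>" using n0 k0 by (simp add: powr_divide powr_minus field_simps)
        finally show ?thesis .
      qed
      then have "Q * (D * (E + 1) * real m powr - \<alpha>) \<le> Q * (D * (E + 1) * ((2 * real k) powr \<alpha> * real n powr - \<alpha>))"
        using D E by (intro mult_left_mono) (auto simp: Q_def)
      then have "Q * (D * (E * real m powr - \<alpha> + real m powr - \<alpha>)) \<le> D1 * real n powr - \<alpha>"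
        by (simp add: D1_def algebra_simps)
      moreover have "ennreal Q * ennreal (D * (E * real m powr - \<alpha> + real m powr - \<alpha>)) = ennreal (Q * (D * (E * real m powr - \<alpha> + real m powr - \<alpha>)))"
        using D E by (intro ennreal_mult[symmetric]) (auto simp: Q_def)
      ultimately show ?thesis by (simp add: ennreal_leI)
    qed
    ultimately have "norm_le p (aw n) (\<lambda>x. f x - poly P x) (ennreal (D1 * real n powr - \<alpha>))" by (rule norm_le_mono)
    then show ?thesis using P(1) Kn by (intro exI[of _ P]) simp
  qed
  moreover have "D1 \<ge> 0" using D E by (simp add: D1_def Q_def)
  ultimately show ?thesis by blast
qed

end

section \<open>Passage to a Borel representative and the equivalence\<close>

lemma wnorm_cong_AE:
  assumes ae: "AE x in lborel. x \<in> {-1..1} \<longrightarrow> g x = g0 x"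
    and g0[measurable]: "g0 \<in> borel_measurable borel" and v[measurable]: "v \<in> borel_measurable borel"
  shows "wnorm p v g = wnorm p v g0"
proof -
  \<comment> \<open>Nothing is known about \<open>g\<close> off \<open>[-1,1]\<close>; it is
    replaced there by \<open>g0\<close> before completeness of Lebesgue measure is applied.\<close>
  define g1 where "g1 x = (if x \<in> {-1..1} then g x else g0 x)" for x
  have "AE x in lebesgue. g0 x = g1 x"
    using ae by (intro AE_completion) (auto simp: g1_def elim!: eventually_mono)
  moreover have "g0 \<in> borel_measurable lebesgue" by (rule measurable_completion) simp
  ultimately have "g1 \<in> borel_measurable lebesgue" using borel_measurable_AE by blast
  then have "g1 \<in> borel_measurable (lebesgue_on {-1..1})" by (rule measurable_restrict_space1)
  then have g: "g \<in> borel_measurable (lebesgue_on {-1..1})"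
    by (subst (asm) measurable_cong[where g = g]) (auto simp: g1_def)
  have g0': "g0 \<in> borel_measurable (lebesgue_on {-1..1})" "v \<in> borel_measurable (lebesgue_on {-1..1})"
    by (intro measurable_restrict_space1 measurable_completion; simp)+
  have ae': "AE x in lebesgue_on {-1..1}. ennreal (\<bar>g x\<bar> * v x) = ennreal (\<bar>g0 x\<bar> * v x)"
    using ae unfolding AE_lebesgue_on_iff by (auto elim!: eventually_mono)
  have m: "(\<lambda>x. ennreal (\<bar>g x\<bar> * v x)) \<in> borel_measurable (lebesgue_on {-1..1})" "(\<lambda>x. ennreal (\<bar>g0 x\<bar> * v x)) \<in> borel_measurable (lebesgue_on {-1..1})"
    using g g0' by (intro measurable_compose[OF _ measurable_ennreal] borel_measurable_times borel_measurable_abs; simp)+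
  show ?thesis unfolding wnorm_def
    using nn_integral_cong_AE[OF ae'] esssup_AE_cong[OF m ae'] by simp
qed

text \<open>Each of the finitely many points \<open>x + \<tau> * phi x\<close> in the difference
  meets the exceptional null set only for a null set of \<open>x\<close>, by the change of variables
  on the inner zone.\<close>

lemma AE_central_difference_cong:
  assumes ae: "AE x in lborel. x \<in> {-1..1} \<longrightarrow> f x = f0 x" and h: "h > 0" and k: "k \<ge> 1"
  shows "AE x in lborel. x \<in> {-1..1} \<longrightarrow> central_difference k (h * phi x) f x = central_difference k (h * phi x) f0 x"
proof -
  obtain N where N: "{x \<in> space lborel. \<not> (x \<in> {-1..1} \<longrightarrow> f x = f0 x)} \<subseteq> N" "emeasure lborel N = 0" "N \<in> sets lborel"
    using AE_E[OF ae] by blast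
  have [measurable]: "N \<in> sets borel" using N(3) by simp
  define c where "c = real k * h / 2"
  have c: "c > 0" using k h by (simp add: c_def)
  have "AE x in lborel. x \<in> inner_zone c \<longrightarrow> x + \<tau> * phi x \<notin> N" if \<tau>: "\<bar>\<tau>\<bar> \<le> c" for \<tau>
  proof -
    have "(NN x\<in>inner_zone c. indicator N (x + \<tau> * phi x)) \<le> 2 * (NN y\<in>{-1..1}. indicator N y)"
      by (rule shift_integral_le[OF _ c \<tau>]) measurable
    also have "(NN y\<in>{-1..1}. indicator N y) \<le> (NN y. indicator N y)"
      by (intro nn_integral_mono) (auto simp: indicator_def)
    also have "\<dots> = 0" using N by simp
    finally have z: "(NN x\<in>inner_zone c. indicator N (x + \<tau> * phi x)) = 0" by (simp add: mult_left_mono)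
    have "(\<lambda>x. indicator N (x + \<tau> * phi x) * indicator (inner_zone c) x :: ennreal) \<in> borel_measurable lborel" by measurable
    then have "AE x in lborel. indicator N (x + \<tau> * phi x) * indicator (inner_zone c) x = (0 :: ennreal)"
      using z by (simp only: nn_integral_0_iff_AE)
    then show ?thesis by (rule eventually_mono) (auto simp: indicator_def split: if_splits)
  qed
  then have "AE x in lborel. \<forall>i\<in>{0..k}. x \<in> inner_zone c \<longrightarrow> x + (real i * h - c) * phi x \<notin> N"
  proof (intro AE_finite_allI)
    fix i assume "i \<in> {0..k}"
    then have "real i * h \<le> real k * h" using h by (intro mult_right_mono) auto
    moreover have "0 \<le> real i * h" using h by simp
    ultimately have "\<bar>real i * h - c\<bar> \<le> c" unfolding c_def by linarith
    then show "AE x in lborel. x \<in> inner_zone c \<longrightarrow> x + (real i * h - c) * phi x \<notin> N"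
      using \<open>\<And>\<tau>. \<bar>\<tau>\<bar> \<le> c \<Longrightarrow> AE x in lborel. x \<in> inner_zone c \<longrightarrow> x + \<tau> * phi x \<notin> N\<close> by blast
  qed simp
  then show ?thesis
  proof (rule eventually_mono, intro impI)
    fix x assume x: "\<forall>i\<in>{0..k}. x \<in> inner_zone c \<longrightarrow> x + (real i * h - c) * phi x \<notin> N" and x1: "x \<in> {-1..1}"
    have e: "real k * (h * phi x) / 2 = c * phi x" by (simp add: c_def)
    show "central_difference k (h * phi x) f x = central_difference k (h * phi x) f0 x"
    proof (cases "x - c * phi x \<in> {-1..1} \<and> x + c * phi x \<in> {-1..1}")
      case True
      then have iz: "x \<in> inner_zone c" using x1 by (simp add: inner_zone_def)
      have "f (x - c * phi x + real i * (h * phi x)) = f0 (x - c * phi x + real i * (h * phi x))" if i: "i \<in> {0..k}" for i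
      proof -
        have y: "x - c * phi x + real i * (h * phi x) = x + (real i * h - c) * phi x" by (simp add: algebra_simps)
        have p0: "0 \<le> phi x" by (rule phi_nonneg[OF x1])
        have "real i * (h * phi x) \<le> real k * (h * phi x)" using i h p0 by (intro mult_right_mono) auto
        also have "\<dots> = 2 * (c * phi x)" using e by linarith
        finally have "x - c * phi x + real i * (h * phi x) \<le> x + c * phi x" by simp
        moreover have "0 \<le> real i * (h * phi x)" using h p0 by simp
        ultimately have "x - c * phi x + real i * (h * phi x) \<in> {-1..1}" using True by auto
        moreover have "x - c * phi x + real i * (h * phi x) \<notin> N" unfolding y using x i iz by blast
        ultimately show ?thesis using N(1) by auto
      qed
      then have "(\<Sum>i = 0..k. real (k choose i) * (-1) ^ (k - i) * f (x - c * phi x + real i * (h * phi x)))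
        = (\<Sum>i = 0..k. real (k choose i) * (-1) ^ (k - i) * f0 (x - c * phi x + real i * (h * phi x)))"
        by (intro sum.cong) auto
      then show ?thesis unfolding central_difference_def e by (simp only:)
    next
      case False
      then show ?thesis unfolding central_difference_def e by (simp only: if_False)
    qed
  qed
qed

lemma ex_borel_representative:
  assumes "f \<in> borel_measurable (lebesgue_on {-1..1 :: real})"
  shows "\<exists>f0 :: real \<Rightarrow> real. f0 \<in> borel_measurable borel \<and> (AE x in lborel. x \<in> {-1..1} \<longrightarrow> f x = f0 x)"
proof -
  have "(\<lambda>x. if x \<in> {-1..1} then f x else 0) \<in> borel_measurable lebesgue"
    using assms by (rule borel_measurable_if_I) simp
  from completion_ex_borel_measurable_real[OF this] obtain f0 where
    f0: "f0 \<in> borel_measurable lborel" "AE x in lborel. (if x \<in> {-1..1} then f x else 0) = f0 x" by (elim bexE)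
  have "AE x in lborel. x \<in> {-1..1} \<longrightarrow> f x = f0 x"
    using f0(2) by (rule eventually_mono) auto
  then show ?thesis using f0(1) by auto
qed

theorem corollary7p8:
  fixes w f :: "real \<Rightarrow> real" and r :: nat and p :: ennreal and \<alpha> :: real
  assumes "doubling_weight w"
    and "r \<ge> 1"
    and "p = 1 \<or> p = \<infinity>"
    and "in_Lp p f"
    and "0 < \<alpha>" and "\<alpha> < real r"
  shows "is_bigO (\<lambda>n. best_approx n f p (avg_weight w n)) (\<lambda>n. real n powr (-\<alpha>)) \<longleftrightarrow>
         is_bigO (\<lambda>n. phi_modulus (r + 1) f (1 / real n) p (avg_weight w n)) (\<lambda>n. real n powr (-\<alpha>))"
proof -
  obtain C s where C: "C \<ge> 0" and slow: "\<forall>n\<ge>1. \<forall>\<theta>\<in>{0..pi}. \<forall>t\<in>{0..pi}.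
    avg_weight w n (cos \<theta>) \<le> C * (1 + real n * \<bar>\<theta> - t\<bar>) ^ s * avg_weight w n (cos t)"
    using avg_weight_slow[OF assms(1)] by (elim exE conjE)
  interpret slow_weight w C s by unfold_locales (use assms(1) C slow in auto)
  obtain f0 where f0[measurable]: "f0 \<in> borel_measurable borel" and ae: "AE x in lborel. x \<in> {-1..1} \<longrightarrow> f x = f0 x"
    using ex_borel_representative[of f] assms(4) unfolding in_Lp_def by blast
  have nb: "wnorm p (avg_weight w n) (\<lambda>x. f x - poly P x) \<le> c \<longleftrightarrow> norm_le p (avg_weight w n) (\<lambda>x. f0 x - poly P x) c" for n P c
  proof -
    have "wnorm p (avg_weight w n) (\<lambda>x. f x - poly P x) = wnorm p (avg_weight w n) (\<lambda>x. f0 x - poly P x)"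
      using ae by (intro wnorm_cong_AE) (auto elim!: eventually_mono)
    then show ?thesis using wnorm_le_iff[OF assms(3), of "\<lambda>x. f0 x - poly P x" "avg_weight w n" c] by simp
  qed
  have nc: "wnorm p (avg_weight w n) (\<lambda>x. central_difference (r + 1) (h * phi x) f x) \<le> c
    \<longleftrightarrow> norm_le p (avg_weight w n) (\<lambda>x. central_difference (r + 1) (h * phi x) f0 x) c" if h: "h > 0" for n h c
  proof -
    have "wnorm p (avg_weight w n) (\<lambda>x. central_difference (r + 1) (h * phi x) f x)
      = wnorm p (avg_weight w n) (\<lambda>x. central_difference (r + 1) (h * phi x) f0 x)"
      by (intro wnorm_cong_AE AE_central_difference_cong[OF ae h]) simp_all
    then show ?thesis using wnorm_le_iff[OF assms(3), of "\<lambda>x. central_difference (r + 1) (h * phi x) f0 x" "avg_weight w n" c] by simp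
  qed
  \<comment> \<open>Whitney's inequality in the mean asks for integrability under both exponents;
    for the sup norm it follows from the finite length of the interval.\<close>
  have fin: "(NN x\<in>{-1..1}. ennreal \<bar>f0 x\<bar>) < \<infinity>"
  proof -
    define c where "c = wnorm p (\<lambda>_. 1) f"
    have c: "c < \<infinity>" using assms(4) by (simp add: in_Lp_def c_def)
    have "wnorm p (\<lambda>_. 1) f0 \<le> c" unfolding c_def using wnorm_cong_AE[OF ae f0, of "\<lambda>_. 1" p] by simp
    then have nl: "norm_le p (\<lambda>_. 1) f0 c" by (subst (asm) wnorm_le_iff[OF assms(3)]) auto
    show ?thesis
    proof (cases "p = 1")
      case True
      then show ?thesis using nl c by (simp add: norm_le_def)
    next
      case False
      have "(NN x\<in>{-1..1}. ennreal \<bar>f0 x\<bar>) \<le> (\<integral>\<^sup>+x\<in>{-1..1}. c \<partial>(lborel :: real measure))"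
        using nl False by (intro nn_integral_mono_AE) (auto simp: norm_le_def indicator_def elim!: eventually_mono)
      also have "\<dots> = c * 2" by (simp add: nn_integral_cmult_indicator)
      also have "\<dots> < \<infinity>" using c by (simp add: ennreal_mult_less_top)
      finally show ?thesis .
    qed
  qed
  show ?thesis
  proof
    assume "is_bigO (\<lambda>n. best_approx n f p (avg_weight w n)) (\<lambda>n. real n powr (-\<alpha>))"
    then obtain E n0 where E: "E \<ge> 0" and n0: "\<forall>n\<ge>n0. best_approx n f p (avg_weight w n) \<le> ennreal (E * \<bar>real n powr - \<alpha>\<bar>)"
      unfolding is_bigO_def eventually_sequentially by (elim exE conjE)
    \<comment> \<open>The infimum may not be attained; \<open>E + 1\<close> leaves room for an
      approximant strictly below the bound, and \<open>n >= n0 + 1\<close> makes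
      \<open>n powr - \<alpha>\<close> positive.\<close>
    have "\<forall>n\<in>{n0 + 1..}. \<exists>P :: real poly. degree P < n \<and> norm_le p (avg_weight w n) (\<lambda>x. f0 x - poly P x) (ennreal ((E + 1) * real n powr - \<alpha>))"
    proof
      fix n assume n: "n \<in> {n0 + 1..}"
      then have "0 < real n powr - \<alpha>" by simp
      then have "E * real n powr - \<alpha> < (E + 1) * real n powr - \<alpha>" by (simp add: distrib_right)
      then have "ennreal (E * real n powr - \<alpha>) < ennreal ((E + 1) * real n powr - \<alpha>)"
        using E by (intro ennreal_lessI) (auto intro: le_less_trans[rotated] mult_nonneg_nonneg)
      moreover have "best_approx n f p (avg_weight w n) \<le> ennreal (E * real n powr - \<alpha>)" using n0 n by simp
      ultimately have "best_approx n f p (avg_weight w n) < ennreal ((E + 1) * real n powr - \<alpha>)" by (rule le_less_trans[rotated])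
      then obtain P :: "real poly" where P: "degree P < n" "wnorm p (avg_weight w n) (\<lambda>x. f x - poly P x) < ennreal ((E + 1) * real n powr - \<alpha>)"
        unfolding best_approx_def INF_less_iff by auto
      have "norm_le p (avg_weight w n) (\<lambda>x. f0 x - poly P x) (ennreal ((E + 1) * real n powr - \<alpha>))"
        using less_imp_le[OF P(2)] by (simp only: nb)
      then show "\<exists>P :: real poly. degree P < n \<and> norm_le p (avg_weight w n) (\<lambda>x. f0 x - poly P x) (ennreal ((E + 1) * real n powr - \<alpha>))"
        using P(1) by blast
    qed
    from bchoice[OF this] obtain P :: "nat \<Rightarrow> real poly" where
      P: "\<forall>n\<in>{n0 + 1..}. degree (P n) < n \<and> norm_le p (avg_weight w n) (\<lambda>x. f0 x - poly (P n) x) (ennreal ((E + 1) * real n powr - \<alpha>))" by (elim exE)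
    have E1: "0 \<le> E + 1" using E by simp
    have P': "n0 + 1 \<le> n \<Longrightarrow> degree (P n) < n \<and> norm_le p (avg_weight w n) (\<lambda>x. f0 x - poly (P n) x) (ennreal ((E + 1) * real n powr - \<alpha>))" for n
      using P by simp
    have "\<exists>D\<ge>0. \<exists>N. \<forall>n\<ge>N. \<forall>h>0. h \<le> 1 / real n \<longrightarrow>
      norm_le p (avg_weight w n) (\<lambda>x. central_difference (r + 1) (h * phi x) f0 x) (ennreal (D * real n powr - \<alpha>))"
      by (rule inverse_rate[where ?n0.0 = "n0 + 1", OF assms(2,5,6) f0 E1 P'])
    then obtain D N where D: "D \<ge> 0" and N: "\<forall>n\<ge>N. \<forall>h>0. h \<le> 1 / real n \<longrightarrow>
      norm_le p (avg_weight w n) (\<lambda>x. central_difference (r + 1) (h * phi x) f0 x) (ennreal (D * real n powr - \<alpha>))"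
      by (elim exE conjE)
    have "phi_modulus (r + 1) f (1 / real n) p (avg_weight w n) \<le> ennreal (D * \<bar>real n powr - \<alpha>\<bar>)" if "n \<ge> N" for n
      unfolding phi_modulus_def using N that nc by (intro SUP_least) auto
    then show "is_bigO (\<lambda>n. phi_modulus (r + 1) f (1 / real n) p (avg_weight w n)) (\<lambda>n. real n powr (-\<alpha>))"
      unfolding is_bigO_def eventually_sequentially using D by blast
  next
    assume "is_bigO (\<lambda>n. phi_modulus (r + 1) f (1 / real n) p (avg_weight w n)) (\<lambda>n. real n powr (-\<alpha>))"
    then obtain E n0 where E: "E \<ge> 0" and n0: "\<forall>n\<ge>n0. phi_modulus (r + 1) f (1 / real n) p (avg_weight w n) \<le> ennreal (E * \<bar>real n powr - \<alpha>\<bar>)"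
      unfolding is_bigO_def eventually_sequentially by (elim exE conjE)
    have cd: "norm_le p (avg_weight w n) (\<lambda>x. central_difference (r + 1) (h * phi x) f0 x) (ennreal (E * real n powr - \<alpha>))"
      if "n0 \<le> n" "0 < h" "h \<le> 1 / real n" for n h
    proof -
      have "wnorm p (avg_weight w n) (\<lambda>x. central_difference (r + 1) (h * phi x) f x) \<le> phi_modulus (r + 1) f (1 / real n) p (avg_weight w n)"
        unfolding phi_modulus_def using that by (intro SUP_upper) auto
      also have "\<dots> \<le> ennreal (E * real n powr - \<alpha>)" using n0 that by simp
      finally show ?thesis by (simp only: nc[OF that(2)])
    qed
    have "\<exists>D\<ge>0. \<exists>N. \<forall>n\<ge>N. \<exists>P :: real poly. degree P < n \<and> norm_le p (avg_weight w n) (\<lambda>x. f0 x - poly P x) (ennreal (D * real n powr - \<alpha>))"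
      by (rule direct_rate[where ?n0.0 = n0, OF assms(2,5) f0 E fin cd])
    then obtain D N where D: "D \<ge> 0" and N: "\<forall>n\<ge>N. \<exists>P :: real poly. degree P < n \<and> norm_le p (avg_weight w n) (\<lambda>x. f0 x - poly P x) (ennreal (D * real n powr - \<alpha>))"
      by (elim exE conjE)
    have "best_approx n f p (avg_weight w n) \<le> ennreal (D * \<bar>real n powr - \<alpha>\<bar>)" if n: "n \<ge> N" for n
    proof -
      obtain P :: "real poly" where P: "degree P < n" "norm_le p (avg_weight w n) (\<lambda>x. f0 x - poly P x) (ennreal (D * real n powr - \<alpha>))"
        using N n by blast
      have "best_approx n f p (avg_weight w n) \<le> wnorm p (avg_weight w n) (\<lambda>x. f x - poly P x)"
        unfolding best_approx_def using P(1) by (intro INF_lower) simp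
      also have "\<dots> \<le> ennreal (D * real n powr - \<alpha>)" unfolding nb by (rule P(2))
      finally show ?thesis by simp
    qed
    then show "is_bigO (\<lambda>n. best_approx n f p (avg_weight w n)) (\<lambda>n. real n powr (-\<alpha>))"
      unfolding is_bigO_def eventually_sequentially using D by blast
  qed
qed

end
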